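(* Let $d\ge 1$, $l\in\mathbb S^{d-1}_q$, $M>6d$, $c>0$ and $0<\alpha\le\min\{\frac19,\frac1{2c+1}\}$, and let $\phi:[0,\infty)\to[0,\infty)$ satisfy $\lim_{r\to\infty}\phi(r)=0$. Consider a random walk in a random environment whose environment law $\mathbb P$ is stationary and satisfies the uniform ellipticity condition $(UE)|l$, the cone mixing condition $(CM)_{\alpha,\phi}|l$ and the non-effective polynomial condition $(PC)_{M,c}|l$. Then there exists a deterministic $\hat v\in\mathbb S^{d-1}$ such that $P_0$-a.s. $$\lim_{n\to\infty}\frac{X_n}{|X_n|_2}=\hat v .$$
   Context: Norms: $|\cdot|_1,|\cdot|_2,|\cdot|_\infty$ are the $l_1,l_2,l_\infty$ norms on $\mathbb R^d$. $\mathbb S^{d-1}_q:=\{l/|l|_2: l\in\mathbb Z^d\setminus\{0\}\}$. Random walk in random environment: $U:=\{e\in\mathbb Z^d:|e|_1=1\}$, $\mathcal P_d$ is the simplex of probability vectors indexed by $U$, $\Omega:=\mathcal P_d^{\mathbb Z^d}$ with product $\sigma$-algebra. For $\omega=\{\omega(y,e)\}\in\Omega$ and $x\in\mathbb Z^d$, $P_{x,\omega}$ is the law of the Markov chain $(X_n)_{n\ge0}$ on $\mathbb Z^d$ with $X_0=x$ and $P_{x,\omega}[X_{n+1}=X_n+e\mid X_n]=\omega(X_n,e)$, $e\in U$. $\mathbb P$ is a probability measure on $\Omega$; stationary means invariant under spatial shifts. The annealed law is $P_x(A\times B):=\int_A P_{x,\omega}(B)\,d\mathbb P$. $(UE)|l$: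 $\mathbb P[\omega(0,e)>0]=1$ for every $e\in U$, and there is $\kappa>0$ with $\mathbb P[\min_{e\in\mathcal E}\omega(0,e)\ge2\kappa]=1$, where $\mathcal E:=\bigcup_{i=1}^d\{\mathrm{sgn}(l_i)e_i\}\setminus\{0\}$, $\mathrm{sgn}(0)=0$. Fix a rotation $R$ of $\mathbb R^d$ with $R(e_1)=l$. For $\alpha>0$ and $2\le i\le d$ let $l_{\pm i}:=\frac{l\pm\alpha R(e_i)}{|l\pm\alpha R(e_i)|_2}$, and let the cone be $C(x,l,\alpha):=\bigcap_{i=2}^d\{z\in\mathbb R^d:(z-x)\cdot l_{+i}\ge0,\ (z-x)\cdot l_{-i}\ge0\}$. $(CM)_{\alpha,\phi}|l$: for every $r>0$ and all events $A\in\sigma\{\omega(z,\cdot):z\cdot l\le0\}$ with $\mathbb P(A)>0$ and $B\in\sigma\{\omega(z,\cdot):z\in C(rl,l,\alpha)\}$, $\left|\frac{\mathbb P[A\cap B]}{\mathbb P[A]}-\mathbb P[B]\right|\le\phi(r|l|_1)$. For $A\subset\mathbb Z^d$: $\partial A:=\{z\in\mathbb Z^d\setminus A:\exists y\in A,\ |y-z|_1=1\}$ and $T_A:=\inf\{n\ge0:X_n\notin A\}$. For $L,L'>0$: $B_{L,L',l}(x):=\big(x+R((-L,L)\times(-L',L')^{d-1})\big)\cap\mathbb Z^d$, and $\partial^+B_{L,L',l}(0):=\partial B_{L,L',l}(0)\cap\{z:z\cdot l\ge L\}$. For $x\in\mathbb Z^d$: $H_{x,l}:=\{y\in\mathbb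 Z^d:y\cdot l<x\cdot l\}$ and $\mathcal H_{x,l}:=\sigma(\omega(y):y\in H_{x,l})$. Let $\tau_{H_{y,l}}:=\inf\{n\ge0:X_n\in H_{y,l}\}$. $(PC)_{M,c}|l$: $$\limsup_{L\to\infty}L^M\sup P_0\left[X_{T_{B_{L,cL,l}(0)}}\notin\partial^+B_{L,cL,l}(0),\ T_{B_{L,cL,l}(0)}<\tau_{H_{y,l}}\,\middle|\,\mathcal H_{y,l}\right]=0,$$ where the supremum is over $y\in H_{0,l}$ and (as an essential supremum) over the environment configuration on which one conditions. *)

theory Defs
  imports "HOL-Probability.Probability"
begin

section \<open>Lattice and norms\<close>

text \<open>The lattice points are elements of \<open>int^'d\<close>; \<open>real_vec\<close> is the inclusion into \<open>real^'d\<close>.\<close>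

definition real_vec :: "int^'d::finite \<Rightarrow> real^'d" where
  "real_vec z = (\<chi> i. real_of_int (z $ i))"

definition l1_norm :: "'a::ordered_ab_group_add_abs^'d::finite \<Rightarrow> 'a" where
  "l1_norm z = (\<Sum>i\<in>UNIV. \<bar>z $ i\<bar>)"

definition rational_sphere :: "(real^'d::finite) set" where
  "rational_sphere = {real_vec z /\<^sub>R norm (real_vec z) | z. z \<noteq> 0}"

definition unit_steps :: "(int^'d::finite) set" where
  "unit_steps = {e. l1_norm e = 1}"

definition outer_boundary :: "(int^'d::finite) set \<Rightarrow> (int^'d) set" where
  "outer_boundary A = {z. z \<notin> A \<and> (\<exists>y\<in>A. l1_norm (y - z) = 1)}"

section \<open>Environments\<close>

type_synonym 'd env = "int^'d \<Rightarrow> int^'d \<Rightarrow> real"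

text \<open>The simplex of probability vectors indexed by the unit steps, with its Borel sets. Its
  elements are extensional functions, i.e. \<open>undefined\<close> off \<open>unit_steps\<close>.\<close>

definition step_simplex :: "(int^'d::finite \<Rightarrow> real) measure" where
  "step_simplex = restrict_space (\<Pi>\<^sub>M e\<in>unit_steps. borel)
     {p. (\<forall>e\<in>unit_steps. 0 \<le> p e) \<and> (\<Sum>e\<in>unit_steps. p e) = 1}"

text \<open>Only the underlying set and the product \<open>\<sigma>\<close>-algebra of \<open>env_space\<close> are used.\<close>

definition env_space :: "('d::finite) env measure" where
  "env_space = (\<Pi>\<^sub>M z\<in>UNIV. step_simplex)"

definition env_sigma :: "(int^'d::finite) set \<Rightarrow> 'd env measure" where
  "env_sigma S = sigma (space env_space)
     {(\<lambda>\<omega>. \<omega> z) -` A \<inter> space env_space | z A. z \<in> S \<and> A \<in> sets step_simplex}"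

definition env_law :: "('d::finite) env measure \<Rightarrow> bool" where
  "env_law \<P> \<longleftrightarrow> prob_space \<P> \<and> sets \<P> = sets env_space"

definition stationary :: "('d::finite) env measure \<Rightarrow> bool" where
  "stationary \<P> \<longleftrightarrow> (\<forall>x. distr \<P> \<P> (\<lambda>\<omega> z. \<omega> (z + x)) = \<P>)"

section \<open>Quenched and annealed laws\<close>

definition step_law :: "('d::finite) env \<Rightarrow> int^'d \<Rightarrow> (int^'d) measure" where
  "step_law \<omega> x =
     distr (point_measure unit_steps (\<lambda>e. ennreal (\<omega> x e))) (count_space UNIV) (\<lambda>e. x + e)"

text \<open>The law of the \<open>n\<close>-th position of the walk given the positions \<open>h\<close> before time \<open>n\<close>.\<close>

definition walk_kernel ::
    "('d::finite) env \<Rightarrow> int^'d \<Rightarrow> nat \<Rightarrow> (nat \<Rightarrow> int^'d) \<Rightarrow> (int^'d) measure" where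
  "walk_kernel \<omega> x n h =
     (case n of 0 \<Rightarrow> return (count_space UNIV) x | Suc m \<Rightarrow> step_law \<omega> (h m))"

abbreviation path_space :: "(nat \<Rightarrow> int^'d::finite) measure" where
  "path_space \<equiv> \<Pi>\<^sub>M n\<in>UNIV. count_space UNIV"

text \<open>The measure on path space given by the Ionescu-Tulcea theorem. It is meaningful for
  \<open>\<omega> \<in> space env_space\<close>; see \<open>emeasure_quenched_cylinder\<close> below.\<close>

definition quenched :: "('d::finite) env \<Rightarrow> int^'d \<Rightarrow> (nat \<Rightarrow> int^'d) measure" where
  "quenched \<omega> x = projective_family.lim UNIV
     (Ionescu_Tulcea.CI (walk_kernel \<omega> x) (\<lambda>_. count_space UNIV)) (\<lambda>_. count_space UNIV)"

definition annealed :: "('d::finite) env measure \<Rightarrow> int^'d \<Rightarrow> ('d env \<times> (nat \<Rightarrow> int^'d)) measure" where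
  "annealed \<P> x = \<P> \<bind> (\<lambda>\<omega>. distr (quenched \<omega> x) (env_space \<Otimes>\<^sub>M path_space) (Pair \<omega>))"

lemma finite_unit_steps: "finite (unit_steps :: (int^'d::finite) set)"
proof -
  have "unit_steps \<subseteq> {e::int^'d. \<forall>i. e $ i \<in> {-1..1}}"
  proof safe
    fix e :: "int^'d" and i assume "e \<in> unit_steps"
    then have "(\<Sum>i\<in>UNIV. \<bar>e $ i\<bar>) = 1" by (simp add: unit_steps_def l1_norm_def)
    moreover have "\<bar>e $ i\<bar> \<le> (\<Sum>i\<in>UNIV. \<bar>e $ i\<bar>)" by (rule member_le_sum) auto
    ultimately show "e $ i \<in> {-1..1}" by auto
  qed
  moreover have "finite {e::int^'d. \<forall>i. e $ i \<in> {-1..1}}"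
  proof (rule finite_surj)
    show "finite (Pi\<^sub>E (UNIV :: 'd set) (\<lambda>_. {-1..1::int}))" by (intro finite_PiE) auto
    show "{e::int^'d. \<forall>i. e $ i \<in> {-1..1}} \<subseteq> vec_lambda ` Pi\<^sub>E UNIV (\<lambda>_. {-1..1})"
    proof
      fix e :: "int^'d" assume "e \<in> {e. \<forall>i. e $ i \<in> {-1..1}}"
      then show "e \<in> vec_lambda ` Pi\<^sub>E UNIV (\<lambda>_. {-1..1})"
        by (intro image_eqI[where x="vec_nth e"]) auto
    qed
  qed
  ultimately show ?thesis by (rule finite_subset)
qed

lemma space_env_spaceD:
  assumes "\<omega> \<in> space env_space"
  shows "\<And>e. e \<in> unit_steps \<Longrightarrow> 0 \<le> \<omega> x e" "(\<Sum>e\<in>unit_steps. \<omega> x e) = 1"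
  using assms by (auto simp: env_space_def space_PiM PiE_iff step_simplex_def space_restrict_space)

lemma measurable_env_coord:
  assumes "e \<in> unit_steps"
  shows "(\<lambda>\<omega>. \<omega> x e) \<in> borel_measurable env_space"
proof -
  have "(\<lambda>p. p e) \<in> borel_measurable step_simplex"
    unfolding step_simplex_def
    by (intro measurable_restrict_space1 measurable_component_singleton assms)
  moreover have "(\<lambda>\<omega>. \<omega> x) \<in> env_space \<rightarrow>\<^sub>M step_simplex"
    unfolding env_space_def by (intro measurable_component_singleton) auto
  ultimately show ?thesis by (rule measurable_compose[rotated])
qed

lemma prob_space_step_law:
  assumes "\<omega> \<in> space env_space"
  shows "prob_space (step_law \<omega> x)"
  unfolding step_law_def
proof (rule prob_space.prob_space_distr)
  show "prob_space (point_measure unit_steps (\<lambda>e. ennreal (\<omega> x e)))"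
  proof
    have "(\<Sum>e\<in>unit_steps. ennreal (\<omega> x e)) = ennreal (\<Sum>e\<in>unit_steps. \<omega> x e)"
      by (rule sum_ennreal) (rule space_env_spaceD(1)[OF assms])
    then show "emeasure (point_measure unit_steps (\<lambda>e. ennreal (\<omega> x e)))
        (space (point_measure unit_steps (\<lambda>e. ennreal (\<omega> x e)))) = 1"
      by (simp add: space_point_measure emeasure_point_measure_finite finite_unit_steps
            space_env_spaceD(2)[OF assms])
  qed
qed auto

lemma emeasure_step_law:
  "emeasure (step_law \<omega> x) {y} =
     (if y - x \<in> unit_steps then ennreal (\<omega> x (y - x)) else 0)"
proof -
  have "(\<lambda>e. x + e) -` {y} \<inter> unit_steps = (if y - x \<in> unit_steps then {y - x} else {})"
    by auto
  then show ?thesis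
    unfolding step_law_def
    by (subst emeasure_distr)
       (auto simp: space_point_measure emeasure_point_measure_finite finite_unit_steps)
qed

lemma Ionescu_Tulcea_walk_kernel:
  assumes "\<omega> \<in> space env_space"
  shows "Ionescu_Tulcea (walk_kernel \<omega> x) (\<lambda>_. count_space UNIV)"
proof (rule Ionescu_Tulcea.intro)
  fix n
  show "walk_kernel \<omega> x n \<in> (\<Pi>\<^sub>M i\<in>{0..<n}. count_space UNIV) \<rightarrow>\<^sub>M subprob_algebra (count_space UNIV)"
  proof (cases n)
    case 0
    have "return (count_space UNIV) x \<in> space (subprob_algebra (count_space UNIV))"
      by (simp add: space_subprob_algebra prob_space_return prob_space_imp_subprob_space)
    then show ?thesis by (simp add: 0 walk_kernel_def[abs_def])
  next
    case (Suc m)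
    have "(\<lambda>h. h m) \<in> (\<Pi>\<^sub>M i\<in>{0..<n}. count_space UNIV) \<rightarrow>\<^sub>M count_space (UNIV :: (int^'a) set)"
      by (intro measurable_component_singleton) (simp add: Suc)
    moreover have "step_law \<omega> \<in> count_space UNIV \<rightarrow>\<^sub>M subprob_algebra (count_space UNIV)"
      using prob_space_step_law[OF assms]
      by (auto simp: space_subprob_algebra prob_space_imp_subprob_space step_law_def)
    ultimately have "(\<lambda>h. step_law \<omega> (h m)) \<in> (\<Pi>\<^sub>M i\<in>{0..<n}. count_space UNIV)
        \<rightarrow>\<^sub>M subprob_algebra (count_space UNIV)"
      by (rule measurable_compose)
    then show ?thesis by (simp add: Suc walk_kernel_def[abs_def])
  qed
next
  fix n :: nat and h :: "nat \<Rightarrow> int^'a"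
  assume "h \<in> space (\<Pi>\<^sub>M i\<in>{0..<n}. count_space (UNIV :: (int^'a) set))"
  show "prob_space (walk_kernel \<omega> x n h)"
    by (auto simp: walk_kernel_def prob_space_return prob_space_step_law[OF assms] split: nat.split)
qed

lemma
  assumes "\<omega> \<in> space env_space"
  shows sets_quenched: "sets (quenched \<omega> x) = sets path_space"
    and prob_space_quenched: "prob_space (quenched \<omega> x)"
proof -
  interpret Ionescu_Tulcea "walk_kernel \<omega> x" "\<lambda>_. count_space UNIV"
    by (rule Ionescu_Tulcea_walk_kernel[OF assms])
  show "sets (quenched \<omega> x) = sets path_space" by (simp add: quenched_def)
  interpret CI: prob_space "CI {}" by (rule PF.prob_space_P) auto
  have "emeasure (quenched \<omega> x) (PF.emb UNIV {} {\<lambda>_. undefined}) = emeasure (CI {}) {\<lambda>_. undefined}"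
    unfolding quenched_def by (rule lim) (auto simp: PiM_empty)
  moreover have "space (CI {}) = {\<lambda>_. undefined}"
    by (simp add: CI_def space_PiM)
  ultimately show "prob_space (quenched \<omega> x)"
    using CI.emeasure_space_1
    by (intro prob_spaceI) (simp add: quenched_def prod_emb_def space_PiM restrict_def)
qed

lemma emeasure_quenched_cylinder:
  assumes \<omega>: "\<omega> \<in> space env_space"
  shows "emeasure (quenched \<omega> x) {X. \<forall>i\<le>n. X i = p i} =
    (if p 0 = x then \<Prod>i<n. (if p (Suc i) - p i \<in> unit_steps
                             then ennreal (\<omega> (p i) (p (Suc i) - p i)) else 0) else 0)"
proof -
  interpret Ionescu_Tulcea "walk_kernel \<omega> x" "\<lambda>_. count_space UNIV"
    by (rule Ionescu_Tulcea_walk_kernel[OF \<omega>])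
  let ?M = "\<lambda>_. count_space (UNIV :: (int^'a) set)"
  let ?t = "\<lambda>i. if p (Suc i) - p i \<in> unit_steps
                   then ennreal (\<omega> (p i) (p (Suc i) - p i)) else 0"
  define r where "r n = restrict p {0..<n}" for n
  have r_sets: "{r n} \<in> sets (Pi\<^sub>M {0..<n} ?M)" for n
  proof -
    have "{r n} = Pi\<^sub>E {0..<n} (\<lambda>i. {p i})"
      by (auto simp: r_def PiE_iff extensional_def restrict_def)
    also have "\<dots> \<in> sets (Pi\<^sub>M {0..<n} ?M)" by (intro sets_PiM_I_finite) auto
    finally show ?thesis .
  qed
  have r_space: "r n \<in> space (Pi\<^sub>M {0..<n} ?M)" for n
    by (simp add: r_def space_PiM)
  have u: "(\<lambda>_. undefined) \<in> space (Pi\<^sub>M {0..<0} ?M)"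
    by (simp add: space_PiM PiE_def extensional_def)
  have rec: "emeasure (C 0 (Suc n) (\<lambda>_. undefined)) {r (Suc n)} =
      emeasure (walk_kernel \<omega> x n (r n)) {p n} * emeasure (C 0 n (\<lambda>_. undefined)) {r n}" for n
  proof -
    have eP: "emeasure (eP n h) {r (Suc n)} =
        emeasure (walk_kernel \<omega> x n (r n)) {p n} * indicator {r n} h"
      if h: "h \<in> space (Pi\<^sub>M {0..<n} ?M)" for h
    proof -
      have "(\<lambda>y. h(n := y)) -` {r (Suc n)} = (if h = r n then {p n} else {})"
      proof -
        have "h(n := y) = r (Suc n) \<longleftrightarrow> h = r n \<and> y = p n" for y
        proof
          assume *: "h(n := y) = r (Suc n)"
          have "y = p n" using fun_cong[OF *, of n] by (simp add: r_def)
          moreover have "h i = r n i" for i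
            using fun_cong[OF *, of i] h
            by (cases "i = n") (auto simp: r_def space_PiM PiE_iff extensional_def restrict_def)
          ultimately show "h = r n \<and> y = p n" by auto
        qed (auto simp: r_def fun_eq_iff restrict_def)
        then show ?thesis by auto
      qed
      then show ?thesis
        by (subst emeasure_eP[OF h r_sets]) (auto simp: indicator_def)
    qed
    have ne: "space (C 0 n (\<lambda>_. undefined)) \<noteq> {}"
      using prob_space.not_empty[OF prob_space_C[OF u]] .
    have eP_meas: "eP n \<in> C 0 n (\<lambda>_. undefined) \<rightarrow>\<^sub>M subprob_algebra (Pi\<^sub>M {0..<Suc n} ?M)"
      using measurable_eP[of n] sets_C[OF u, of n] by (simp cong: measurable_cong_sets)
    have "emeasure (C 0 (Suc n) (\<lambda>_. undefined)) {r (Suc n)} =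
        (\<integral>\<^sup>+h. emeasure (eP n h) {r (Suc n)} \<partial>C 0 n (\<lambda>_. undefined))"
      using emeasure_bind[OF ne eP_meas r_sets] by simp
    also have "\<dots> = (\<integral>\<^sup>+h. emeasure (walk_kernel \<omega> x n (r n)) {p n} * indicator {r n} h
                      \<partial>C 0 n (\<lambda>_. undefined))"
      by (intro nn_integral_cong eP) (simp add: space_C[OF u])
    also have "\<dots> = emeasure (walk_kernel \<omega> x n (r n)) {p n} * emeasure (C 0 n (\<lambda>_. undefined)) {r n}"
      using r_sets[of n] sets_C[OF u, of n] by (simp add: nn_integral_cmult_indicator)
    finally show ?thesis .
  qed
  have C_eq: "emeasure (C 0 (Suc n) (\<lambda>_. undefined)) {r (Suc n)} =
      (if p 0 = x then \<Prod>i<n. ?t i else 0)" for n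
  proof (induction n)
    case 0
    have "r 0 = (\<lambda>_. undefined)" by (simp add: r_def restrict_def)
    then show ?case
      using r_sets[of 0] by (subst rec) (auto simp: walk_kernel_def indicator_def)
  next
    case (Suc n)
    have "emeasure (walk_kernel \<omega> x (Suc n) (r (Suc n))) {p (Suc n)} = ?t n"
      by (simp add: walk_kernel_def emeasure_step_law r_def)
    then show ?case
      unfolding rec[of "Suc n"] Suc.IH by (simp add: mult.commute)
  qed
  have "restrict X {0..<Suc n} = r (Suc n) \<longleftrightarrow> (\<forall>i\<le>n. X i = p i)" for X
  proof
    assume *: "restrict X {0..<Suc n} = r (Suc n)"
    show "\<forall>i\<le>n. X i = p i"
    proof safe
      fix i assume "i \<le> n"
      then show "X i = p i" using fun_cong[OF *, of i] by (simp add: r_def)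
    qed
  next
    assume "\<forall>i\<le>n. X i = p i"
    then show "restrict X {0..<Suc n} = r (Suc n)"
      unfolding r_def by (intro restrict_ext) auto
  qed
  then have emb: "prod_emb UNIV ?M {0..<Suc n} {r (Suc n)} = {X. \<forall>i\<le>n. X i = p i}"
    by (simp add: prod_emb_def space_PiM vimage_def)
  have "emeasure (quenched \<omega> x) (prod_emb UNIV ?M {0..<Suc n} {r (Suc n)}) =
      emeasure (CI {0..<Suc n}) {r (Suc n)}"
    unfolding quenched_def by (rule lim) (auto intro: r_sets)
  also have "\<dots> = emeasure (C 0 (Suc n) (\<lambda>_. undefined))
      (prod_emb {0..<Suc n} ?M {0..<Suc n} {r (Suc n)})"
    by (rule emeasure_CI[OF order_refl r_sets])
  also have "prod_emb {0..<Suc n} ?M {0..<Suc n} {r (Suc n)} = {r (Suc n)}"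
    by (rule prod_emb_id) (simp add: r_def)
  finally show ?thesis by (simp only: emb C_eq)
qed

lemma path_cylinder_sets:
  "{X. \<forall>i\<le>n. X i = p i} \<in> sets (path_space :: (nat \<Rightarrow> int^'d::finite) measure)"
proof -
  have "{X. \<forall>i\<le>n. X i = p i} = (\<Inter>i\<in>{..n}. (\<lambda>X. X i) -` {p i} \<inter> space path_space)"
    by (auto simp: space_PiM)
  also have "\<dots> \<in> sets path_space"
    by (intro sets.finite_INT measurable_sets[OF measurable_component_singleton]) auto
  finally show ?thesis .
qed

lemma sets_path_space_cylinders:
  "sets (path_space :: (nat \<Rightarrow> int^'d::finite) measure) =
     sigma_sets UNIV (insert {} (range (\<lambda>(n, p). {X. \<forall>i\<le>n. X i = p i})))"
  (is "_ = sigma_sets UNIV ?G")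
proof
  interpret G: sigma_algebra UNIV "sigma_sets UNIV ?G"
    by (rule sigma_algebra_sigma_sets) simp
  have space: "(\<Pi>\<^sub>E i\<in>UNIV. space (count_space UNIV)) = (UNIV :: (nat \<Rightarrow> int^'d) set)"
    by simp
  show "sets path_space \<subseteq> sigma_sets UNIV ?G"
    unfolding sets_PiM_single space
  proof (rule sigma_sets_mono, safe)
    fix n and A :: "(int^'d) set"
    let ?P = "{xs :: (int^'d) list. length xs = Suc n \<and> xs ! n \<in> A}"
    have *: "\<exists>xs\<in>?P. \<forall>i\<le>n. X i = xs ! i" if "X n \<in> A" for X :: "nat \<Rightarrow> int^'d"
      using that by (intro bexI[of _ "map X [0..<Suc n]"]) (auto simp del: upt_Suc)
    have "{f \<in> UNIV. f n \<in> A} =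
        (\<Union>xs\<in>?P. {X. \<forall>i\<le>n. X i = xs ! i})"
      using * by auto
    also have "\<dots> \<in> sigma_sets UNIV ?G"
      by (intro G.countable_UN' sigma_sets.Basic) auto
    finally show "{f \<in> UNIV. f n \<in> A}
        \<in> sigma_sets UNIV ?G" .
  qed
  have "sigma_sets (space path_space) ?G \<subseteq> sets path_space"
    by (rule sets.sigma_sets_subset) (auto simp: path_cylinder_sets)
  then show "sigma_sets UNIV ?G \<subseteq> sets path_space"
    by (simp add: space_PiM)
qed

lemma measurable_quenched:
  "(\<lambda>\<omega>. quenched \<omega> x) \<in> env_space \<rightarrow>\<^sub>M subprob_algebra (path_space :: (nat \<Rightarrow> int^'d::finite) measure)"
proof (rule measurable_subprob_algebra_generated[OF sets_path_space_cylinders])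
  show "Int_stable (insert {} (range (\<lambda>(n, p :: nat \<Rightarrow> int^'d). {X. \<forall>i\<le>n. X i = p i})))"
  proof (rule Int_stableI, clarsimp, safe)
    fix m n and p q :: "nat \<Rightarrow> int^'d" and X
    assume *: "{X. \<forall>i\<le>m. X i = p i} \<inter> {X. \<forall>i\<le>n. X i = q i} \<notin> range (\<lambda>(n, p). {X. \<forall>i\<le>n. X i = p i})"
       "\<forall>i\<le>m. X i = p i" "\<forall>i\<le>n. X i = q i"
    have "{X. \<forall>i\<le>m. X i = p i} \<inter> {X. \<forall>i\<le>n. X i = q i} = {Y. \<forall>i\<le>max m n. Y i = X i}"
      using *(2,3) by (auto simp: le_max_iff_disj)
    with *(1) show "X \<in> {}" by (auto simp: image_iff)
  qed
next
  fix \<omega> :: "'d env" assume \<omega>: "\<omega> \<in> space env_space"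
  show "subprob_space (quenched \<omega> x)"
    by (rule prob_space_imp_subprob_space[OF prob_space_quenched[OF \<omega>]])
  show "sets (quenched \<omega> x) = sets path_space"
    by (rule sets_quenched[OF \<omega>])
next
  fix S assume "S \<in> insert {} (range (\<lambda>(n, p :: nat \<Rightarrow> int^'d). {X. \<forall>i\<le>n. X i = p i}))"
  then consider "S = {}" | n p where "S = {X. \<forall>i\<le>n. X i = p i}" by auto
  then show "(\<lambda>\<omega>. emeasure (quenched \<omega> x) S) \<in> borel_measurable env_space"
  proof cases
    case 2
    have "(\<lambda>\<omega>. if p 0 = x then \<Prod>i<n. (if p (Suc i) - p i \<in> unit_steps
         then ennreal (\<omega> (p i) (p (Suc i) - p i)) else 0) else 0) \<in> borel_measurable env_space"
    proof (cases "p 0 = x")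
      case True
      have "(\<lambda>\<omega>. if p (Suc i) - p i \<in> unit_steps
         then ennreal (\<omega> (p i) (p (Suc i) - p i)) else 0) \<in> borel_measurable env_space" for i
        using measurable_env_coord[of "p (Suc i) - p i" "p i"]
        by (cases "p (Suc i) - p i \<in> unit_steps") auto
      then have "(\<lambda>\<omega>. \<Prod>i<n. (if p (Suc i) - p i \<in> unit_steps
         then ennreal (\<omega> (p i) (p (Suc i) - p i)) else 0)) \<in> borel_measurable env_space"
        by (rule borel_measurable_prod_ennreal)
      with True show ?thesis by simp
    qed simp
    then show ?thesis
      unfolding 2 by (subst measurable_cong[OF emeasure_quenched_cylinder]) auto
  qed simp
next
  have "emeasure (quenched \<omega> x) UNIV = 1" if "\<omega> \<in> space env_space" for \<omega>
    using prob_space.emeasure_space_1[OF prob_space_quenched[OF that, of x]]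
      sets_eq_imp_space_eq[OF sets_quenched[OF that, of x]] by (simp add: space_PiM)
  then show "(\<lambda>\<omega>. emeasure (quenched \<omega> x) UNIV) \<in> borel_measurable env_space"
    by (subst measurable_cong) auto
qed auto

lemma
  fixes \<P> :: "('d::finite) env measure" and x :: "int^'d"
  assumes "env_law \<P>"
  shows sets_annealed: "sets (annealed \<P> x) = sets (env_space \<Otimes>\<^sub>M path_space)"
    and emeasure_annealed_Times:
      "\<And>A B. A \<in> sets env_space \<Longrightarrow> B \<in> sets path_space \<Longrightarrow>
         emeasure (annealed \<P> x) (A \<times> B) = (\<integral>\<^sup>+\<omega>\<in>A. emeasure (quenched \<omega> x) B \<partial>\<P>)"
proof -
  interpret prob_space \<P> using assms by (simp add: env_law_def)
  let ?N = "env_space \<Otimes>\<^sub>M path_space :: ('d env \<times> (nat \<Rightarrow> int^'d)) measure"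
  have [measurable_cong]: "sets \<P> = sets env_space" using assms by (simp add: env_law_def)
  have space: "space \<P> = space env_space"
    by (rule sets_eq_imp_space_eq) fact
  have kernel: "(\<lambda>\<omega>. distr (quenched \<omega> x) ?N (Pair \<omega>)) \<in> \<P> \<rightarrow>\<^sub>M subprob_algebra ?N"
    using measurable_quenched[of x, measurable] by (intro measurable_distr2[where M=path_space]) measurable
  show "sets (annealed \<P> x) = sets ?N"
    unfolding annealed_def by (rule sets_bind) (auto simp: not_empty)
  fix A :: "'d env set" and B :: "(nat \<Rightarrow> int^'d) set"
  assume A: "A \<in> sets env_space" and B: "B \<in> sets path_space"
  have "emeasure (annealed \<P> x) (A \<times> B) =
      (\<integral>\<^sup>+\<omega>. emeasure (distr (quenched \<omega> x) ?N (Pair \<omega>)) (A \<times> B) \<partial>\<P>)"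
    unfolding annealed_def using A B by (intro emeasure_bind[OF not_empty kernel]) auto
  also have "\<dots> = (\<integral>\<^sup>+\<omega>\<in>A. emeasure (quenched \<omega> x) B \<partial>\<P>)"
  proof (rule nn_integral_cong)
    fix \<omega> assume "\<omega> \<in> space \<P>"
    then have \<omega>: "\<omega> \<in> space env_space" by (simp add: space)
    have "Pair \<omega> \<in> quenched \<omega> x \<rightarrow>\<^sub>M ?N"
      using \<omega> sets_quenched[OF \<omega>, of x] by (simp cong: measurable_cong_sets)
    moreover have "Pair \<omega> -` (A \<times> B) \<inter> space (quenched \<omega> x) = (if \<omega> \<in> A then B else {})"
      using sets.sets_into_space[OF B] sets_eq_imp_space_eq[OF sets_quenched[OF \<omega>, of x]] by auto
    ultimately show "emeasure (distr (quenched \<omega> x) ?N (Pair \<omega>)) (A \<times> B) =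
        emeasure (quenched \<omega> x) B * indicator A \<omega>"
      using A B by (subst emeasure_distr) auto
  qed
  finally show "emeasure (annealed \<P> x) (A \<times> B) = (\<integral>\<^sup>+\<omega>\<in>A. emeasure (quenched \<omega> x) B \<partial>\<P>)" .
qed

section \<open>Hitting and exit times\<close>

definition hitting_time :: "'a set \<Rightarrow> (nat \<Rightarrow> 'a) \<Rightarrow> enat" where
  "hitting_time A X = (INF n\<in>{n. X n \<in> A}. enat n)"

abbreviation exit_time :: "'a set \<Rightarrow> (nat \<Rightarrow> 'a) \<Rightarrow> enat" where
  "exit_time A \<equiv> hitting_time (- A)"

section \<open>Boxes, half-spaces and cones\<close>

text \<open>In what follows \<open>R\<close> is a linear isometry taking the first basis vector to \<open>l\<close>. The index
  type \<open>'d\<close> carries no order, so the first coordinate is a distinguished index \<open>k\<close>. Boxes and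
  cones do not change when \<open>R\<close> is composed with the reflection of a coordinate other than \<open>k\<close>, so
  the sign of the determinant of \<open>R\<close> is irrelevant; in dimension one the isometry for \<open>l = -1\<close> has
  determinant \<open>-1\<close>.\<close>

definition lattice_box :: "(real^'d::finite \<Rightarrow> real^'d) \<Rightarrow> 'd \<Rightarrow> real \<Rightarrow> real \<Rightarrow> int^'d \<Rightarrow> (int^'d) set" where
  "lattice_box R k L L' x = {z. real_vec z \<in> (\<lambda>u. real_vec x + R u) `
     {u. u $ k \<in> {-L<..<L} \<and> (\<forall>i. i \<noteq> k \<longrightarrow> u $ i \<in> {-L'<..<L'})}}"

definition front_boundary ::
    "(real^'d::finite \<Rightarrow> real^'d) \<Rightarrow> 'd \<Rightarrow> real^'d \<Rightarrow> real \<Rightarrow> real \<Rightarrow> (int^'d) set" where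
  "front_boundary R k l L L' = outer_boundary (lattice_box R k L L' 0) \<inter> {z. L \<le> real_vec z \<bullet> l}"

definition half_space :: "real^'d::finite \<Rightarrow> int^'d \<Rightarrow> (int^'d) set" where
  "half_space l x = {y. real_vec y \<bullet> l < real_vec x \<bullet> l}"

definition mixing_cone ::
    "(real^'d::finite \<Rightarrow> real^'d) \<Rightarrow> 'd \<Rightarrow> real^'d \<Rightarrow> real^'d \<Rightarrow> real \<Rightarrow> (real^'d) set" where
  "mixing_cone R k x l \<alpha> = (\<Inter>i\<in>UNIV - {k}.
     {z. 0 \<le> (z - x) \<bullet> ((l + \<alpha> *\<^sub>R R (axis i 1)) /\<^sub>R norm (l + \<alpha> *\<^sub>R R (axis i 1))) \<and>
         0 \<le> (z - x) \<bullet> ((l - \<alpha> *\<^sub>R R (axis i 1)) /\<^sub>R norm (l - \<alpha> *\<^sub>R R (axis i 1)))})"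

section \<open>Assumptions on the environment\<close>

definition forward_steps :: "real^'d::finite \<Rightarrow> (int^'d) set" where
  "forward_steps l = {e. real_vec e \<in> (\<Union>i. {sgn (l $ i) *\<^sub>R axis i 1}) - {0}}"

definition uniformly_elliptic :: "('d::finite) env measure \<Rightarrow> real^'d \<Rightarrow> bool" where
  "uniformly_elliptic \<P> l \<longleftrightarrow>
     (\<forall>e\<in>unit_steps. AE \<omega> in \<P>. 0 < \<omega> 0 e) \<and>
     (\<exists>\<kappa>>0. AE \<omega> in \<P>. 2 * \<kappa> \<le> (MIN e\<in>forward_steps l. \<omega> 0 e))"

definition cone_mixing ::
    "('d::finite) env measure \<Rightarrow> (real^'d \<Rightarrow> real^'d) \<Rightarrow> 'd \<Rightarrow> real^'d \<Rightarrow> real \<Rightarrow> (real \<Rightarrow> real) \<Rightarrow> bool"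
  where
  "cone_mixing \<P> R k l \<alpha> \<phi> \<longleftrightarrow>
     (\<forall>r>0. \<forall>A \<in> sets (env_sigma {z. real_vec z \<bullet> l \<le> 0}).
        \<forall>B \<in> sets (env_sigma {z. real_vec z \<in> mixing_cone R k (r *\<^sub>R l) l \<alpha>}).
          measure \<P> A > 0 \<longrightarrow>
          \<bar>measure \<P> (A \<inter> B) / measure \<P> A - measure \<P> B\<bar> \<le> \<phi> (r * l1_norm l))"

definition bad_exit ::
    "(real^'d::finite \<Rightarrow> real^'d) \<Rightarrow> 'd \<Rightarrow> real^'d \<Rightarrow> real \<Rightarrow> real \<Rightarrow> int^'d \<Rightarrow>
     ('d env \<times> (nat \<Rightarrow> int^'d)) set" where
  "bad_exit R k l c L y = {(\<omega>, X).
     X (the_enat (exit_time (lattice_box R k L (c * L) 0) X)) \<notin> front_boundary R k l L (c * L) \<and>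
     exit_time (lattice_box R k L (c * L) 0) X < hitting_time (half_space l y) X}"

lemma hitting_time_less_iff:
  "hitting_time A X < hitting_time B X \<and> P (the_enat (hitting_time A X)) \<longleftrightarrow>
     (\<exists>n. X n \<in> A \<and> (\<forall>m<n. X m \<notin> A) \<and> (\<forall>m\<le>n. X m \<notin> B) \<and> P n)"
proof -
  have eq: "hitting_time A X = enat n" if "X n \<in> A" "\<forall>m<n. X m \<notin> A" for n
    unfolding hitting_time_def
  proof (rule antisym)
    show "(INF n\<in>{n. X n \<in> A}. enat n) \<le> enat n" by (rule INF_lower) (simp add: that)
    have "n \<le> m" if "X m \<in> A" for m using \<open>\<forall>m<n. X m \<notin> A\<close> that not_less by blast
    then show "enat n \<le> (INF n\<in>{n. X n \<in> A}. enat n)" by (intro INF_greatest) auto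
  qed
  have less: "enat n < hitting_time B X \<longleftrightarrow> (\<forall>m\<le>n. X m \<notin> B)" for n
  proof -
    have "enat n < hitting_time B X \<longleftrightarrow> enat (Suc n) \<le> hitting_time B X"
      by (simp add: Suc_ile_eq)
    also have "\<dots> \<longleftrightarrow> (\<forall>m. X m \<in> B \<longrightarrow> Suc n \<le> m)"
      by (simp add: hitting_time_def le_INF_iff)
    finally show ?thesis by (auto simp: not_le[symmetric] Suc_le_eq)
  qed
  have first: "\<exists>n. X n \<in> A \<and> (\<forall>m<n. X m \<notin> A)" if "hitting_time A X < hitting_time B X"
  proof -
    have "\<exists>n. X n \<in> A"
    proof (rule ccontr)
      assume "\<nexists>n. X n \<in> A"
      then have "hitting_time A X = \<infinity>" by (simp add: hitting_time_def top_enat_def)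
      with that show False by simp
    qed
    then show ?thesis using exists_least_iff[of "\<lambda>n. X n \<in> A"] by simp
  qed
  show ?thesis
  proof
    assume *: "hitting_time A X < hitting_time B X \<and> P (the_enat (hitting_time A X))"
    with first obtain n where n: "X n \<in> A" "\<forall>m<n. X m \<notin> A" by blast
    with * eq[OF n] less[of n]
    show "\<exists>n. X n \<in> A \<and> (\<forall>m<n. X m \<notin> A) \<and> (\<forall>m\<le>n. X m \<notin> B) \<and> P n" by auto
  next
    assume "\<exists>n. X n \<in> A \<and> (\<forall>m<n. X m \<notin> A) \<and> (\<forall>m\<le>n. X m \<notin> B) \<and> P n"
    then show "hitting_time A X < hitting_time B X \<and> P (the_enat (hitting_time A X))"
      using eq less by auto
  qed
qed

text \<open>\<open>real_cond_exp\<close> takes a default value when its arguments are not measurable; the next two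
  lemmas show that this does not occur in the condition below.\<close>

lemma indicator_bad_exit_measurable:
  fixes R :: "real^'d::finite \<Rightarrow> real^'d"
  assumes "env_law \<P>"
  shows "(indicator (bad_exit R k l c L y) :: _ \<Rightarrow> real) \<in> borel_measurable (annealed \<P> 0)"
proof -
  let ?B = "lattice_box R k L (c * L) 0"
  let ?S = "\<lambda>n. ({X. X n \<in> - ?B - front_boundary R k l L (c * L)} \<inter>
     {X. \<forall>m\<in>{..<n}. X m \<in> ?B} \<inter> {X. \<forall>m\<in>{..n}. X m \<notin> half_space l y}) :: (nat \<Rightarrow> int^'d) set"
  have bad: "bad_exit R k l c L y \<inter> space (env_space \<Otimes>\<^sub>M path_space) =
      space env_space \<times> (\<Union>n. ?S n)"
  proof -
    have "(\<omega>, X) \<in> bad_exit R k l c L y \<longleftrightarrow> (\<exists>n. X \<in> ?S n)" for \<omega> X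
      using hitting_time_less_iff[of "- ?B" X "half_space l y"
          "\<lambda>n. X n \<notin> front_boundary R k l L (c * L)"]
      by (simp add: bad_exit_def conj_commute conj_left_commute Ball_def)
    then show ?thesis by (auto simp: space_pair_measure space_PiM)
  qed
  have coord: "{X. X n \<in> A} \<in> sets (path_space :: (nat \<Rightarrow> int^'d) measure)" for n A
    using measurable_sets[OF measurable_component_singleton[of n UNIV "\<lambda>_. count_space UNIV"], of A]
    by (simp add: space_PiM vimage_def)
  have all: "{X. \<forall>m\<in>F. X m \<in> A} \<in> sets (path_space :: (nat \<Rightarrow> int^'d) measure)"
    if "finite F" for F A
  proof -
    have "{X \<in> space path_space. \<forall>m\<in>F. X m \<in> A} \<in> sets (path_space :: (nat \<Rightarrow> int^'d) measure)"
      by (rule sets.sets_Collect_finite_All) (use that coord in \<open>auto simp: space_PiM\<close>)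
    then show ?thesis by (simp add: space_PiM)
  qed
  have "?S n \<in> sets path_space" for n
    using coord[of n "- ?B - front_boundary R k l L (c * L)"] all[of "{..<n}" ?B]
      all[of "{..n}" "- half_space l y"]
    by (intro sets.Int) auto
  then have "bad_exit R k l c L y \<inter> space (env_space \<Otimes>\<^sub>M path_space)
      \<in> sets (env_space \<Otimes>\<^sub>M path_space)"
    unfolding bad by (intro pair_measureI sets.countable_UN) auto
  then show ?thesis
    using sets_annealed[OF assms, of 0] sets_eq_imp_space_eq[OF sets_annealed[OF assms, of 0]]
    by (simp add: borel_measurable_indicator_iff)
qed

lemma subalgebra_annealed:
  assumes "env_law \<P>"
  shows "subalgebra (annealed \<P> 0) (vimage_algebra (space (annealed \<P> 0)) fst (env_sigma S))"
proof -
  have sp: "space (annealed \<P> 0) = space (env_space \<Otimes>\<^sub>M path_space)"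
    by (rule sets_eq_imp_space_eq[OF sets_annealed[OF assms]])
  have "sets (env_sigma S) = sigma_sets (space env_space)
      {(\<lambda>\<omega>. \<omega> z) -` A \<inter> space env_space | z A. z \<in> S \<and> A \<in> sets step_simplex}"
    unfolding env_sigma_def by (rule sets_measure_of) auto
  also have "\<dots> \<subseteq> sets env_space"
    by (rule sets.sigma_sets_subset)
       (auto intro!: measurable_sets measurable_component_singleton simp: env_space_def)
  finally have *: "sets (env_sigma S) \<subseteq> sets env_space" .
  have spE: "space (env_sigma S) = space env_space"
    unfolding env_sigma_def by (rule space_measure_of) auto
  have "fst \<in> annealed \<P> 0 \<rightarrow>\<^sub>M env_space"
    using sets_annealed[OF assms, of 0] by (simp cong: measurable_cong_sets)
  then have "fst -` A \<inter> space (annealed \<P> 0) \<in> sets (annealed \<P> 0)" if "A \<in> sets (env_sigma S)" for A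
    using that * by (auto intro: measurable_sets)
  moreover have "fst \<in> space (annealed \<P> 0) \<rightarrow> space (env_sigma S)"
    by (auto simp: sp spE space_pair_measure)
  ultimately show ?thesis
    by (auto simp: subalgebra_def sets_vimage_algebra2)
qed

text \<open>The \<open>\<sigma>\<close>-algebra \<open>\<H>\<close> on environments is pulled back to environment-path pairs along \<open>fst\<close>.\<close>

definition polynomial_condition ::
    "('d::finite) env measure \<Rightarrow> (real^'d \<Rightarrow> real^'d) \<Rightarrow> 'd \<Rightarrow> real^'d \<Rightarrow> real \<Rightarrow> real \<Rightarrow> bool" where
  "polynomial_condition \<P> R k l M c \<longleftrightarrow>
     Limsup at_top (\<lambda>L::real. ereal (L powr M) *
       (SUP y\<in>half_space l 0. esssup (annealed \<P> 0) (\<lambda>p. ereal (real_cond_exp (annealed \<P> 0)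
          (vimage_algebra (space (annealed \<P> 0)) fst (env_sigma (half_space l y)))
          (indicator (bad_exit R k l c L y)) p)))) = 0"

end

(* Call a first visit of a site good at scale L if the walk leaves the box of size L around it through
   the front. By the polynomial condition and a union bound over sites, a walk started at height r
   above a half-space stays in a cone with apex at height r/2, whatever the environment in the
   half-space, up to probability O(1/r). On that event cone mixing decouples the walk from the
   half-space, but only if there is a gap of size r between the two.
   The gap is obtained from a martingale: if G depends only on the path after reaching level A, then
   h(y), the quenched mean of G from y, is harmonic below A, so h(X_n) is a bounded martingale and its
   total quadratic variation is at most 1. With ellipticity in the forward directions, at most of the
   levels before A the value of h changes little when the starting point is moved ahead along a
   forward path of length c log b. Hence a bounded functional of the path up to level a is nearly
   uncorrelated with the increments of the walk over levels a + sqrt b to a + sqrt b + b.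
   It follows that the mean displacements per level converge along the scales 4^i, and a second moment
   recursion over blocks together with Borel-Cantelli gives convergence of the hitting positions of
   the levels of a grid. Between grid levels the walk is confined to a good box. *)

theory Submission
  imports Defs
begin

section \<open>The quenched walk\<close>

text \<open>The mixing function \<phi> tends to 0 without any rate, so its errors can be summed
  neither over scales nor over the blocks of one scale. Both limits are arranged so that \<phi>
  enters once. For the means, all blocks of size \<open>4 ^ i\<close>, at whatever level they start,
  have nearly the same mean; larger scales follow by plain additivity, with errors that come only
  from bad exits and add up to O(1 / i). For the concentration, the error from \<phi> is put into
  the deterministic centring \<open>drift\<close>, which leaves correlation errors of order
  \<open>2 powr (- real i / 4)\<close>, summable over the scales. A forced stretch of n forward
  steps has probability of order \<kappa>^n only, so the gap is not produced by conditioning on such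
  a stretch. Comparing the harmonic function at a point with its value ahead costs n^2 / \<kappa>^n
  once, and this cost is shared by a number of levels that is a power of b; hence n may be of order
  log b. Since the apex of the cone is only that far away, bad blocks at scale b are bounded by
  order 1 / log b.\<close>

abbreviation cyl :: "nat \<Rightarrow> (nat \<Rightarrow> int^'d::finite) \<Rightarrow> (nat \<Rightarrow> int^'d) set" where
  "cyl n p \<equiv> {X. \<forall>i\<le>n. X i = p i}"

definition walk_shift :: "nat \<Rightarrow> (nat \<Rightarrow> 'a) \<Rightarrow> nat \<Rightarrow> 'a" where
  "walk_shift n X = (\<lambda>m. X (n + m))"

text \<open>Stands in for measurability with respect to the first n + 1 positions: the state space
  is countable, so a function with this property is automatically measurable
  (\<open>prefix_det_measurable\<close>).\<close>

definition prefix_det :: "nat \<Rightarrow> ((nat \<Rightarrow> 'a) \<Rightarrow> 'b) \<Rightarrow> bool" where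
  "prefix_det n V \<longleftrightarrow> (\<forall>X Y. (\<forall>i\<le>n. X i = Y i) \<longrightarrow> V X = V Y)"

definition path_weight :: "('d::finite) env \<Rightarrow> int^'d \<Rightarrow> nat \<Rightarrow> (nat \<Rightarrow> int^'d) \<Rightarrow> ennreal" where
  "path_weight \<omega> x n p = (if p 0 = x then \<Prod>i<n. (if p (Suc i) - p i \<in> unit_steps
                             then ennreal (\<omega> (p i) (p (Suc i) - p i)) else 0) else 0)"

lemma space_path_space [simp]: "space (path_space :: (nat \<Rightarrow> int^'d::finite) measure) = UNIV"
  by (simp add: space_PiM)

lemma space_quenched [simp]:
  assumes "\<omega> \<in> space env_space"
  shows "space (quenched \<omega> x) = UNIV"
  using sets_eq_imp_space_eq[OF sets_quenched[OF assms, of x]] by simp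

lemma measurable_quenched_cong:
  assumes "\<omega> \<in> space env_space"
  shows "measurable (quenched \<omega> x) N = measurable path_space N"
  by (rule measurable_cong_sets) (simp_all add: sets_quenched[OF assms])

lemma emeasure_quenched_cyl:
  assumes "\<omega> \<in> space env_space"
  shows "emeasure (quenched \<omega> x) (cyl n p) = path_weight \<omega> x n p"
  unfolding path_weight_def by (rule emeasure_quenched_cylinder[OF assms])

lemma measurable_coord [measurable]: "(\<lambda>X. X n) \<in> path_space \<rightarrow>\<^sub>M count_space (UNIV :: (int^'d::finite) set)"
  by (rule measurable_component_singleton) simp

lemma measurable_walk_shift [measurable]:
  "walk_shift n \<in> path_space \<rightarrow>\<^sub>M (path_space :: (nat \<Rightarrow> int^'d::finite) measure)"
  unfolding walk_shift_def by (rule measurable_PiM_single') auto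

lemma measurable_walk_translate [measurable]:
  "(\<lambda>X m. X m + x) \<in> path_space \<rightarrow>\<^sub>M (path_space :: (nat \<Rightarrow> int^'d::finite) measure)"
proof (rule measurable_PiM_single')
  fix i
  have "(\<lambda>X. X i) \<in> path_space \<rightarrow>\<^sub>M count_space (UNIV :: (int^'d) set)" by measurable
  then show "(\<lambda>X. X i + x) \<in> path_space \<rightarrow>\<^sub>M count_space (UNIV :: (int^'d) set)"
    by (rule measurable_compose) simp
qed auto

lemma Int_stable_cyl:
  "Int_stable (insert {} (range (\<lambda>(n, p :: nat \<Rightarrow> int^'d::finite). cyl n p)))"
proof (rule Int_stableI, clarsimp, safe)
  fix m n and p q :: "nat \<Rightarrow> int^'d" and X
  assume *: "cyl m p \<inter> cyl n q \<notin> range (\<lambda>(n, p). cyl n p)"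
     "\<forall>i\<le>m. X i = p i" "\<forall>i\<le>n. X i = q i"
  have "cyl m p \<inter> cyl n q = cyl (max m n) X"
    using *(2,3) by (auto simp: le_max_iff_disj)
  with *(1) show "X \<in> {}" by (auto simp: image_iff)
qed

lemma path_measure_eqI:
  fixes M N :: "(nat \<Rightarrow> int^'d::finite) measure"
  assumes "sets M = sets path_space" "sets N = sets path_space" "finite_measure M"
    and eq: "\<And>n p. emeasure M (cyl n p) = emeasure N (cyl n p)"
  shows "M = N"
proof (rule measure_eqI_generator_eq_countable[OF Int_stable_cyl,
      where \<Omega>=UNIV and A="range (\<lambda>x::int^'d. cyl 0 (\<lambda>_. x))"])
  interpret finite_measure M by fact
  show "sets M = sigma_sets UNIV (insert {} (range (\<lambda>(n, p). cyl n p)))"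
    "sets N = sigma_sets UNIV (insert {} (range (\<lambda>(n, p). cyl n p)))"
    using assms(1,2) sets_path_space_cylinders[where 'd='d] by auto
  show "range (\<lambda>x::int^'d. cyl 0 (\<lambda>_. x)) \<subseteq> insert {} (range (\<lambda>(n, p). cyl n p))"
    by auto
  show "\<Union> (range (\<lambda>x::int^'d. cyl 0 (\<lambda>_. x))) = UNIV" by auto
  show "emeasure M a \<noteq> \<infinity>" for a by simp
  show "emeasure M X = emeasure N X" if "X \<in> insert {} (range (\<lambda>(n, p). cyl n p))" for X
    using that eq by auto
  show "countable (range (\<lambda>x::int^'d. cyl 0 (\<lambda>_. x)))" by simp
qed auto

lemma path_weight_append:
  assumes "q 0 = p n"
  shows "path_weight \<omega> x n p * path_weight \<omega> (p n) m q =
    path_weight \<omega> x (n + m) (\<lambda>i. if i \<le> n then p i else q (i - n))"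
proof -
  define r where "r = (\<lambda>i. if i \<le> n then p i else q (i - n))"
  let ?t = "\<lambda>p i. (if p (Suc i) - p i \<in> unit_steps then ennreal (\<omega> (p i) (p (Suc i) - p i)) else 0)"
  have r: "r (n + i) = q i" for i using assms by (cases i) (auto simp: r_def)
  have "(\<Prod>i<n. ?t r i) = (\<Prod>i<n. ?t p i)" by (rule prod.cong) (auto simp: r_def)
  moreover have "(\<Prod>i<m. ?t r (n + i)) = (\<Prod>i<m. ?t q i)"
    by (rule prod.cong) (auto simp: r simp flip: add_Suc_right)
  moreover have "(\<Prod>i<n+m. ?t r i) = (\<Prod>i<n. ?t r i) * (\<Prod>i<m. ?t r (n + i))"
    by (induction m) (auto simp: mult.assoc)
  ultimately show ?thesis using assms unfolding path_weight_def r_def[symmetric]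
    by (auto simp: r_def)
qed

text \<open>Both sides are finite measures in E. On cylinders they agree because path weights
  multiply under concatenation, and the cylinders form a generating \<pi>-system.\<close>

lemma emeasure_markov_cyl:
  assumes \<omega>: "\<omega> \<in> space env_space" and E: "E \<in> sets path_space"
  shows "emeasure (quenched \<omega> x) (cyl n p \<inter> walk_shift n -` E) =
    path_weight \<omega> x n p * emeasure (quenched \<omega> (p n)) E"
proof -
  interpret prob_space "quenched \<omega> x" by (rule prob_space_quenched[OF \<omega>])
  interpret q: prob_space "quenched \<omega> (p n)" by (rule prob_space_quenched[OF \<omega>])
  have [measurable_cong]: "sets (quenched \<omega> y) = sets path_space" for y by (rule sets_quenched[OF \<omega>])
  have [measurable]: "cyl n p \<in> sets path_space" by (rule path_cylinder_sets)
  define A where "A = distr (density (quenched \<omega> x) (indicator (cyl n p))) path_space (walk_shift n)"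
  define B where "B = scale_measure (path_weight \<omega> x n p) (quenched \<omega> (p n))"
  have A: "emeasure A E = emeasure (quenched \<omega> x) (cyl n p \<inter> walk_shift n -` E)"
    if [measurable]: "E \<in> sets path_space" for E
  proof -
    have "walk_shift n -` E \<inter> space path_space \<in> sets path_space" by measurable
    then have *[measurable]: "walk_shift n -` E \<in> sets path_space" by simp
    have "emeasure A E = emeasure (density (quenched \<omega> x) (indicator (cyl n p))) (walk_shift n -` E)"
      unfolding A_def by (subst emeasure_distr) (auto simp: \<omega>)
    also have "\<dots> = (\<integral>\<^sup>+X. indicator (cyl n p) X * indicator (walk_shift n -` E) X \<partial>quenched \<omega> x)"
      by (rule emeasure_density) measurable
    also have "\<dots> = (\<integral>\<^sup>+X. indicator (cyl n p \<inter> walk_shift n -` E) X \<partial>quenched \<omega> x)"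
      by (simp add: indicator_inter_arith)
    also have "\<dots> = emeasure (quenched \<omega> x) (cyl n p \<inter> walk_shift n -` E)"
      by (rule nn_integral_indicator) measurable
    finally show ?thesis .
  qed
  have "A = B"
  proof (rule path_measure_eqI)
    show "sets A = sets path_space" by (simp add: A_def)
    show "sets B = sets path_space" by (simp add: B_def \<omega> sets_quenched)
    show "finite_measure A"
    proof (rule finite_measureI)
      have "emeasure A (space A) = emeasure (quenched \<omega> x) (cyl n p \<inter> walk_shift n -` UNIV)"
        using A[of UNIV] sets.top[of path_space] by (simp add: A_def)
      then show "emeasure A (space A) \<noteq> \<infinity>" by simp
    qed
    fix m q
    have "emeasure A (cyl m q) = emeasure (quenched \<omega> x) (cyl n p \<inter> walk_shift n -` cyl m q)"
      by (rule A) (rule path_cylinder_sets)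
    also have "\<dots> = path_weight \<omega> x n p * path_weight \<omega> (p n) m q"
    proof (cases "q 0 = p n")
      case True
      have "cyl n p \<inter> walk_shift n -` cyl m q = cyl (n + m) (\<lambda>i. if i \<le> n then p i else q (i - n))"
        (is "?L = ?R")
      proof
        show "?L \<subseteq> ?R"
        proof safe
          fix X i assume X: "\<forall>i\<le>n. X i = p i" "\<forall>i\<le>m. walk_shift n X i = q i" "i \<le> n + m"
          show "X i = (if i \<le> n then p i else q (i - n))"
            using X(1) X(2)[rule_format, of "i - n"] X(3) by (auto simp: walk_shift_def)
        qed
        show "?R \<subseteq> ?L"
        proof
          fix X assume X: "X \<in> ?R"
          have "walk_shift n X i = q i" if "i \<le> m" for i
          proof -
            have "X (n + i) = (if n + i \<le> n then p (n + i) else q (n + i - n))"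
              by (rule CollectD[OF X, rule_format]) (use that in simp)
            then show ?thesis using True by (cases i) (auto simp: walk_shift_def)
          qed
          moreover have "X i = p i" if "i \<le> n" for i
            using CollectD[OF X, rule_format, of i] that by simp
          ultimately show "X \<in> ?L" by simp
        qed
      qed
      then show ?thesis by (simp add: emeasure_quenched_cyl[OF \<omega>] path_weight_append[of q p n, OF True])
    next
      case False
      then have "cyl n p \<inter> walk_shift n -` cyl m q = {}"
        by (force simp: walk_shift_def)
      with False show ?thesis by (simp add: path_weight_def)
    qed
    also have "\<dots> = emeasure B (cyl m q)"
      by (simp add: B_def emeasure_quenched_cyl[OF \<omega>])
    finally show "emeasure A (cyl m q) = emeasure B (cyl m q)" .
  qed
  then show ?thesis using A[OF E] by (simp add: B_def)
qed

text \<open>The prefixes of length n + 1 form a countable partition of path space. Coding them by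
  natural numbers turns the decomposition into a series; numbers that code no prefix contribute the
  empty set.\<close>

lemma nn_integral_prefix_split:
  fixes F :: "(nat \<Rightarrow> int^'d::finite) \<Rightarrow> ennreal"
  assumes [measurable]: "F \<in> borel_measurable M" and M: "sets M = sets path_space"
  shows "(\<integral>\<^sup>+X. F X \<partial>M) =
    (\<Sum>j. \<integral>\<^sup>+X. F X * indicator {X. to_nat (map X [0..<Suc n]) = j} X \<partial>M)"
proof -
  have *: "{X. to_nat (map X [0..<Suc n]) = j} \<in> sets M" for j
  proof (cases "\<exists>X0 :: nat \<Rightarrow> int^'d. to_nat (map X0 [0..<Suc n]) = j")
    case True
    then obtain X0 :: "nat \<Rightarrow> int^'d" where "to_nat (map X0 [0..<Suc n]) = j" by blast
    then have "{X. to_nat (map X [0..<Suc n]) = j} = cyl n X0"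
      by (auto simp del: upt_Suc)
    then show ?thesis by (simp only: M path_cylinder_sets)
  next
    case False
    then show ?thesis by (simp del: upt_Suc)
  qed
  have "F X = (\<Sum>j. F X * indicator {X. to_nat (map X [0..<Suc n]) = j} X)" for X
  proof -
    have "(\<Sum>j. F X * indicator {X. to_nat (map X [0..<Suc n]) = j} X) =
      (\<Sum>j\<in>{to_nat (map X [0..<Suc n])}. F X * indicator {X. to_nat (map X [0..<Suc n]) = j} X)"
      by (rule suminf_finite) (auto simp del: upt_Suc)
    then show ?thesis by (simp del: upt_Suc)
  qed
  then have "(\<integral>\<^sup>+X. F X \<partial>M) = (\<integral>\<^sup>+X. (\<Sum>j. F X * indicator {X. to_nat (map X [0..<Suc n]) = j} X) \<partial>M)"
    by (simp del: upt_Suc)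
  also have "\<dots> = (\<Sum>j. \<integral>\<^sup>+X. F X * indicator {X. to_nat (map X [0..<Suc n]) = j} X \<partial>M)"
    by (rule nn_integral_suminf) (use * in measurable)
  finally show ?thesis .
qed

lemma prefix_det_measurable:
  fixes V :: "(nat \<Rightarrow> int^'d::finite) \<Rightarrow> 'b"
  assumes "prefix_det n V" and "range V \<subseteq> space N"
  shows "V \<in> path_space \<rightarrow>\<^sub>M N"
proof -
  have "(\<lambda>X. map X [0..<Suc n]) \<in> path_space \<rightarrow>\<^sub>M count_space (UNIV :: (int^'d) list set)"
  proof (rule measurable_count_space_eq2_countable[THEN iffD2], intro conjI allI impI ballI)
    fix xs :: "(int^'d) list"
    show "(\<lambda>X. map X [0..<Suc n]) -` {xs} \<inter> space path_space \<in> sets path_space"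
    proof (cases "\<exists>X0. map X0 [0..<Suc n] = xs")
      case True
      then obtain X0 where "map X0 [0..<Suc n] = xs" by blast
      then have "(\<lambda>X. map X [0..<Suc n]) -` {xs} = cyl n X0" by (auto simp del: upt_Suc)
      then show ?thesis using path_cylinder_sets by (simp del: upt_Suc)
    next
      case False
      then have "(\<lambda>X. map X [0..<Suc n]) -` {xs} = {}" by (auto simp del: upt_Suc)
      then show ?thesis by (simp del: upt_Suc)
    qed
  qed auto
  moreover have "(\<lambda>xs. V (\<lambda>i. xs ! i)) \<in> count_space (UNIV :: (int^'d) list set) \<rightarrow>\<^sub>M N"
    using assms(2) by auto
  ultimately have "(\<lambda>X. V (\<lambda>i. map X [0..<Suc n] ! i)) \<in> path_space \<rightarrow>\<^sub>M N"
    by (rule measurable_compose)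
  moreover have "V (\<lambda>i. map X [0..<Suc n] ! i) = V X" for X
  proof -
    have "\<forall>i\<le>n. map X [0..<Suc n] ! i = X i" by (auto simp del: upt_Suc)
    then show ?thesis using assms(1) unfolding prefix_det_def by blast
  qed
  ultimately show ?thesis by simp
qed

text \<open>On a cylinder V is constant and X n is a fixed site, so only G varies; there the
  identity passes from sets to functions by measurable induction, and the cylinders are summed
  up.\<close>

lemma nn_integral_markov:
  assumes \<omega>: "\<omega> \<in> space env_space" and V: "prefix_det n V"
    and G[measurable]: "G \<in> borel_measurable path_space"
  shows "(\<integral>\<^sup>+X. V X * G (walk_shift n X) \<partial>quenched \<omega> x) =
    (\<integral>\<^sup>+X. V X * (\<integral>\<^sup>+Y. G Y \<partial>quenched \<omega> (X n)) \<partial>quenched \<omega> x)"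
proof -
  have [measurable_cong]: "sets (quenched \<omega> y) = sets path_space" for y by (rule sets_quenched[OF \<omega>])
  have Vm[measurable]: "V \<in> borel_measurable path_space" by (rule prefix_det_measurable[OF V]) simp
  have hm: "(\<lambda>X. \<integral>\<^sup>+Y. G Y \<partial>quenched \<omega> (X n)) \<in> borel_measurable path_space"
    by (rule prefix_det_measurable[where n=n]) (auto simp: prefix_det_def)
  have cyl_case: "(\<integral>\<^sup>+X. V X * G (walk_shift n X) * indicator (cyl n p) X \<partial>quenched \<omega> x) =
    (\<integral>\<^sup>+X. V X * (\<integral>\<^sup>+Y. G Y \<partial>quenched \<omega> (X n)) * indicator (cyl n p) X \<partial>quenched \<omega> x)" for p
  proof -
    have [measurable]: "cyl n p \<in> sets path_space" by (rule path_cylinder_sets)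
    have VX: "V X = V p" if "X \<in> cyl n p" for X using V that unfolding prefix_det_def by blast
    have VX': "V X * (a * indicator (cyl n p) X) = V p * (a * indicator (cyl n p) X)" for X a
      using VX[of X] by (cases "X \<in> cyl n p") auto
    have base: "(\<integral>\<^sup>+X. G (walk_shift n X) * indicator (cyl n p) X \<partial>quenched \<omega> x) =
      path_weight \<omega> x n p * (\<integral>\<^sup>+Y. G Y \<partial>quenched \<omega> (p n))"
      using G
    proof (induction rule: borel_measurable_induct)
      case (cong f g) then show ?case by (simp cong: nn_integral_cong)
    next
      case (set A)
      have [measurable]: "A \<in> sets path_space" by fact
      have "walk_shift n -` A \<inter> space path_space \<in> sets path_space" by measurable
      then have [measurable]: "walk_shift n -` A \<in> sets path_space" by simp
      have "(\<integral>\<^sup>+X. indicator A (walk_shift n X) * indicator (cyl n p) X \<partial>quenched \<omega> x) =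
        (\<integral>\<^sup>+X. indicator (cyl n p \<inter> walk_shift n -` A) X \<partial>quenched \<omega> x)"
        by (intro nn_integral_cong) (auto simp: indicator_def)
      also have "\<dots> = emeasure (quenched \<omega> x) (cyl n p \<inter> walk_shift n -` A)"
        by (rule nn_integral_indicator) measurable
      finally show ?case using set by (simp add: emeasure_markov_cyl[OF \<omega>] sets_quenched[OF \<omega>])
    next
      case (mult u c)
      have [measurable]: "u \<in> borel_measurable path_space" by fact
      from mult show ?case
        by (simp add: mult.assoc nn_integral_cmult mult.left_commute)
    next
      case (add u v)
      have [measurable]: "u \<in> borel_measurable path_space" "v \<in> borel_measurable path_space" by fact+
      from add show ?case
        by (simp add: distrib_right nn_integral_add distrib_left)
    next
      case (seq U)
      have [measurable]: "U i \<in> borel_measurable path_space" for i by fact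
      have inc: "incseq (\<lambda>i X. U i (walk_shift n X) * indicator (cyl n p) X)"
        using seq by (auto simp: incseq_def le_fun_def intro!: mult_right_mono)
      have 1: "(\<integral>\<^sup>+X. (SUP i. U i) (walk_shift n X) * indicator (cyl n p) X \<partial>quenched \<omega> x) =
        (\<integral>\<^sup>+X. (SUP i. U i (walk_shift n X) * indicator (cyl n p) X) \<partial>quenched \<omega> x)"
        by (intro nn_integral_cong) (auto simp: SUP_mult_right_ennreal[symmetric] indicator_def image_image)
      have 2: "\<dots> = (SUP i. \<integral>\<^sup>+X. U i (walk_shift n X) * indicator (cyl n p) X \<partial>quenched \<omega> x)"
        by (rule nn_integral_monotone_convergence_SUP[OF inc]) measurable
      have 3: "(\<integral>\<^sup>+Y. (SUP i. U i) Y \<partial>quenched \<omega> (p n)) = (SUP i. \<integral>\<^sup>+Y. U i Y \<partial>quenched \<omega> (p n))"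
        using nn_integral_monotone_convergence_SUP[of U "quenched \<omega> (p n)"] seq
        by (simp add: image_image)
      have IH: "(\<integral>\<^sup>+X. U i (walk_shift n X) * indicator (cyl n p) X \<partial>quenched \<omega> x) =
        path_weight \<omega> x n p * (\<integral>\<^sup>+Y. U i Y \<partial>quenched \<omega> (p n))" for i
        by fact
      show ?case unfolding 1 2 3 IH by (rule SUP_mult_left_ennreal[symmetric])
    qed
    have "(\<integral>\<^sup>+X. V X * G (walk_shift n X) * indicator (cyl n p) X \<partial>quenched \<omega> x) =
      (\<integral>\<^sup>+X. V p * (G (walk_shift n X) * indicator (cyl n p) X) \<partial>quenched \<omega> x)"
      by (simp only: mult.assoc VX')
    also have "\<dots> = V p * (\<integral>\<^sup>+X. G (walk_shift n X) * indicator (cyl n p) X \<partial>quenched \<omega> x)"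
      by (rule nn_integral_cmult) measurable
    also have "\<dots> = V p * (\<integral>\<^sup>+Y. G Y \<partial>quenched \<omega> (p n)) * emeasure (quenched \<omega> x) (cyl n p)"
      by (simp add: base emeasure_quenched_cyl[OF \<omega>] mult_ac)
    also have "\<dots> = (\<integral>\<^sup>+X. V p * (\<integral>\<^sup>+Y. G Y \<partial>quenched \<omega> (p n)) * indicator (cyl n p) X \<partial>quenched \<omega> x)"
      by (subst nn_integral_cmult_indicator) measurable
    also have "\<dots> = (\<integral>\<^sup>+X. V X * (\<integral>\<^sup>+Y. G Y \<partial>quenched \<omega> (X n)) * indicator (cyl n p) X \<partial>quenched \<omega> x)"
      proof (intro nn_integral_cong)
      fix X show "V p * (\<integral>\<^sup>+Y. G Y \<partial>quenched \<omega> (p n)) * indicator (cyl n p) X =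
        V X * (\<integral>\<^sup>+Y. G Y \<partial>quenched \<omega> (X n)) * indicator (cyl n p) X"
        using VX[of X] by (cases "X \<in> cyl n p") auto
    qed
    finally show ?thesis .
  qed
  have split: "(\<integral>\<^sup>+X. V X * G (walk_shift n X) * indicator {X. to_nat (map X [0..<Suc n]) = j} X \<partial>quenched \<omega> x) =
    (\<integral>\<^sup>+X. V X * (\<integral>\<^sup>+Y. G Y \<partial>quenched \<omega> (X n)) * indicator {X. to_nat (map X [0..<Suc n]) = j} X \<partial>quenched \<omega> x)" for j
  proof (cases "\<exists>X0::nat \<Rightarrow> int^'a. to_nat (map X0 [0..<Suc n]) = j")
    case True
    then obtain X0 :: "nat \<Rightarrow> int^'a" where "to_nat (map X0 [0..<Suc n]) = j" by blast
    then have "{X. to_nat (map X [0..<Suc n]) = j} = cyl n X0"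
      by (auto simp del: upt_Suc)
    then show ?thesis using cyl_case[of X0] by simp
  qed (simp del: upt_Suc)
  have "(\<integral>\<^sup>+X. V X * G (walk_shift n X) \<partial>quenched \<omega> x) =
    (\<Sum>j. \<integral>\<^sup>+X. V X * G (walk_shift n X) * indicator {X. to_nat (map X [0..<Suc n]) = j} X \<partial>quenched \<omega> x)"
    by (rule nn_integral_prefix_split[OF _ sets_quenched[OF \<omega>]]) measurable
  also have "\<dots> = (\<Sum>j. \<integral>\<^sup>+X. V X * (\<integral>\<^sup>+Y. G Y \<partial>quenched \<omega> (X n)) *
      indicator {X. to_nat (map X [0..<Suc n]) = j} X \<partial>quenched \<omega> x)"
    unfolding split ..
  also have "\<dots> = (\<integral>\<^sup>+X. V X * (\<integral>\<^sup>+Y. G Y \<partial>quenched \<omega> (X n)) \<partial>quenched \<omega> x)"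
    by (rule nn_integral_prefix_split[OF _ sets_quenched[OF \<omega>], symmetric])
       (simp only: measurable_quenched_cong[OF \<omega>], intro borel_measurable_times_ennreal Vm hm)
  finally show ?thesis .
qed

lemma nn_integral_eqI_cyl:
  fixes M N :: "(nat \<Rightarrow> int^'d::finite) measure"
  assumes F: "F \<in> borel_measurable path_space" "F' \<in> borel_measurable path_space"
    and M: "sets M = sets path_space" "sets N = sets path_space"
    and eq: "\<And>p. (\<integral>\<^sup>+X. F X * indicator (cyl n p) X \<partial>M) = (\<integral>\<^sup>+X. F' X * indicator (cyl n p) X \<partial>N)"
  shows "(\<integral>\<^sup>+X. F X \<partial>M) = (\<integral>\<^sup>+X. F' X \<partial>N)"
proof -
  have sp: "(\<integral>\<^sup>+X. F X * indicator {X. to_nat (map X [0..<Suc n]) = j} X \<partial>M) =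
    (\<integral>\<^sup>+X. F' X * indicator {X. to_nat (map X [0..<Suc n]) = j} X \<partial>N)" for j
  proof (cases "\<exists>X0::nat \<Rightarrow> int^'d. to_nat (map X0 [0..<Suc n]) = j")
    case True
    then obtain X0 :: "nat \<Rightarrow> int^'d" where "to_nat (map X0 [0..<Suc n]) = j" by blast
    then have "{X. to_nat (map X [0..<Suc n]) = j} = cyl n X0"
      by (auto simp del: upt_Suc)
    then show ?thesis using eq[of X0] by simp
  qed (simp del: upt_Suc)
  have "F \<in> borel_measurable M" "F' \<in> borel_measurable N"
    using F measurable_cong_sets[OF M(1) refl] measurable_cong_sets[OF M(2) refl] by blast+
  then show ?thesis
    using nn_integral_prefix_split[OF _ M(1), of F n] nn_integral_prefix_split[OF _ M(2), of F' n]
    by (simp add: sp del: upt_Suc)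
qed

lemma nn_integral_cyl:
  assumes \<omega>: "\<omega> \<in> space env_space" and V: "prefix_det n V"
  shows "(\<integral>\<^sup>+X. V X * indicator (cyl n p) X \<partial>quenched \<omega> x) = V p * path_weight \<omega> x n p"
proof -
  have "V X * indicator (cyl n p) X = V p * indicator (cyl n p) X" for X
  proof (cases "X \<in> cyl n p")
    case True
    then have "V X = V p" using V unfolding prefix_det_def by blast
    then show ?thesis by simp
  qed simp
  then have "(\<integral>\<^sup>+X. V X * indicator (cyl n p) X \<partial>quenched \<omega> x) =
    (\<integral>\<^sup>+X. V p * indicator (cyl n p) X \<partial>quenched \<omega> x)"
    by presburger
  also have "\<dots> = V p * path_weight \<omega> x n p"
    by (subst nn_integral_cmult_indicator)
      (simp_all add: sets_quenched[OF \<omega>] path_cylinder_sets emeasure_quenched_cyl[OF \<omega>])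
  finally show ?thesis .
qed

lemma prefix_det_borel_measurable:
  fixes V :: "(nat \<Rightarrow> int^'d::finite) \<Rightarrow> 'b::topological_space"
  shows "prefix_det n V \<Longrightarrow> V \<in> borel_measurable path_space"
  by (rule prefix_det_measurable) auto

lemma path_weight_local:
  assumes "\<And>z. z \<in> S \<Longrightarrow> \<omega> z = \<omega>' z" and "\<And>i. i < n \<Longrightarrow> p i \<in> S"
  shows "path_weight \<omega> x n p = path_weight \<omega>' x n p"
  using assms unfolding path_weight_def by (auto intro!: prod.cong)

text \<open>The environment is read only at sites from which the walk steps, hence at times before
  n. The endpoint X n may lie outside S, which later allows it to sit on the boundary of the
  half-space that carries the past.\<close>

lemma quenched_local_prefix:
  assumes \<omega>: "\<omega> \<in> space env_space" "\<omega>' \<in> space env_space"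
    and S: "\<And>z. z \<in> S \<Longrightarrow> \<omega> z = \<omega>' z"
    and V: "prefix_det n V" "\<And>X i. i < n \<Longrightarrow> X i \<notin> S \<Longrightarrow> V X = 0"
  shows "(\<integral>\<^sup>+X. V X \<partial>quenched \<omega> x) = (\<integral>\<^sup>+X. V X \<partial>quenched \<omega>' x)"
proof (rule nn_integral_eqI_cyl[where n=n])
  fix p
  show "(\<integral>\<^sup>+X. V X * indicator (cyl n p) X \<partial>quenched \<omega> x) =
    (\<integral>\<^sup>+X. V X * indicator (cyl n p) X \<partial>quenched \<omega>' x)"
  proof (cases "\<forall>i<n. p i \<in> S")
    case True
    then show ?thesis
      using path_weight_local[of S \<omega> \<omega>' n p x] S
      by (simp add: nn_integral_cyl[OF \<omega>(1) V(1)] nn_integral_cyl[OF \<omega>(2) V(1)])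
  next
    case False
    then have "V p = 0" using V(2) by blast
    then show ?thesis
      by (simp add: nn_integral_cyl[OF \<omega>(1) V(1)] nn_integral_cyl[OF \<omega>(2) V(1)])
  qed
qed (use \<omega> V in \<open>auto intro: prefix_det_borel_measurable simp: sets_quenched\<close>)

lemma stay_sets:
  "{X. \<forall>i. X i \<in> S} \<in> sets (path_space :: (nat \<Rightarrow> int^'d::finite) measure)"
  "{X. \<forall>i<n. X i \<in> S} \<in> sets (path_space :: (nat \<Rightarrow> int^'d::finite) measure)"
proof -
  have "{X \<in> space path_space. \<forall>i. X i \<in> S} \<in> sets (path_space :: (nat \<Rightarrow> int^'d::finite) measure)"
    by measurable
  then show "{X. \<forall>i. X i \<in> S} \<in> sets (path_space :: (nat \<Rightarrow> int^'d::finite) measure)" by simp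
  have "{X \<in> space path_space. \<forall>i<n. X i \<in> S} \<in> sets (path_space :: (nat \<Rightarrow> int^'d::finite) measure)"
    by measurable
  then show "{X. \<forall>i<n. X i \<in> S} \<in> sets (path_space :: (nat \<Rightarrow> int^'d::finite) measure)" by simp
qed

text \<open>Confinement to S up to time N depends on finitely many steps, so
  \<open>quenched_local_prefix\<close> applies to it; letting N grow gives confinement forever by
  continuity from above.\<close>

lemma quenched_local_stay:
  fixes \<omega> \<omega>' :: "('d::finite) env"
  assumes \<omega>: "\<omega> \<in> space env_space" "\<omega>' \<in> space env_space"
    and S: "\<And>z. z \<in> S \<Longrightarrow> \<omega> z = \<omega>' z"
    and G[measurable]: "G \<in> borel_measurable path_space"
  shows "(\<integral>\<^sup>+X. G X * indicator {X. \<forall>i. X i \<in> S} X \<partial>quenched \<omega> x) =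
    (\<integral>\<^sup>+X. G X * indicator {X. \<forall>i. X i \<in> S} X \<partial>quenched \<omega>' x)"
proof -
  let ?S = "{X. \<forall>i. X i \<in> S}"
  note st[measurable] = stay_sets(1)[where S=S]
  have sq[measurable_cong]: "sets (quenched \<omega> x) = sets path_space" "sets (quenched \<omega>' x) = sets path_space"
    by (rule sets_quenched[OF \<omega>(1)] sets_quenched[OF \<omega>(2)])+
  interpret q: prob_space "quenched \<omega> x" by (rule prob_space_quenched[OF \<omega>(1)])
  have lim: "(\<lambda>N. emeasure (quenched \<nu> x) (cyl m p \<inter> {X. \<forall>i<N. X i \<in> S}))
      \<longlonglongrightarrow> emeasure (quenched \<nu> x) (cyl m p \<inter> ?S)"
    if \<nu>: "\<nu> \<in> space env_space" for \<nu> m p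
  proof -
    interpret qn: prob_space "quenched \<nu> x" by (rule prob_space_quenched[OF \<nu>])
    have "(\<Inter>N. cyl m p \<inter> {X. \<forall>i<N. X i \<in> S}) = cyl m p \<inter> ?S" by auto
    moreover have "(\<lambda>N. emeasure (quenched \<nu> x) (cyl m p \<inter> {X. \<forall>i<N. X i \<in> S})) \<longlonglongrightarrow>
      emeasure (quenched \<nu> x) (\<Inter>N. cyl m p \<inter> {X. \<forall>i<N. X i \<in> S})"
      by (rule Lim_emeasure_decseq)
        (auto simp: sets_quenched[OF \<nu>] decseq_def intro!: sets.Int stay_sets path_cylinder_sets)
    ultimately show ?thesis by simp
  qed
  have cylS: "emeasure (quenched \<omega> x) (cyl m p \<inter> ?S) = emeasure (quenched \<omega>' x) (cyl m p \<inter> ?S)" for m p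
  proof (rule LIMSEQ_unique[OF lim[OF \<omega>(1)]])
    have fin: "emeasure (quenched \<omega> x) (cyl m p \<inter> {X. \<forall>i<N. X i \<in> S}) =
      emeasure (quenched \<omega>' x) (cyl m p \<inter> {X. \<forall>i<N. X i \<in> S})" if "m \<le> N" for N
    proof -
      have "(\<integral>\<^sup>+X. indicator (cyl m p \<inter> {X. \<forall>i<N. X i \<in> S}) X \<partial>quenched \<omega> x) =
        (\<integral>\<^sup>+X. indicator (cyl m p \<inter> {X. \<forall>i<N. X i \<in> S}) X \<partial>quenched \<omega>' x)"
      proof (rule quenched_local_prefix[OF \<omega> S])
        show "prefix_det N (indicator (cyl m p \<inter> {X. \<forall>i<N. X i \<in> S}) :: _ \<Rightarrow> ennreal)"
          using that by (auto simp: prefix_det_def indicator_def)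
      qed (auto simp: indicator_def)
      then show ?thesis
        by (simp add: sq sets.Int stay_sets path_cylinder_sets)
    qed
    have "\<forall>\<^sub>F N in sequentially. emeasure (quenched \<omega>' x) (cyl m p \<inter> {X. \<forall>i<N. X i \<in> S}) =
      emeasure (quenched \<omega> x) (cyl m p \<inter> {X. \<forall>i<N. X i \<in> S})"
      using eventually_ge_at_top[of m] by eventually_elim (rule fin[symmetric])
    from Lim_transform_eventually[OF lim[OF \<omega>(2)] this]
    show "(\<lambda>N. emeasure (quenched \<omega> x) (cyl m p \<inter> {X. \<forall>i<N. X i \<in> S}))
      \<longlonglongrightarrow> emeasure (quenched \<omega>' x) (cyl m p \<inter> ?S)" .
  qed
  have dens: "emeasure (density (quenched \<nu> x) (indicator ?S)) E = emeasure (quenched \<nu> x) (E \<inter> ?S)"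
    if \<nu>: "\<nu> \<in> space env_space" and E: "E \<in> sets path_space" for \<nu> E
  proof -
    have "emeasure (density (quenched \<nu> x) (indicator ?S)) E =
      (\<integral>\<^sup>+X. indicator ?S X * indicator E X \<partial>quenched \<nu> x)"
      by (rule emeasure_density) (use E st in \<open>simp_all add: sets_quenched[OF \<nu>] measurable_quenched_cong[OF \<nu>]\<close>)
    also have "\<dots> = (\<integral>\<^sup>+X. indicator (E \<inter> ?S) X \<partial>quenched \<nu> x)"
      by (intro nn_integral_cong) (auto simp: indicator_def)
    also have "\<dots> = emeasure (quenched \<nu> x) (E \<inter> ?S)"
      by (rule nn_integral_indicator) (use E st in \<open>simp add: sets_quenched[OF \<nu>]\<close>)
    finally show ?thesis .
  qed
  \<comment> \<open>The confinement is moved into the measure, so that agreement on cylinders yields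
    equality for every integrand G.\<close>
  have "density (quenched \<omega> x) (indicator ?S) = density (quenched \<omega>' x) (indicator ?S)"
  proof (rule path_measure_eqI)
    have "(UNIV :: (nat \<Rightarrow> int^'d) set) \<in> sets path_space"
      using sets.top[of "path_space :: (nat \<Rightarrow> int^'d) measure"] by simp
    from dens[OF \<omega>(1) this] show "finite_measure (density (quenched \<omega> x) (indicator ?S))"
      by (intro finite_measureI) (simp add: \<omega>)
  qed (simp_all add: sq dens \<omega> path_cylinder_sets cylS)
  then have "(\<integral>\<^sup>+X. G X \<partial>density (quenched \<omega> x) (indicator ?S)) =
    (\<integral>\<^sup>+X. G X \<partial>density (quenched \<omega>' x) (indicator ?S))" by simp
  then show ?thesis
    by (subst (asm) (1 2) nn_integral_density)
      (use st in \<open>simp_all add: measurable_quenched_cong \<omega> mult.commute\<close>)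
qed

section \<open>Dependence of quenched quantities on the environment in a set of sites\<close>

lemma space_env_sigma [simp]: "space (env_sigma S) = space env_space"
  unfolding env_sigma_def by (rule space_measure_of) auto

lemma measurable_env_sigma_coord:
  "z \<in> S \<Longrightarrow> (\<lambda>\<omega>. \<omega> z) \<in> env_sigma S \<rightarrow>\<^sub>M step_simplex"
proof (rule measurableI)
  fix A :: "(int^'a \<Rightarrow> real) set" assume "z \<in> S" "A \<in> sets step_simplex"
  then show "(\<lambda>\<omega>. \<omega> z) -` A \<inter> space (env_sigma S) \<in> sets (env_sigma S)"
    unfolding space_env_sigma unfolding env_sigma_def by (subst sets_measure_of) auto
qed (auto simp: env_space_def space_PiM)

lemma sets_env_sigma_subset: "sets (env_sigma S) \<subseteq> sets env_space"
proof -
  have "sets (env_sigma S) = sigma_sets (space env_space)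
      {(\<lambda>\<omega>. \<omega> z) -` A \<inter> space env_space | z A. z \<in> S \<and> A \<in> sets step_simplex}"
    unfolding env_sigma_def by (rule sets_measure_of) auto
  also have "\<dots> \<subseteq> sets env_space"
    by (rule sets.sigma_sets_subset)
       (auto intro!: measurable_sets measurable_component_singleton simp: env_space_def)
  finally show ?thesis .
qed

lemma measurable_env_sigma_space:
  "f \<in> env_sigma S \<rightarrow>\<^sub>M N \<Longrightarrow> f \<in> env_space \<rightarrow>\<^sub>M N"
  using sets_env_sigma_subset[of S] by (auto simp: measurable_def)

lemma measurable_env_sigma_mono:
  assumes "S \<subseteq> S'" "f \<in> env_sigma S \<rightarrow>\<^sub>M N"
  shows "f \<in> env_sigma S' \<rightarrow>\<^sub>M N"
proof -
  have "sets (env_sigma S) \<subseteq> sets (env_sigma S')"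
    unfolding env_sigma_def using assms(1)
    by (subst (1 2) sets_measure_of) (auto intro!: sigma_sets_mono')
  then show ?thesis using assms(2) by (auto simp: measurable_def)
qed

text \<open>Freezes the environment off S at one fixed probability vector: a measurable functional
  that is unchanged by this map is measurable with respect to \<open>env_sigma S\<close>.\<close>

definition env_cut :: "(int^'d::finite) set \<Rightarrow> 'd env \<Rightarrow> 'd env" where
  "env_cut S \<omega> = (\<lambda>z. if z \<in> S then \<omega> z else (SOME p. p \<in> space step_simplex))"

definition env_shift :: "int^'d::finite \<Rightarrow> 'd env \<Rightarrow> 'd env" where
  "env_shift x \<omega> = (\<lambda>z. \<omega> (z + x))"

lemma in_space_env_space: "\<omega> \<in> space env_space \<longleftrightarrow> (\<forall>z. \<omega> z \<in> space step_simplex)"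
  by (auto simp: env_space_def space_PiM)

lemma env_cut_space [simp]: "\<omega> \<in> space env_space \<Longrightarrow> env_cut S \<omega> \<in> space env_space"
  unfolding in_space_env_space env_cut_def using someI_ex[of "\<lambda>p. p \<in> space step_simplex"] by auto

lemma env_shift_space [simp]: "\<omega> \<in> space env_space \<Longrightarrow> env_shift x \<omega> \<in> space env_space"
  unfolding in_space_env_space env_shift_def by auto

lemma env_cut_eq: "z \<in> S \<Longrightarrow> env_cut S \<omega> z = \<omega> z"
  by (simp add: env_cut_def)

lemma measurable_env_cut: "env_cut S \<in> env_sigma S \<rightarrow>\<^sub>M env_space"
  unfolding env_space_def
proof (rule measurable_PiM_single')
  fix z
  show "(\<lambda>\<omega>. env_cut S \<omega> z) \<in> env_sigma S \<rightarrow>\<^sub>M step_simplex"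
  proof (cases "z \<in> S")
    case True
    then show ?thesis using measurable_env_sigma_coord[OF True] by (simp add: env_cut_def)
  next
    case False
    have "(\<lambda>\<omega>::'a env. SOME p :: int^'a \<Rightarrow> real. p \<in> space step_simplex) \<in> env_sigma S \<rightarrow>\<^sub>M step_simplex"
    proof (cases "space (step_simplex :: (int^'a \<Rightarrow> real) measure) = {}")
      \<comment> \<open>If the simplex were empty, the choice in \<open>env_cut\<close> would have
        no witness; but then \<open>space env_space\<close> is empty as well and every map on it is
        measurable.\<close>
      case True
      then have "space (env_space :: 'a env measure) = {}"
        by (auto simp: in_space_env_space)
      then show ?thesis by (auto simp: measurable_def)
    next
      case False
      then show ?thesis by (intro measurable_const) (simp add: some_in_eq)
    qed
    with False show ?thesis by (simp add: env_cut_def)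
  qed
next
  show "env_cut S \<in> space (env_sigma S) \<rightarrow> (\<Pi>\<^sub>E i\<in>UNIV. space step_simplex)"
    using env_cut_space[of _ S] by (auto simp: env_space_def space_PiM)
qed

lemma measurable_env_shift_sigma: "env_shift x \<in> env_sigma {z. z - x \<in> S} \<rightarrow>\<^sub>M env_sigma S"
proof -
  have "(\<lambda>\<omega>. env_shift x \<omega>) \<in> measurable (env_sigma {z. z - x \<in> S}) (sigma (space env_space)
     {(\<lambda>\<omega>. \<omega> z) -` A \<inter> space env_space | z A. z \<in> S \<and> A \<in> sets step_simplex})"
  proof (rule measurable_measure_of)
    fix Y assume "Y \<in> {(\<lambda>\<omega>::'a env. \<omega> z) -` A \<inter> space env_space | z A. z \<in> S \<and> A \<in> sets step_simplex}"
    then obtain z A where Y: "Y = (\<lambda>\<omega>. \<omega> z) -` A \<inter> space env_space" "z \<in> S" "A \<in> sets step_simplex"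
      by auto
    have "env_shift x -` Y \<inter> space (env_sigma {z. z - x \<in> S}) =
      (\<lambda>\<omega>. \<omega> (z + x)) -` A \<inter> space (env_sigma {z. z - x \<in> S})"
      using env_shift_space by (auto simp: Y env_shift_def)
    also have "\<dots> \<in> sets (env_sigma {z. z - x \<in> S})"
      by (rule measurable_sets[OF measurable_env_sigma_coord Y(3)]) (use Y in simp)
    finally show "env_shift x -` Y \<inter> space (env_sigma {z. z - x \<in> S}) \<in> sets (env_sigma {z. z - x \<in> S})" .
  qed auto
  then show ?thesis unfolding env_sigma_def[of S] .
qed

lemma measurable_env_shift: "env_shift x \<in> env_space \<rightarrow>\<^sub>M env_space"
  unfolding env_space_def env_shift_def
  by (rule measurable_PiM_single') (auto simp: space_PiM)

lemma measurable_quenched_integral: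
  assumes "G \<in> borel_measurable path_space"
  shows "(\<lambda>\<omega>. \<integral>\<^sup>+X. G X \<partial>quenched \<omega> x) \<in> borel_measurable env_space"
  by (rule nn_integral_measurable_subprob_algebra2[OF _ measurable_quenched])
    (use measurable_compose[OF measurable_snd assms] in \<open>simp add: split_beta'\<close>)

lemma measurable_eq_onI:
  "f \<in> M \<rightarrow>\<^sub>M N \<Longrightarrow> (\<And>w. w \<in> space M \<Longrightarrow> f w = g w) \<Longrightarrow> g \<in> M \<rightarrow>\<^sub>M N"
  by (subst measurable_cong[of M g f]) auto

text \<open>By \<open>quenched_local_prefix\<close> the integral is unchanged by
  \<open>env_cut S\<close>, so it factors through the environment in S.\<close>

lemma measurable_quenched_prefix:
  assumes V: "prefix_det n V" "\<And>X i. i < n \<Longrightarrow> X i \<notin> S \<Longrightarrow> V X = 0"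
  shows "(\<lambda>\<omega>. \<integral>\<^sup>+X. V X \<partial>quenched \<omega> x) \<in> borel_measurable (env_sigma S)"
proof -
  have "(\<lambda>\<omega>. \<integral>\<^sup>+X. V X \<partial>quenched (env_cut S \<omega>) x) \<in> borel_measurable (env_sigma S)"
    by (rule measurable_compose[OF measurable_env_cut
          measurable_quenched_integral[OF prefix_det_borel_measurable[OF V(1)]]])
  moreover have "(\<integral>\<^sup>+X. V X \<partial>quenched (env_cut S \<omega>) x) = (\<integral>\<^sup>+X. V X \<partial>quenched \<omega> x)"
    if "\<omega> \<in> space (env_sigma S)" for \<omega>
    by (rule quenched_local_prefix[OF _ _ _ V, where S=S]) (use that in \<open>simp_all add: env_cut_eq\<close>)
  ultimately show ?thesis
    by (rule measurable_eq_onI)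
qed

lemma measurable_quenched_stay:
  assumes "G \<in> borel_measurable path_space"
  shows "(\<lambda>\<omega>. \<integral>\<^sup>+X. G X * indicator {X. \<forall>i. X i \<in> S} X \<partial>quenched \<omega> x) \<in> borel_measurable (env_sigma S)"
proof -
  have "(\<lambda>\<omega>. \<integral>\<^sup>+X. G X * indicator {X. \<forall>i. X i \<in> S} X \<partial>quenched (env_cut S \<omega>) x)
    \<in> borel_measurable (env_sigma S)"
    by (rule measurable_compose[OF measurable_env_cut measurable_quenched_integral])
      (use assms stay_sets(1)[where S=S] in simp)
  moreover have "(\<integral>\<^sup>+X. G X * indicator {X. \<forall>i. X i \<in> S} X \<partial>quenched (env_cut S \<omega>) x) =
    (\<integral>\<^sup>+X. G X * indicator {X. \<forall>i. X i \<in> S} X \<partial>quenched \<omega> x)"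
    if "\<omega> \<in> space (env_sigma S)" for \<omega>
    by (rule quenched_local_stay[OF _ _ _ assms, where S=S]) (use that in \<open>simp_all add: env_cut_eq\<close>)
  ultimately show ?thesis
    by (rule measurable_eq_onI)
qed

section \<open>Translation of the environment and first-step expansions\<close>

lemma path_weight_shift:
  "path_weight (env_shift x \<omega>) y n p = path_weight \<omega> (y + x) n (\<lambda>i. p i + x)"
  unfolding path_weight_def env_shift_def by (auto intro!: prod.cong)

lemma quenched_shift:
  assumes \<omega>: "\<omega> \<in> space env_space"
  shows "quenched (env_shift x \<omega>) y = distr (quenched \<omega> (y + x)) path_space (\<lambda>X m. X m + - x)"
proof (rule path_measure_eqI)
  have [measurable_cong]: "sets (quenched \<omega> (y + x)) = sets path_space" by (rule sets_quenched[OF \<omega>])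
  show "finite_measure (quenched (env_shift x \<omega>) y)"
    using prob_space_quenched[OF env_shift_space[OF \<omega>]] by (simp add: prob_space_def)
  show "emeasure (quenched (env_shift x \<omega>) y) (cyl n p) =
    emeasure (distr (quenched \<omega> (y + x)) path_space (\<lambda>X m. X m + - x)) (cyl n p)" for n p
  proof -
    have "(\<lambda>X m. X m + - x) -` cyl n p = cyl n (\<lambda>i. p i + x)" by (auto simp: algebra_simps)
    then have "emeasure (distr (quenched \<omega> (y + x)) path_space (\<lambda>X m. X m + - x)) (cyl n p) =
      emeasure (quenched \<omega> (y + x)) (cyl n (\<lambda>i. p i + x))"
      by (subst emeasure_distr) (use measurable_walk_translate[of "- x"] in
        \<open>simp_all add: path_cylinder_sets \<omega> measurable_quenched_cong[OF \<omega>]\<close>)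
    then show ?thesis
      by (simp add: emeasure_quenched_cyl \<omega> path_weight_shift)
  qed
qed (simp_all add: sets_quenched \<omega>)

lemma nn_integral_quenched_shift:
  assumes \<omega>: "\<omega> \<in> space env_space" and G: "G \<in> borel_measurable path_space"
  shows "(\<integral>\<^sup>+X. G X \<partial>quenched \<omega> (y + x)) = (\<integral>\<^sup>+X. G (\<lambda>m. X m + x) \<partial>quenched (env_shift x \<omega>) y)"
proof -
  have m: "(\<lambda>X. G (\<lambda>m. X m + x)) \<in> borel_measurable path_space"
    by (rule measurable_compose[OF measurable_walk_translate G])
  show ?thesis
    unfolding quenched_shift[OF \<omega>]
    by (subst nn_integral_distr) (use m measurable_walk_translate[of "- x"] in \<open>simp_all add: measurable_quenched_cong[OF \<omega>]\<close>)
qed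

lemma AE_quenched_steps:
  assumes \<omega>: "\<omega> \<in> space env_space"
  shows "AE X in quenched \<omega> x. X 0 = x \<and> (\<forall>n. X (Suc n) - X n \<in> unit_steps)"
proof -
  have 1: "AE X in quenched \<omega> x. X n \<in> A" if n: "\<And>p. p n \<notin> A \<Longrightarrow> path_weight \<omega> x n p = 0" for n A
  proof -
    let ?V = "\<lambda>X. indicator (- A) (X n) :: ennreal"
    have V: "prefix_det n ?V" by (auto simp: prefix_det_def)
    have "(\<integral>\<^sup>+X. ?V X \<partial>quenched \<omega> x) = (\<integral>\<^sup>+X. 0 \<partial>quenched \<omega> x)"
    proof (rule nn_integral_eqI_cyl[where n=n])
      show "(\<integral>\<^sup>+X. ?V X * indicator (cyl n p) X \<partial>quenched \<omega> x) =
        (\<integral>\<^sup>+X. 0 * indicator (cyl n p) X \<partial>quenched \<omega> x)" for p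
        using n[of p] by (cases "p n \<in> A") (simp_all add: nn_integral_cyl[OF \<omega> V])
    qed (use prefix_det_borel_measurable[OF V] in \<open>simp_all add: sets_quenched[OF \<omega>]\<close>)
    then have "AE X in quenched \<omega> x. ?V X = 0"
      using nn_integral_0_iff_AE[of ?V "quenched \<omega> x"] prefix_det_borel_measurable[OF V]
      by (simp add: measurable_quenched_cong[OF \<omega>])
    then show ?thesis by eventually_elim (auto simp: indicator_def split: if_splits)
  qed
  have "AE X in quenched \<omega> x. X 0 \<in> {x}" by (rule 1) (auto simp: path_weight_def)
  moreover have "AE X in quenched \<omega> x. X (Suc n) - X n \<in> unit_steps" for n
  proof -
    let ?V = "\<lambda>X. if X (Suc n) - X n \<in> unit_steps then 0 else 1 :: ennreal"
    have V: "prefix_det (Suc n) ?V" by (auto simp: prefix_det_def)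
    have "(\<integral>\<^sup>+X. ?V X \<partial>quenched \<omega> x) = (\<integral>\<^sup>+X. 0 \<partial>quenched \<omega> x)"
    proof (rule nn_integral_eqI_cyl[where n="Suc n"])
      show "(\<integral>\<^sup>+X. ?V X * indicator (cyl (Suc n) p) X \<partial>quenched \<omega> x) =
        (\<integral>\<^sup>+X. 0 * indicator (cyl (Suc n) p) X \<partial>quenched \<omega> x)" for p
        by (simp only: nn_integral_cyl[OF \<omega> V]) (auto simp: path_weight_def)
    qed (use prefix_det_borel_measurable[OF V] in \<open>simp_all add: sets_quenched[OF \<omega>]\<close>)
    then have "AE X in quenched \<omega> x. ?V X = 0"
      using nn_integral_0_iff_AE[of ?V "quenched \<omega> x"] prefix_det_borel_measurable[OF V]
      by (simp add: measurable_quenched_cong[OF \<omega>])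
    then show ?thesis by eventually_elim (auto split: if_splits)
  qed
  ultimately show ?thesis by (simp add: AE_all_countable)
qed

lemma nn_integral_quenched_one_step:
  assumes \<omega>: "\<omega> \<in> space env_space"
  shows "(\<integral>\<^sup>+X. f (X 1) \<partial>quenched \<omega> x) = (\<Sum>e\<in>unit_steps. ennreal (\<omega> x e) * f (x + e))"
proof -
  let ?p = "\<lambda>e i. if i = 0 then x else x + e :: int^'a"
  have "(\<integral>\<^sup>+X. f (X 1) \<partial>quenched \<omega> x) =
    (\<integral>\<^sup>+X. (\<Sum>e\<in>unit_steps. f (x + e) * indicator (cyl 1 (?p e)) X) \<partial>quenched \<omega> x)"
  proof (rule nn_integral_cong_AE, use AE_quenched_steps[OF \<omega>, of x] in eventually_elim)
    case (elim X)
    have *: "X \<in> cyl 1 (?p e) \<longleftrightarrow> e = X 1 - x" for e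
      using elim by (auto simp: le_Suc_eq)
    have "(\<Sum>e\<in>unit_steps. f (x + e) * indicator (cyl 1 (?p e)) X) =
      (\<Sum>e\<in>unit_steps. if e = X 1 - x then f (X 1) else 0)"
      by (intro sum.cong refl) (use * in \<open>auto simp: indicator_def\<close>)
    also have "\<dots> = f (X 1)"
      using elim spec[OF conjunct2[OF elim], of 0] by (simp add: finite_unit_steps)
    finally show ?case ..
  qed
  also have "\<dots> = (\<Sum>e\<in>unit_steps. f (x + e) * emeasure (quenched \<omega> x) (cyl 1 (?p e)))"
    by (subst nn_integral_sum)
      (auto simp: nn_integral_cmult_indicator sets_quenched[OF \<omega>] path_cylinder_sets
        measurable_quenched_cong[OF \<omega>])
  also have "\<dots> = (\<Sum>e\<in>unit_steps. ennreal (\<omega> x e) * f (x + e))"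
    by (intro sum.cong refl) (simp only: emeasure_quenched_cyl[OF \<omega>], simp add: path_weight_def mult.commute)
  finally show ?thesis .
qed

lemma nn_integral_quenched_first_step:
  assumes \<omega>: "\<omega> \<in> space env_space" and G: "G \<in> borel_measurable path_space"
  shows "(\<integral>\<^sup>+X. G (walk_shift 1 X) \<partial>quenched \<omega> x) =
    (\<Sum>e\<in>unit_steps. ennreal (\<omega> x e) * (\<integral>\<^sup>+Y. G Y \<partial>quenched \<omega> (x + e)))"
  using nn_integral_markov[OF \<omega> _ G, where n=1 and V="\<lambda>_. 1" and x=x]
    nn_integral_quenched_one_step[OF \<omega>, where f="\<lambda>y. \<integral>\<^sup>+Y. G Y \<partial>quenched \<omega> y" and x=x]
  by (simp add: prefix_det_def)

section \<open>Consequences of the hypotheses on the environment\<close>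

text \<open>The hypothesis is a weak form of E[F | N] \<le> \<delta>. Tested on sets, it extends to
  all nonnegative weights by measurable induction; conditional bounds are carried in this form
  throughout.\<close>

lemma nn_integral_test_le:
  assumes N: "sets N \<subseteq> sets P" "space N = space P"
    and F[measurable]: "F \<in> borel_measurable P"
    and le: "\<And>A. A \<in> sets N \<Longrightarrow> (\<integral>\<^sup>+\<omega>. indicator A \<omega> * F \<omega> \<partial>P) \<le> \<delta> * emeasure P A"
    and f: "f \<in> borel_measurable N"
  shows "(\<integral>\<^sup>+\<omega>. f \<omega> * F \<omega> \<partial>P) \<le> \<delta> * (\<integral>\<^sup>+\<omega>. f \<omega> \<partial>P)"
proof -
  have sub: "g \<in> borel_measurable P" if "g \<in> borel_measurable N" for g :: "'a \<Rightarrow> ennreal"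
    using that N by (auto simp: measurable_def)
  show ?thesis using f
  proof (induction rule: borel_measurable_induct)
    case (cong f g)
    have "(\<integral>\<^sup>+\<omega>. f \<omega> * F \<omega> \<partial>P) = (\<integral>\<^sup>+\<omega>. g \<omega> * F \<omega> \<partial>P)" "(\<integral>\<^sup>+\<omega>. f \<omega> \<partial>P) = (\<integral>\<^sup>+\<omega>. g \<omega> \<partial>P)"
      using cong N(2) by (auto intro!: nn_integral_cong)
    with cong show ?case by simp
  next
    case (set A)
    then have "A \<in> sets P" using N by auto
    with le[OF set] show ?case by simp
  next
    case (mult u v)
    have [measurable]: "u \<in> borel_measurable P" by (rule sub) fact
    show ?case
      using mult_left_mono[OF mult(4), of v]
      by (simp add: mult.assoc nn_integral_cmult mult.left_commute)
  next
    case (add u v)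
    have [measurable]: "u \<in> borel_measurable P" "v \<in> borel_measurable P" by (rule sub, fact)+
    have uF: "(\<integral>\<^sup>+\<omega>. u \<omega> * F \<omega> \<partial>P) \<le> \<delta> * (\<integral>\<^sup>+\<omega>. u \<omega> \<partial>P)" by fact
    have vF: "(\<integral>\<^sup>+\<omega>. v \<omega> * F \<omega> \<partial>P) \<le> \<delta> * (\<integral>\<^sup>+\<omega>. v \<omega> \<partial>P)" by fact
    show ?case
      using add_mono[OF uF vF]
      by (simp add: distrib_right nn_integral_add distrib_left add.commute)
  next
    case (seq U)
    have [measurable]: "U i \<in> borel_measurable P" for i by (rule sub) fact
    have inc: "incseq (\<lambda>i \<omega>. U i \<omega> * F \<omega>)"
      using seq by (auto simp: incseq_def le_fun_def intro!: mult_right_mono)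
    have "(\<integral>\<^sup>+\<omega>. (SUP i. U i) \<omega> * F \<omega> \<partial>P) = (\<integral>\<^sup>+\<omega>. (SUP i. U i \<omega> * F \<omega>) \<partial>P)"
      by (intro nn_integral_cong) (simp add: SUP_mult_right_ennreal image_image)
    also have "\<dots> = (SUP i. \<integral>\<^sup>+\<omega>. U i \<omega> * F \<omega> \<partial>P)"
      by (rule nn_integral_monotone_convergence_SUP[OF inc]) measurable
    also have "\<dots> \<le> \<delta> * (\<integral>\<^sup>+\<omega>. (SUP i. U i) \<omega> \<partial>P)"
    proof (rule SUP_least)
      fix i
      have "(\<integral>\<^sup>+\<omega>. U i \<omega> * F \<omega> \<partial>P) \<le> \<delta> * (\<integral>\<^sup>+\<omega>. U i \<omega> \<partial>P)" by fact
      also have "\<dots> \<le> \<delta> * (\<integral>\<^sup>+\<omega>. (SUP i. U i) \<omega> \<partial>P)"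
        by (intro mult_left_mono nn_integral_mono) (auto intro: SUP_upper2)
      finally show "(\<integral>\<^sup>+\<omega>. U i \<omega> * F \<omega> \<partial>P) \<le> \<delta> * (\<integral>\<^sup>+\<omega>. (SUP i. U i) \<omega> \<partial>P)" .
    qed
    finally show ?case .
  qed
qed

section \<open>The polynomial condition and stationarity in integral form\<close>

definition bad_path ::
    "(real^'d::finite \<Rightarrow> real^'d) \<Rightarrow> 'd \<Rightarrow> real^'d \<Rightarrow> real \<Rightarrow> real \<Rightarrow> int^'d \<Rightarrow> (nat \<Rightarrow> int^'d) set" where
  "bad_path R k l c L y = {X.
     X (the_enat (exit_time (lattice_box R k L (c * L) 0) X)) \<notin> front_boundary R k l L (c * L) \<and>
     exit_time (lattice_box R k L (c * L) 0) X < hitting_time (half_space l y) X}"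

lemma bad_exit_eq: "bad_exit R k l c L y = UNIV \<times> bad_path R k l c L y"
  by (auto simp: bad_exit_def bad_path_def)

lemma env_law_facts:
  assumes "env_law (\<P> :: ('d::finite) env measure)"
  shows "prob_space \<P>" "sets \<P> = sets env_space" "space \<P> = space env_space"
  using assms sets_eq_imp_space_eq by (auto simp: env_law_def)

lemma measurable_law_cong:
  "env_law (\<P> :: ('d::finite) env measure) \<Longrightarrow> measurable \<P> N = measurable env_space N"
  by (rule measurable_cong_sets) (simp_all add: env_law_facts)

lemma prob_space_annealed:
  assumes "env_law (\<P> :: ('d::finite) env measure)"
  shows "prob_space (annealed \<P> x)"
proof
  interpret prob_space \<P> by (rule env_law_facts[OF assms])
  have "(UNIV :: (nat \<Rightarrow> int^'d) set) \<in> sets path_space"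
    using sets.top[of "path_space :: (nat \<Rightarrow> int^'d) measure"] by simp
  then have "emeasure (annealed \<P> x) (space env_space \<times> UNIV) =
    (\<integral>\<^sup>+\<omega>\<in>space env_space. emeasure (quenched \<omega> x) UNIV \<partial>\<P>)"
    by (intro emeasure_annealed_Times assms) auto
  also have "\<dots> = (\<integral>\<^sup>+\<omega>. 1 \<partial>\<P>)"
  proof (intro nn_integral_cong)
    fix \<omega> assume "\<omega> \<in> space \<P>"
    then have "\<omega> \<in> space env_space" by (simp add: env_law_facts[OF assms])
    then show "emeasure (quenched \<omega> x) UNIV * indicator (space env_space) \<omega> = 1"
      using prob_space.emeasure_space_1[OF prob_space_quenched, of \<omega> x] by simp
  qed
  finally show "emeasure (annealed \<P> x) (space (annealed \<P> x)) = 1"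
    using sets_eq_imp_space_eq[OF sets_annealed[OF assms, of x]]
    by (simp add: space_pair_measure emeasure_space_1)
qed

lemma sets_bad_path:
  assumes "env_law (\<P> :: ('d::finite) env measure)"
  shows "bad_path R k l c L y \<in> sets (path_space :: (nat \<Rightarrow> int^'d) measure)"
proof -
  interpret prob_space \<P> by (rule env_law_facts[OF assms])
  obtain \<omega> :: "'d env" where \<omega>: "\<omega> \<in> space env_space"
    using not_empty env_law_facts(3)[OF assms] by blast
  have "bad_exit R k l c L y \<inter> space (env_space \<Otimes>\<^sub>M path_space) \<in> sets (env_space \<Otimes>\<^sub>M path_space)"
    using indicator_bad_exit_measurable[OF assms, of R k l c L y]
      sets_annealed[OF assms, of 0] sets_eq_imp_space_eq[OF sets_annealed[OF assms, of 0]]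
    by (simp add: borel_measurable_indicator_iff)
  from sets_Pair1[OF this, of \<omega>] show ?thesis
    using \<omega> by (simp add: bad_exit_eq space_pair_measure vimage_def)
qed

text \<open>Translates the essential supremum of conditional probabilities into an inequality
  between integrals over events A of the past. The limit 0 is kept only as the bound L^-M for large
  L.\<close>

lemma polynomial_condition_bound:
  fixes \<P> :: "('d::finite) env measure"
  assumes law: "env_law \<P>" and pc: "polynomial_condition \<P> R k l M c"
  obtains L\<^sub>0 where "L\<^sub>0 \<ge> 1"
    "\<And>L y A. L \<ge> L\<^sub>0 \<Longrightarrow> y \<in> half_space l 0 \<Longrightarrow> A \<in> sets (env_sigma (half_space l y)) \<Longrightarrow>
       (\<integral>\<^sup>+\<omega>. indicator A \<omega> * emeasure (quenched \<omega> 0) (bad_path R k l c L y) \<partial>\<P>)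
         \<le> ennreal (L powr - M) * emeasure \<P> A"
proof -
  interpret A: prob_space "annealed \<P> 0" by (rule prob_space_annealed[OF law])
  let ?F = "\<lambda>y. vimage_algebra (space (annealed \<P> 0)) fst (env_sigma (half_space l y))"
  let ?c = "\<lambda>L y. real_cond_exp (annealed \<P> 0) (?F y) (indicator (bad_exit R k l c L y))"
  let ?s = "\<lambda>L. SUP y\<in>half_space l 0. esssup (annealed \<P> 0) (\<lambda>p. ereal (?c L y p))"
  have spA: "space (annealed \<P> 0) = space env_space \<times> UNIV"
    using sets_eq_imp_space_eq[OF sets_annealed[OF law, of 0]] by (simp add: space_pair_measure)
  have "Limsup at_top (\<lambda>L::real. ereal (L powr M) * ?s L) < 1"
    using pc unfolding polynomial_condition_def by simp
  then have "\<forall>\<^sub>F L in at_top. ereal (L powr M) * ?s L < 1"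
    by (rule Limsup_lessD)
  then obtain L1 where L1: "\<And>L. L \<ge> L1 \<Longrightarrow> ereal (L powr M) * ?s L < 1"
    unfolding eventually_at_top_linorder by auto
  show ?thesis
  proof (rule that[of "max 1 L1"])
    fix L y A
    assume L: "max 1 L1 \<le> L" and y: "y \<in> half_space l 0" and A: "A \<in> sets (env_sigma (half_space l y))"
    have Lp: "L powr M > 0" "L > 0" using L by auto
    have AE: "AE p in annealed \<P> 0. ?c L y p \<le> L powr - M"
    proof -
      have s: "ereal (L powr M) * ?s L < 1" using L1 L by auto
      have "?s L \<le> ereal (L powr - M)"
      proof (rule ccontr)
        assume "\<not> ?s L \<le> ereal (L powr - M)"
        then have "ereal (L powr M) * ereal (L powr - M) \<le> ereal (L powr M) * ?s L"
          by (intro ereal_mult_left_mono) auto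
        moreover have "ereal (L powr M) * ereal (L powr - M) = 1"
          using Lp by (simp add: powr_minus one_ereal_def)
        ultimately have "1 \<le> ereal (L powr M) * ?s L" by (simp only:)
        from leD[OF this] s show False by (rule notE)
      qed
      then have "esssup (annealed \<P> 0) (\<lambda>p. ereal (?c L y p)) \<le> ereal (L powr - M)"
        using y unfolding SUP_le_iff by blast
      note le = this
      show ?thesis
        using esssup_AE[where M="annealed \<P> 0" and f="\<lambda>p. ereal (?c L y p)"]
      proof eventually_elim
        case (elim p)
        from order_trans[OF this le] show ?case by simp
      qed
    qed
    interpret S: finite_measure_subalgebra "annealed \<P> 0" "?F y"
      by standard (rule subalgebra_annealed[OF law])
    have A': "A \<in> sets env_space" using A sets_env_sigma_subset by blast
    define A2 where "A2 = A \<times> (UNIV :: (nat \<Rightarrow> int^'d) set)"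
    have As: "A \<subseteq> space env_space" using sets.sets_into_space[OF A'] .
    have A2F: "A2 \<in> sets (?F y)"
    proof -
      have "fst -` A \<inter> space (annealed \<P> 0) = A2" using As by (auto simp: A2_def spA)
      then show ?thesis using in_vimage_algebra[OF A, of fst "space (annealed \<P> 0)"] by simp
    qed
    have A2m: "A2 \<in> sets (annealed \<P> 0)" using S.subalg A2F unfolding subalgebra_def by blast
    have bm: "bad_path R k l c L y \<in> sets path_space" by (rule sets_bad_path[OF law])
    have U: "(UNIV :: (nat \<Rightarrow> int^'d) set) \<in> sets path_space"
      using sets.top[of "path_space :: (nat \<Rightarrow> int^'d) measure"] by simp
    have ABm: "A \<times> bad_path R k l c L y \<in> sets (annealed \<P> 0)"
      using A' bm by (simp add: sets_annealed[OF law])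
    have int: "integrable (annealed \<P> 0) (indicator (bad_exit R k l c L y) :: _ \<Rightarrow> real)"
      by (rule A.integrable_const_bound[where B=1])
        (use indicator_bad_exit_measurable[OF law] in \<open>auto simp: indicator_def\<close>)
    have ci: "integrable (annealed \<P> 0) (?c L y)" by (rule S.real_cond_exp_int(1)[OF int])
    have "measure (annealed \<P> 0) (A \<times> bad_path R k l c L y) =
      (\<integral>p\<in>A2. indicator (bad_exit R k l c L y) p \<partial>annealed \<P> 0)"
    proof -
      have "(\<lambda>p. indicat_real A2 p *\<^sub>R indicator (bad_exit R k l c L y) p) = indicat_real (A \<times> bad_path R k l c L y)"
        by (auto simp: fun_eq_iff indicator_def A2_def bad_exit_eq)
      then show ?thesis unfolding set_lebesgue_integral_def using ABm by simp
    qed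
    also have "\<dots> = (\<integral>p\<in>A2. ?c L y p \<partial>annealed \<P> 0)"
      by (rule S.real_cond_exp_intA[OF int A2F])
    also have "\<dots> \<le> (\<integral>p\<in>A2. L powr - M \<partial>annealed \<P> 0)"
      unfolding set_lebesgue_integral_def
    proof (rule integral_mono_AE)
      show "integrable (annealed \<P> 0) (\<lambda>p. indicat_real A2 p *\<^sub>R ?c L y p)"
        using integrable_mult_indicator[OF A2m ci] by simp
      show "AE p in annealed \<P> 0. indicat_real A2 p *\<^sub>R ?c L y p \<le> indicat_real A2 p *\<^sub>R L powr - M"
        using AE by eventually_elim (auto simp: indicator_def)
      show "integrable (annealed \<P> 0) (\<lambda>p. indicat_real A2 p *\<^sub>R L powr - M)"
        using A2m by (auto simp: A.emeasure_eq_measure)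
    qed
    also have "\<dots> = L powr - M * measure (annealed \<P> 0) A2"
      unfolding set_lebesgue_integral_def using A2m by (simp add: mult.commute)
    finally have "emeasure (annealed \<P> 0) (A \<times> bad_path R k l c L y) \<le>
      ennreal (L powr - M) * emeasure (annealed \<P> 0) A2"
      by (simp add: A.emeasure_eq_measure ennreal_mult[symmetric])
    moreover have "emeasure (annealed \<P> 0) A2 = emeasure \<P> A"
    proof -
      have "emeasure (annealed \<P> 0) A2 = (\<integral>\<^sup>+\<omega>\<in>A. emeasure (quenched \<omega> 0) UNIV \<partial>\<P>)"
        unfolding A2_def by (rule emeasure_annealed_Times[OF law A' U])
      also have "\<dots> = (\<integral>\<^sup>+\<omega>. indicator A \<omega> \<partial>\<P>)"
      proof (intro nn_integral_cong)
        fix \<omega> assume "\<omega> \<in> space \<P>"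
        then have "\<omega> \<in> space env_space" by (simp add: env_law_facts[OF law])
        then show "emeasure (quenched \<omega> 0) UNIV * indicator A \<omega> = indicator A \<omega>"
          using prob_space.emeasure_space_1[OF prob_space_quenched, of \<omega> 0] by simp
      qed
      also have "\<dots> = emeasure \<P> A" using A' by (simp add: env_law_facts[OF law])
      finally show ?thesis .
    qed
    moreover have "emeasure (annealed \<P> 0) (A \<times> bad_path R k l c L y) =
      (\<integral>\<^sup>+\<omega>. indicator A \<omega> * emeasure (quenched \<omega> 0) (bad_path R k l c L y) \<partial>\<P>)"
      by (subst emeasure_annealed_Times[OF law A' bm]) (simp add: mult.commute)
    ultimately show "(\<integral>\<^sup>+\<omega>. indicator A \<omega> * emeasure (quenched \<omega> 0) (bad_path R k l c L y) \<partial>\<P>)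
         \<le> ennreal (L powr - M) * emeasure \<P> A" by simp
  qed simp
qed

lemma stationary_nn_integral:
  fixes \<P> :: "('d::finite) env measure"
  assumes law: "env_law \<P>" and st: "stationary \<P>" and F: "F \<in> borel_measurable env_space"
  shows "(\<integral>\<^sup>+\<omega>. F (env_shift x \<omega>) \<partial>\<P>) = (\<integral>\<^sup>+\<omega>. F \<omega> \<partial>\<P>)"
proof -
  have eq: "distr \<P> \<P> (env_shift x) = \<P>"
    using st unfolding stationary_def env_shift_def by blast
  have m2: "env_shift x \<in> \<P> \<rightarrow>\<^sub>M \<P>"
    using measurable_env_shift[of x] measurable_cong_sets[of \<P> env_space \<P> env_space]
    by (simp add: env_law_facts[OF law])
  have F': "F \<in> borel_measurable \<P>"
    using F by (simp add: measurable_law_cong[OF law])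
  have "(\<integral>\<^sup>+\<omega>. F \<omega> \<partial>\<P>) = (\<integral>\<^sup>+\<omega>. F \<omega> \<partial>distr \<P> \<P> (env_shift x))" by (simp add: eq)
  also have "\<dots> = (\<integral>\<^sup>+\<omega>. F (env_shift x \<omega>) \<partial>\<P>)"
    by (rule nn_integral_distr[OF m2]) (use F' in simp)
  finally show ?thesis ..
qed

lemma stationary_AE:
  fixes \<P> :: "('d::finite) env measure"
  assumes law: "env_law \<P>" and st: "stationary \<P>" and AE: "AE \<omega> in \<P>. Q (\<omega> 0)"
  shows "AE \<omega> in \<P>. \<forall>x. Q (\<omega> x)"
proof -
  have "AE \<omega> in \<P>. Q (\<omega> x)" for x
  proof -
    have eq: "distr \<P> \<P> (env_shift x) = \<P>"
      using st unfolding stationary_def env_shift_def by blast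
    have m2: "env_shift x \<in> \<P> \<rightarrow>\<^sub>M \<P>"
      using measurable_env_shift[of x] measurable_cong_sets[of \<P> env_space \<P> env_space]
      by (simp add: env_law_facts[OF law])
    have "AE \<omega> in distr \<P> \<P> (env_shift x). Q (\<omega> 0)" unfolding eq by (rule AE)
    from AE_distrD[OF m2 this] show ?thesis by (simp add: env_shift_def)
  qed
  then show ?thesis by (simp add: AE_all_countable)
qed


section \<open>Lattice vectors and forward steps\<close>

lemma real_vec_nth [simp]: "real_vec z $ i = real_of_int (z $ i)"
  by (simp add: real_vec_def)

lemma real_vec_add: "real_vec (x + y) = real_vec x + real_vec y"
  and real_vec_diff: "real_vec (x - y) = real_vec x - real_vec y"
  and real_vec_0 [simp]: "real_vec 0 = 0"
  by (simp_all add: vec_eq_iff)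

lemma real_vec_eq_0_iff [simp]: "real_vec x = 0 \<longleftrightarrow> x = 0"
  by (simp add: vec_eq_iff)

lemma norm_unit_step:
  assumes "e \<in> unit_steps"
  shows "norm (real_vec e) \<le> 1"
proof -
  have "norm (real_vec e) \<le> (\<Sum>i\<in>UNIV. \<bar>real_vec e $ i\<bar>)" by (rule norm_le_l1_cart)
  also have "\<dots> = real_of_int (l1_norm e)" by (simp add: l1_norm_def)
  also have "\<dots> = 1" using assms by (simp add: unit_steps_def)
  finally show ?thesis .
qed

lemma forward_step_iff:
  "e \<in> forward_steps l \<longleftrightarrow> (\<exists>i. l $ i \<noteq> 0 \<and> e = axis i (if l $ i > 0 then 1 else -1))"
proof -
  have "real_vec e = sgn (l $ i) *\<^sub>R axis i 1 \<and> real_vec e \<noteq> 0 \<longleftrightarrow>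
    l $ i \<noteq> 0 \<and> e = axis i (if l $ i > 0 then 1 else -1)" for i
  proof -
    have "real_vec (axis i (if l $ i > 0 then 1 else -1)) = sgn (l $ i) *\<^sub>R axis i 1" if "l $ i \<noteq> 0"
      using that by (auto simp: vec_eq_iff axis_def sgn_if)
    moreover have "real_vec x = real_vec y \<longleftrightarrow> x = y" for x y :: "int^'a"
      by (simp add: vec_eq_iff)
    ultimately show ?thesis
      by (metis axis_eq_0_iff scaleR_eq_0_iff sgn_zero_iff zero_neq_one)
  qed
  then show ?thesis unfolding forward_steps_def by blast
qed

lemma forward_steps_unit: "forward_steps l \<subseteq> unit_steps"
proof
  fix e assume "e \<in> forward_steps l"
  then obtain i where e: "e = axis i (if l $ i > 0 then 1 else -1)"
    unfolding forward_step_iff by blast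
  have "l1_norm e = (\<Sum>j\<in>UNIV. if j = i then 1 else 0)"
    unfolding l1_norm_def by (intro sum.cong) (auto simp: e axis_def)
  then show "e \<in> unit_steps" by (simp add: unit_steps_def)
qed

lemma finite_forward_steps: "finite (forward_steps l)"
  using finite_subset[OF forward_steps_unit finite_unit_steps] .

lemma forward_steps_pos:
  assumes "e \<in> forward_steps l"
  shows "real_vec e \<bullet> l > 0"
proof -
  obtain i where i: "l $ i \<noteq> 0" "e = axis i (if l $ i > 0 then 1 else -1)"
    using assms unfolding forward_step_iff by blast
  then have "real_vec e = axis i (sgn (l $ i))"
    by (auto simp: vec_eq_iff axis_def)
  then have "real_vec e \<bullet> l = \<bar>l $ i\<bar>"
    by (simp add: inner_axis' abs_sgn mult.commute)
  with i show ?thesis by simp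
qed

lemma forward_steps_nonempty: "l \<noteq> 0 \<Longrightarrow> forward_steps l \<noteq> {}"
  using forward_step_iff by (metis empty_iff vec_eq_iff zero_index)

text \<open>Forward steps are those whose probability is bounded below uniformly. They reach every
  point of the closed orthant of l, in particular the lattice vector that spans its direction; the
  induction removes one unit of the l1 norm.\<close>

lemma forward_list:
  fixes z :: "int^'d::finite"
  assumes "\<And>i. z $ i = 0 \<or> sgn (real_of_int (z $ i)) = sgn (l $ i)"
  shows "\<exists>es. set es \<subseteq> forward_steps l \<and> sum_list es = z"
  using assms
proof (induction "nat (l1_norm z)" arbitrary: z)
  case 0
  have "l1_norm z \<ge> 0" by (simp add: l1_norm_def sum_nonneg)
  with 0 have "l1_norm z = 0" by simp
  then have "z = 0" by (simp add: l1_norm_def sum_nonneg_eq_0_iff vec_eq_iff)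
  then show ?case by (intro exI[of _ "[]"]) simp
next
  case (Suc n)
  then have "l1_norm z > 0" by simp
  then have "z \<noteq> 0" by (auto simp: l1_norm_def)
  then obtain i where i: "z $ i \<noteq> 0" by (auto simp: vec_eq_iff)
  define e :: "int^'d" where "e = axis i (if l $ i > 0 then 1 else -1)"
  have li: "l $ i \<noteq> 0" and sg: "sgn (real_of_int (z $ i)) = sgn (l $ i)"
    using Suc.prems[of i] i by (auto simp: sgn_if split: if_splits)
  then have e: "e \<in> forward_steps l" unfolding forward_step_iff e_def by blast
  have ei: "\<bar>z $ i - e $ i\<bar> = \<bar>z $ i\<bar> - 1"
    using sg li i by (auto simp: e_def axis_def sgn_if split: if_splits)
  have ej: "e $ j = 0" if "j \<noteq> i" for j using that by (simp add: e_def axis_def)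
  have "l1_norm z = \<bar>z $ i\<bar> + (\<Sum>j\<in>UNIV - {i}. \<bar>z $ j\<bar>)"
    unfolding l1_norm_def by (rule sum.remove) auto
  moreover have "l1_norm (z - e) = \<bar>z $ i - e $ i\<bar> + (\<Sum>j\<in>UNIV - {i}. \<bar>z $ j\<bar>)"
    unfolding l1_norm_def by (subst sum.remove[of _ i]) (auto simp: ej)
  ultimately have "n = nat (l1_norm (z - e))" using Suc.hyps(2) ei by simp
  moreover have "(z - e) $ j = 0 \<or> sgn (real_of_int ((z - e) $ j)) = sgn (l $ j)" for j
  proof (cases "j = i")
    case True
    then show ?thesis using sg li i by (auto simp: e_def axis_def sgn_if split: if_splits)
  next
    case False
    then show ?thesis using Suc.prems[of j] by (simp add: ej)
  qed
  ultimately obtain es where "set es \<subseteq> forward_steps l" "sum_list es = z - e"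
    using Suc.hyps(1) by blast
  then show ?case using e by (intro exI[of _ "e # es"]) auto
qed

lemma finite_lattice_ball:
  fixes r :: real
  assumes "r \<ge> 0"
  shows "finite {z :: int^'d::finite. norm (real_vec z) \<le> r}"
    and "real (card {z :: int^'d::finite. norm (real_vec z) \<le> r}) \<le> (2 * r + 1) ^ CARD('d)"
proof -
  let ?B = "{z :: int^'d. norm (real_vec z) \<le> r}" and ?I = "{-\<lfloor>r\<rfloor>..\<lfloor>r\<rfloor>}"
  have sub: "?B \<subseteq> vec_lambda ` Pi\<^sub>E UNIV (\<lambda>_. ?I)"
  proof
    fix z :: "int^'d" assume z: "z \<in> ?B"
    have "z $ i \<in> ?I" for i
    proof -
      have "\<bar>real_of_int (z $ i)\<bar> \<le> r"
        using component_le_norm_cart[of "real_vec z" i] z by simp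
      then show ?thesis 
        using le_floor_iff[of "- (z $ i)" r] le_floor_iff[of "z $ i" r] by (simp add: abs_le_iff)
    qed
    then show "z \<in> vec_lambda ` Pi\<^sub>E UNIV (\<lambda>_. ?I)"
      by (intro image_eqI[where x="vec_nth z"]) auto
  qed
  have fin: "finite (Pi\<^sub>E (UNIV :: 'd set) (\<lambda>_. ?I))" by (intro finite_PiE) auto
  then show "finite ?B" by (rule finite_surj[OF _ sub])
  have "card ?B \<le> card (Pi\<^sub>E (UNIV :: 'd set) (\<lambda>_. ?I))"
    using surj_card_le[OF fin sub] .
  also have "\<dots> = (card ?I) ^ CARD('d)" by (simp add: card_PiE)
  finally have "real (card ?B) \<le> real (card ?I) ^ CARD('d)" by (metis of_nat_le_iff of_nat_power)
  also have "real (card ?I) \<le> 2 * r + 1" using assms by simp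
  then have "real (card ?I) ^ CARD('d) \<le> (2 * r + 1) ^ CARD('d)" by (rule power_mono) simp
  finally show "real (card ?B) \<le> (2 * r + 1) ^ CARD('d)" .
qed

lemma uniform_ellipticity_everywhere:
  fixes \<P> :: "('d::finite) env measure"
  assumes law: "env_law \<P>" and st: "stationary \<P>" and ue: "uniformly_elliptic \<P> l" and l: "l \<noteq> 0"
  obtains \<kappa> :: real where "0 < \<kappa>" "\<kappa> \<le> 1"
    "AE \<omega> in \<P>. \<forall>x. \<forall>e\<in>forward_steps l. \<kappa> \<le> \<omega> x e"
proof -
  obtain \<kappa> where \<kappa>: "\<kappa> > 0" "AE \<omega> in \<P>. 2 * \<kappa> \<le> (MIN e\<in>forward_steps l. \<omega> 0 e)"
    using ue unfolding uniformly_elliptic_def by auto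
  show ?thesis
  \<comment> \<open>The cap at 1 makes powers of the constant decreasing and
    \<open>ln (1 / \<kappa>)\<close> nonnegative.\<close>
  proof (rule that[of "min 1 (2 * \<kappa>)"])
    show "AE \<omega> in \<P>. \<forall>x. \<forall>e\<in>forward_steps l. min 1 (2 * \<kappa>) \<le> \<omega> x e"
    proof (rule stationary_AE[OF law st])
      show "AE \<omega> in \<P>. \<forall>e\<in>forward_steps l. min 1 (2 * \<kappa>) \<le> \<omega> 0 e"
        using \<kappa>(2)
      proof eventually_elim
        case (elim \<omega>)
        show ?case
        proof
          fix e assume "e \<in> forward_steps l"
          then have "(MIN e\<in>forward_steps l. \<omega> 0 e) \<le> \<omega> 0 e"
            using finite_forward_steps by (intro Min_le) auto
          with elim show "min 1 (2 * \<kappa>) \<le> \<omega> 0 e" by simp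
        qed
      qed
    qed
  qed (use \<kappa> in auto)
qed

section \<open>Boxes and cones\<close>

text \<open>The hypotheses in working form: \<open>z\<^sub>0\<close> is a lattice vector in
  direction l, \<kappa> bounds the forward transition probabilities at all sites, and
  \<open>L\<^sub>0\<close> is the size from which the polynomial condition holds as an integral
  inequality.\<close>

locale rwre =
  fixes \<P> :: "('d::finite) env measure" and l :: "real^'d" and R :: "real^'d \<Rightarrow> real^'d" and k :: 'd
    and M c \<alpha> :: real and \<phi> :: "real \<Rightarrow> real" and z\<^sub>0 :: "int^'d" and \<kappa> L\<^sub>0 :: real
  assumes law: "env_law \<P>" and st: "stationary \<P>"
    and z0: "z\<^sub>0 \<noteq> 0" and l_def: "l = real_vec z\<^sub>0 /\<^sub>R norm (real_vec z\<^sub>0)"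
    and R: "orthogonal_transformation R" and Rk: "R (axis k 1) = l"
    and M: "M > 6 * real CARD('d)" and c: "c > 0"
    and \<alpha>: "0 < \<alpha>" "\<alpha> \<le> 1 / 9" "\<alpha> \<le> 1 / (2 * c + 1)"
    and \<phi>: "\<And>r. r \<ge> 0 \<Longrightarrow> \<phi> r \<ge> 0" "(\<phi> \<longlongrightarrow> 0) at_top"
    and \<kappa>: "0 < \<kappa>" "\<kappa> \<le> 1"
    and elliptic: "AE \<omega> in \<P>. \<forall>x. \<forall>e\<in>forward_steps l. \<kappa> \<le> \<omega> x e"
    and L0: "L\<^sub>0 \<ge> 1"
    and pc: "\<And>L y A. L \<ge> L\<^sub>0 \<Longrightarrow> y \<in> half_space l 0 \<Longrightarrow> A \<in> sets (env_sigma (half_space l y)) \<Longrightarrow>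
       (\<integral>\<^sup>+\<omega>. indicator A \<omega> * emeasure (quenched \<omega> 0) (bad_path R k l c L y) \<partial>\<P>)
         \<le> ennreal (L powr - M) * emeasure \<P> A"
    and cm: "cone_mixing \<P> R k l \<alpha> \<phi>"
begin

sublocale prob_space \<P>
  by (rule env_law_facts[OF law])

lemmas spP = env_law_facts(3)[OF law] and setsP = env_law_facts(2)[OF law]
  and mP = measurable_law_cong[OF law]

definition lev :: "int^'d \<Rightarrow> real" where "lev x = real_vec x \<bullet> l"
definition tau :: "'d \<Rightarrow> int^'d \<Rightarrow> real" where "tau i x = real_vec x \<bullet> R (axis i 1)"

definition ellip :: "'d env \<Rightarrow> bool" where
  "ellip \<omega> \<longleftrightarrow> \<omega> \<in> space env_space \<and> (\<forall>x. \<forall>e\<in>forward_steps l. \<kappa> \<le> \<omega> x e)"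

lemma AE_ellip: "AE \<omega> in \<P>. ellip \<omega>"
  using elliptic AE_space by eventually_elim (simp add: ellip_def spP)

lemma norm_l: "norm l = 1"
  using z0 by (simp add: l_def)

lemma l_nz: "l \<noteq> 0" using norm_l by auto

lemma norm_Raxis: "norm (R (axis i 1)) = 1"
  using orthogonal_transformation_norm[OF R] by simp

lemma lev_add: "lev (x + y) = lev x + lev y" and lev_diff: "lev (x - y) = lev x - lev y"
  and lev_0 [simp]: "lev 0 = 0" and lev_minus: "lev (- x) = - lev x"
proof -
  show "lev (x + y) = lev x + lev y" "lev (x - y) = lev x - lev y" "lev 0 = 0"
    by (simp_all add: lev_def real_vec_add real_vec_diff inner_add_left inner_diff_left)
  have "real_vec (- x) = - real_vec x" by (simp add: vec_eq_iff)
  then show "lev (- x) = - lev x" by (simp add: lev_def)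
qed

lemma tau_add: "tau i (x + y) = tau i x + tau i y" and tau_diff: "tau i (x - y) = tau i x - tau i y"
  and tau_0 [simp]: "tau i 0 = 0"
  by (simp_all add: tau_def real_vec_add real_vec_diff inner_add_left inner_diff_left)

lemma abs_lev_le: "\<bar>lev x\<bar> \<le> norm (real_vec x)"
  using Cauchy_Schwarz_ineq2[of "real_vec x" l] by (simp add: lev_def norm_l)

lemma abs_tau_le: "\<bar>tau i x\<bar> \<le> norm (real_vec x)"
  using Cauchy_Schwarz_ineq2[of "real_vec x" "R (axis i 1)"] by (simp add: tau_def norm_Raxis)

lemma norm_le_lev_tau: "norm (real_vec x) \<le> \<bar>lev x\<bar> + (\<Sum>i\<in>UNIV - {k}. \<bar>tau i x\<bar>)"
proof -
  obtain u where u: "real_vec x = R u"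
    using orthogonal_transformation_surj[OF R] by (metis surjD)
  have comp: "u $ i = real_vec x \<bullet> R (axis i 1)" for i
    using R by (simp add: u orthogonal_transformation_def inner_axis)
  have "norm (real_vec x) = norm u" using orthogonal_transformation_norm[OF R] u by simp
  also have "\<dots> \<le> (\<Sum>i\<in>UNIV. \<bar>u $ i\<bar>)" by (rule norm_le_l1_cart)
  also have "\<dots> = \<bar>u $ k\<bar> + (\<Sum>i\<in>UNIV - {k}. \<bar>u $ i\<bar>)" by (rule sum.remove) auto
  finally show ?thesis by (simp add: comp lev_def tau_def Rk)
qed

lemma unit_step_lev: "e \<in> unit_steps \<Longrightarrow> \<bar>lev e\<bar> \<le> 1"
  and unit_step_tau: "e \<in> unit_steps \<Longrightarrow> \<bar>tau i e\<bar> \<le> 1"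
  using abs_lev_le[of e] abs_tau_le[of i e] norm_unit_step[of e] by auto

section \<open>Boxes and good exits\<close>

definition Box :: "real \<Rightarrow> int^'d \<Rightarrow> (int^'d) set" where
  "Box L x = {z. \<bar>lev z - lev x\<bar> < L \<and> (\<forall>i. i \<noteq> k \<longrightarrow> \<bar>tau i z - tau i x\<bar> < c * L)}"

lemma lattice_box_eq: "lattice_box R k L (c * L) 0 = Box L 0"
proof -
  have "real_vec z \<in> (\<lambda>u. real_vec 0 + R u) `
     {u. u $ k \<in> {-L<..<L} \<and> (\<forall>i. i \<noteq> k \<longrightarrow> u $ i \<in> {-(c * L)<..<c * L})} \<longleftrightarrow> z \<in> Box L 0" for z
  proof -
    obtain u where u: "real_vec z = R u"
      using orthogonal_transformation_surj[OF R] by (metis surjD)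
    have comp: "u $ i = real_vec z \<bullet> R (axis i 1)" for i
      using R by (simp add: u orthogonal_transformation_def inner_axis)
    have inj: "R u = R v \<longleftrightarrow> u = v" for v
      using orthogonal_transformation_inj[OF R] by (auto dest: injD)
    have "real_vec z \<in> (\<lambda>u. real_vec 0 + R u) `
     {u. u $ k \<in> {-L<..<L} \<and> (\<forall>i. i \<noteq> k \<longrightarrow> u $ i \<in> {-(c * L)<..<c * L})} \<longleftrightarrow>
      u $ k \<in> {-L<..<L} \<and> (\<forall>i. i \<noteq> k \<longrightarrow> u $ i \<in> {-(c * L)<..<c * L})"
      by (auto simp: u inj)
    also have "\<dots> \<longleftrightarrow> z \<in> Box L 0"
      by (auto simp: comp Box_def lev_def tau_def Rk abs_less_iff)
    finally show ?thesis .
  qed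
  then show ?thesis unfolding lattice_box_def by auto
qed

lemma Box_translate: "z + x \<in> Box L (y + x) \<longleftrightarrow> z \<in> Box L y"
  by (simp add: Box_def lev_add tau_add)

text \<open>Chosen for \<open>norm_le_C0\<close>: L + 1 \<le> 2 L along the axis and c L + 1 \<le>
  (c + 1) L in each lateral coordinate, so a box of size L \<ge> 1, enlarged by one step, lies
  within \<open>C\<^sub>0 * L\<close> of its centre.\<close>

definition C\<^sub>0 :: real where "C\<^sub>0 = 2 + real CARD('d) * (c + 1)"

lemma C0_ge: "C\<^sub>0 \<ge> 2" using c by (simp add: C\<^sub>0_def)

lemma norm_le_C0:
  assumes L: "L \<ge> 1" and "\<bar>lev x\<bar> \<le> L + 1" and t: "\<And>i. i \<noteq> k \<Longrightarrow> \<bar>tau i x\<bar> \<le> c * L + 1"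
  shows "norm (real_vec x) \<le> C\<^sub>0 * L"
proof -
  have "(\<Sum>i\<in>UNIV - {k}. \<bar>tau i x\<bar>) \<le> (\<Sum>i\<in>UNIV - {k}. (c + 1) * L)"
  proof (rule sum_mono)
    fix i assume "i \<in> UNIV - {k}"
    with t[of i] L show "\<bar>tau i x\<bar> \<le> (c + 1) * L" by (simp add: distrib_right)
  qed
  also have "\<dots> \<le> real CARD('d) * ((c + 1) * L)"
    using c L by (auto intro!: mult_right_mono simp: card_Diff_subset)
  finally have "norm (real_vec x) \<le> (L + 1) + real CARD('d) * ((c + 1) * L)"
    using norm_le_lev_tau[of x] assms(2) by linarith
  also have "\<dots> \<le> C\<^sub>0 * L" using L by (simp add: C\<^sub>0_def algebra_simps)
  finally show ?thesis .
qed

lemma finite_Box: "finite (Box L x)"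
proof (cases "L > 0")
  case True
  have "Box L x \<subseteq> (\<lambda>z. z + x) ` {z. norm (real_vec z) \<le> C\<^sub>0 * max 1 L}"
  proof
    fix z assume z: "z \<in> Box L x"
    have "norm (real_vec (z - x)) \<le> C\<^sub>0 * max 1 L"
    proof (rule norm_le_C0)
      fix i assume "i \<noteq> k"
      then have "\<bar>tau i (z - x)\<bar> \<le> c * L" using z by (auto simp: Box_def tau_diff)
      also have "\<dots> \<le> c * max 1 L" using c by (intro mult_left_mono) auto
      finally show "\<bar>tau i (z - x)\<bar> \<le> c * max 1 L + 1" by simp
    qed (use z in \<open>auto simp: Box_def lev_diff\<close>)
    then show "z \<in> (\<lambda>z. z + x) ` {z. norm (real_vec z) \<le> C\<^sub>0 * max 1 L}"
      by (intro image_eqI[where x="z - x"]) auto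
  qed
  then show ?thesis using finite_lattice_ball(1)[of "C\<^sub>0 * max 1 L"] C0_ge
    by (auto intro: finite_subset)
next
  case False
  then have "Box L x = {}" by (auto simp: Box_def dest: le_less_trans[OF abs_ge_zero])
  then show ?thesis by simp
qed

text \<open>Exit through the front, in a form read off from finitely many positions. Any such n is
  the exit time, since its level already lies outside the box; the slack 1 in the lateral bounds is
  the length of the last step.\<close>

definition good :: "real \<Rightarrow> (nat \<Rightarrow> int^'d) \<Rightarrow> bool" where
  "good L X \<longleftrightarrow> (\<exists>n. (\<forall>m<n. X m \<in> Box L (X 0)) \<and> lev (X 0) + L \<le> lev (X n) \<and>
     (\<forall>i. i \<noteq> k \<longrightarrow> \<bar>tau i (X n) - tau i (X 0)\<bar> \<le> c * L + 1))"

definition steps :: "(nat \<Rightarrow> int^'d) \<Rightarrow> bool" where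
  "steps X \<longleftrightarrow> (\<forall>n. X (Suc n) - X n \<in> unit_steps)"

lemma steps_lev: "steps X \<Longrightarrow> \<bar>lev (X (Suc n)) - lev (X n)\<bar> \<le> 1"
  and steps_tau: "steps X \<Longrightarrow> \<bar>tau i (X (Suc n)) - tau i (X n)\<bar> \<le> 1"
  using unit_step_lev[of "X (Suc n) - X n"] unit_step_tau[of "X (Suc n) - X n"]
  by (auto simp: steps_def lev_diff tau_diff)

lemma AE_steps:
  assumes "\<omega> \<in> space env_space"
  shows "AE X in quenched \<omega> x. X 0 = x \<and> steps X"
  using AE_quenched_steps[OF assms] by (simp add: steps_def)

lemma good_translate: "good L (\<lambda>m. X m + x) \<longleftrightarrow> good L X"
  by (simp add: good_def Box_translate lev_add tau_add)

lemma sets_goodI: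
  assumes "\<And>n. prefix_det n (p n)"
  shows "{X :: nat \<Rightarrow> int^'d. \<exists>n. p n X} \<in> sets path_space"
proof -
  have "{X \<in> space (path_space :: (nat \<Rightarrow> int^'d) measure). \<exists>n. p n X} \<in> sets path_space"
  proof (rule sets.sets_Collect_countable_Ex)
    fix n
    have "p n \<in> path_space \<rightarrow>\<^sub>M count_space (UNIV :: bool set)"
      by (rule prefix_det_measurable[OF assms]) simp
    then show "{X \<in> space (path_space :: (nat \<Rightarrow> int^'d) measure). p n X} \<in> sets path_space"
      by measurable
  qed
  then show ?thesis by simp
qed

lemma sets_good: "{X. good L X} \<in> sets (path_space :: (nat \<Rightarrow> int^'d) measure)"
  unfolding good_def by (rule sets_goodI) (auto simp: prefix_det_def)

lemma sets_not_good: "{X. \<not> good L X} \<in> sets (path_space :: (nat \<Rightarrow> int^'d) measure)"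
proof -
  have "space path_space - {X. good L X} \<in> sets (path_space :: (nat \<Rightarrow> int^'d) measure)"
    by (rule sets.compl_sets[OF sets_good])
  moreover have "space path_space - {X. good L X} = {X. \<not> good L X}" by auto
  ultimately show ?thesis by simp
qed

text \<open>Level \<open>lev y\<close> lies at least L + 1 below the start, while the walk leaves
  the box at a level above - L - 1. So the half-space below y cannot interrupt the exit, and an exit
  that is not good is one of those excluded by the polynomial condition.\<close>

lemma bad_path_of_not_good:
  assumes X: "steps X" "X 0 = 0" and L: "L > 0" and ng: "\<not> good L X"
    and exit: "\<exists>n. X n \<notin> Box L 0" and y: "lev y \<le> - L - 1"
  shows "X \<in> bad_path R k l c L y"
proof -
  define n where "n = (LEAST n. X n \<notin> Box L 0)"
  have n: "X n \<notin> Box L 0" and before: "X m \<in> Box L 0" if "m < n" for m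
    using LeastI_ex[OF exit] not_less_Least[of m "\<lambda>n. X n \<notin> Box L 0"] that by (auto simp: n_def)
  have nout: "X n \<notin> Box L 0" using LeastI_ex[OF exit] by (simp add: n_def)
  have "0 \<in> Box L 0" using L c by (simp add: Box_def)
  with nout X have "n \<noteq> 0" by (metis)
  then obtain m where m: "n = Suc m" by (cases n) auto
  have mb: "X m \<in> Box L 0" using before m by simp
  have lev_n: "- L - 1 < lev (X n)"
    using mb steps_lev[OF X(1), of m] by (auto simp: Box_def m)
  have half: "X j \<notin> half_space l y" if "j \<le> n" for j
  proof (cases "j = n")
    case True
    then show ?thesis using lev_n y by (simp add: half_space_def lev_def)
  next
    case False
    then have "X j \<in> Box L 0" using before that by simp
    then show ?thesis using y by (auto simp: Box_def half_space_def lev_def)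
  qed
  have "X n \<notin> front_boundary R k l L (c * L)"
  proof
    assume "X n \<in> front_boundary R k l L (c * L)"
    then have "L \<le> lev (X n)" by (simp add: front_boundary_def lev_def)
    moreover have "\<bar>tau i (X n)\<bar> \<le> c * L + 1" if "i \<noteq> k" for i
      using mb that steps_tau[OF X(1), of i m] by (auto simp: Box_def m)
    ultimately have "good L X"
      unfolding good_def using before X(2) by (intro exI[of _ n]) auto
    with ng show False by simp
  qed
  then show ?thesis
    using nout before half
      hitting_time_less_iff[of "- Box L 0" X "half_space l y" "\<lambda>n. X n \<notin> front_boundary R k l L (c * L)"]
    unfolding bad_path_def lattice_box_eq by auto
qed

text \<open>Maximum principle for the probability h of staying in B forever. The highest of its
  maximisers has a forward neighbour where h is smaller, and ellipticity gives this neighbour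
  positive weight, against the mean value inequality.\<close>

lemma AE_exit:
  assumes \<omega>: "ellip \<omega>" and B: "finite B"
  shows "AE X in quenched \<omega> x. \<exists>n. X n \<notin> B"
proof -
  have \<omega>s: "\<omega> \<in> space env_space" using \<omega> by (simp add: ellip_def)
  let ?S = "{X. \<forall>i. X i \<in> B} :: (nat \<Rightarrow> int^'d) set"
  define h where "h y = measure (quenched \<omega> y) ?S" for y
  have Sm: "?S \<in> sets path_space" by (rule stay_sets)
  have em: "emeasure (quenched \<omega> y) ?S = ennreal (h y)" for y
  proof -
    interpret q: prob_space "quenched \<omega> y" by (rule prob_space_quenched[OF \<omega>s])
    show ?thesis by (simp add: h_def q.emeasure_eq_measure)
  qed
  have h0: "h y \<ge> 0" for y by (simp add: h_def)
  have h_out: "h y = 0" if "y \<notin> B" for y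
  proof -
    have "AE X in quenched \<omega> y. X \<notin> ?S"
      using AE_quenched_steps[OF \<omega>s] by eventually_elim (use that in auto)
    then have "emeasure (quenched \<omega> y) ?S = 0"
      using AE_iff_measurable[of ?S "quenched \<omega> y" "\<lambda>X. X \<notin> ?S"] Sm by (auto simp: sets_quenched[OF \<omega>s] \<omega>s)
    then show ?thesis by (simp add: em h0)
  qed
  have step: "h y \<le> (\<Sum>e\<in>unit_steps. \<omega> y e * h (y + e))" for y
  proof -
    have "ennreal (h y) = (\<integral>\<^sup>+X. indicator ?S X \<partial>quenched \<omega> y)"
      using Sm by (simp add: sets_quenched[OF \<omega>s] em)
    also have "\<dots> \<le> (\<integral>\<^sup>+X. indicator ?S (walk_shift 1 X) \<partial>quenched \<omega> y)"
      by (intro nn_integral_mono) (auto simp: indicator_def walk_shift_def)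
    also have "\<dots> = (\<Sum>e\<in>unit_steps. ennreal (\<omega> y e) * (\<integral>\<^sup>+Y. indicator ?S Y \<partial>quenched \<omega> (y + e)))"
      using Sm by (intro nn_integral_quenched_first_step[OF \<omega>s]) simp
    also have "\<dots> = (\<Sum>e\<in>unit_steps. ennreal (\<omega> y e * h (y + e)))"
      using Sm by (intro sum.cong) (simp_all add: sets_quenched[OF \<omega>s] em ennreal_mult'' h0)
    also have "\<dots> = ennreal (\<Sum>e\<in>unit_steps. \<omega> y e * h (y + e))"
      by (intro sum_ennreal) (use space_env_spaceD(1)[OF \<omega>s] h0 in auto)
    finally show ?thesis
      by (subst (asm) ennreal_le_iff) (auto intro!: sum_nonneg mult_nonneg_nonneg space_env_spaceD(1)[OF \<omega>s] h0)
  qed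
  have "h y = 0" for y
  proof (rule ccontr)
    assume "h y \<noteq> 0"
    then have yB: "y \<in> B" "h y > 0" using h_out h0[of y] by force+
    define m where "m = Max (h ` B)"
    have mB: "h w \<le> m" if "w \<in> B" for w
      unfolding m_def using B that by (intro Max_ge) auto
    have mpos: "m > 0" using mB[OF yB(1)] yB(2) by linarith
    have m: "h w \<le> m" for w
      using mB[of w] h_out[of w] mpos by (cases "w \<in> B") auto
    define W where "W = {w \<in> B. h w = m}"
    have W: "finite W" "W \<noteq> {}"
    proof -
      have "Max (h ` B) \<in> h ` B" using B yB by (intro Max_in) auto
      then show "finite W" "W \<noteq> {}" using B by (auto simp: W_def m_def)
    qed
    obtain w where w: "w \<in> W" "\<And>v. v \<in> W \<Longrightarrow> lev v \<le> lev w"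
    proof -
      have "Max (lev ` W) \<in> lev ` W" using W by (intro Max_in) auto
      then obtain w where "w \<in> W" "lev w = Max (lev ` W)" by auto
      moreover have "lev v \<le> Max (lev ` W)" if "v \<in> W" for v
        using W that by (intro Max_ge) auto
      ultimately show ?thesis using that by auto
    qed
    obtain e where e: "e \<in> forward_steps l" using forward_steps_nonempty[OF l_nz] by auto
    have eu: "e \<in> unit_steps" using e forward_steps_unit by blast
    have "lev (w + e) > lev w" using forward_steps_pos[OF e] by (simp add: lev_add, simp add: lev_def)
    then have "w + e \<notin> W" using w(2)[of "w + e"] by auto
    then have less: "h (w + e) < m"
      using m[of "w + e"] h_out[of "w + e"] mpos by (cases "w + e \<in> B") (auto simp: W_def less_le)
    have "\<kappa> \<le> \<omega> w e" using \<omega> e by (simp add: ellip_def)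
    then have pos: "\<omega> w e > 0" using \<kappa>(1) by linarith
    have "m = h w" using w(1) by (simp add: W_def)
    also have "\<dots> \<le> (\<Sum>e\<in>unit_steps. \<omega> w e * h (w + e))" by (rule step)
    also have "\<dots> < (\<Sum>e\<in>unit_steps. \<omega> w e * m)"
    proof (rule sum_strict_mono_ex1[OF finite_unit_steps])
      show "\<forall>e\<in>unit_steps. \<omega> w e * h (w + e) \<le> \<omega> w e * m"
        using m space_env_spaceD(1)[OF \<omega>s] by (auto intro: mult_left_mono)
      show "\<exists>e\<in>unit_steps. \<omega> w e * h (w + e) < \<omega> w e * m"
        using eu less pos by (intro bexI[of _ e] mult_strict_left_mono)
    qed
    also have "\<dots> = m" using space_env_spaceD(2)[OF \<omega>s] by (simp add: sum_distrib_right[symmetric])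
    finally show False by simp
  qed
  then have "emeasure (quenched \<omega> x) ?S = 0" by (simp add: em)
  then have "AE X in quenched \<omega> x. X \<notin> ?S"
    using Sm by (intro AE_not_in) (simp add: null_sets_def sets_quenched[OF \<omega>s])
  then show ?thesis by eventually_elim auto
qed

lemma exists_low_site: "\<exists>y. lev y \<le> r"
proof -
  define n where "n = nat \<lceil>\<bar>r\<bar> / norm (real_vec z\<^sub>0)\<rceil>"
  have nz: "norm (real_vec z\<^sub>0) > 0" using z0 by simp
  have "lev z\<^sub>0 = norm (real_vec z\<^sub>0)"
    unfolding lev_def by (subst l_def) (use nz in \<open>simp add: dot_square_norm power2_eq_square\<close>)
  moreover have "lev (\<chi> i. - (int n * z\<^sub>0 $ i)) = - real n * lev z\<^sub>0"
  proof -
    have "real_vec (\<chi> i. - (int n * z\<^sub>0 $ i)) = (- real n) *\<^sub>R real_vec z\<^sub>0"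
      by (simp add: vec_eq_iff)
    then show ?thesis by (simp only: lev_def inner_scaleR_left)
  qed
  moreover have "real n * norm (real_vec z\<^sub>0) \<ge> \<bar>r\<bar>"
  proof -
    have "real n \<ge> \<bar>r\<bar> / norm (real_vec z\<^sub>0)" unfolding n_def by linarith
    then show ?thesis using nz by (simp add: field_simps)
  qed
  ultimately show ?thesis by (intro exI[of _ "\<chi> i. - (int n * z\<^sub>0 $ i)"]) auto
qed

lemma measurable_emeasure_quenched:
  "E \<in> sets path_space \<Longrightarrow> (\<lambda>\<omega>. emeasure (quenched \<omega> x) E) \<in> borel_measurable env_space"
  by (rule measurable_compose[OF measurable_quenched measurable_emeasure_subprob_algebra])

text \<open>Stationarity moves x to the origin and with it the half-space carrying f. There the
  polynomial condition applies: the box is left almost surely, so a path that is not good is a bad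
  path.\<close>

lemma not_good_bound:
  assumes y: "lev y \<le> lev x - L - 1" and L: "L \<ge> L\<^sub>0"
    and f: "f \<in> borel_measurable (env_sigma (half_space l y))"
  shows "(\<integral>\<^sup>+\<omega>. f \<omega> * emeasure (quenched \<omega> x) {X. \<not> good L X} \<partial>\<P>) \<le>
    ennreal (L powr - M) * (\<integral>\<^sup>+\<omega>. f \<omega> \<partial>\<P>)"
proof -
  let ?B = "{X. \<not> good L X} :: (nat \<Rightarrow> int^'d) set"
  define g where "g \<omega> = f (env_shift (- x) \<omega>)" for \<omega>
  have fg: "f \<omega> = g (env_shift x \<omega>)" for \<omega>
    by (simp add: g_def env_shift_def)
  have "{z. z - - x \<in> half_space l y} = half_space l (y - x)"
    by (auto simp: half_space_def real_vec_add real_vec_diff inner_add_left inner_diff_left)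
  then have g: "g \<in> borel_measurable (env_sigma (half_space l (y - x)))"
    unfolding g_def using measurable_compose[OF measurable_env_shift_sigma[of "- x" "half_space l y"] f] by simp
  have gm: "g \<in> borel_measurable env_space" by (rule measurable_env_sigma_space[OF g])
  have fm: "f \<in> borel_measurable env_space" by (rule measurable_env_sigma_space[OF f])
  note Bm = sets_not_good[of L]
  note bm = sets_bad_path[OF law, of R k l c L "y - x"]
  have "(\<integral>\<^sup>+\<omega>. f \<omega> * emeasure (quenched \<omega> x) ?B \<partial>\<P>) =
    (\<integral>\<^sup>+\<omega>. g (env_shift x \<omega>) * emeasure (quenched (env_shift x \<omega>) 0) ?B \<partial>\<P>)"
  proof (rule nn_integral_cong)
    fix \<omega> assume "\<omega> \<in> space \<P>"
    then have \<omega>: "\<omega> \<in> space env_space" by (simp add: spP)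
    have "emeasure (quenched \<omega> (0 + x)) ?B = (\<integral>\<^sup>+X. indicator ?B X \<partial>quenched \<omega> (0 + x))"
      using Bm by (simp add: sets_quenched[OF \<omega>])
    also have "\<dots> = (\<integral>\<^sup>+X. indicator ?B (\<lambda>m. X m + x) \<partial>quenched (env_shift x \<omega>) 0)"
      by (rule nn_integral_quenched_shift[OF \<omega>]) (use Bm in simp)
    also have "\<dots> = (\<integral>\<^sup>+X. indicator ?B X \<partial>quenched (env_shift x \<omega>) 0)"
      by (intro nn_integral_cong) (simp add: indicator_def good_translate)
    also have "\<dots> = emeasure (quenched (env_shift x \<omega>) 0) ?B"
      using Bm \<omega> by (simp add: sets_quenched)
    finally show "f \<omega> * emeasure (quenched \<omega> x) ?B =
      g (env_shift x \<omega>) * emeasure (quenched (env_shift x \<omega>) 0) ?B" by (simp add: fg)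
  qed
  also have "\<dots> = (\<integral>\<^sup>+\<omega>. g \<omega> * emeasure (quenched \<omega> 0) ?B \<partial>\<P>)"
    by (rule stationary_nn_integral[OF law st])
      (intro borel_measurable_times_ennreal gm measurable_emeasure_quenched Bm)
  also have "\<dots> \<le> (\<integral>\<^sup>+\<omega>. g \<omega> * emeasure (quenched \<omega> 0) (bad_path R k l c L (y - x)) \<partial>\<P>)"
  proof (rule nn_integral_mono_AE, use AE_ellip in eventually_elim)
    case (elim \<omega>)
    then have \<omega>: "\<omega> \<in> space env_space" by (simp add: ellip_def)
    have "emeasure (quenched \<omega> 0) ?B \<le> emeasure (quenched \<omega> 0) (bad_path R k l c L (y - x))"
    proof (rule emeasure_mono_AE)
      show "AE X in quenched \<omega> 0. X \<in> ?B \<longrightarrow> X \<in> bad_path R k l c L (y - x)"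
        using AE_steps[OF \<omega>, of 0] AE_exit[OF elim finite_Box[of L 0], of 0]
      proof eventually_elim
        case (elim X)
        then show ?case
          using bad_path_of_not_good[of X L "y - x"] y L L0 by (auto simp: lev_diff)
      qed
    qed (use bm in \<open>simp add: sets_quenched[OF \<omega>]\<close>)
    then show ?case by (rule mult_left_mono) simp
  qed
  also have "\<dots> \<le> ennreal (L powr - M) * (\<integral>\<^sup>+\<omega>. g \<omega> \<partial>\<P>)"
  proof (rule nn_integral_test_le[OF _ _ _ _ g])
    show "sets (env_sigma (half_space l (y - x))) \<subseteq> sets \<P>"
      using sets_env_sigma_subset by (simp add: setsP)
    show "(\<lambda>\<omega>. emeasure (quenched \<omega> 0) (bad_path R k l c L (y - x))) \<in> borel_measurable \<P>"
      unfolding mP by (rule measurable_emeasure_quenched[OF bm])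
    have "y - x \<in> half_space l 0"
      using y L L0 by (simp add: half_space_def lev_def[symmetric] lev_diff)
    then show "(\<integral>\<^sup>+\<omega>. indicator A \<omega> * emeasure (quenched \<omega> 0) (bad_path R k l c L (y - x)) \<partial>\<P>) \<le>
        ennreal (L powr - M) * emeasure \<P> A"
      if "A \<in> sets (env_sigma (half_space l (y - x)))" for A
      using pc[OF L _ that] by simp
  qed (simp add: spP)
  also have "(\<integral>\<^sup>+\<omega>. g \<omega> \<partial>\<P>) = (\<integral>\<^sup>+\<omega>. f \<omega> \<partial>\<P>)"
    using stationary_nn_integral[OF law st gm, of x] by (simp add: fg)
  finally show ?thesis .
qed


section \<open>First visits and union bounds over sites\<close>

definition bad_at :: "int^'d \<Rightarrow> real \<Rightarrow> (nat \<Rightarrow> int^'d) \<Rightarrow> bool" where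
  "bad_at x L X \<longleftrightarrow> (\<exists>n. X n = x \<and> (\<forall>m<n. X m \<noteq> x) \<and> \<not> good L (walk_shift n X))"

lemma measurable_shift_vimage:
  "E \<in> sets path_space \<Longrightarrow> walk_shift n -` E \<in> sets (path_space :: (nat \<Rightarrow> int^'d) measure)"
  using measurable_sets[OF measurable_walk_shift, of E n] by simp

lemma sets_prefix:
  assumes "prefix_det n p"
  shows "{X :: nat \<Rightarrow> int^'d. p X} \<in> sets path_space"
proof -
  have "p \<in> path_space \<rightarrow>\<^sub>M count_space (UNIV :: bool set)"
    by (rule prefix_det_measurable[OF assms]) simp
  then have "{X \<in> space (path_space :: (nat \<Rightarrow> int^'d) measure). p X} \<in> sets path_space"
    by measurable
  then show ?thesis by simp
qed

lemma sets_bad_at: "{X. bad_at x L X} \<in> sets path_space"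
proof -
  have "{X. bad_at x L X} = (\<Union>n. {X. X n = x \<and> (\<forall>m<n. X m \<noteq> x)} \<inter> walk_shift n -` {X. \<not> good L X})"
    by (auto simp: bad_at_def)
  also have "\<dots> \<in> sets path_space"
  proof (rule sets.countable_UN'', simp)
    fix n
    have "{X. X n = x \<and> (\<forall>m<n. X m \<noteq> x)} \<in> sets path_space"
      by (rule sets_prefix[of n]) (auto simp: prefix_det_def)
    then show "{X. X n = x \<and> (\<forall>m<n. X m \<noteq> x)} \<inter> walk_shift n -` {X. \<not> good L X} \<in> sets path_space"
      by (rule sets.Int[OF _ measurable_shift_vimage[OF sets_not_good]])
  qed
  finally show ?thesis .
qed

text \<open>A site has at most one first visit, so the sum over the time of this visit has total
  weight at most 1. Hence a union bound over sites controls boxes that are started at random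
  times.\<close>

lemma bad_at_le:
  assumes \<omega>: "\<omega> \<in> space env_space"
  shows "emeasure (quenched \<omega> x0) {X. bad_at x L X} \<le> emeasure (quenched \<omega> x) {X. \<not> good L X}"
proof -
  let ?B = "{X. \<not> good L X} :: (nat \<Rightarrow> int^'d) set"
  let ?q = "quenched \<omega> x0"
  interpret q: prob_space ?q by (rule prob_space_quenched[OF \<omega>])
  define A where "A n = {X :: nat \<Rightarrow> int^'d. X n = x \<and> (\<forall>m<n. X m \<noteq> x)}" for n
  have A: "A n \<in> sets path_space" for n
    unfolding A_def by (rule sets_prefix[of n]) (auto simp: prefix_det_def)
  note Bm = sets_not_good[of L]
  have sq: "sets ?q = sets path_space" by (rule sets_quenched[OF \<omega>])
  have V: "prefix_det n (indicator (A n) :: _ \<Rightarrow> ennreal)" for n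
    by (auto simp: prefix_det_def A_def indicator_def)
  have each: "emeasure ?q (A n \<inter> walk_shift n -` ?B) = emeasure ?q (A n) * emeasure (quenched \<omega> x) ?B" for n
  proof -
    have "emeasure ?q (A n \<inter> walk_shift n -` ?B) =
      (\<integral>\<^sup>+X. indicator (A n \<inter> walk_shift n -` ?B) X \<partial>?q)"
      using A Bm measurable_shift_vimage[OF Bm] by (simp add: sq)
    also have "\<dots> = (\<integral>\<^sup>+X. indicator (A n) X * indicator ?B (walk_shift n X) \<partial>?q)"
      by (intro nn_integral_cong) (auto simp: indicator_def)
    also have "\<dots> = (\<integral>\<^sup>+X. indicator (A n) X * (\<integral>\<^sup>+Y. indicator ?B Y \<partial>quenched \<omega> (X n)) \<partial>?q)"
      by (rule nn_integral_markov[OF \<omega> V]) (use Bm in simp)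
    also have "\<dots> = (\<integral>\<^sup>+X. indicator (A n) X * emeasure (quenched \<omega> x) ?B \<partial>?q)"
    proof (intro nn_integral_cong)
      fix X show "indicator (A n) X * (\<integral>\<^sup>+Y. indicator ?B Y \<partial>quenched \<omega> (X n)) =
        indicator (A n) X * emeasure (quenched \<omega> x) ?B"
        using Bm by (cases "X \<in> A n") (simp_all add: A_def sets_quenched[OF \<omega>])
    qed
    also have "\<dots> = emeasure ?q (A n) * emeasure (quenched \<omega> x) ?B"
      using A by (simp add: nn_integral_multc sq measurable_quenched_cong[OF \<omega>])
    finally show ?thesis .
  qed
  have "{X. bad_at x L X} = (\<Union>n. A n \<inter> walk_shift n -` ?B)"
    by (auto simp: bad_at_def A_def)
  then have "emeasure ?q {X. bad_at x L X} \<le> (\<Sum>n. emeasure ?q (A n \<inter> walk_shift n -` ?B))"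
    using A measurable_shift_vimage[OF Bm] by (auto simp: sq intro!: emeasure_subadditive_countably)
  also have "\<dots> = (\<Sum>n. emeasure ?q (A n)) * emeasure (quenched \<omega> x) ?B"
    unfolding each by simp
  also have "(\<Sum>n. emeasure ?q (A n)) = emeasure ?q (\<Union>n. A n)"
  proof (rule suminf_emeasure)
    show "disjoint_family A"
      unfolding disjoint_family_on_def A_def by (auto, metis nat_neq_iff)
  qed (use A in \<open>auto simp: sq\<close>)
  also have "\<dots> * emeasure (quenched \<omega> x) ?B \<le> 1 * emeasure (quenched \<omega> x) ?B"
    by (intro mult_right_mono q.emeasure_le_1) simp
  finally show ?thesis by simp
qed

lemma union_finite:
  assumes Q: "finite Q" and L1: "L1 \<ge> L\<^sub>0" and Lf: "\<And>x. x \<in> Q \<Longrightarrow> L1 \<le> Lf x"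
    and y: "\<And>x. x \<in> Q \<Longrightarrow> lev y \<le> lev x - Lf x - 1"
    and f: "f \<in> borel_measurable (env_sigma (half_space l y))"
  shows "(\<integral>\<^sup>+\<omega>. f \<omega> * emeasure (quenched \<omega> x0) {X. \<exists>x\<in>Q. bad_at x (Lf x) X} \<partial>\<P>) \<le>
    ennreal (real (card Q) * L1 powr - M) * (\<integral>\<^sup>+\<omega>. f \<omega> \<partial>\<P>)"
proof -
  have fm: "f \<in> borel_measurable \<P>" unfolding mP by (rule measurable_env_sigma_space[OF f])
  have qm: "(\<lambda>\<omega>. emeasure (quenched \<omega> x) {X. \<not> good L X}) \<in> borel_measurable \<P>" for x L
    unfolding mP by (rule measurable_emeasure_quenched[OF sets_not_good])
  have "(\<integral>\<^sup>+\<omega>. f \<omega> * emeasure (quenched \<omega> x0) {X. \<exists>x\<in>Q. bad_at x (Lf x) X} \<partial>\<P>) \<le>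
    (\<integral>\<^sup>+\<omega>. (\<Sum>x\<in>Q. f \<omega> * emeasure (quenched \<omega> x) {X. \<not> good (Lf x) X}) \<partial>\<P>)"
  proof (rule nn_integral_mono)
    fix \<omega> assume "\<omega> \<in> space \<P>"
    then have \<omega>: "\<omega> \<in> space env_space" by (simp add: spP)
    have "{X. \<exists>x\<in>Q. bad_at x (Lf x) X} = (\<Union>x\<in>Q. {X. bad_at x (Lf x) X})" by auto
    then have "emeasure (quenched \<omega> x0) {X. \<exists>x\<in>Q. bad_at x (Lf x) X} \<le>
      (\<Sum>x\<in>Q. emeasure (quenched \<omega> x0) {X. bad_at x (Lf x) X})"
      using Q sets_bad_at by (auto intro!: emeasure_subadditive_finite simp: sets_quenched[OF \<omega>])
    also have "\<dots> \<le> (\<Sum>x\<in>Q. emeasure (quenched \<omega> x) {X. \<not> good (Lf x) X})"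
      by (intro sum_mono bad_at_le[OF \<omega>])
    finally show "f \<omega> * emeasure (quenched \<omega> x0) {X. \<exists>x\<in>Q. bad_at x (Lf x) X} \<le>
      (\<Sum>x\<in>Q. f \<omega> * emeasure (quenched \<omega> x) {X. \<not> good (Lf x) X})"
      by (simp add: sum_distrib_left[symmetric] mult_left_mono)
  qed
  also have "\<dots> = (\<Sum>x\<in>Q. \<integral>\<^sup>+\<omega>. f \<omega> * emeasure (quenched \<omega> x) {X. \<not> good (Lf x) X} \<partial>\<P>)"
    by (intro nn_integral_sum borel_measurable_times_ennreal fm qm)
  also have "\<dots> \<le> (\<Sum>x\<in>Q. ennreal (L1 powr - M) * (\<integral>\<^sup>+\<omega>. f \<omega> \<partial>\<P>))"
  proof (rule sum_mono)
    fix x assume x: "x \<in> Q"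
    have "(\<integral>\<^sup>+\<omega>. f \<omega> * emeasure (quenched \<omega> x) {X. \<not> good (Lf x) X} \<partial>\<P>) \<le>
      ennreal (Lf x powr - M) * (\<integral>\<^sup>+\<omega>. f \<omega> \<partial>\<P>)"
      using Lf[OF x] L1 by (intro not_good_bound[OF y[OF x] _ f]) simp
    also have "\<dots> \<le> ennreal (L1 powr - M) * (\<integral>\<^sup>+\<omega>. f \<omega> \<partial>\<P>)"
      using Lf[OF x] L1 L0 M by (intro mult_right_mono ennreal_leI powr_mono2') auto
    finally show "(\<integral>\<^sup>+\<omega>. f \<omega> * emeasure (quenched \<omega> x) {X. \<not> good (Lf x) X} \<partial>\<P>) \<le>
      ennreal (L1 powr - M) * (\<integral>\<^sup>+\<omega>. f \<omega> \<partial>\<P>)" .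
  qed
  also have "\<dots> = ennreal (real (card Q) * L1 powr - M) * (\<integral>\<^sup>+\<omega>. f \<omega> \<partial>\<P>)"
    by (simp add: ennreal_mult ennreal_of_nat_eq_real_of_nat mult.assoc)
  finally show ?thesis .
qed

section \<open>Confinement to a cone\<close>

definition cone_sites :: "real \<Rightarrow> (int^'d) set" where
  "cone_sites r = {x. r \<le> lev x \<and> (\<forall>i. i \<noteq> k \<longrightarrow> \<bar>tau i x\<bar> \<le> (c + 1 / 10) * lev x)}"

text \<open>Box sizes grow in proportion to the height: every box stays above three quarters of the
  height of its centre, away from the half-space below 0, and the failure probabilities are summable
  over dyadic shells of heights.\<close>

definition cone_bad :: "real \<Rightarrow> (nat \<Rightarrow> int^'d) \<Rightarrow> bool" where
  "cone_bad r X \<longleftrightarrow> (\<exists>x\<in>cone_sites r. bad_at x (lev x / 4) X)"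

lemma sets_cone_bad: "{X. cone_bad r X} \<in> sets path_space"
proof -
  have "{X. cone_bad r X} = (\<Union>x\<in>cone_sites r. {X. bad_at x (lev x / 4) X})"
    by (auto simp: cone_bad_def)
  also have "\<dots> \<in> sets path_space" by (intro sets.countable_UN'' sets_bad_at) auto
  finally show ?thesis .
qed

text \<open>The mixing cone with apex at height r/2 on the axis, in the coordinates
  \<open>lev\<close> and \<open>tau\<close>; see \<open>in_cone_mixing_cone\<close>.\<close>

definition in_cone :: "real \<Rightarrow> int^'d \<Rightarrow> bool" where
  "in_cone r x \<longleftrightarrow> r / 2 \<le> lev x \<and> (\<forall>i. i \<noteq> k \<longrightarrow> \<alpha> * \<bar>tau i x\<bar> \<le> lev x - r / 2)"

lemma \<alpha>_c: "\<alpha> * c \<le> 1 / 2"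
proof -
  have "\<alpha> * (2 * c + 1) \<le> 1" using \<alpha> c by (simp add: field_simps)
  then show ?thesis using \<alpha> by (simp add: algebra_simps)
qed

text \<open>Let s be the height of x. After multiplication by \<alpha> the lateral distance of x is
  at most (1/2 + 1/90)(s - r), as \<alpha> c \<le> 1/2 and \<alpha> \<le> 1/9, and the half-width of
  the box is at most s/8. The sum stays below 3s/4 - r/2, while every point of the box has height at
  least 3s/4.\<close>

lemma Box_in_cone:
  assumes r: "r \<ge> 40" and x: "r \<le> lev x" "\<And>i. i \<noteq> k \<Longrightarrow> \<bar>tau i x\<bar> \<le> (c + 1 / 10) * (lev x - r)"
    and z: "z \<in> Box (lev x / 4) x"
  shows "in_cone r z"
proof -
  define s where "s = lev x"
  have "\<bar>lev z - s\<bar> < s / 4" using z by (simp add: Box_def s_def)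
  then have lz: "lev z \<ge> 3 / 4 * s" by (simp only: abs_less_iff) linarith
  have "\<alpha> * \<bar>tau i z\<bar> \<le> lev z - r / 2" if i: "i \<noteq> k" for i
  proof -
    have "\<bar>tau i z\<bar> \<le> (c + 1 / 10) * (s - r) + c * (s / 4)"
    proof -
      have "\<bar>tau i z - tau i x\<bar> < c * (s / 4)" using z i by (simp add: Box_def s_def)
      then show ?thesis using x(2)[OF i] unfolding s_def by linarith
    qed
    then have "\<alpha> * \<bar>tau i z\<bar> \<le> \<alpha> * ((c + 1 / 10) * (s - r) + c * (s / 4))"
      using \<alpha> by (intro mult_left_mono) auto
    also have "\<dots> = \<alpha> * c * (s - r) + \<alpha> / 10 * (s - r) + \<alpha> * c * (s / 4)" by (simp add: algebra_simps)
    also have "\<dots> \<le> 1 / 2 * (s - r) + 1 / 90 * (s - r) + 1 / 2 * (s / 4)"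
      using \<alpha> \<alpha>_c x(1) r by (intro add_mono mult_right_mono) (auto simp: s_def)
    also have "\<dots> \<le> 3 / 4 * s - r / 2"
    proof -
      have "r \<le> s" "0 \<le> r" using x(1) r by (auto simp: s_def)
      then show ?thesis by (simp add: field_simps)
    qed
    finally show ?thesis using lz by simp
  qed
  moreover have "r / 2 \<le> lev z" using lz x(1) r by (simp add: s_def)
  ultimately show ?thesis by (simp add: in_cone_def)
qed

lemma bad_at_first:
  assumes "\<not> bad_at (X n) L X" and "\<And>m. m < n \<Longrightarrow> lev (X m) < lev (X n)"
  shows "good L (walk_shift n X)"
proof -
  have "X m \<noteq> X n" if "m < n" for m using assms(2)[OF that] by auto
  then show ?thesis using assms(1) by (auto simp: bad_at_def)
qed

lemma goodE:
  assumes "good L (walk_shift n X)" "L > 0"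
  obtains N where "N > n" "\<And>m. n \<le> m \<Longrightarrow> m < N \<Longrightarrow> X m \<in> Box L (X n)"
    "lev (X n) + L \<le> lev (X N)" "\<And>i. i \<noteq> k \<Longrightarrow> \<bar>tau i (X N) - tau i (X n)\<bar> \<le> c * L + 1"
proof -
  obtain j where j: "\<forall>m<j. X (n + m) \<in> Box L (X n)" "lev (X n) + L \<le> lev (X (n + j))"
     "\<forall>i. i \<noteq> k \<longrightarrow> \<bar>tau i (X (n + j)) - tau i (X n)\<bar> \<le> c * L + 1"
    using assms(1) unfolding good_def walk_shift_def by auto
  have "j \<noteq> 0" using j(2) assms(2) by (intro notI) simp
  show ?thesis
  proof (rule that[of "n + j"])
    fix m assume "n \<le> m" "m < n + j"
    then show "X m \<in> Box L (X n)" using j(1)[rule_format, of "m - n"] by simp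
  qed (use j \<open>j \<noteq> 0\<close> in auto)
qed

text \<open>A good exit of the box of size \<open>lev x / 4\<close> from a first visit of \<open>x\<close> ends in a new maximum of the
  level, where the argument is repeated; the boxes stay in the cone because \<open>\<alpha> \<le> 1 / (2 * c + 1)\<close>.\<close>

lemma cone_good_path:
  assumes r: "r \<ge> 40" and X: "lev (X 0) = r" "\<And>i. i \<noteq> k \<Longrightarrow> tau i (X 0) = 0"
    and nb: "\<not> cone_bad r X"
  shows "in_cone r (X n)" and "\<exists>n. s \<le> lev (X n)"
proof -
  \<comment> \<open>State after j exits: a new maximum of the level, at height at least r + j r/4,
    so heights are unbounded. The bound n \<ge> j makes the last clause cover every time
    eventually.\<close>
  have ind: "\<exists>n\<ge>j. r + real j * (r / 4) \<le> lev (X n) \<and> (\<forall>m<n. lev (X m) < lev (X n)) \<and>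
    (\<forall>i. i \<noteq> k \<longrightarrow> \<bar>tau i (X n)\<bar> \<le> (c + 1 / 10) * (lev (X n) - r)) \<and> (\<forall>m<n. in_cone r (X m))" for j
  proof (induction j)
    case 0
    show ?case using X by (intro exI[of _ 0]) auto
  next
    case (Suc j)
    then obtain n where n: "n \<ge> j" "r + real j * (r / 4) \<le> lev (X n)" "\<And>m. m < n \<Longrightarrow> lev (X m) < lev (X n)"
      "\<And>i. i \<noteq> k \<Longrightarrow> \<bar>tau i (X n)\<bar> \<le> (c + 1 / 10) * (lev (X n) - r)" "\<And>m. m < n \<Longrightarrow> in_cone r (X m)"
      by blast
    define s where "s = lev (X n)"
    have s: "s \<ge> r" using n(2) r unfolding s_def
      by (smt (verit) mult_nonneg_nonneg of_nat_0_le_iff divide_nonneg_nonneg)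
    have "X n \<in> cone_sites r"
    proof -
      have "(c + 1 / 10) * (s - r) \<le> (c + 1 / 10) * s" using c r by (intro mult_left_mono) auto
      then show ?thesis using s n(4) by (force simp: cone_sites_def s_def)
    qed
    then have "\<not> bad_at (X n) (s / 4) X" using nb unfolding cone_bad_def s_def by blast
    then have "good (s / 4) (walk_shift n X)" by (rule bad_at_first[where n=n and X=X, OF _ n(3)])
    then obtain N where N: "N > n" "\<And>m. n \<le> m \<Longrightarrow> m < N \<Longrightarrow> X m \<in> Box (s / 4) (X n)"
      "s + s / 4 \<le> lev (X N)" "\<And>i. i \<noteq> k \<Longrightarrow> \<bar>tau i (X N) - tau i (X n)\<bar> \<le> c * (s / 4) + 1"
      by (rule goodE) (use s r in \<open>auto simp: s_def\<close>)
    have "lev (X m) < lev (X N)" if "m < N" for m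
    proof (cases "m < n")
      case True
      then show ?thesis using n(3)[OF True] N(3) s r by (simp add: s_def)
    next
      case False
      then have "\<bar>lev (X m) - s\<bar> < s / 4" using N(2)[of m] that by (simp add: Box_def s_def)
      then have "lev (X m) < s + s / 4" by (simp only: abs_less_iff) linarith
      then show ?thesis using N(3) by simp
    qed
    moreover have "in_cone r (X m)" if "m < N" for m
    proof (cases "m < n")
      case False
      then show ?thesis
        using Box_in_cone[OF r _ n(4), of "X m"] N(2)[of m] that s by (simp add: s_def)
    qed (use n in auto)
    \<comment> \<open>One exit raises the height by at least s/4 and moves sideways by at most c s/4
      + 1. Since s \<ge> 40, the 1 is absorbed by s/40: this is the origin of the slope c + 1/10 and
      of the bound r \<ge> 40.\<close>
    moreover have "\<bar>tau i (X N)\<bar> \<le> (c + 1 / 10) * (lev (X N) - r)" if i: "i \<noteq> k" for i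
    proof -
      have "\<bar>tau i (X N)\<bar> \<le> (c + 1 / 10) * (s - r) + (c * (s / 4) + 1)"
        using n(4)[OF i] N(4)[OF i] by (auto simp: s_def)
      also have "\<dots> \<le> (c + 1 / 10) * (s - r) + (c + 1 / 10) * (s / 4)"
        using s r by (simp add: algebra_simps)
      also have "\<dots> = (c + 1 / 10) * (s + s / 4 - r)" by (simp add: field_simps)
      also have "\<dots> \<le> (c + 1 / 10) * (lev (X N) - r)"
        using N(3) c by (intro mult_left_mono) auto
      finally show ?thesis .
    qed
    moreover have "r + real (Suc j) * (r / 4) \<le> lev (X N)"
    proof -
      have "real (Suc j) * (r / 4) = real j * (r / 4) + r / 4" by (simp add: field_simps)
      then show ?thesis using N(3) n(2) s unfolding s_def by linarith
    qed
    ultimately show ?case using N(1) n(1) by (intro exI[of _ N]) auto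
  qed
  show "in_cone r (X n)"
    using ind[of "Suc n"] by (auto simp: Suc_le_eq)
  obtain j :: nat where "s / (r / 4) \<le> real j" using real_arch_simple by blast
  then have "s \<le> real j * (r / 4)" using r by (simp add: field_simps)
  then show "\<exists>n. s \<le> lev (X n)"
    using ind[of j] r by (smt (verit))
qed

definition C\<^sub>1 :: real where "C\<^sub>1 = 1 + real CARD('d) * (c + 1 / 10)"

lemma C1_ge: "C\<^sub>1 \<ge> 1" using c by (simp add: C\<^sub>1_def)

lemma cone_sites_norm: "r \<ge> 0 \<Longrightarrow> x \<in> cone_sites r \<Longrightarrow> norm (real_vec x) \<le> C\<^sub>1 * lev x"
proof -
  assume r: "r \<ge> 0" and x: "x \<in> cone_sites r"
  have "(\<Sum>i\<in>UNIV - {k}. \<bar>tau i x\<bar>) \<le> (\<Sum>i\<in>UNIV - {k}. (c + 1 / 10) * lev x)"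
    using x by (intro sum_mono) (auto simp: cone_sites_def)
  also have "\<dots> \<le> real CARD('d) * ((c + 1 / 10) * lev x)"
    using c x r by (auto intro!: mult_right_mono simp: card_Diff_subset cone_sites_def)
  finally show ?thesis
    using norm_le_lev_tau[of x] x r by (simp add: C\<^sub>1_def cone_sites_def algebra_simps)
qed

text \<open>The constant of the dyadic sum in \<open>cone_bad_bound\<close>:
  \<open>(5 * C\<^sub>1) ^ CARD('d)\<close> counts sites, \<open>4 powr M\<close> comes from the box
  size being a quarter of the height, and 2 is the sum of the geometric series.\<close>

definition C\<^sub>2 :: real where "C\<^sub>2 = 2 * (5 * C\<^sub>1) ^ CARD('d) * 4 powr M"

lemma C2_pos: "C\<^sub>2 > 0" using C1_ge by (simp add: C\<^sub>2_def)

lemma d_ge_1: "real CARD('d) \<ge> 1" using finite_UNIV_card_ge_0[where 'a='d] by simp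

text \<open>The shell of heights between a = 2^j r and 2 a has at most of order a^d sites, each
  failing with probability of order a^-M. As M \<ge> d + 1, the shell contributes order 1/a, and the
  sum over j is of order 1/r.\<close>

lemma cone_bad_bound:
  assumes r: "r \<ge> 40" "r \<ge> 4 * L\<^sub>0" and f: "f \<in> borel_measurable (env_sigma (half_space l 0))"
  shows "(\<integral>\<^sup>+\<omega>. f \<omega> * emeasure (quenched \<omega> x0) {X. cone_bad r X} \<partial>\<P>) \<le>
    ennreal (C\<^sub>2 / r) * (\<integral>\<^sup>+\<omega>. f \<omega> \<partial>\<P>)"
proof -
  define S where "S j = {x \<in> cone_sites r. 2 ^ j * r \<le> lev x \<and> lev x < 2 ^ Suc j * r}" for j :: nat
  let ?E = "\<lambda>j. {X. \<exists>x\<in>S j. bad_at x (lev x / 4) X} :: (nat \<Rightarrow> int^'d) set"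
  have fm: "f \<in> borel_measurable \<P>" unfolding mP by (rule measurable_env_sigma_space[OF f])
  have Sr: "1 \<le> 2 ^ j * r" "2 ^ j * r \<ge> 4 * L\<^sub>0" for j :: nat
  proof -
    have "1 * r \<le> 2 ^ j * r" using r by (intro mult_right_mono) auto
    then have "r \<le> 2 ^ j * r" by simp
    then show "1 \<le> 2 ^ j * r" "2 ^ j * r \<ge> 4 * L\<^sub>0" using r by linarith+
  qed
  have Ssub: "S j \<subseteq> {x. norm (real_vec x) \<le> C\<^sub>1 * (2 ^ Suc j * r)}" for j
  proof
    fix x assume x: "x \<in> S j"
    then have "norm (real_vec x) \<le> C\<^sub>1 * lev x" using cone_sites_norm[of r x] r by (simp add: S_def)
    also have "\<dots> \<le> C\<^sub>1 * (2 ^ Suc j * r)" using x C1_ge by (intro mult_left_mono) (auto simp: S_def)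
    finally show "x \<in> {x. norm (real_vec x) \<le> C\<^sub>1 * (2 ^ Suc j * r)}" by simp
  qed
  have nn: "0 \<le> C\<^sub>1 * (2 ^ Suc j * r)" for j using C1_ge r by simp
  have Sfin: "finite (S j)" for j
    using finite_subset[OF Ssub finite_lattice_ball(1)[OF nn]] .
  have Scard: "real (card (S j)) \<le> (5 * C\<^sub>1 * (2 ^ j * r)) ^ CARD('d)" for j
  proof -
    have "real (card (S j)) \<le> real (card {x::int^'d. norm (real_vec x) \<le> C\<^sub>1 * (2 ^ Suc j * r)})"
      using card_mono[OF finite_lattice_ball(1)[OF nn] Ssub] by simp
    also have "\<dots> \<le> (2 * (C\<^sub>1 * (2 ^ Suc j * r)) + 1) ^ CARD('d)"
      by (rule finite_lattice_ball(2)[OF nn])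
    also have "\<dots> \<le> (5 * C\<^sub>1 * (2 ^ j * r)) ^ CARD('d)"
    proof (rule power_mono)
      have "1 \<le> C\<^sub>1 * (2 ^ j * r)" using mult_mono[OF C1_ge Sr(1)[of j]] C1_ge by simp
      then show "2 * (C\<^sub>1 * (2 ^ Suc j * r)) + 1 \<le> 5 * C\<^sub>1 * (2 ^ j * r)" by (simp add: algebra_simps)
    qed (use C1_ge r in simp)
    finally show ?thesis .
  qed
  have Em: "?E j \<in> sets path_space" for j
  proof -
    have "?E j = (\<Union>x\<in>S j. {X. bad_at x (lev x / 4) X})" by auto
    also have "\<dots> \<in> sets path_space" by (intro sets.countable_UN'' sets_bad_at) auto
    finally show ?thesis .
  qed
  have each: "(\<integral>\<^sup>+\<omega>. f \<omega> * emeasure (quenched \<omega> x0) (?E j) \<partial>\<P>) \<le>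
      ennreal (C\<^sub>2 / r * (1 / 2) ^ Suc j) * (\<integral>\<^sup>+\<omega>. f \<omega> \<partial>\<P>)" for j
  proof -
    have "(\<integral>\<^sup>+\<omega>. f \<omega> * emeasure (quenched \<omega> x0) (?E j) \<partial>\<P>) \<le>
      ennreal (real (card (S j)) * (2 ^ j * r / 4) powr - M) * (\<integral>\<^sup>+\<omega>. f \<omega> \<partial>\<P>)"
    proof (rule union_finite[OF Sfin _ _ _ f])
      show "2 ^ j * r / 4 \<ge> L\<^sub>0" using Sr[of j] by simp
      show "2 ^ j * r / 4 \<le> lev x / 4" if "x \<in> S j" for x using that by (simp add: S_def)
      show "lev 0 \<le> lev x - lev x / 4 - 1" if "x \<in> S j" for x
        using that r by (simp add: S_def cone_sites_def)
    qed
    also have "\<dots> \<le> ennreal (C\<^sub>2 / r * (1 / 2) ^ Suc j) * (\<integral>\<^sup>+\<omega>. f \<omega> \<partial>\<P>)"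
    proof (intro mult_right_mono ennreal_leI)
      define a where "a = 2 ^ j * r"
      have a: "a \<ge> 1" using Sr(1) by (simp add: a_def)
      have "real (card (S j)) * (2 ^ j * r / 4) powr - M \<le>
        (5 * C\<^sub>1 * a) ^ CARD('d) * (a / 4) powr - M"
        unfolding a_def by (intro mult_right_mono Scard) simp
      also have "\<dots> = (5 * C\<^sub>1) ^ CARD('d) * 4 powr M * (a powr real CARD('d) * a powr - M)"
        using a by (simp add: power_mult_distrib powr_divide powr_minus field_simps powr_realpow)
      also have "a powr real CARD('d) * a powr - M = a powr (real CARD('d) - M)"
        by (simp add: powr_add[symmetric])
      also have "\<dots> \<le> a powr -1"
      proof (rule powr_mono)
        show "real CARD('d) - M \<le> -1" using M d_ge_1 by linarith
      qed (rule a)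
      also have "a powr -1 = (1 / r) * (1 / 2) ^ j"
        using a by (simp add: powr_minus_divide a_def power_one_over)
      finally show "real (card (S j)) * (2 ^ j * r / 4) powr - M \<le> C\<^sub>2 / r * (1 / 2) ^ Suc j"
        using C1_ge by (simp add: C\<^sub>2_def mult.assoc mult_left_mono)
    qed simp
    finally show ?thesis .
  qed
  have "(\<integral>\<^sup>+\<omega>. f \<omega> * emeasure (quenched \<omega> x0) {X. cone_bad r X} \<partial>\<P>) \<le>
    (\<integral>\<^sup>+\<omega>. (\<Sum>j. f \<omega> * emeasure (quenched \<omega> x0) (?E j)) \<partial>\<P>)"
  proof (rule nn_integral_mono)
    fix \<omega> assume "\<omega> \<in> space \<P>"
    then have \<omega>: "\<omega> \<in> space env_space" by (simp add: spP)
    have "x \<in> S (nat \<lfloor>log 2 (lev x / r)\<rfloor>)" if "x \<in> cone_sites r" for x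
    proof -
      define t where "t = lev x / r"
      have t: "t \<ge> 1" using that r by (simp add: cone_sites_def t_def)
      define j where "j = nat \<lfloor>log 2 t\<rfloor>"
      have "log 2 t \<ge> 0" using t by simp
      then have "real j \<le> log 2 t" "log 2 t < real (Suc j)" unfolding j_def by linarith+
      then have "2 powr real j \<le> t" "t < 2 powr real (Suc j)"
        using t by (simp_all add: le_log_iff log_less_iff)
      then have "2 ^ j \<le> t" "t < 2 ^ Suc j" by (simp_all add: powr_realpow[symmetric] powr_add)
      then show ?thesis using that r by (simp add: S_def t_def[symmetric] j_def[symmetric])
        (simp add: t_def field_simps)
    qed
    then have "{X. cone_bad r X} \<subseteq> (\<Union>j. ?E j)" by (fastforce simp: cone_bad_def)
    then have "emeasure (quenched \<omega> x0) {X. cone_bad r X} \<le> emeasure (quenched \<omega> x0) (\<Union>j. ?E j)"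
      using Em by (intro emeasure_mono) (auto simp: sets_quenched[OF \<omega>])
    also have "\<dots> \<le> (\<Sum>j. emeasure (quenched \<omega> x0) (?E j))"
      using Em by (intro emeasure_subadditive_countably) (auto simp: sets_quenched[OF \<omega>])
    finally show "f \<omega> * emeasure (quenched \<omega> x0) {X. cone_bad r X} \<le>
      (\<Sum>j. f \<omega> * emeasure (quenched \<omega> x0) (?E j))"
      by (simp add: mult_left_mono)
  qed
  also have "\<dots> = (\<Sum>j. \<integral>\<^sup>+\<omega>. f \<omega> * emeasure (quenched \<omega> x0) (?E j) \<partial>\<P>)"
    by (intro nn_integral_suminf borel_measurable_times_ennreal fm)
      (simp add: mP measurable_emeasure_quenched Em)
  also have "\<dots> \<le> (\<Sum>j. ennreal (C\<^sub>2 / r * (1 / 2) ^ Suc j) * (\<integral>\<^sup>+\<omega>. f \<omega> \<partial>\<P>))"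
    by (intro suminf_le each) auto
  also have "\<dots> = (\<Sum>j. ennreal (C\<^sub>2 / r * (1 / 2) ^ Suc j)) * (\<integral>\<^sup>+\<omega>. f \<omega> \<partial>\<P>)"
    by simp
  also have "(\<Sum>j. ennreal (C\<^sub>2 / r * (1 / 2) ^ Suc j)) = ennreal (C\<^sub>2 / r)"
  proof (rule suminf_ennreal_eq)
    show "(\<lambda>j. C\<^sub>2 / r * (1 / 2) ^ Suc j) sums (C\<^sub>2 / r)"
      using sums_mult[OF power_half_series, of "C\<^sub>2 / r"] by simp
  qed (use C2_pos r in simp)
  finally show ?thesis .
qed


section \<open>Insensitivity to the starting point\<close>

definition hits :: "real \<Rightarrow> nat \<Rightarrow> (nat \<Rightarrow> int^'d) \<Rightarrow> bool" where
  "hits s n X \<longleftrightarrow> s \<le> lev (X n) \<and> (\<forall>m<n. lev (X m) < s)"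

text \<open>Functionals of the path from its first time at level A on, expressed by invariance under
  deleting one initial position below A. In this form a single first-step expansion makes the
  quenched mean of G harmonic below A. Paths that start at or above A are unconstrained.\<close>

definition future :: "real \<Rightarrow> ((nat \<Rightarrow> int^'d) \<Rightarrow> 'b) \<Rightarrow> bool" where
  "future A G \<longleftrightarrow> (\<forall>X. lev (X 0) < A \<longrightarrow> G (walk_shift 1 X) = G X)"

text \<open>The counterpart for the past of level s. Nothing is asked of paths that never reach s;
  they form a null set by \<open>AE_reach\<close>.\<close>

definition adapted :: "real \<Rightarrow> ((nat \<Rightarrow> int^'d) \<Rightarrow> 'b) \<Rightarrow> bool" where
  "adapted s U \<longleftrightarrow> (\<forall>X Y n. hits s n X \<longrightarrow> (\<forall>i\<le>n. X i = Y i) \<longrightarrow> U X = U Y)"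

lemma prefix_det_hits: "prefix_det n (hits s n)"
  by (auto simp: prefix_det_def hits_def)

lemma future_shift:
  assumes "future A G" and "\<And>m. m < n \<Longrightarrow> lev (X m) < A"
  shows "G (walk_shift n X) = G X"
  using assms(2)
proof (induction n)
  case (Suc n)
  have "walk_shift (Suc n) X = walk_shift 1 (walk_shift n X)"
    by (simp add: walk_shift_def fun_eq_iff)
  moreover have "lev (walk_shift n X 0) < A" using Suc.prems[of n] by (simp add: walk_shift_def)
  ultimately have "G (walk_shift (Suc n) X) = G (walk_shift n X)"
    using assms(1) unfolding future_def by metis
  with Suc show ?case by simp
qed (simp add: walk_shift_def)

lemma adapted_prefix_det:
  fixes U :: "(nat \<Rightarrow> int^'d) \<Rightarrow> ennreal"
  assumes "adapted s U"
  shows "prefix_det n (\<lambda>X. U X * indicator {X. hits s n X} X)"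
  unfolding prefix_det_def
proof (intro allI impI)
  fix X Y :: "nat \<Rightarrow> int^'d" assume eq: "\<forall>i\<le>n. X i = Y i"
  have h: "hits s n X = hits s n Y"
    using prefix_det_hits eq unfolding prefix_det_def by blast
  show "U X * indicator {X. hits s n X} X = U Y * indicator {X. hits s n X} Y"
  proof (cases "hits s n X")
    case True
    then have "U X = U Y" using assms eq unfolding adapted_def by blast
    with h show ?thesis by (simp add: indicator_def)
  qed (use h in simp)
qed

lemma adapted_mono:
  assumes "adapted s U" "s \<le> s'"
  shows "adapted s' U"
  unfolding adapted_def
proof (intro allI impI)
  fix X Y n assume h: "hits s' n X" and eq: "\<forall>i\<le>n. X i = Y i"
  have ex: "s \<le> lev (X n)" using h assms(2) by (simp add: hits_def)
  define m where "m = (LEAST m. s \<le> lev (X m))"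
  have "s \<le> lev (X m)" "m \<le> n" unfolding m_def by (rule LeastI[of _ n], rule ex) (rule Least_le, rule ex)
  moreover have "lev (X j) < s" if "j < m" for j
    using not_less_Least[of j "\<lambda>m. s \<le> lev (X m)"] that by (simp add: m_def)
  ultimately have "hits s m X" by (simp add: hits_def)
  moreover have "\<forall>i\<le>m. X i = Y i" using eq \<open>m \<le> n\<close> by simp
  ultimately show "U X = U Y" using assms(1) unfolding adapted_def by blast
qed

section \<open>Harmonic functions of future functionals and their energy\<close>

definition future_mean :: "'d env \<Rightarrow> ((nat \<Rightarrow> int^'d) \<Rightarrow> real) \<Rightarrow> int^'d \<Rightarrow> real" where
  "future_mean \<omega> G y = enn2real (\<integral>\<^sup>+X. ennreal (G X) \<partial>quenched \<omega> y)"

lemma future_mean: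
  assumes \<omega>: "\<omega> \<in> space env_space" and G: "\<And>X. 0 \<le> G X" "\<And>X. G X \<le> 1"
  shows "ennreal (future_mean \<omega> G y) = (\<integral>\<^sup>+X. ennreal (G X) \<partial>quenched \<omega> y)" "0 \<le> future_mean \<omega> G y" "future_mean \<omega> G y \<le> 1"
proof -
  interpret q: prob_space "quenched \<omega> y" by (rule prob_space_quenched[OF \<omega>])
  have le: "(\<integral>\<^sup>+X. ennreal (G X) \<partial>quenched \<omega> y) \<le> 1"
  proof -
    have "(\<integral>\<^sup>+X. ennreal (G X) \<partial>quenched \<omega> y) \<le> (\<integral>\<^sup>+X. 1 \<partial>quenched \<omega> y)"
      using G by (intro nn_integral_mono) (simp add: ennreal_leI ennreal_1[symmetric] del: ennreal_1)
    then show ?thesis by (simp add: q.emeasure_space_1)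
  qed
  then show "ennreal (future_mean \<omega> G y) = (\<integral>\<^sup>+X. ennreal (G X) \<partial>quenched \<omega> y)"
    unfolding future_mean_def by (intro ennreal_enn2real) (metis ennreal_one_less_top le_less_trans)
  show "0 \<le> future_mean \<omega> G y" by (simp add: future_mean_def)
  show "future_mean \<omega> G y \<le> 1" unfolding future_mean_def using enn2real_mono[OF le] by simp
qed

lemma future_mean_harmonic:
  assumes \<omega>: "\<omega> \<in> space env_space" and G: "\<And>X. 0 \<le> G X" "\<And>X. G X \<le> 1"
    "G \<in> borel_measurable path_space" "future A G" and y: "lev y < A"
  shows "future_mean \<omega> G y = (\<Sum>e\<in>unit_steps. \<omega> y e * future_mean \<omega> G (y + e))"
proof -
  have Gm: "(\<lambda>X. ennreal (G X)) \<in> borel_measurable path_space" using G(3) by simp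
  have "ennreal (future_mean \<omega> G y) = (\<integral>\<^sup>+X. ennreal (G (walk_shift 1 X)) \<partial>quenched \<omega> y)"
    unfolding future_mean(1)[OF \<omega> G(1,2)]
  proof (rule nn_integral_cong_AE, use AE_quenched_steps[OF \<omega>, of y] in eventually_elim)
    case (elim X)
    then show ?case using G(4) y unfolding future_def by auto
  qed
  also have "\<dots> = (\<Sum>e\<in>unit_steps. ennreal (\<omega> y e) * ennreal (future_mean \<omega> G (y + e)))"
    unfolding future_mean(1)[OF \<omega> G(1,2)] by (rule nn_integral_quenched_first_step[OF \<omega> Gm])
  also have "\<dots> = ennreal (\<Sum>e\<in>unit_steps. \<omega> y e * future_mean \<omega> G (y + e))"
    using space_env_spaceD(1)[OF \<omega>] future_mean(2)[OF \<omega> G(1,2)]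
    by (subst sum_ennreal[symmetric]) (auto intro!: sum.cong simp: ennreal_mult)
  finally show ?thesis
    using space_env_spaceD(1)[OF \<omega>] future_mean(2)[OF \<omega> G(1,2)]
    by (subst (asm) ennreal_inj) (auto intro!: sum_nonneg)
qed

definition local_energy :: "'d env \<Rightarrow> ((nat \<Rightarrow> int^'d) \<Rightarrow> real) \<Rightarrow> int^'d \<Rightarrow> real" where
  "local_energy \<omega> G y = (\<Sum>e\<in>unit_steps. \<omega> y e * (future_mean \<omega> G (y + e) - future_mean \<omega> G y)\<^sup>2)"

lemma local_energy_nonneg:
  assumes "\<omega> \<in> space env_space"
  shows "0 \<le> local_energy \<omega> G y"
  unfolding local_energy_def using space_env_spaceD(1)[OF assms]
  by (intro sum_nonneg mult_nonneg_nonneg) auto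

text \<open>Variance identity for one step: expanding the square, harmonicity turns the cross term
  into a multiple of the square of the mean.\<close>

lemma local_energy_eq:
  assumes \<omega>: "\<omega> \<in> space env_space" and G: "\<And>X. 0 \<le> G X" "\<And>X. G X \<le> 1"
    "G \<in> borel_measurable path_space" "future A G" and y: "lev y < A"
  shows "(\<Sum>e\<in>unit_steps. \<omega> y e * (future_mean \<omega> G (y + e))\<^sup>2) = (future_mean \<omega> G y)\<^sup>2 + local_energy \<omega> G y"
proof -
  let ?h = "future_mean \<omega> G"
  have "local_energy \<omega> G y = (\<Sum>e\<in>unit_steps. \<omega> y e * (?h (y + e))\<^sup>2 - 2 * ?h y * (\<omega> y e * ?h (y + e)) + (?h y)\<^sup>2 * \<omega> y e)"
    unfolding local_energy_def by (intro sum.cong) (auto simp: power2_eq_square algebra_simps)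
  also have "\<dots> = (\<Sum>e\<in>unit_steps. \<omega> y e * (?h (y + e))\<^sup>2) - 2 * ?h y * (\<Sum>e\<in>unit_steps. \<omega> y e * ?h (y + e))
      + (?h y)\<^sup>2 * (\<Sum>e\<in>unit_steps. \<omega> y e)"
    by (simp add: sum.distrib sum_subtractf sum_distrib_left)
  also have "\<dots> = (\<Sum>e\<in>unit_steps. \<omega> y e * (?h (y + e))\<^sup>2) - (?h y)\<^sup>2"
    using future_mean_harmonic[OF \<omega> G y] space_env_spaceD(2)[OF \<omega>] by (simp add: power2_eq_square)
  finally show ?thesis by simp
qed

lemma prefix_det_mono: "prefix_det n V \<Longrightarrow> n \<le> m \<Longrightarrow> prefix_det m V"
  unfolding prefix_det_def by (meson order_trans)

lemma prefix_det_times: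
  fixes V :: "(nat \<Rightarrow> int^'d) \<Rightarrow> ennreal"
  assumes "prefix_det n V" "j \<le> n"
  shows "prefix_det n (\<lambda>X. V X * g (X j))"
  unfolding prefix_det_def
proof (intro allI impI)
  fix X Y :: "nat \<Rightarrow> int^'d" assume eq: "\<forall>i\<le>n. X i = Y i"
  then have "V X = V Y" using assms(1) unfolding prefix_det_def by blast
  moreover have "X j = Y j" using eq assms(2) by simp
  ultimately show "V X * g (X j) = V Y * g (Y j)" by simp
qed

lemma nn_integral_step:
  assumes \<omega>: "\<omega> \<in> space env_space" and V: "prefix_det n V"
  shows "(\<integral>\<^sup>+X. V X * g (X (Suc n)) \<partial>quenched \<omega> x) =
    (\<integral>\<^sup>+X. V X * (\<Sum>e\<in>unit_steps. ennreal (\<omega> (X n) e) * g (X n + e)) \<partial>quenched \<omega> x)"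
proof -
  have gm: "(\<lambda>Y. g (Y 1)) \<in> borel_measurable path_space"
    by (rule prefix_det_borel_measurable[of 1]) (simp add: prefix_det_def)
  show ?thesis
    using nn_integral_markov[OF \<omega> V gm, of x] nn_integral_quenched_one_step[OF \<omega>, where f=g]
    by (simp add: walk_shift_def)
qed

lemma nn_integral_forward_step:
  assumes \<omega>: "ellip \<omega>" and V: "prefix_det n V" and e: "e \<in> forward_steps l"
  shows "ennreal \<kappa> * (\<integral>\<^sup>+X. V X * g (X n + e) \<partial>quenched \<omega> x) \<le> (\<integral>\<^sup>+X. V X * g (X (Suc n)) \<partial>quenched \<omega> x)"
proof -
  have \<omega>s: "\<omega> \<in> space env_space" using \<omega> by (simp add: ellip_def)
  have m: "(\<lambda>X. V X * g (X n + e)) \<in> borel_measurable path_space"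
    by (rule prefix_det_borel_measurable[OF prefix_det_times[OF V order_refl, of "\<lambda>y. g (y + e)"]])
  have "ennreal \<kappa> * (\<integral>\<^sup>+X. V X * g (X n + e) \<partial>quenched \<omega> x) =
    (\<integral>\<^sup>+X. V X * (ennreal \<kappa> * g (X n + e)) \<partial>quenched \<omega> x)"
    using m by (subst nn_integral_cmult[symmetric]) (simp_all add: measurable_quenched_cong[OF \<omega>s] mult.left_commute)
  also have "\<dots> \<le> (\<integral>\<^sup>+X. V X * (\<Sum>e\<in>unit_steps. ennreal (\<omega> (X n) e) * g (X n + e)) \<partial>quenched \<omega> x)"
  proof (intro nn_integral_mono mult_left_mono)
    fix X :: "nat \<Rightarrow> int^'d"
    have "ennreal \<kappa> * g (X n + e) \<le> ennreal (\<omega> (X n) e) * g (X n + e)"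
      using \<omega> e by (intro mult_right_mono ennreal_leI) (auto simp: ellip_def)
    also have "\<dots> \<le> (\<Sum>e\<in>unit_steps. ennreal (\<omega> (X n) e) * g (X n + e))"
      using e forward_steps_unit finite_unit_steps by (intro member_le_sum) auto
    finally show "ennreal \<kappa> * g (X n + e) \<le> (\<Sum>e\<in>unit_steps. ennreal (\<omega> (X n) e) * g (X n + e))" .
  qed simp
  also have "\<dots> = (\<integral>\<^sup>+X. V X * g (X (Suc n)) \<partial>quenched \<omega> x)"
    by (rule nn_integral_step[OF \<omega>s V, symmetric])
  finally show ?thesis .
qed

text \<open>Following \<open>es\<close> to its end has conditional probability at least
  \<kappa>^length. This exchanges a displaced position for one that the walk itself visits later,
  where the total energy is bounded.\<close>

lemma nn_integral_forward_path:
  assumes \<omega>: "ellip \<omega>" and V: "prefix_det n V" and es: "set es \<subseteq> forward_steps l"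
  shows "ennreal (\<kappa> ^ length es) * (\<integral>\<^sup>+X. V X * g (X n + sum_list es) \<partial>quenched \<omega> x) \<le>
    (\<integral>\<^sup>+X. V X * g (X (n + length es)) \<partial>quenched \<omega> x)"
  using es
proof (induction es arbitrary: g rule: rev_induct)
  case (snoc e es)
  have e: "e \<in> forward_steps l" and IH: "set es \<subseteq> forward_steps l" using snoc by auto
  have "ennreal (\<kappa> ^ length (es @ [e])) * (\<integral>\<^sup>+X. V X * g (X n + sum_list (es @ [e])) \<partial>quenched \<omega> x) =
    ennreal \<kappa> * (ennreal (\<kappa> ^ length es) * (\<integral>\<^sup>+X. V X * g (X n + sum_list es + e) \<partial>quenched \<omega> x))"
    using \<kappa> by (simp add: ennreal_mult add.assoc mult.assoc)
  also have "\<dots> \<le> ennreal \<kappa> * (\<integral>\<^sup>+X. V X * g (X (n + length es) + e) \<partial>quenched \<omega> x)"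
    using snoc.IH[OF IH, of "\<lambda>y. g (y + e)"] by (intro mult_left_mono) auto
  also have "\<dots> \<le> (\<integral>\<^sup>+X. V X * g (X (n + length (es @ [e]))) \<partial>quenched \<omega> x)"
    using nn_integral_forward_step[OF \<omega> prefix_det_mono[OF V le_add1[of n "length es"]] e, where g=g and x=x]
    by simp
  finally show ?case .
qed simp

text \<open>Up to level \<open>A\<close> the process \<open>future_mean \<omega> G (X n)\<close> is a martingale with values in \<open>[0, 1]\<close>, and
  \<open>local_energy\<close> is the conditional variance of its increments.\<close>

lemma energy_bound:
  assumes \<omega>: "\<omega> \<in> space env_space" and G: "\<And>X. 0 \<le> G X" "\<And>X. G X \<le> 1"
    "G \<in> borel_measurable path_space" "future A G"
  shows "(\<Sum>n. \<integral>\<^sup>+X. indicator {X. \<forall>m\<le>n. lev (X m) < A} X * ennreal (local_energy \<omega> G (X n)) \<partial>quenched \<omega> x) \<le> 1"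
proof -
  interpret q: prob_space "quenched \<omega> x" by (rule prob_space_quenched[OF \<omega>])
  let ?h = "future_mean \<omega> G" and ?q = "quenched \<omega> x"
  let ?al = "\<lambda>n. indicator {X. \<forall>m\<le>n. lev (X m) < A} :: (nat \<Rightarrow> int^'d) \<Rightarrow> ennreal"
  define E where "E n = (\<integral>\<^sup>+X. ?al n X * ennreal (local_energy \<omega> G (X n)) \<partial>?q)" for n
  define D where "D n = (\<integral>\<^sup>+X. ?al n X * ennreal ((?h (X n))\<^sup>2) \<partial>?q)" for n
  define p where "p n = (\<integral>\<^sup>+X. ?al n X \<partial>?q)" for n
  have al: "prefix_det n (?al n)" for n by (auto simp: prefix_det_def indicator_def)
  have pm: "V \<in> borel_measurable ?q" if "prefix_det n V" for n and V :: "(nat \<Rightarrow> int^'d) \<Rightarrow> ennreal"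
    using prefix_det_borel_measurable[OF that] by (simp add: measurable_quenched_cong[OF \<omega>])
  have m1: "?al n \<in> borel_measurable ?q" for n by (rule pm[OF al])
  have m2: "(\<lambda>X. ?al n X * g (X n)) \<in> borel_measurable ?q"
    "(\<lambda>X. ?al n X * g (X (Suc n))) \<in> borel_measurable ?q" for n and g :: "int^'d \<Rightarrow> ennreal"
    by (rule pm[OF prefix_det_times[OF al order_refl]],
        rule pm[OF prefix_det_times[OF prefix_det_mono[OF al le_SucI[OF order_refl]] order_refl]])
  have h1: "(?h y)\<^sup>2 \<le> 1" for y
    using future_mean(2,3)[OF \<omega> G(1,2)] by (simp add: power_le_one)
  have ple: "p n \<le> 1" for n
  proof -
    have "p n \<le> (\<integral>\<^sup>+X. 1 \<partial>?q)" unfolding p_def by (intro nn_integral_mono) (auto simp: indicator_def)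
    then show ?thesis by (simp add: q.emeasure_space_1)
  qed
  have Dp: "D n \<le> p n" for n
    unfolding D_def p_def using h1
    by (intro nn_integral_mono) (auto simp: indicator_def ennreal_le_1)
  \<comment> \<open>Written without subtraction, which truncates on \<open>ennreal\<close>. The loss
    p n - p (n + 1) is the probability of crossing level A at this step; since h^2 \<le> 1, it pays
    for the crossing paths that are missing from D (n + 1).\<close>
  have rec: "E n + D n + p (Suc n) \<le> D (Suc n) + p n" for n
  proof -
    have "E n + D n = (\<integral>\<^sup>+X. ?al n X * ennreal (local_energy \<omega> G (X n)) + ?al n X * ennreal ((?h (X n))\<^sup>2) \<partial>?q)"
      unfolding E_def D_def by (rule nn_integral_add[symmetric]) (rule m2)+
    also have "\<dots> = (\<integral>\<^sup>+X. ?al n X * (\<Sum>e\<in>unit_steps. ennreal (\<omega> (X n) e) * ennreal ((?h (X n + e))\<^sup>2)) \<partial>?q)"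
    proof (intro nn_integral_cong)
      fix X :: "nat \<Rightarrow> int^'d"
      show "?al n X * ennreal (local_energy \<omega> G (X n)) + ?al n X * ennreal ((?h (X n))\<^sup>2) =
        ?al n X * (\<Sum>e\<in>unit_steps. ennreal (\<omega> (X n) e) * ennreal ((?h (X n + e))\<^sup>2))"
      proof (cases "\<forall>m\<le>n. lev (X m) < A")
        case True
        then have "lev (X n) < A" by simp
        from local_energy_eq[OF \<omega> G this]
        have "ennreal ((?h (X n))\<^sup>2 + local_energy \<omega> G (X n)) = ennreal (\<Sum>e\<in>unit_steps. \<omega> (X n) e * (?h (X n + e))\<^sup>2)"
          by simp
        also have "\<dots> = (\<Sum>e\<in>unit_steps. ennreal (\<omega> (X n) e) * ennreal ((?h (X n + e))\<^sup>2))"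
          using space_env_spaceD(1)[OF \<omega>]
          by (subst sum_ennreal[symmetric]) (auto intro!: sum.cong simp: ennreal_mult)
        finally show ?thesis using True local_energy_nonneg[OF \<omega>] by (simp add: ennreal_plus add.commute)
      qed simp
    qed
    also have "\<dots> = (\<integral>\<^sup>+X. ?al n X * ennreal ((?h (X (Suc n)))\<^sup>2) \<partial>?q)"
      by (rule nn_integral_step[OF \<omega> al, where g="\<lambda>y. ennreal ((?h y)\<^sup>2)", symmetric])
    finally have ED: "E n + D n = (\<integral>\<^sup>+X. ?al n X * ennreal ((?h (X (Suc n)))\<^sup>2) \<partial>?q)" .
    have "E n + D n + p (Suc n) =
      (\<integral>\<^sup>+X. ?al n X * ennreal ((?h (X (Suc n)))\<^sup>2) + ?al (Suc n) X \<partial>?q)"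
      unfolding ED p_def by (rule nn_integral_add[symmetric]) (rule m2 m1)+
    also have "\<dots> \<le> (\<integral>\<^sup>+X. ?al (Suc n) X * ennreal ((?h (X (Suc n)))\<^sup>2) + ?al n X \<partial>?q)"
    proof (intro nn_integral_mono)
      fix X :: "nat \<Rightarrow> int^'d"
      show "?al n X * ennreal ((?h (X (Suc n)))\<^sup>2) + ?al (Suc n) X \<le>
        ?al (Suc n) X * ennreal ((?h (X (Suc n)))\<^sup>2) + ?al n X"
      proof (cases "\<forall>m\<le>Suc n. lev (X m) < A")
        case False
        have "?al n X * ennreal ((?h (X (Suc n)))\<^sup>2) \<le> ?al n X * 1"
          using h1 by (intro mult_left_mono) (simp_all add: ennreal_le_1)
        with False show ?thesis by simp
      qed simp
    qed
    also have "\<dots> = D (Suc n) + p n"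
      unfolding D_def p_def by (rule nn_integral_add) (rule m2 m1)+
    finally show ?thesis .
  qed
  have fin: "p n < top" "D n < top" for n
    using le_less_trans[OF ple ennreal_one_less_top] le_less_trans[OF order_trans[OF Dp ple] ennreal_one_less_top]
    by auto
  \<comment> \<open>The telescoped recursion. As D N \<le> p N, the quantity p N cancels afterwards
    and the energies sum to at most 1.\<close>
  have "(\<Sum>n<N. E n) + p N \<le> D N + 1" for N
  proof (induction N)
    case 0
    show ?case using ple[of 0] by (simp add: add_increasing)
  next
    case (Suc N)
    have "((\<Sum>n<N. E n) + p N) + (E N + D N + p (Suc N)) \<le> (D N + 1) + (D (Suc N) + p N)"
      by (intro add_mono Suc rec)
    then have "(D N + p N) + ((\<Sum>n<Suc N. E n) + p (Suc N)) \<le> (D N + p N) + (D (Suc N) + 1)"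
      by (simp add: add_ac)
    then show ?case
      using less_imp_neq[OF fin(1)[of N]] less_imp_neq[OF fin(2)[of N]]
      by (subst (asm) ennreal_add_left_cancel_le) auto
  qed
  then have pN: "(\<Sum>n<N. E n) + p N \<le> p N + 1" for N
    using add_right_mono[OF Dp, of _ 1] by (rule order_trans)
  have "(\<Sum>n<N. E n) \<le> 1" for N
    using pN[of N] less_imp_neq[OF fin(1)[of N]] by (simp add: add.commute[of _ "p N"] ennreal_add_left_cancel_le)
  then show ?thesis
    unfolding E_def[symmetric] by (intro suminf_le_const) auto
qed


lemma local_energy_ge:
  assumes \<omega>: "ellip \<omega>" and e: "e \<in> forward_steps l"
  shows "\<kappa> * (future_mean \<omega> G (y + e) - future_mean \<omega> G y)\<^sup>2 \<le> local_energy \<omega> G y"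
proof -
  have \<omega>s: "\<omega> \<in> space env_space" using \<omega> by (simp add: ellip_def)
  have "\<kappa> * (future_mean \<omega> G (y + e) - future_mean \<omega> G y)\<^sup>2 \<le> \<omega> y e * (future_mean \<omega> G (y + e) - future_mean \<omega> G y)\<^sup>2"
    using \<omega> e by (intro mult_right_mono) (auto simp: ellip_def)
  also have "\<dots> \<le> local_energy \<omega> G y"
    unfolding local_energy_def using e forward_steps_unit[of l] finite_unit_steps space_env_spaceD(1)[OF \<omega>s]
    by (intro member_le_sum) auto
  finally show ?thesis .
qed

text \<open>Telescoping along \<open>es\<close> and Cauchy-Schwarz; by ellipticity each squared
  forward difference is at most the local energy at its base point divided by \<kappa>.\<close>

lemma forward_difference_bound:
  assumes \<omega>: "ellip \<omega>" and es: "set es \<subseteq> forward_steps l"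
  shows "(future_mean \<omega> G (z + sum_list es) - future_mean \<omega> G z)\<^sup>2 \<le>
    (real (length es) / \<kappa>) * (\<Sum>j<length es. local_energy \<omega> G (z + sum_list (take j es)))"
proof -
  define D where "D j = future_mean \<omega> G (z + sum_list (take (Suc j) es)) - future_mean \<omega> G (z + sum_list (take j es))" for j
  have "future_mean \<omega> G (z + sum_list es) - future_mean \<omega> G z = (\<Sum>j<length es. D j)"
    unfolding D_def by (subst sum_lessThan_telescope) simp
  then have "(future_mean \<omega> G (z + sum_list es) - future_mean \<omega> G z)\<^sup>2 \<le> (\<Sum>j<length es. (D j)\<^sup>2) * real (length es)"
    using sum_squared_le_sum_of_squares[of D "{..<length es}"] by simp
  also have "\<dots> \<le> (\<Sum>j<length es. local_energy \<omega> G (z + sum_list (take j es)) / \<kappa>) * real (length es)"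
  proof (intro mult_right_mono sum_mono)
    fix j assume "j \<in> {..<length es}"
    then have j: "j < length es" by simp
    have "z + sum_list (take (Suc j) es) = (z + sum_list (take j es)) + es ! j"
      using j by (simp add: take_Suc_conv_app_nth add.assoc)
    then have "\<kappa> * (D j)\<^sup>2 \<le> local_energy \<omega> G (z + sum_list (take j es))"
      unfolding D_def using local_energy_ge[OF \<omega>, of "es ! j" G "z + sum_list (take j es)"] es j by (simp add: subset_iff add.assoc)
    then show "(D j)\<^sup>2 \<le> local_energy \<omega> G (z + sum_list (take j es)) / \<kappa>"
      using \<kappa> by (simp add: field_simps)
  qed simp
  finally show ?thesis by (simp add: sum_divide_distrib[symmetric] mult.commute)
qed

lemma hits_lev_less:
  assumes X: "steps X" "lev (X 0) \<le> s" and h: "hits s n X"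
  shows "lev (X n) < s + 1"
proof (cases n)
  case 0
  then show ?thesis using X by simp
next
  case (Suc m)
  then have "lev (X m) < s" using h by (simp add: hits_def)
  then show ?thesis using steps_lev[OF X(1), of m] by (auto simp: Suc)
qed

lemma steps_lev_add: "steps X \<Longrightarrow> lev (X (n + j)) \<le> lev (X n) + real j"
proof (induction j)
  case (Suc j)
  then show ?case using steps_lev[of X "n + j"] by simp
qed simp

lemma sets_hits: "{X. hits s n X} \<in> sets path_space"
  by (rule sets_prefix[OF prefix_det_hits])

lemma prefix_det_indicator:
  fixes p :: "(nat \<Rightarrow> int^'d) \<Rightarrow> bool"
  assumes "prefix_det n p"
  shows "prefix_det n (indicator {X. p X} :: _ \<Rightarrow> ennreal)"
  unfolding prefix_det_def
proof (intro allI impI)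
  fix X Y :: "nat \<Rightarrow> int^'d" assume "\<forall>i\<le>n. X i = Y i"
  then have "p X = p Y" using assms unfolding prefix_det_def by blast
  then show "indicator {X. p X} X = (indicator {X. p X} Y :: ennreal)" by (simp add: indicator_def)
qed

lemma hits_unique: "hits s n X \<Longrightarrow> hits s m X \<Longrightarrow> n = m"
  unfolding hits_def by (metis linorder_neqE_nat not_less)

lemma hits_total_le:
  assumes \<omega>: "\<omega> \<in> space env_space"
  shows "(\<Sum>n. \<integral>\<^sup>+X. indicator {X. hits s n X} X \<partial>quenched \<omega> x) \<le> 1"
proof -
  interpret q: prob_space "quenched \<omega> x" by (rule prob_space_quenched[OF \<omega>])
  have "(\<Sum>n. \<integral>\<^sup>+X. indicator {X. hits s n X} X \<partial>quenched \<omega> x) = (\<Sum>n. emeasure (quenched \<omega> x) {X. hits s n X})"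
    using sets_hits by (simp add: sets_quenched[OF \<omega>])
  also have "\<dots> = emeasure (quenched \<omega> x) (\<Union>n. {X. hits s n X})"
  proof (rule suminf_emeasure)
    show "disjoint_family (\<lambda>n. {X. hits s n X})"
      unfolding disjoint_family_on_def using hits_unique by blast
  qed (use sets_hits in \<open>auto simp: sets_quenched[OF \<omega>]\<close>)
  also have "\<dots> \<le> 1" by (rule q.emeasure_le_1)
  finally show ?thesis .
qed

text \<open>At cost \<kappa>^-j the displaced position is replaced by the position j steps later.
  Those positions are visited below level A and no time is counted for two levels, so the sum is at
  most the total energy of the walk, whatever the number I of levels.\<close>

lemma insensitivity_energy:
  assumes \<omega>: "ellip \<omega>" and G: "\<And>X. 0 \<le> G X" "\<And>X. G X \<le> 1"
    "G \<in> borel_measurable path_space" "future A G"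
    and es: "set es \<subseteq> forward_steps l" and j: "j < length es"
    and a: "lev x \<le> a" "a + real I + real (length es) \<le> A"
  shows "(\<Sum>i<I. \<Sum>n. \<integral>\<^sup>+X. indicator {X. hits (a + real i) n X} X *
      ennreal (local_energy \<omega> G (X n + sum_list (take j es))) \<partial>quenched \<omega> x) \<le> ennreal (1 / \<kappa> ^ j)"
proof -
  have \<omega>s: "\<omega> \<in> space env_space" using \<omega> by (simp add: ellip_def)
  let ?q = "quenched \<omega> x"
  let ?H = "\<lambda>i n. indicator {X. hits (a + real i) n X} :: (nat \<Rightarrow> int^'d) \<Rightarrow> ennreal"
  let ?al = "\<lambda>n. indicator {X. \<forall>m\<le>n. lev (X m) < A} :: (nat \<Rightarrow> int^'d) \<Rightarrow> ennreal"
  let ?g = "\<lambda>y. ennreal (local_energy \<omega> G y)"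
  have H: "prefix_det n (?H i n)" for i n by (rule prefix_det_indicator[OF prefix_det_hits])
  have pm: "V \<in> borel_measurable ?q" if "prefix_det n V" for n and V :: "(nat \<Rightarrow> int^'d) \<Rightarrow> ennreal"
    using prefix_det_borel_measurable[OF that] by (simp add: measurable_quenched_cong[OF \<omega>s])
  have len: "length (take j es) = j" using j by simp
  have tk: "set (take j es) \<subseteq> forward_steps l" using es set_take_subset[of j es] by blast
  have fp: "ennreal (\<kappa> ^ j) * (\<integral>\<^sup>+X. ?H i n X * ?g (X n + sum_list (take j es)) \<partial>?q) \<le>
    (\<integral>\<^sup>+X. ?H i n X * ?g (X (n + j)) \<partial>?q)" for i n
  proof -
    have H': "prefix_det n (?H i n)" by (rule H)
    show ?thesis using nn_integral_forward_path[OF \<omega> H' tk, where g="?g" and x=x] unfolding len .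
  qed
  have m: "(\<lambda>X. ?H i n X * ?g (X (n + j))) \<in> borel_measurable ?q" for i n
    by (rule pm[OF prefix_det_times[OF prefix_det_mono[OF H le_add1[of n j]] order_refl]])
  have "ennreal (\<kappa> ^ j) * (\<Sum>i<I. \<Sum>n. \<integral>\<^sup>+X. ?H i n X * ?g (X n + sum_list (take j es)) \<partial>?q) =
    (\<Sum>i<I. \<Sum>n. ennreal (\<kappa> ^ j) * (\<integral>\<^sup>+X. ?H i n X * ?g (X n + sum_list (take j es)) \<partial>?q))"
    by (simp add: sum_distrib_left)
  also have "\<dots> \<le> (\<Sum>i<I. \<Sum>n. \<integral>\<^sup>+X. ?H i n X * ?g (X (n + j)) \<partial>?q)"
    by (intro sum_mono suminf_le fp) auto
  also have "\<dots> = (\<Sum>n. \<Sum>i<I. \<integral>\<^sup>+X. ?H i n X * ?g (X (n + j)) \<partial>?q)"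
    by (rule suminf_sum[symmetric]) simp
  also have "\<dots> \<le> (\<Sum>n. \<integral>\<^sup>+X. ?al (n + j) X * ?g (X (n + j)) \<partial>?q)"
  proof (intro suminf_le)
    fix n
    have "(\<Sum>i<I. \<integral>\<^sup>+X. ?H i n X * ?g (X (n + j)) \<partial>?q) = (\<integral>\<^sup>+X. (\<Sum>i<I. ?H i n X * ?g (X (n + j))) \<partial>?q)"
      by (rule nn_integral_sum[symmetric]) (rule m)
    also have "\<dots> \<le> (\<integral>\<^sup>+X. ?al (n + j) X * ?g (X (n + j)) \<partial>?q)"
    proof (rule nn_integral_mono_AE, use AE_steps[OF \<omega>s, of x] in eventually_elim)
      case (elim X)
      define S where "S = {i \<in> {..<I}. hits (a + real i) n X}"
      \<comment> \<open>A step changes the level by at most 1, so a level is overshot by less than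
        1, and at a given time at most one of the levels a + i is hit for the first time.\<close>
      have one: "i = i'" if "i \<in> S" "i' \<in> S" for i i'
      proof -
        have "lev (X n) < a + real i + 1" "a + real i \<le> lev (X n)"
          "lev (X n) < a + real i' + 1" "a + real i' \<le> lev (X n)"
          using that hits_lev_less[of X _ n] elim a(1) by (auto simp: S_def hits_def)
        then show ?thesis by linarith
      qed
      have fS: "finite S" by (simp add: S_def)
      have "(\<Sum>i<I. ?H i n X * ?g (X (n + j))) = (\<Sum>i\<in>S. ?H i n X * ?g (X (n + j)))"
        by (rule sum.mono_neutral_right) (auto simp: S_def)
      also have "\<dots> = (\<Sum>i\<in>S. ?g (X (n + j)))"
        by (rule sum.cong) (auto simp: S_def)
      also have "\<dots> \<le> ?al (n + j) X * ?g (X (n + j))"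
      proof (cases "S = {}")
        case False
        then obtain i where i: "i \<in> S" by auto
        then have Si: "S = {i}" using one by auto
        have hi: "hits (a + real i) n X" "i < I" using i by (auto simp: S_def)
        have "lev (X m) < A" if "m \<le> n + j" for m
        proof (cases "m < n")
          case True
          then show ?thesis using hi a(2) by (force simp: hits_def)
        next
          case False
          then obtain m' where m': "m = n + m'" using le_Suc_ex not_less by metis
          have "lev (X n) < a + real i + 1" using hits_lev_less[OF _ _ hi(1)] elim a(1) by auto
          moreover have "real m' \<le> real j" "real j + 1 \<le> real (length es)" "real i + 1 \<le> real I"
            using that m' j hi(2) by auto
          ultimately show ?thesis
            using steps_lev_add[of X n m'] elim a(2) unfolding m' by linarith
        qed
        then show ?thesis by (simp add: Si)
      qed simp
      finally show ?case .
    qed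
    finally show "(\<Sum>i<I. \<integral>\<^sup>+X. ?H i n X * ?g (X (n + j)) \<partial>?q) \<le> (\<integral>\<^sup>+X. ?al (n + j) X * ?g (X (n + j)) \<partial>?q)" .
  qed auto
  also have "\<dots> \<le> (\<Sum>n. \<integral>\<^sup>+X. ?al n X * ?g (X n) \<partial>?q)"
  proof (rule suminf_le_const)
    fix N
    have "(\<Sum>n<N. \<integral>\<^sup>+X. ?al (n + j) X * ?g (X (n + j)) \<partial>?q) = (\<Sum>n\<in>(\<lambda>n. n + j) ` {..<N}. \<integral>\<^sup>+X. ?al n X * ?g (X n) \<partial>?q)"
      by (subst sum.reindex) (auto simp: inj_on_def)
    also have "\<dots> \<le> (\<Sum>n. \<integral>\<^sup>+X. ?al n X * ?g (X n) \<partial>?q)" by (rule sum_le_suminf) auto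
    finally show "(\<Sum>n<N. \<integral>\<^sup>+X. ?al (n + j) X * ?g (X (n + j)) \<partial>?q) \<le> (\<Sum>n. \<integral>\<^sup>+X. ?al n X * ?g (X n) \<partial>?q)" .
  qed auto
  also have "\<dots> \<le> 1" by (rule energy_bound[OF \<omega>s G])
  finally have main: "ennreal (\<kappa> ^ j) * (\<Sum>i<I. \<Sum>n. \<integral>\<^sup>+X. ?H i n X * ?g (X n + sum_list (take j es)) \<partial>?q) \<le> 1" (is "_ * ?T \<le> 1") .
  have "?T = ennreal (1 / \<kappa> ^ j) * (ennreal (\<kappa> ^ j) * ?T)"
    using \<kappa> by (simp add: mult.assoc[symmetric] ennreal_mult[symmetric])
  also have "\<dots> \<le> ennreal (1 / \<kappa> ^ j) * 1" by (intro mult_left_mono main) simp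
  finally show ?thesis by simp
qed

text \<open>One factor n comes from Cauchy-Schwarz along the path, the other from adding n energies.
  The power of \<kappa> combines the 1/\<kappa> of \<open>forward_difference_bound\<close> with the
  cost, at most \<kappa>^-(n-1), of walking to the points of the path.\<close>

definition insens :: "nat \<Rightarrow> real" where
  "insens n = (real n)\<^sup>2 / \<kappa> ^ n"

text \<open>The right-hand side does not depend on I: the total energy is a fixed budget, so the
  average effect per level decreases as more levels share it.\<close>

lemma insensitivity_square:
  assumes \<omega>: "ellip \<omega>" and G: "\<And>X. 0 \<le> G X" "\<And>X. G X \<le> 1"
    "G \<in> borel_measurable path_space" "future A G"
    and es: "set es \<subseteq> forward_steps l"
    and a: "lev x \<le> a" "a + real I + real (length es) \<le> A"
  shows "(\<Sum>i<I. \<Sum>n. \<integral>\<^sup>+X. indicator {X. hits (a + real i) n X} X *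
      ennreal ((future_mean \<omega> G (X n + sum_list es) - future_mean \<omega> G (X n))\<^sup>2) \<partial>quenched \<omega> x) \<le> ennreal (insens (length es))"
proof -
  have \<omega>s: "\<omega> \<in> space env_space" using \<omega> by (simp add: ellip_def)
  let ?q = "quenched \<omega> x" and ?R = "length es"
  let ?H = "\<lambda>i n. indicator {X. hits (a + real i) n X} :: (nat \<Rightarrow> int^'d) \<Rightarrow> ennreal"
  let ?g = "\<lambda>j y. ennreal (local_energy \<omega> G (y + sum_list (take j es)))"
  have H: "prefix_det n (?H i n)" for i n by (rule prefix_det_indicator[OF prefix_det_hits])
  have m: "(\<lambda>X. ?H i n X * ?g j (X n)) \<in> borel_measurable ?q" for i n j
    using prefix_det_borel_measurable[OF prefix_det_times[OF H order_refl, where g="?g j"]]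
    by (simp add: measurable_quenched_cong[OF \<omega>s])
  have pw: "ennreal ((future_mean \<omega> G (z + sum_list es) - future_mean \<omega> G z)\<^sup>2) \<le> ennreal (real ?R / \<kappa>) * (\<Sum>j<?R. ?g j z)" for z
  proof -
    have "ennreal ((future_mean \<omega> G (z + sum_list es) - future_mean \<omega> G z)\<^sup>2) \<le>
      ennreal ((real ?R / \<kappa>) * (\<Sum>j<?R. local_energy \<omega> G (z + sum_list (take j es))))"
      by (intro ennreal_leI forward_difference_bound[OF \<omega> es])
    also have "\<dots> = ennreal (real ?R / \<kappa>) * ennreal (\<Sum>j<?R. local_energy \<omega> G (z + sum_list (take j es)))"
      using \<kappa> by (intro ennreal_mult sum_nonneg local_energy_nonneg[OF \<omega>s]) simp
    also have "\<dots> = ennreal (real ?R / \<kappa>) * (\<Sum>j<?R. ?g j z)"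
      by (simp add: local_energy_nonneg[OF \<omega>s])
    finally show ?thesis .
  qed
  have "(\<Sum>i<I. \<Sum>n. \<integral>\<^sup>+X. ?H i n X * ennreal ((future_mean \<omega> G (X n + sum_list es) - future_mean \<omega> G (X n))\<^sup>2) \<partial>?q) \<le>
    (\<Sum>i<I. \<Sum>n. \<integral>\<^sup>+X. ennreal (real ?R / \<kappa>) * (\<Sum>j<?R. ?H i n X * ?g j (X n)) \<partial>?q)"
  proof (intro sum_mono suminf_le nn_integral_mono)
    fix i n X
    show "?H i n X * ennreal ((future_mean \<omega> G (X n + sum_list es) - future_mean \<omega> G (X n))\<^sup>2) \<le>
      ennreal (real ?R / \<kappa>) * (\<Sum>j<?R. ?H i n X * ?g j (X n))"
      using mult_left_mono[OF pw, of "?H i n X" "X n"]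
      by (simp add: sum_distrib_left[symmetric] mult.left_commute)
  qed auto
  also have "\<dots> = (\<Sum>i<I. \<Sum>n. ennreal (real ?R / \<kappa>) * (\<Sum>j<?R. \<integral>\<^sup>+X. ?H i n X * ?g j (X n) \<partial>?q))"
  proof -
    have "(\<integral>\<^sup>+X. ennreal (real ?R / \<kappa>) * (\<Sum>j<?R. ?H i n X * ?g j (X n)) \<partial>?q) =
      ennreal (real ?R / \<kappa>) * (\<integral>\<^sup>+X. (\<Sum>j<?R. ?H i n X * ?g j (X n)) \<partial>?q)" for i n
      by (rule nn_integral_cmult) (rule borel_measurable_sum, rule m)
    moreover have "(\<integral>\<^sup>+X. (\<Sum>j<?R. ?H i n X * ?g j (X n)) \<partial>?q) =
      (\<Sum>j<?R. \<integral>\<^sup>+X. ?H i n X * ?g j (X n) \<partial>?q)" for i n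
      by (rule nn_integral_sum) (rule m)
    ultimately show ?thesis by presburger
  qed
  also have "\<dots> = ennreal (real ?R / \<kappa>) * (\<Sum>i<I. \<Sum>n. \<Sum>j<?R. \<integral>\<^sup>+X. ?H i n X * ?g j (X n) \<partial>?q)"
    unfolding ennreal_suminf_cmult by (rule sum_distrib_left[symmetric])
  also have "(\<Sum>i<I. \<Sum>n. \<Sum>j<?R. \<integral>\<^sup>+X. ?H i n X * ?g j (X n) \<partial>?q) =
      (\<Sum>j<?R. \<Sum>i<I. \<Sum>n. \<integral>\<^sup>+X. ?H i n X * ?g j (X n) \<partial>?q)"
  proof -
    have "(\<Sum>n. \<Sum>j<?R. \<integral>\<^sup>+X. ?H i n X * ?g j (X n) \<partial>?q) = (\<Sum>j<?R. \<Sum>n. \<integral>\<^sup>+X. ?H i n X * ?g j (X n) \<partial>?q)" for i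
      by (rule suminf_sum) simp
    then show ?thesis by (simp only:) (rule sum.swap)
  qed
  also have "ennreal (real ?R / \<kappa>) * \<dots> \<le> ennreal (real ?R / \<kappa>) * (\<Sum>j<?R. ennreal (1 / \<kappa> ^ j))"
    by (intro mult_left_mono sum_mono insensitivity_energy[OF \<omega> G es _ a]) auto
  also have "\<dots> \<le> ennreal (real ?R / \<kappa>) * (\<Sum>j<?R. ennreal (1 / \<kappa> ^ (?R - 1)))"
    using \<kappa> by (intro mult_left_mono sum_mono ennreal_leI divide_left_mono power_decreasing) auto
  also have "\<dots> = ennreal (real ?R / \<kappa> * (real ?R * (1 / \<kappa> ^ (?R - 1))))"
  proof -
    have "(\<Sum>j<?R. ennreal (1 / \<kappa> ^ (?R - 1))) = ennreal (real ?R * (1 / \<kappa> ^ (?R - 1)))"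
      using \<kappa> by (subst sum_ennreal) auto
    then show ?thesis using \<kappa> by (simp only:) (rule ennreal_mult[symmetric], auto)
  qed
  also have "real ?R / \<kappa> * (real ?R * (1 / \<kappa> ^ (?R - 1))) = insens ?R"
    using \<kappa> by (cases ?R) (auto simp: insens_def power2_eq_square field_simps)
  finally show ?thesis .
qed

lemma insensitivity_abs:
  assumes \<omega>: "ellip \<omega>" and G: "\<And>X. 0 \<le> G X" "\<And>X. G X \<le> 1"
    "G \<in> borel_measurable path_space" "future A G"
    and es: "set es \<subseteq> forward_steps l" "es \<noteq> []" and I: "I > 0"
    and a: "lev x \<le> a" "a + real I + real (length es) \<le> A"
  shows "(\<Sum>i<I. \<Sum>n. \<integral>\<^sup>+X. indicator {X. hits (a + real i) n X} X *
      ennreal \<bar>future_mean \<omega> G (X n + sum_list es) - future_mean \<omega> G (X n)\<bar> \<partial>quenched \<omega> x)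
      \<le> ennreal (real I * sqrt (insens (length es) / real I))"
proof -
  have \<omega>s: "\<omega> \<in> space env_space" using \<omega> by (simp add: ellip_def)
  let ?q = "quenched \<omega> x" and ?K = "insens (length es)"
  let ?H = "\<lambda>i n. indicator {X. hits (a + real i) n X} :: (nat \<Rightarrow> int^'d) \<Rightarrow> ennreal"
  let ?D = "\<lambda>y. future_mean \<omega> G (y + sum_list es) - future_mean \<omega> G y"
  have H: "prefix_det n (?H i n)" for i n by (rule prefix_det_indicator[OF prefix_det_hits])
  have m: "(\<lambda>X. ?H i n X * g (X n)) \<in> borel_measurable ?q" "?H i n \<in> borel_measurable ?q"
    for i n and g :: "int^'d \<Rightarrow> ennreal"
    using prefix_det_borel_measurable[OF prefix_det_times[OF H order_refl, where g=g]]
      prefix_det_borel_measurable[OF H]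
    by (simp_all add: measurable_quenched_cong[OF \<omega>s])
  \<comment> \<open>This t balances the two terms of |u| \<le> t/2 + u^2/(2 t) after summation over
    the I levels.\<close>
  define t where "t = sqrt (?K / real I)"
  have Kpos: "?K > 0" using es \<kappa> by (simp add: insens_def)
  have t: "t > 0" "t\<^sup>2 = ?K / real I" using Kpos I by (simp_all add: t_def)
  have pw: "ennreal \<bar>u\<bar> \<le> ennreal (t / 2) + ennreal (1 / (2 * t)) * ennreal (u\<^sup>2)" for u :: real
  proof -
    have "0 \<le> (\<bar>u\<bar> - t)\<^sup>2" by simp
    then have "2 * t * \<bar>u\<bar> \<le> t\<^sup>2 + u\<^sup>2" by (simp add: power2_eq_square algebra_simps)
    then have "\<bar>u\<bar> \<le> t / 2 + 1 / (2 * t) * u\<^sup>2" using t(1) by (simp add: field_simps power2_eq_square)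
    then have "ennreal \<bar>u\<bar> \<le> ennreal (t / 2 + 1 / (2 * t) * u\<^sup>2)" by (rule ennreal_leI)
    also have "\<dots> = ennreal (t / 2) + ennreal (1 / (2 * t) * u\<^sup>2)"
      using t by (intro ennreal_plus) auto
    also have "ennreal (1 / (2 * t) * u\<^sup>2) = ennreal (1 / (2 * t)) * ennreal (u\<^sup>2)"
      using t by (intro ennreal_mult) auto
    finally show ?thesis .
  qed
  have "(\<Sum>i<I. \<Sum>n. \<integral>\<^sup>+X. ?H i n X * ennreal \<bar>?D (X n)\<bar> \<partial>?q) \<le>
    (\<Sum>i<I. \<Sum>n. \<integral>\<^sup>+X. ennreal (t / 2) * ?H i n X + ennreal (1 / (2 * t)) * (?H i n X * ennreal ((?D (X n))\<^sup>2)) \<partial>?q)"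
  proof (intro sum_mono suminf_le nn_integral_mono)
    fix i n X
    show "?H i n X * ennreal \<bar>?D (X n)\<bar> \<le>
      ennreal (t / 2) * ?H i n X + ennreal (1 / (2 * t)) * (?H i n X * ennreal ((?D (X n))\<^sup>2))"
      using mult_left_mono[OF pw[of "?D (X n)"], of "?H i n X"]
      by (simp add: distrib_left mult_ac)
  qed auto
  also have "\<dots> = (\<Sum>i<I. \<Sum>n. ennreal (t / 2) * (\<integral>\<^sup>+X. ?H i n X \<partial>?q) +
      ennreal (1 / (2 * t)) * (\<integral>\<^sup>+X. ?H i n X * ennreal ((?D (X n))\<^sup>2) \<partial>?q))"
  proof -
    have "(\<integral>\<^sup>+X. ennreal (t / 2) * ?H i n X + ennreal (1 / (2 * t)) * (?H i n X * ennreal ((?D (X n))\<^sup>2)) \<partial>?q) =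
      (\<integral>\<^sup>+X. ennreal (t / 2) * ?H i n X \<partial>?q) +
      (\<integral>\<^sup>+X. ennreal (1 / (2 * t)) * (?H i n X * ennreal ((?D (X n))\<^sup>2)) \<partial>?q)" for i n
      by (rule nn_integral_add) (intro borel_measurable_times_ennreal borel_measurable_const m)+
    moreover have "(\<integral>\<^sup>+X. ennreal (t / 2) * ?H i n X \<partial>?q) = ennreal (t / 2) * (\<integral>\<^sup>+X. ?H i n X \<partial>?q)" for i n
      by (rule nn_integral_cmult) (rule m)
    moreover have "(\<integral>\<^sup>+X. ennreal (1 / (2 * t)) * (?H i n X * ennreal ((?D (X n))\<^sup>2)) \<partial>?q) =
      ennreal (1 / (2 * t)) * (\<integral>\<^sup>+X. ?H i n X * ennreal ((?D (X n))\<^sup>2) \<partial>?q)" for i n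
      by (rule nn_integral_cmult) (rule m)
    ultimately show ?thesis by presburger
  qed
  also have "\<dots> = ennreal (t / 2) * (\<Sum>i<I. \<Sum>n. \<integral>\<^sup>+X. ?H i n X \<partial>?q) +
      ennreal (1 / (2 * t)) * (\<Sum>i<I. \<Sum>n. \<integral>\<^sup>+X. ?H i n X * ennreal ((?D (X n))\<^sup>2) \<partial>?q)"
    by (simp only: suminf_add[OF summableI summableI, symmetric] sum.distrib ennreal_suminf_cmult sum_distrib_left)
  also have "\<dots> \<le> ennreal (t / 2) * (\<Sum>i<I. 1) + ennreal (1 / (2 * t)) * ennreal ?K"
    by (intro add_mono mult_left_mono sum_mono hits_total_le[OF \<omega>s]
        insensitivity_square[OF \<omega> G es(1) a]) auto
  also have "\<dots> = ennreal (t / 2 * real I + 1 / (2 * t) * ?K)"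
  proof -
    have "ennreal (t / 2) * (\<Sum>i<I. 1) = ennreal (t / 2 * real I)"
      using t by (subst ennreal_mult) (auto simp: ennreal_of_nat_eq_real_of_nat)
    moreover have "ennreal (1 / (2 * t)) * ennreal ?K = ennreal (1 / (2 * t) * ?K)"
      using t Kpos by (intro ennreal_mult[symmetric]) auto
    ultimately show ?thesis using t Kpos by (simp only:) (rule ennreal_plus[symmetric], auto)
  qed
  also have "t / 2 * real I + 1 / (2 * t) * ?K = real I * t"
  proof -
    have "?K = t\<^sup>2 * real I" using t I by simp
    then show ?thesis using t by (simp add: power2_eq_square field_simps)
  qed
  finally show ?thesis by (simp add: t_def)
qed


section \<open>Decoupling from the past\<close>

text \<open>The path marginal of the annealed law; \<open>AE_annealedI\<close> transfers almost sure
  statements back.\<close>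

definition path_law :: "int^'d \<Rightarrow> (nat \<Rightarrow> int^'d) measure" where
  "path_law x = \<P> \<bind> (\<lambda>\<omega>. quenched \<omega> x)"

lemma measurable_quenched_P: "(\<lambda>\<omega>. quenched \<omega> x) \<in> \<P> \<rightarrow>\<^sub>M subprob_algebra path_space"
  unfolding mP by (rule measurable_quenched)

lemma sets_path_law: "sets (path_law x) = sets path_space"
proof -
  have "sets (quenched \<omega> x) = sets path_space" if "\<omega> \<in> space \<P>" for \<omega>
    using that by (simp add: sets_quenched spP)
  then show ?thesis unfolding path_law_def by (rule sets_bind[OF _ not_empty])
qed

lemma space_path_law [simp]: "space (path_law x) = UNIV"
  using sets_eq_imp_space_eq[OF sets_path_law] by simp

lemma measurable_path_law: "measurable (path_law x) N = measurable path_space N"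
  by (rule measurable_cong_sets) (simp_all add: sets_path_law)

lemma nn_integral_path_law:
  assumes "F \<in> borel_measurable path_space"
  shows "(\<integral>\<^sup>+X. F X \<partial>path_law x) = (\<integral>\<^sup>+\<omega>. \<integral>\<^sup>+X. F X \<partial>quenched \<omega> x \<partial>\<P>)"
  unfolding path_law_def by (rule nn_integral_bind[OF assms measurable_quenched_P])

lemma emeasure_path_law:
  assumes "E \<in> sets path_space"
  shows "emeasure (path_law x) E = (\<integral>\<^sup>+\<omega>. emeasure (quenched \<omega> x) E \<partial>\<P>)"
  unfolding path_law_def by (rule emeasure_bind[OF not_empty measurable_quenched_P assms])

lemma prob_space_path_law: "prob_space (path_law x)"
proof
  have "(UNIV :: (nat \<Rightarrow> int^'d) set) \<in> sets path_space"
    using sets.top[of "path_space :: (nat \<Rightarrow> int^'d) measure"] by simp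
  then have "emeasure (path_law x) UNIV = (\<integral>\<^sup>+\<omega>. emeasure (quenched \<omega> x) UNIV \<partial>\<P>)"
    by (rule emeasure_path_law)
  also have "\<dots> = (\<integral>\<^sup>+\<omega>. 1 \<partial>\<P>)"
  proof (intro nn_integral_cong)
    fix \<omega> assume "\<omega> \<in> space \<P>"
    then have \<omega>: "\<omega> \<in> space env_space" by (simp add: spP)
    then show "emeasure (quenched \<omega> x) UNIV = 1"
      using prob_space.emeasure_space_1[OF prob_space_quenched[OF \<omega>], of x] by simp
  qed
  finally show "emeasure (path_law x) (space (path_law x)) = 1" by (simp add: emeasure_space_1)
qed

lemma AE_path_lawI:
  assumes "{X. \<not> Q X} \<in> sets path_space" and "AE \<omega> in \<P>. AE X in quenched \<omega> x. Q X"
  shows "AE X in path_law x. Q X"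
proof -
  have "emeasure (path_law x) {X. \<not> Q X} = (\<integral>\<^sup>+\<omega>. emeasure (quenched \<omega> x) {X. \<not> Q X} \<partial>\<P>)"
    by (rule emeasure_path_law[OF assms(1)])
  also have "\<dots> = (\<integral>\<^sup>+\<omega>. 0 \<partial>\<P>)"
  proof (rule nn_integral_cong_AE, use assms(2) AE_ellip in eventually_elim)
    case (elim \<omega>)
    then have "\<omega> \<in> space env_space" by (simp add: ellip_def)
    with elim assms(1) show ?case
      using AE_iff_measurable[of "{X. \<not> Q X}" "quenched \<omega> x" Q] by (simp add: sets_quenched)
  qed
  finally show ?thesis
    using assms(1) AE_iff_measurable[of "{X. \<not> Q X}" "path_law x" Q] by (simp add: sets_path_law)
qed

lemma AE_path_lawD:
  assumes m: "{X. \<not> Q X} \<in> sets path_space" and "AE X in path_law x. Q X"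
  shows "AE \<omega> in \<P>. AE X in quenched \<omega> x. Q X"
proof -
  have "(\<integral>\<^sup>+\<omega>. emeasure (quenched \<omega> x) {X. \<not> Q X} \<partial>\<P>) = 0"
    using assms AE_iff_measurable[of "{X. \<not> Q X}" "path_law x" Q]
    by (simp add: emeasure_path_law[OF m, symmetric] sets_path_law)
  then have "AE \<omega> in \<P>. emeasure (quenched \<omega> x) {X. \<not> Q X} = 0"
    by (subst (asm) nn_integral_0_iff_AE) (simp_all add: mP measurable_emeasure_quenched m)
  then show ?thesis
    using AE_ellip
  proof eventually_elim
    case (elim \<omega>)
    then have "\<omega> \<in> space env_space" by (simp add: ellip_def)
    with elim m show ?case
      using AE_iff_measurable[of "{X. \<not> Q X}" "quenched \<omega> x" Q] by (simp add: sets_quenched)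
  qed
qed

lemma path_law_translate:
  assumes G: "G \<in> borel_measurable path_space"
  shows "(\<integral>\<^sup>+X. G X \<partial>path_law x) = (\<integral>\<^sup>+X. G (\<lambda>m. X m + x) \<partial>path_law 0)"
proof -
  have m: "(\<lambda>X. G (\<lambda>m. X m + x)) \<in> borel_measurable path_space"
    by (rule measurable_compose[OF measurable_walk_translate G])
  have "(\<integral>\<^sup>+X. G X \<partial>path_law x) = (\<integral>\<^sup>+\<omega>. \<integral>\<^sup>+X. G X \<partial>quenched \<omega> (0 + x) \<partial>\<P>)"
    by (simp add: nn_integral_path_law[OF G])
  also have "\<dots> = (\<integral>\<^sup>+\<omega>. \<integral>\<^sup>+X. G (\<lambda>m. X m + x) \<partial>quenched (env_shift x \<omega>) 0 \<partial>\<P>)"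
    by (intro nn_integral_cong nn_integral_quenched_shift G) (simp add: spP)
  also have "\<dots> = (\<integral>\<^sup>+\<omega>. \<integral>\<^sup>+X. G (\<lambda>m. X m + x) \<partial>quenched \<omega> 0 \<partial>\<P>)"
    by (rule stationary_nn_integral[OF law st measurable_quenched_integral[OF m]])
  finally show ?thesis by (simp add: nn_integral_path_law[OF m])
qed

lemma not_good_path_law:
  assumes "L \<ge> L\<^sub>0"
  shows "emeasure (path_law x) {X. \<not> good L X} \<le> ennreal (L powr - M)"
proof -
  obtain y where y: "lev y \<le> lev x - L - 1" using exists_low_site by blast
  have "(\<integral>\<^sup>+\<omega>. 1 * emeasure (quenched \<omega> x) {X. \<not> good L X} \<partial>\<P>) \<le> ennreal (L powr - M) * (\<integral>\<^sup>+\<omega>. 1 \<partial>\<P>)"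
    by (rule not_good_bound[OF y assms]) simp
  then show ?thesis by (simp add: emeasure_path_law[OF sets_not_good] emeasure_space_1)
qed

lemma sets_reach: "{X :: nat \<Rightarrow> int^'d. \<exists>n. s \<le> lev (X n)} \<in> sets path_space"
  by (rule sets_goodI) (auto simp: prefix_det_def)

lemma good_reach:
  assumes "good L X" "s \<le> lev (X 0) + L"
  shows "\<exists>n. s \<le> lev (X n)"
  using assms unfolding good_def by (meson order_trans)

lemma sets_all_reach: "{X. \<not> (\<forall>s. \<exists>n. s \<le> lev (X n))} \<in> sets path_space"
proof -
  have "{X :: nat \<Rightarrow> int^'d. \<not> (\<forall>s. \<exists>n. s \<le> lev (X n))} = (\<Union>s::nat. {X. \<not> (\<exists>n. real s \<le> lev (X n))})"
  proof
    show "{X :: nat \<Rightarrow> int^'d. \<not> (\<forall>s. \<exists>n. s \<le> lev (X n))} \<subseteq> (\<Union>s::nat. {X. \<not> (\<exists>n. real s \<le> lev (X n))})"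
    proof
      fix X :: "nat \<Rightarrow> int^'d" assume "X \<in> {X. \<not> (\<forall>s. \<exists>n. s \<le> lev (X n))}"
      then obtain s where s: "\<And>n. \<not> s \<le> lev (X n)" by auto
      obtain s' :: nat where "s \<le> real s'" using real_arch_simple by blast
      then have "\<not> (\<exists>n. real s' \<le> lev (X n))" using s order_trans by blast
      then show "X \<in> (\<Union>s::nat. {X. \<not> (\<exists>n. real s \<le> lev (X n))})" by auto
    qed
  qed auto
  also have "\<dots> \<in> sets path_space"
  proof (rule sets.countable_UN'')
    fix s :: nat
    have "space path_space - {X. \<exists>n. real s \<le> lev (X n)} \<in> sets path_space"
      by (rule sets.compl_sets[OF sets_reach])
    moreover have "space path_space - {X. \<exists>n. real s \<le> lev (X n)} = {X. \<not> (\<exists>n. real s \<le> lev (X n))}" by auto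
    ultimately show "{X. \<not> (\<exists>n. real s \<le> lev (X n))} \<in> sets path_space" by simp
  qed simp
  finally show ?thesis .
qed

lemma AE_start: "AE X in path_law x. X 0 = x \<and> steps X"
proof (rule AE_path_lawI)
  have "{X. \<not> (X 0 = x \<and> steps X)} = {X :: nat \<Rightarrow> int^'d. \<exists>n. X 0 \<noteq> x \<or> X (Suc n) - X n \<notin> unit_steps}"
    by (auto simp: steps_def)
  also have "\<dots> \<in> sets path_space"
  proof -
    have "{X :: nat \<Rightarrow> int^'d. X 0 \<noteq> x \<or> X (Suc n) - X n \<notin> unit_steps} \<in> sets path_space" for n
      by (rule sets_prefix[of "Suc n"]) (auto simp: prefix_det_def)
    then have "(\<Union>n. {X :: nat \<Rightarrow> int^'d. X 0 \<noteq> x \<or> X (Suc n) - X n \<notin> unit_steps}) \<in> sets path_space"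
      by (intro sets.countable_UN'') auto
    moreover have "(\<Union>n. {X :: nat \<Rightarrow> int^'d. X 0 \<noteq> x \<or> X (Suc n) - X n \<notin> unit_steps}) =
      {X. \<exists>n. X 0 \<noteq> x \<or> X (Suc n) - X n \<notin> unit_steps}" by auto
    ultimately show ?thesis by simp
  qed
  finally show "{X. \<not> (X 0 = x \<and> steps X)} \<in> sets path_space" .
  show "AE \<omega> in \<P>. AE X in quenched \<omega> x. X 0 = x \<and> steps X"
    using AE_ellip
  proof eventually_elim
    case (elim \<omega>)
    then show ?case by (intro AE_steps) (simp add: ellip_def)
  qed
qed

text \<open>A path that never reaches level s fails to be good at all sufficiently large sizes. For
  every N it therefore lies in the union of the failures at sizes j + N, whose probability is at
  most a tail of the convergent series of j^-M.\<close>

lemma AE_reach: "AE X in path_law x. \<forall>s. \<exists>n. s \<le> lev (X n)"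
proof -
  let ?B = "{X. \<not> (\<forall>s. \<exists>n. s \<le> lev (X n))} :: (nat \<Rightarrow> int^'d) set"
  have le: "emeasure (path_law x) ?B \<le> ennreal (\<epsilon>)" if "\<epsilon> > 0" for \<epsilon> :: real
  proof -
    have sum: "summable (\<lambda>j. real (j::nat) powr - M)"
      using M d_ge_1 by (subst summable_real_powr_iff) linarith
    have "(\<lambda>j. real (j::nat) powr - M) \<longlonglongrightarrow> 0" by (rule summable_LIMSEQ_zero[OF sum])
    have ge: "emeasure (path_law x) ?B \<le> ennreal (\<Sum>j. real (j + N) powr - M)" if N: "real N \<ge> L\<^sub>0" for N
    proof -
      have sum': "summable (\<lambda>j. real (j + N) powr - M)" using sum by (rule summable_ignore_initial_segment)
      let ?E = "\<lambda>j. {X. \<not> good (real (j + N)) X} :: (nat \<Rightarrow> int^'d) set"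
      have "AE X in path_law x. X \<in> ?B \<longrightarrow> X \<in> (\<Union>j. ?E j)"
        using AE_start[of x]
      proof eventually_elim
        case (elim X)
        show ?case
        proof
          assume "X \<in> ?B"
          then obtain s where s: "\<nexists>n. s \<le> lev (X n)" by auto
          obtain j where "s - lev (X 0) \<le> real j" using real_arch_simple by blast
          then have "\<not> good (real (j + N)) X" using good_reach[of "real (j + N)" X s] s by auto
          then show "X \<in> (\<Union>j. ?E j)" by auto
        qed
      qed
      then have "emeasure (path_law x) ?B \<le> emeasure (path_law x) (\<Union>j. ?E j)"
        by (rule emeasure_mono_AE) (auto simp: sets_path_law intro!: sets.countable_UN'' sets_not_good)
      also have "\<dots> \<le> (\<Sum>j. emeasure (path_law x) (?E j))"
        by (rule emeasure_subadditive_countably) (auto simp: sets_path_law intro!: sets_not_good)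
      also have "\<dots> \<le> (\<Sum>j. ennreal (real (j + N) powr - M))"
        using N by (intro suminf_le not_good_path_law) auto
      also have "\<dots> = ennreal (\<Sum>j. real (j + N) powr - M)"
        by (rule suminf_ennreal2[OF _ sum']) simp
      finally show ?thesis .
    qed
    have "(\<lambda>N. \<Sum>j. real (j + N) powr - M) \<longlonglongrightarrow> 0"
      by (rule suminf_exist_split2[OF sum])
    then have "\<forall>\<^sub>F N in sequentially. (\<Sum>j. real (j + N) powr - M) < \<epsilon>"
      using \<open>\<epsilon> > 0\<close> by (rule order_tendstoD)
    moreover have "\<forall>\<^sub>F N in sequentially. L\<^sub>0 \<le> real N"
      using filterlim_real_sequentially unfolding filterlim_at_top by blast
    ultimately have "\<forall>\<^sub>F N in sequentially. emeasure (path_law x) ?B \<le> ennreal \<epsilon>"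
    proof eventually_elim
      case (elim N)
      from ge[OF elim(2)] show ?case
        by (rule order_trans) (use elim(1) in \<open>auto intro: ennreal_leI\<close>)
    qed
    then show ?thesis by (auto simp: eventually_sequentially)
  qed
  have "emeasure (path_law x) ?B = 0"
  proof -
    have "emeasure (path_law x) ?B \<le> 0"
      by (rule ennreal_le_epsilon) (use le in simp)
    then show ?thesis by simp
  qed
  then show ?thesis
    using AE_iff_measurable[of ?B "path_law x"] sets_all_reach by (simp add: sets_path_law)
qed

lemma hits_ex:
  assumes "s \<le> lev (X n)"
  shows "\<exists>m\<le>n. hits s m X"
proof -
  define m where "m = (LEAST m. s \<le> lev (X m))"
  have "s \<le> lev (X m)" "m \<le> n" unfolding m_def by (rule LeastI[of _ n], rule assms) (rule Least_le, rule assms)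
  moreover have "lev (X j) < s" if "j < m" for j
    using not_less_Least[of j "\<lambda>m. s \<le> lev (X m)"] that by (simp add: m_def)
  ultimately show ?thesis by (auto simp: hits_def)
qed

section \<open>Summation over hitting times and hitting places\<close>

lemma sum_hits:
  fixes u :: ennreal
  assumes "\<exists>n. s \<le> lev (X n)"
  shows "(\<Sum>n. u * indicator {X. hits s n X} X) = u"
proof -
  obtain m where m: "hits s m X" using assms hits_ex by blast
  have "(\<Sum>n. u * indicator {X. hits s n X} X) = (\<Sum>n\<in>{m}. u * indicator {X. hits s n X} X)"
    using hits_unique[OF m] by (intro suminf_finite) (auto simp: indicator_def)
  then show ?thesis using m by simp
qed

lemma nn_integral_count_single:
  fixes u :: "'a \<Rightarrow> ennreal"
  shows "(\<integral>\<^sup>+z. u z * indicator {z} y \<partial>count_space UNIV) = u y"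
proof -
  have "(\<integral>\<^sup>+z. u z * indicator {z} y \<partial>count_space UNIV) = (\<Sum>z\<in>{y}. u z * indicator {z} y)"
    by (rule nn_integral_count_space') auto
  then show ?thesis by simp
qed

text \<open>The weight of the paths that first reach level \<open>s\<close> at \<open>z\<close> depends only on the environment in
  \<open>half_space l z\<close>, so that it can play the role of \<open>f\<close>.\<close>

lemma decoupling:
  assumes U: "adapted s U" and s: "0 \<le> s"
    and B: "\<And>z f. s \<le> lev z \<Longrightarrow> lev z < s + 1 \<Longrightarrow> f \<in> borel_measurable (env_sigma (half_space l z)) \<Longrightarrow>
      (\<integral>\<^sup>+\<omega>. f \<omega> * H \<omega> z \<partial>\<P>) \<le> B * (\<integral>\<^sup>+\<omega>. f \<omega> \<partial>\<P>)"
    and H: "\<And>z. (\<lambda>\<omega>. H \<omega> z) \<in> borel_measurable env_space"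
  shows "(\<integral>\<^sup>+\<omega>. \<integral>\<^sup>+X. U X * indicator {X. hits s n X} X * H \<omega> (X n) \<partial>quenched \<omega> 0 \<partial>\<P>) \<le>
    B * (\<integral>\<^sup>+\<omega>. \<integral>\<^sup>+X. U X * indicator {X. hits s n X} X \<partial>quenched \<omega> 0 \<partial>\<P>)"
proof -
  let ?V = "\<lambda>X. U X * indicator {X. hits s n X} X :: ennreal"
  have V: "prefix_det n ?V" by (rule adapted_prefix_det[OF U])
  have Vz: "prefix_det n (\<lambda>X. ?V X * indicator {z} (X n))" for z
    by (rule prefix_det_times[OF V order_refl])
  define f where "f z \<omega> = (\<integral>\<^sup>+X. ?V X * indicator {z} (X n) \<partial>quenched \<omega> 0)" for z \<omega>
  have fm: "f z \<in> borel_measurable env_space" for z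
    unfolding f_def by (rule measurable_quenched_integral[OF prefix_det_borel_measurable[OF Vz]])
  have fm': "f z \<in> borel_measurable \<P>" and Hm: "(\<lambda>\<omega>. H \<omega> z) \<in> borel_measurable \<P>" for z
    unfolding mP by (rule fm, rule H)
  have inner: "(\<integral>\<^sup>+X. ?V X * g (X n) \<partial>quenched \<omega> 0) = (\<integral>\<^sup>+z. f z \<omega> * g z \<partial>count_space UNIV)"
    if \<omega>: "\<omega> \<in> space env_space" for \<omega> and g :: "int^'d \<Rightarrow> ennreal"
  proof -
    have "(\<integral>\<^sup>+X. ?V X * g (X n) \<partial>quenched \<omega> 0) =
      (\<integral>\<^sup>+X. \<integral>\<^sup>+z. ?V X * indicator {z} (X n) * g z \<partial>count_space UNIV \<partial>quenched \<omega> 0)"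
    proof (intro nn_integral_cong)
      fix X :: "nat \<Rightarrow> int^'d"
      show "?V X * g (X n) = (\<integral>\<^sup>+z. ?V X * indicator {z} (X n) * g z \<partial>count_space UNIV)"
        using nn_integral_count_single[of "\<lambda>z. ?V X * g z" "X n"] by (simp add: mult_ac)
    qed
    also have "\<dots> = (\<integral>\<^sup>+z. \<integral>\<^sup>+X. ?V X * indicator {z} (X n) * g z \<partial>quenched \<omega> 0 \<partial>count_space UNIV)"
    proof (rule nn_integral_count_space_nn_integral)
      show "(\<lambda>X. ?V X * indicator {z} (X n) * g z) \<in> borel_measurable (quenched \<omega> 0)" for z
        using prefix_det_borel_measurable[OF Vz[of z]] by (simp add: measurable_quenched_cong[OF \<omega>])
    qed simp
    also have "\<dots> = (\<integral>\<^sup>+z. f z \<omega> * g z \<partial>count_space UNIV)"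
      unfolding f_def using prefix_det_borel_measurable[OF Vz]
      by (intro nn_integral_cong nn_integral_multc) (simp add: measurable_quenched_cong[OF \<omega>])
    finally show ?thesis .
  qed
  \<comment> \<open>For z in the overshoot window all earlier positions have level below s, hence
    lie in the half-space under z, and \<open>B\<close> applies with weight \<open>f z\<close>.
    Sites outside the window are hit with probability 0.\<close>
  have each: "(\<integral>\<^sup>+\<omega>. f z \<omega> * H \<omega> z \<partial>\<P>) \<le> B * (\<integral>\<^sup>+\<omega>. f z \<omega> \<partial>\<P>)" for z
  proof (cases "s \<le> lev z \<and> lev z < s + 1")
    case True
    have "f z \<in> borel_measurable (env_sigma (half_space l z))"
      unfolding f_def
    proof (rule measurable_quenched_prefix[OF Vz])
      fix X :: "nat \<Rightarrow> int^'d" and i assume "i < n" and out: "X i \<notin> half_space l z"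
      show "?V X * indicator {z} (X n) = 0"
      proof (rule ccontr)
        assume "\<not> ?thesis"
        then have "hits s n X" by (auto simp: indicator_def split: if_splits)
        then have "lev (X i) < s" using \<open>i < n\<close> by (simp add: hits_def)
        with out True show False by (simp add: half_space_def lev_def)
      qed
    qed
    with True show ?thesis using B by blast
  next
    case False
    have "f z \<omega> = 0" if \<omega>: "\<omega> \<in> space env_space" for \<omega>
    proof -
      have "f z \<omega> = (\<integral>\<^sup>+X. 0 \<partial>quenched \<omega> 0)"
        unfolding f_def
      proof (rule nn_integral_cong_AE, use AE_steps[OF \<omega>, of 0] in eventually_elim)
        case (elim X)
        show ?case
        proof (rule ccontr)
          assume "\<not> ?case"
          then have h: "hits s n X" "X n = z" by (auto simp: indicator_def split: if_splits)
          then have "lev z < s + 1" "s \<le> lev z"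
            using hits_lev_less[of X s n] elim s by (auto simp: hits_def)
          with False show False by simp
        qed
      qed
      then show ?thesis by simp
    qed
    then have "(\<integral>\<^sup>+\<omega>. f z \<omega> * H \<omega> z \<partial>\<P>) = (\<integral>\<^sup>+\<omega>. 0 \<partial>\<P>)"
      by (intro nn_integral_cong) (simp add: spP)
    then show ?thesis by simp
  qed
  have "(\<integral>\<^sup>+\<omega>. \<integral>\<^sup>+X. ?V X * H \<omega> (X n) \<partial>quenched \<omega> 0 \<partial>\<P>) =
    (\<integral>\<^sup>+\<omega>. \<integral>\<^sup>+z. f z \<omega> * H \<omega> z \<partial>count_space UNIV \<partial>\<P>)"
    by (intro nn_integral_cong inner) (simp add: spP)
  also have "\<dots> = (\<integral>\<^sup>+z. \<integral>\<^sup>+\<omega>. f z \<omega> * H \<omega> z \<partial>\<P> \<partial>count_space UNIV)"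
    by (rule nn_integral_count_space_nn_integral) (auto intro: borel_measurable_times_ennreal fm' Hm)
  also have "\<dots> \<le> (\<integral>\<^sup>+z. B * (\<integral>\<^sup>+\<omega>. f z \<omega> \<partial>\<P>) \<partial>count_space UNIV)"
    by (intro nn_integral_mono each)
  also have "\<dots> = B * (\<integral>\<^sup>+z. \<integral>\<^sup>+\<omega>. f z \<omega> \<partial>\<P> \<partial>count_space UNIV)"
    by (rule nn_integral_cmult) simp
  also have "(\<integral>\<^sup>+z. \<integral>\<^sup>+\<omega>. f z \<omega> \<partial>\<P> \<partial>count_space UNIV) = (\<integral>\<^sup>+\<omega>. \<integral>\<^sup>+z. f z \<omega> \<partial>count_space UNIV \<partial>\<P>)"
    by (rule nn_integral_count_space_nn_integral[symmetric]) (auto intro: fm')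
  also have "\<dots> = (\<integral>\<^sup>+\<omega>. \<integral>\<^sup>+X. ?V X \<partial>quenched \<omega> 0 \<partial>\<P>)"
  proof (rule nn_integral_cong)
    fix \<omega> assume "\<omega> \<in> space \<P>"
    then have "\<omega> \<in> space env_space" by (simp add: spP)
    from inner[OF this, of "\<lambda>_. 1"]
    show "(\<integral>\<^sup>+z. f z \<omega> \<partial>count_space UNIV) = (\<integral>\<^sup>+X. ?V X \<partial>quenched \<omega> 0)" by simp
  qed
  finally show ?thesis .
qed


text \<open>Before the hitting time of s \<le> A the walk is below A, so G may be evaluated on the
  shifted path. The Markov property at the fixed time n, restricted to \<open>hits s n\<close>, then
  suffices.\<close>

lemma strong_markov_hits:
  assumes \<omega>: "\<omega> \<in> space env_space" and G: "\<And>X. 0 \<le> G X" "\<And>X. G X \<le> 1"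
    "G \<in> borel_measurable path_space" "future A G"
    and U: "adapted s U" and sA: "s \<le> A"
  shows "(\<integral>\<^sup>+X. U X * indicator {X. hits s n X} X * ennreal (G X) \<partial>quenched \<omega> x) =
    (\<integral>\<^sup>+X. U X * indicator {X. hits s n X} X * ennreal (future_mean \<omega> G (X n)) \<partial>quenched \<omega> x)"
proof -
  have Gm: "(\<lambda>X. ennreal (G X)) \<in> borel_measurable path_space" using G(3) by simp
  have "(\<integral>\<^sup>+X. U X * indicator {X. hits s n X} X * ennreal (G X) \<partial>quenched \<omega> x) =
    (\<integral>\<^sup>+X. U X * indicator {X. hits s n X} X * ennreal (G (walk_shift n X)) \<partial>quenched \<omega> x)"
  proof (intro nn_integral_cong)
    fix X :: "nat \<Rightarrow> int^'d"
    show "U X * indicator {X. hits s n X} X * ennreal (G X) =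
      U X * indicator {X. hits s n X} X * ennreal (G (walk_shift n X))"
    proof (cases "hits s n X")
      case True
      have "G (walk_shift n X) = G X"
      proof (rule future_shift[OF G(4)])
        fix m assume "m < n"
        then have "lev (X m) < s" using True by (simp add: hits_def)
        then show "lev (X m) < A" using sA by simp
      qed
      then show ?thesis by simp
    qed simp
  qed
  also have "\<dots> = (\<integral>\<^sup>+X. U X * indicator {X. hits s n X} X *
      (\<integral>\<^sup>+Y. ennreal (G Y) \<partial>quenched \<omega> (X n)) \<partial>quenched \<omega> x)"
    by (rule nn_integral_markov[OF \<omega> adapted_prefix_det[OF U] Gm])
  finally show ?thesis by (simp add: future_mean(1)[OF \<omega> G(1,2)])
qed

lemma nn_integral_hits_split:
  assumes \<omega>: "\<omega> \<in> space env_space" and reach: "AE X in quenched \<omega> x. \<forall>s. \<exists>n. s \<le> lev (X n)"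
    and U: "adapted s U" and F: "F \<in> borel_measurable path_space"
  shows "(\<integral>\<^sup>+X. U X * F X \<partial>quenched \<omega> x) =
    (\<Sum>n. \<integral>\<^sup>+X. U X * indicator {X. hits s n X} X * F X \<partial>quenched \<omega> x)"
proof -
  have "(\<integral>\<^sup>+X. U X * F X \<partial>quenched \<omega> x) =
    (\<integral>\<^sup>+X. (\<Sum>n. U X * indicator {X. hits s n X} X * F X) \<partial>quenched \<omega> x)"
  proof (rule nn_integral_cong_AE, use reach in eventually_elim)
    case (elim X)
    have "(\<Sum>n. U X * indicator {X. hits s n X} X * F X) = (\<Sum>n. (U X * F X) * indicator {X. hits s n X} X)"
      by (simp only: mult_ac)
    also have "\<dots> = U X * F X" by (rule sum_hits) (use elim in blast)
    finally show ?case ..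
  qed
  also have "\<dots> = (\<Sum>n. \<integral>\<^sup>+X. U X * indicator {X. hits s n X} X * F X \<partial>quenched \<omega> x)"
    by (rule nn_integral_suminf, unfold measurable_quenched_cong[OF \<omega>])
      (rule borel_measurable_times_ennreal[OF prefix_det_borel_measurable[OF adapted_prefix_det[OF U]] F])
  finally show ?thesis .
qed

lemma measurable_quenched_pair:
  fixes V :: "(nat \<Rightarrow> int^'d) \<Rightarrow> ennreal" and H :: "'d env \<Rightarrow> int^'d \<Rightarrow> ennreal"
  assumes V: "prefix_det n V" and H: "\<And>z. (\<lambda>\<omega>. H \<omega> z) \<in> borel_measurable env_space"
  shows "(\<lambda>\<omega>. \<integral>\<^sup>+X. V X * H \<omega> (X n) \<partial>quenched \<omega> x) \<in> borel_measurable env_space"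
proof (rule nn_integral_measurable_subprob_algebra2[OF _ measurable_quenched])
  have 1: "(\<lambda>p. H (fst p) (snd p n)) \<in> borel_measurable (env_space \<Otimes>\<^sub>M (path_space :: (nat \<Rightarrow> int^'d) measure))"
  proof (rule measurable_compose_countable[where f="\<lambda>z p. H (fst p) z" and g="\<lambda>p. snd p n"])
    show "(\<lambda>p. H (fst p) z) \<in> borel_measurable (env_space \<Otimes>\<^sub>M (path_space :: (nat \<Rightarrow> int^'d) measure))" for z
      by (rule measurable_compose[OF measurable_fst H])
    show "(\<lambda>p. snd p n) \<in> env_space \<Otimes>\<^sub>M (path_space :: (nat \<Rightarrow> int^'d) measure) \<rightarrow>\<^sub>M count_space UNIV"
      by (rule measurable_compose[OF measurable_snd measurable_coord])
  qed
  have 2: "(\<lambda>p. V (snd p)) \<in> borel_measurable (env_space \<Otimes>\<^sub>M (path_space :: (nat \<Rightarrow> int^'d) measure))"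
    by (rule measurable_compose[OF measurable_snd prefix_det_borel_measurable[OF V]])
  from borel_measurable_times_ennreal[OF 2 1] show "(\<lambda>(\<omega>, X). V X * H \<omega> (X n)) \<in> borel_measurable (env_space \<Otimes>\<^sub>M path_space)"
    by (simp add: split_beta')
qed

text \<open>Averaged over the levels \<open>a + i\<close>, \<open>i < I\<close>, moving the starting point of \<open>G\<close> ahead along \<open>es\<close> costs
  little; this opens the gap needed to verify the hypothesis on \<open>B\<close> by mixing.\<close>

lemma key_bound:
  assumes G: "\<And>X. 0 \<le> G X" "\<And>X. G X \<le> 1" "G \<in> borel_measurable path_space" "future A G"
    and U: "adapted a U" "U \<in> borel_measurable path_space" "\<And>X. U X \<le> ennreal Um" and Um: "Um \<ge> 0"
    and es: "set es \<subseteq> forward_steps l" "es \<noteq> []" and I: "I > 0"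
    and a: "0 \<le> a" "a + real I + real (length es) \<le> A"
    and B: "\<And>z f. a \<le> lev z \<Longrightarrow> lev z < a + real I \<Longrightarrow> f \<in> borel_measurable (env_sigma (half_space l z)) \<Longrightarrow>
      (\<integral>\<^sup>+\<omega>. f \<omega> * (\<integral>\<^sup>+X. ennreal (G X) \<partial>quenched \<omega> (z + sum_list es)) \<partial>\<P>) \<le> B * (\<integral>\<^sup>+\<omega>. f \<omega> \<partial>\<P>)"
  shows "(\<integral>\<^sup>+X. U X * ennreal (G X) \<partial>path_law 0) \<le>
    B * (\<integral>\<^sup>+X. U X \<partial>path_law 0) + ennreal (Um * sqrt (insens (length es) / real I))"
proof -
  let ?p = "sum_list es" and ?q = "\<lambda>\<omega>. quenched \<omega> 0" and ?S = "sqrt (insens (length es) / real I)"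
  let ?ind = "\<lambda>i n. indicator {X. hits (a + real i) n X} :: (nat \<Rightarrow> int^'d) \<Rightarrow> ennreal"
  let ?V = "\<lambda>i n X. U X * ?ind i n X"
  have Gm: "(\<lambda>X. ennreal (G X)) \<in> borel_measurable path_space" using G(3) by simp
  have Ua: "adapted (a + real i) U" for i by (rule adapted_mono[OF U(1)]) simp
  have V: "prefix_det n (?V i n)" for i n by (rule adapted_prefix_det[OF Ua])
  have ind: "prefix_det n (?ind i n)" for i n by (rule prefix_det_indicator[OF prefix_det_hits])
  define H where "H \<omega> z = (\<integral>\<^sup>+X. ennreal (G X) \<partial>quenched \<omega> (z + ?p))" for \<omega> z
  have Hm: "(\<lambda>\<omega>. H \<omega> z) \<in> borel_measurable env_space" for z
    unfolding H_def by (rule measurable_quenched_integral[OF Gm])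
  define \<Phi> where "\<Phi> i n \<omega> = (\<integral>\<^sup>+X. ?V i n X * H \<omega> (X n) \<partial>?q \<omega>)" for i n \<omega>
  have \<Phi>m: "\<Phi> i n \<in> borel_measurable \<P>" for i n
    unfolding \<Phi>_def mP by (rule measurable_quenched_pair[OF V Hm])
  have reach: "AE \<omega> in \<P>. AE X in ?q \<omega>. \<forall>s. \<exists>n. s \<le> lev (X n)"
    by (rule AE_path_lawD[OF sets_all_reach AE_reach])
  have UGm: "(\<lambda>X. U X * ennreal (G X)) \<in> borel_measurable path_space"
    by (rule borel_measurable_times_ennreal[OF U(2) Gm])
  have UGm': "(\<lambda>\<omega>. \<integral>\<^sup>+X. U X * ennreal (G X) \<partial>?q \<omega>) \<in> borel_measurable \<P>"
    unfolding mP by (rule measurable_quenched_integral[OF UGm])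
  \<comment> \<open>The same integral is written once for each level a + i and evaluated there by
    the strong Markov property; the sum over i of the errors is exactly what
    \<open>insensitivity_abs\<close> bounds.\<close>
  have quenched_bound: "of_nat I * (\<integral>\<^sup>+X. U X * ennreal (G X) \<partial>?q \<omega>) \<le>
      (\<Sum>i<I. \<Sum>n. \<Phi> i n \<omega>) + ennreal (Um * (real I * ?S))"
    if el: "ellip \<omega>" and rc: "AE X in ?q \<omega>. \<forall>s. \<exists>n. s \<le> lev (X n)" for \<omega>
  proof -
    have \<omega>: "\<omega> \<in> space env_space" using el by (simp add: ellip_def)
    let ?D = "\<lambda>y. \<bar>future_mean \<omega> G (y + ?p) - future_mean \<omega> G y\<bar>"
    have m: "(\<lambda>X. W X * g (X n)) \<in> borel_measurable (?q \<omega>)" if "prefix_det n W"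
      for n and g :: "int^'d \<Rightarrow> ennreal" and W :: "(nat \<Rightarrow> int^'d) \<Rightarrow> ennreal"
      using prefix_det_borel_measurable[OF prefix_det_times[OF that order_refl, where g=g]]
      by (simp add: measurable_quenched_cong[OF \<omega>])
    have mV: "(\<lambda>X. ?V i n X * H \<omega> (X n)) \<in> borel_measurable (?q \<omega>)" for i n
      by (rule m[OF V])
    have mD: "(\<lambda>X. ?ind i n X * ennreal (?D (X n))) \<in> borel_measurable (?q \<omega>)" for i n
      by (rule m[OF ind, of i n "\<lambda>y. ennreal (?D y)"])
    have pw: "?V i n X * ennreal (future_mean \<omega> G (X n)) \<le>
        ?V i n X * H \<omega> (X n) + ennreal Um * (?ind i n X * ennreal (?D (X n)))" for i n X
    proof -
      have "ennreal (future_mean \<omega> G (X n)) \<le> ennreal (future_mean \<omega> G (X n + ?p) + ?D (X n))"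
        by (intro ennreal_leI) simp
      also have "\<dots> = ennreal (future_mean \<omega> G (X n + ?p)) + ennreal (?D (X n))"
        by (intro ennreal_plus future_mean(2)[OF \<omega> G(1,2)]) simp
      also have "ennreal (future_mean \<omega> G (X n + ?p)) = H \<omega> (X n)"
        unfolding H_def by (rule future_mean(1)[OF \<omega> G(1,2)])
      finally have "?V i n X * ennreal (future_mean \<omega> G (X n)) \<le> ?V i n X * (H \<omega> (X n) + ennreal (?D (X n)))"
        by (intro mult_left_mono) auto
      also have "\<dots> = ?V i n X * H \<omega> (X n) + U X * (?ind i n X * ennreal (?D (X n)))"
        by (simp add: distrib_left mult.assoc)
      also have "\<dots> \<le> ?V i n X * H \<omega> (X n) + ennreal Um * (?ind i n X * ennreal (?D (X n)))"
        by (intro add_left_mono mult_right_mono U(3)) simp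
      finally show ?thesis .
    qed
    have "of_nat I * (\<integral>\<^sup>+X. U X * ennreal (G X) \<partial>?q \<omega>) = (\<Sum>i<I. \<integral>\<^sup>+X. U X * ennreal (G X) \<partial>?q \<omega>)"
      by simp
    also have "\<dots> = (\<Sum>i<I. \<Sum>n. \<integral>\<^sup>+X. ?V i n X * ennreal (G X) \<partial>?q \<omega>)"
      by (intro sum.cong refl nn_integral_hits_split[OF \<omega> rc Ua Gm])
    also have "\<dots> = (\<Sum>i<I. \<Sum>n. \<integral>\<^sup>+X. ?V i n X * ennreal (future_mean \<omega> G (X n)) \<partial>?q \<omega>)"
    proof (intro sum.cong suminf_cong refl)
      fix i n assume "i \<in> {..<I}"
      then have "a + real i \<le> A" using a by simp
      then show "(\<integral>\<^sup>+X. ?V i n X * ennreal (G X) \<partial>?q \<omega>) = (\<integral>\<^sup>+X. ?V i n X * ennreal (future_mean \<omega> G (X n)) \<partial>?q \<omega>)"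
        by (rule strong_markov_hits[OF \<omega> G Ua])
    qed
    also have "\<dots> \<le> (\<Sum>i<I. \<Sum>n. \<integral>\<^sup>+X. ?V i n X * H \<omega> (X n) + ennreal Um * (?ind i n X * ennreal (?D (X n))) \<partial>?q \<omega>)"
      by (intro sum_mono suminf_le nn_integral_mono pw) auto
    also have "\<dots> = (\<Sum>i<I. \<Sum>n. \<Phi> i n \<omega> + ennreal Um * (\<integral>\<^sup>+X. ?ind i n X * ennreal (?D (X n)) \<partial>?q \<omega>))"
    proof -
      have "(\<integral>\<^sup>+X. ?V i n X * H \<omega> (X n) + ennreal Um * (?ind i n X * ennreal (?D (X n))) \<partial>?q \<omega>) =
        \<Phi> i n \<omega> + (\<integral>\<^sup>+X. ennreal Um * (?ind i n X * ennreal (?D (X n))) \<partial>?q \<omega>)" for i n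
        unfolding \<Phi>_def
        by (rule nn_integral_add[OF mV borel_measurable_times_ennreal[OF borel_measurable_const mD]])
      moreover have "(\<integral>\<^sup>+X. ennreal Um * (?ind i n X * ennreal (?D (X n))) \<partial>?q \<omega>) =
        ennreal Um * (\<integral>\<^sup>+X. ?ind i n X * ennreal (?D (X n)) \<partial>?q \<omega>)" for i n
        by (rule nn_integral_cmult[OF mD])
      ultimately show ?thesis by presburger
    qed
    also have "\<dots> = (\<Sum>i<I. \<Sum>n. \<Phi> i n \<omega>) +
        ennreal Um * (\<Sum>i<I. \<Sum>n. \<integral>\<^sup>+X. ?ind i n X * ennreal (?D (X n)) \<partial>?q \<omega>)"
      by (simp only: suminf_add[OF summableI summableI, symmetric] sum.distrib ennreal_suminf_cmult sum_distrib_left)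
    also have "\<dots> \<le> (\<Sum>i<I. \<Sum>n. \<Phi> i n \<omega>) + ennreal Um * ennreal (real I * ?S)"
      using a by (intro add_left_mono mult_left_mono insensitivity_abs[OF el G es I]) auto
    also have "ennreal Um * ennreal (real I * ?S) = ennreal (Um * (real I * ?S))"
      using Um \<kappa> by (intro ennreal_mult[symmetric]) (auto simp: insens_def)
    finally show ?thesis .
  qed
  \<comment> \<open>In H the walk starts ahead of its hitting position z, at z +
    \<open>sum_list es\<close>, so the gap is available to the hypothesis on B.\<close>
  have dec: "(\<integral>\<^sup>+\<omega>. \<Phi> i n \<omega> \<partial>\<P>) \<le> B * (\<integral>\<^sup>+\<omega>. \<integral>\<^sup>+X. ?V i n X \<partial>?q \<omega> \<partial>\<P>)" if i: "i < I" for i n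
    unfolding \<Phi>_def
  proof (rule decoupling[OF Ua _ _ Hm])
    fix z and f :: "'d env \<Rightarrow> ennreal"
    assume z: "a + real i \<le> lev z" "lev z < a + real i + 1"
      and f: "f \<in> borel_measurable (env_sigma (half_space l z))"
    have "real i + 1 \<le> real I" using i by simp
    then show "(\<integral>\<^sup>+\<omega>. f \<omega> * H \<omega> z \<partial>\<P>) \<le> B * (\<integral>\<^sup>+\<omega>. f \<omega> \<partial>\<P>)"
      unfolding H_def using z by (intro B f) linarith+
  qed (use a in simp)
  have Usplit: "(\<Sum>n. \<integral>\<^sup>+\<omega>. \<integral>\<^sup>+X. ?V i n X \<partial>?q \<omega> \<partial>\<P>) = (\<integral>\<^sup>+X. U X \<partial>path_law 0)" for i
  proof -
    have "(\<Sum>n. \<integral>\<^sup>+\<omega>. \<integral>\<^sup>+X. ?V i n X \<partial>?q \<omega> \<partial>\<P>) = (\<integral>\<^sup>+\<omega>. (\<Sum>n. \<integral>\<^sup>+X. ?V i n X \<partial>?q \<omega>) \<partial>\<P>)"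
      by (rule nn_integral_suminf[symmetric])
        (simp add: mP measurable_quenched_integral[OF prefix_det_borel_measurable[OF V]])
    also have "\<dots> = (\<integral>\<^sup>+\<omega>. \<integral>\<^sup>+X. U X \<partial>?q \<omega> \<partial>\<P>)"
    proof (rule nn_integral_cong_AE, use AE_ellip reach in eventually_elim)
      case (elim \<omega>)
      then have "\<omega> \<in> space env_space" by (simp add: ellip_def)
      from nn_integral_hits_split[OF this elim(2) Ua, where F="\<lambda>_. 1"]
      show ?case by simp
    qed
    finally show ?thesis by (simp add: nn_integral_path_law[OF U(2)])
  qed
  have "of_nat I * (\<integral>\<^sup>+X. U X * ennreal (G X) \<partial>path_law 0) =
    (\<integral>\<^sup>+\<omega>. of_nat I * (\<integral>\<^sup>+X. U X * ennreal (G X) \<partial>?q \<omega>) \<partial>\<P>)"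
    unfolding nn_integral_path_law[OF UGm] by (rule nn_integral_cmult[OF UGm', symmetric])
  also have "\<dots> \<le> (\<integral>\<^sup>+\<omega>. (\<Sum>i<I. \<Sum>n. \<Phi> i n \<omega>) + ennreal (Um * (real I * ?S)) \<partial>\<P>)"
    by (rule nn_integral_mono_AE, use AE_ellip reach in eventually_elim) (rule quenched_bound)
  also have "\<dots> = (\<integral>\<^sup>+\<omega>. (\<Sum>i<I. \<Sum>n. \<Phi> i n \<omega>) \<partial>\<P>) + ennreal (Um * (real I * ?S))"
    using \<Phi>m by (subst nn_integral_add) (auto simp: emeasure_space_1)
  also have "(\<integral>\<^sup>+\<omega>. (\<Sum>i<I. \<Sum>n. \<Phi> i n \<omega>) \<partial>\<P>) = (\<Sum>i<I. \<Sum>n. \<integral>\<^sup>+\<omega>. \<Phi> i n \<omega> \<partial>\<P>)"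
    using \<Phi>m by (simp add: nn_integral_sum nn_integral_suminf)
  also have "\<dots> \<le> (\<Sum>i<I. \<Sum>n. B * (\<integral>\<^sup>+\<omega>. \<integral>\<^sup>+X. ?V i n X \<partial>?q \<omega> \<partial>\<P>))"
    by (intro sum_mono suminf_le dec) auto
  also have "\<dots> = of_nat I * (B * (\<integral>\<^sup>+X. U X \<partial>path_law 0))"
    unfolding ennreal_suminf_cmult Usplit by simp
  also have "ennreal (Um * (real I * ?S)) = of_nat I * ennreal (Um * ?S)"
    using Um \<kappa> by (subst ennreal_of_nat_eq_real_of_nat, subst ennreal_mult[symmetric])
      (auto simp: insens_def mult_ac)
  finally have "of_nat I * (\<integral>\<^sup>+X. U X * ennreal (G X) \<partial>path_law 0) \<le>
    of_nat I * (B * (\<integral>\<^sup>+X. U X \<partial>path_law 0) + ennreal (Um * ?S))"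
    by (simp add: distrib_left add_right_mono)
  then show ?thesis
    using I by (subst (asm) ennreal_mult_le_mult_iff) auto
qed

end

section \<open>Cone mixing for functions\<close>

lemma layer_sum:
  fixes \<gamma> :: real and n :: nat
  assumes "0 \<le> \<gamma>" "\<gamma> \<le> 1" "n > 0"
  shows "(\<Sum>j\<in>{1..n}. 1 / real n * of_bool (real j / real n \<le> \<gamma>)) \<le> \<gamma>"
    and "\<gamma> \<le> 1 / real n + (\<Sum>j\<in>{1..n}. 1 / real n * of_bool (real j / real n \<le> \<gamma>))"
proof -
  define m where "m = nat \<lfloor>real n * \<gamma>\<rfloor>"
  have m: "real m \<le> real n * \<gamma>" "real n * \<gamma> < real m + 1"
    using assms unfolding m_def by (simp_all add: of_nat_nat)
  have "{j \<in> {1..n}. real j / real n \<le> \<gamma>} = {1..m}"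
  proof -
    have "real j / real n \<le> \<gamma> \<longleftrightarrow> j \<le> m" if "j \<ge> 1" for j
    proof -
      have "real j / real n \<le> \<gamma> \<longleftrightarrow> real j \<le> real n * \<gamma>" using assms by (simp add: field_simps)
      also have "\<dots> \<longleftrightarrow> j \<le> m" using m by linarith
      finally show ?thesis .
    qed
    moreover have "m \<le> n"
    proof -
      have "real n * \<gamma> \<le> real n * 1" using assms by (intro mult_left_mono) auto
      then show ?thesis using m by linarith
    qed
    ultimately show ?thesis by auto
  qed
  then have eq: "(\<Sum>j\<in>{1..n}. 1 / real n * of_bool (real j / real n \<le> \<gamma>)) = real m / real n"
    by (simp add: sum_divide_distrib[symmetric] sum.inter_filter[symmetric] of_bool_def)
  show "(\<Sum>j\<in>{1..n}. 1 / real n * of_bool (real j / real n \<le> \<gamma>)) \<le> \<gamma>"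
    unfolding eq using m(1) assms by (simp add: field_simps)
  show "\<gamma> \<le> 1 / real n + (\<Sum>j\<in>{1..n}. 1 / real n * of_bool (real j / real n \<le> \<gamma>))"
    unfolding eq using m(2) assms by (simp add: field_simps)
qed

context rwre
begin

text \<open>Multiplying by the probability of A includes null sets. Only the upper half of the
  mixing inequality is retained, which makes the estimates for block means one-sided.\<close>

lemma cone_mixing_sets:
  assumes A: "A \<in> sets (env_sigma {z. real_vec z \<bullet> l \<le> 0})"
    and B: "B \<in> sets (env_sigma {z. real_vec z \<in> mixing_cone R k (\<rho> *\<^sub>R l) l \<alpha>})" and \<rho>: "\<rho> > 0"
  shows "emeasure \<P> (A \<inter> B) \<le> (emeasure \<P> B + ennreal (\<phi> (\<rho> * l1_norm l))) * emeasure \<P> A"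
proof -
  have AB: "A \<in> events" "B \<in> events" using A B sets_env_sigma_subset by (auto simp: setsP)
  have l1: "\<rho> * l1_norm l \<ge> 0" using \<rho> by (simp add: l1_norm_def sum_nonneg)
  have "measure \<P> (A \<inter> B) \<le> (measure \<P> B + \<phi> (\<rho> * l1_norm l)) * measure \<P> A"
  proof (cases "measure \<P> A > 0")
    case True
    have "\<bar>measure \<P> (A \<inter> B) / measure \<P> A - measure \<P> B\<bar> \<le> \<phi> (\<rho> * l1_norm l)"
      using cm \<rho> A B True unfolding cone_mixing_def by blast
    then have "measure \<P> (A \<inter> B) / measure \<P> A \<le> measure \<P> B + \<phi> (\<rho> * l1_norm l)" by linarith
    then show ?thesis using True by (simp add: field_simps)
  next
    case False
    then have "measure \<P> A = 0" using measure_nonneg[of \<P> A] by linarith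
    moreover have "measure \<P> (A \<inter> B) \<le> measure \<P> A" using AB by (intro finite_measure_mono) auto
    ultimately show ?thesis by simp
  qed
  then have "ennreal (measure \<P> (A \<inter> B)) \<le> ennreal ((measure \<P> B + \<phi> (\<rho> * l1_norm l)) * measure \<P> A)"
    by (rule ennreal_leI)
  also have "\<dots> = (ennreal (measure \<P> B) + ennreal (\<phi> (\<rho> * l1_norm l))) * ennreal (measure \<P> A)"
    using \<phi>(1)[OF l1] by (simp add: ennreal_mult ennreal_plus)
  finally show ?thesis by (simp add: emeasure_eq_measure)
qed

text \<open>A function with values in [0, 1] is, up to 1/n, the average of the indicators of n upper
  level sets. Mixing applies to each of these sets, and since each has weight 1/n the error \<phi>
  occurs only once.\<close>

lemma cone_mixing_integral:
  fixes n :: nat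
  assumes f: "f \<in> borel_measurable (env_sigma {z. real_vec z \<bullet> l \<le> 0})"
    and g: "g \<in> borel_measurable (env_sigma {z. real_vec z \<in> mixing_cone R k (\<rho> *\<^sub>R l) l \<alpha>})"
    and g1: "\<And>\<omega>. g \<omega> \<le> 1" and \<rho>: "\<rho> > 0" and n: "n > 0"
  shows "(\<integral>\<^sup>+\<omega>. f \<omega> * g \<omega> \<partial>\<P>) \<le>
    (ennreal (1 / real n) + (\<integral>\<^sup>+\<omega>. g \<omega> \<partial>\<P>) + ennreal (\<phi> (\<rho> * l1_norm l))) * (\<integral>\<^sup>+\<omega>. f \<omega> \<partial>\<P>)"
proof -
  let ?N = "env_sigma {z. real_vec z \<in> mixing_cone R k (\<rho> *\<^sub>R l) l \<alpha>} :: 'd env measure"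
  let ?\<phi> = "ennreal (\<phi> (\<rho> * l1_norm l))"
  have fm: "f \<in> borel_measurable \<P>" and gm: "g \<in> borel_measurable \<P>"
    unfolding mP by (rule measurable_env_sigma_space[OF f], rule measurable_env_sigma_space[OF g])
  define B where "B j = {\<omega> \<in> space ?N. ennreal (real j / real n) \<le> g \<omega>}" for j
  have BN: "B j \<in> sets ?N" for j
    unfolding B_def using g by measurable
  then have BP: "B j \<in> sets \<P>" for j using sets_env_sigma_subset by (auto simp: setsP)
  have sumB: "(\<Sum>j\<in>{1..n}. ennreal (1 / real n) * indicator (B j) \<omega>) =
      ennreal (\<Sum>j\<in>{1..n}. 1 / real n * of_bool (real j / real n \<le> enn2real (g \<omega>)))"
    if \<omega>: "\<omega> \<in> space \<P>" for \<omega>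
  proof -
    have fin: "g \<omega> < top" using le_less_trans[OF g1 ennreal_one_less_top] .
    have "ennreal (1 / real n) * indicator (B j) \<omega> =
      ennreal (1 / real n * of_bool (real j / real n \<le> enn2real (g \<omega>)))" for j
    proof -
      have "ennreal (real j / real n) \<le> g \<omega> \<longleftrightarrow> real j / real n \<le> enn2real (g \<omega>)"
      proof -
        have "g \<omega> = ennreal (enn2real (g \<omega>))" using fin by simp
        then show ?thesis by (metis ennreal_le_iff enn2real_nonneg)
      qed
      then show ?thesis using \<omega> by (auto simp: B_def indicator_def spP)
    qed
    then show ?thesis by (subst sum_ennreal[symmetric]) auto
  qed
  have gr: "0 \<le> enn2real (g \<omega>)" "enn2real (g \<omega>) \<le> 1" "ennreal (enn2real (g \<omega>)) = g \<omega>" for \<omega>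
    using enn2real_mono[OF g1[of \<omega>]] le_less_trans[OF g1 ennreal_one_less_top, of \<omega>] by auto
  have low: "(\<Sum>j\<in>{1..n}. ennreal (1 / real n) * indicator (B j) \<omega>) \<le> g \<omega>" if "\<omega> \<in> space \<P>" for \<omega>
    unfolding sumB[OF that] using ennreal_leI[OF layer_sum(1)[OF gr(1,2)[of \<omega>] n]] by (simp only: gr(3))
  have up: "g \<omega> \<le> ennreal (1 / real n) + (\<Sum>j\<in>{1..n}. ennreal (1 / real n) * indicator (B j) \<omega>)"
    if "\<omega> \<in> space \<P>" for \<omega>
  proof -
    have "g \<omega> \<le> ennreal (1 / real n + (\<Sum>j\<in>{1..n}. 1 / real n * of_bool (real j / real n \<le> enn2real (g \<omega>))))"
      using ennreal_leI[OF layer_sum(2)[OF gr(1,2)[of \<omega>] n]] by (simp only: gr(3))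
    also have "\<dots> = ennreal (1 / real n) + (\<Sum>j\<in>{1..n}. ennreal (1 / real n) * indicator (B j) \<omega>)"
      unfolding sumB[OF that] by (rule ennreal_plus) (auto intro!: sum_nonneg)
    finally show ?thesis .
  qed
  have setB: "(\<integral>\<^sup>+\<omega>. f \<omega> * indicator (B j) \<omega> \<partial>\<P>) \<le> (emeasure \<P> (B j) + ?\<phi>) * (\<integral>\<^sup>+\<omega>. f \<omega> \<partial>\<P>)" for j
  proof (rule nn_integral_test_le[OF _ _ _ _ f])
    fix A assume A: "A \<in> sets (env_sigma {z. real_vec z \<bullet> l \<le> 0})"
    then have "A \<in> events" using sets_env_sigma_subset by (auto simp: setsP)
    then have "(\<integral>\<^sup>+\<omega>. indicator A \<omega> * indicator (B j) \<omega> \<partial>\<P>) = emeasure \<P> (A \<inter> B j)"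
      using BP by (simp add: indicator_inter_arith[symmetric])
    then show "(\<integral>\<^sup>+\<omega>. indicator A \<omega> * indicator (B j) \<omega> \<partial>\<P>) \<le> (emeasure \<P> (B j) + ?\<phi>) * emeasure \<P> A"
      using cone_mixing_sets[OF A BN \<rho>] by simp
  next
    show "indicator (B j) \<in> borel_measurable \<P>" using BP by simp
  qed (use sets_env_sigma_subset in \<open>auto simp: setsP spP\<close>)
  have "(\<integral>\<^sup>+\<omega>. f \<omega> * g \<omega> \<partial>\<P>) \<le>
    (\<integral>\<^sup>+\<omega>. ennreal (1 / real n) * f \<omega> + (\<Sum>j\<in>{1..n}. ennreal (1 / real n) * (f \<omega> * indicator (B j) \<omega>)) \<partial>\<P>)"
  proof (rule nn_integral_mono)
    fix \<omega> assume \<omega>: "\<omega> \<in> space \<P>"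
    have "f \<omega> * g \<omega> \<le> f \<omega> * (ennreal (1 / real n) + (\<Sum>j\<in>{1..n}. ennreal (1 / real n) * indicator (B j) \<omega>))"
      by (intro mult_left_mono up \<omega>) simp
    also have "\<dots> = ennreal (1 / real n) * f \<omega> + (\<Sum>j\<in>{1..n}. ennreal (1 / real n) * (f \<omega> * indicator (B j) \<omega>))"
      by (simp only: distrib_left sum_distrib_left mult_ac)
    finally show "f \<omega> * g \<omega> \<le> \<dots>" .
  qed
  also have "\<dots> = ennreal (1 / real n) * (\<integral>\<^sup>+\<omega>. f \<omega> \<partial>\<P>) +
      (\<Sum>j\<in>{1..n}. ennreal (1 / real n) * (\<integral>\<^sup>+\<omega>. f \<omega> * indicator (B j) \<omega> \<partial>\<P>))"
    using fm BP by (simp add: nn_integral_add nn_integral_sum nn_integral_cmult)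
  also have "\<dots> \<le> ennreal (1 / real n) * (\<integral>\<^sup>+\<omega>. f \<omega> \<partial>\<P>) +
      (\<Sum>j\<in>{1..n}. ennreal (1 / real n) * ((emeasure \<P> (B j) + ?\<phi>) * (\<integral>\<^sup>+\<omega>. f \<omega> \<partial>\<P>)))"
    by (intro add_left_mono sum_mono mult_left_mono setB) simp
  also have "\<dots> = (ennreal (1 / real n) + (\<Sum>j\<in>{1..n}. ennreal (1 / real n) * emeasure \<P> (B j)) +
      (\<Sum>j\<in>{1..n}. ennreal (1 / real n) * ?\<phi>)) * (\<integral>\<^sup>+\<omega>. f \<omega> \<partial>\<P>)"
    by (simp only: distrib_right distrib_left sum.distrib sum_distrib_right mult.assoc add.assoc)
  also have "(\<Sum>j\<in>{1..n}. ennreal (1 / real n) * ?\<phi>) = ?\<phi>"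
  proof -
    have "(\<Sum>j\<in>{1..n}. ennreal (1 / real n) * ?\<phi>) = (\<Sum>j\<in>{1..n}. ennreal (1 / real n)) * ?\<phi>"
      by (rule sum_distrib_right[symmetric])
    also have "(\<Sum>j\<in>{1..n}. ennreal (1 / real n)) = 1"
      using n by (subst sum_ennreal) auto
    finally show ?thesis by simp
  qed
  also have "(\<Sum>j\<in>{1..n}. ennreal (1 / real n) * emeasure \<P> (B j)) =
      (\<integral>\<^sup>+\<omega>. (\<Sum>j\<in>{1..n}. ennreal (1 / real n) * indicator (B j) \<omega>) \<partial>\<P>)"
    using BP by (subst nn_integral_sum) (simp_all add: nn_integral_cmult_indicator)
  also have "(ennreal (1 / real n) + \<dots> + ?\<phi>) * (\<integral>\<^sup>+\<omega>. f \<omega> \<partial>\<P>) \<le>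
      (ennreal (1 / real n) + (\<integral>\<^sup>+\<omega>. g \<omega> \<partial>\<P>) + ?\<phi>) * (\<integral>\<^sup>+\<omega>. f \<omega> \<partial>\<P>)"
    by (intro mult_right_mono add_right_mono add_left_mono nn_integral_mono low) auto
  finally show ?thesis .
qed

lemma inner_l_Raxis: "i \<noteq> k \<Longrightarrow> l \<bullet> R (axis i 1) = 0"
  using R Rk by (metis inner_axis_axis orthogonal_transformation_def)

lemma in_cone_mixing_cone:
  assumes "in_cone r z"
  shows "real_vec z \<in> mixing_cone R k ((r / 2) *\<^sub>R l) l \<alpha>"
  unfolding mixing_cone_def
proof (intro INT_I)
  fix i assume "i \<in> UNIV - {k}"
  then have i: "i \<noteq> k" by simp
  have ll: "l \<bullet> l = 1" using norm_l by (simp add: dot_square_norm)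
  have t: "\<alpha> * \<bar>tau i z\<bar> \<le> lev z - r / 2" using assms i by (simp add: in_cone_def)
  have at: "\<bar>\<alpha> * tau i z\<bar> \<le> lev z - r / 2" using t \<alpha>(1) by (simp add: abs_mult)
  have "(real_vec z - (r / 2) *\<^sub>R l) \<bullet> (l + \<alpha> *\<^sub>R R (axis i 1)) = lev z - r / 2 + \<alpha> * tau i z"
    using inner_l_Raxis[OF i] ll
    by (simp add: inner_diff_left inner_add_right lev_def tau_def)
  moreover have "(real_vec z - (r / 2) *\<^sub>R l) \<bullet> (l - \<alpha> *\<^sub>R R (axis i 1)) = lev z - r / 2 - \<alpha> * tau i z"
    using inner_l_Raxis[OF i] ll
    by (simp add: inner_diff_left inner_diff_right lev_def tau_def)
  ultimately show "real_vec z \<in> {z. 0 \<le> (z - (r / 2) *\<^sub>R l) \<bullet> ((l + \<alpha> *\<^sub>R R (axis i 1)) /\<^sub>R norm (l + \<alpha> *\<^sub>R R (axis i 1))) \<and>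
         0 \<le> (z - (r / 2) *\<^sub>R l) \<bullet> ((l - \<alpha> *\<^sub>R R (axis i 1)) /\<^sub>R norm (l - \<alpha> *\<^sub>R R (axis i 1)))}"
    using at by (auto simp: abs_le_iff intro!: mult_nonneg_nonneg)
qed

section \<open>The gap: forward paths along the axis\<close>

definition nz :: real where "nz = norm (real_vec z\<^sub>0)"

lemma nz_pos: "nz > 0" using z0 by (simp add: nz_def)

definition base_path :: "(int^'d) list" where
  "base_path = (SOME es. set es \<subseteq> forward_steps l \<and> sum_list es = z\<^sub>0)"

lemma base_path: "set base_path \<subseteq> forward_steps l" "sum_list base_path = z\<^sub>0" "base_path \<noteq> []"
proof -
  have "z\<^sub>0 $ i = 0 \<or> sgn (real_of_int (z\<^sub>0 $ i)) = sgn (l $ i)" for i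
  proof -
    have "l $ i = real_of_int (z\<^sub>0 $ i) / nz"
      unfolding nz_def by (subst l_def) (simp add: divide_inverse mult.commute)
    then show ?thesis using nz_pos by (simp add: sgn_divide)
  qed
  then have *: "\<exists>es. set es \<subseteq> forward_steps l \<and> sum_list es = z\<^sub>0" by (rule forward_list)
  from someI_ex[OF *] show "set base_path \<subseteq> forward_steps l" "sum_list base_path = z\<^sub>0"
    unfolding base_path_def by auto
  then show "base_path \<noteq> []" using z0 by auto
qed

text \<open>Rationality of l enters here: repeating a forward path from 0 to
  \<open>z\<^sub>0\<close> ends exactly on the axis, at height n * \<open>nz\<close>, the kind of
  start that \<open>cone_good_path\<close> asks for.\<close>

definition fwd_path :: "nat \<Rightarrow> (int^'d) list" where
  "fwd_path n = concat (replicate n base_path)"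

lemma fwd_path: "set (fwd_path n) \<subseteq> forward_steps l" "length (fwd_path n) = n * length base_path"
  "n > 0 \<Longrightarrow> fwd_path n \<noteq> []"
  using base_path by (auto simp: fwd_path_def length_concat sum_list_replicate)

lemma lev_z0: "lev z\<^sub>0 = nz" and tau_z0: "i \<noteq> k \<Longrightarrow> tau i z\<^sub>0 = 0"
proof -
  have "real_vec z\<^sub>0 = nz *\<^sub>R l" using nz_pos unfolding nz_def by (subst l_def) simp
  then show "lev z\<^sub>0 = nz" "i \<noteq> k \<Longrightarrow> tau i z\<^sub>0 = 0"
    using norm_l inner_l_Raxis[of i] by (simp_all add: lev_def tau_def dot_square_norm)
qed

lemma lev_fwd_path: "lev (sum_list (fwd_path n)) = real n * nz"
  and tau_fwd_path: "i \<noteq> k \<Longrightarrow> tau i (sum_list (fwd_path n)) = 0"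
proof -
  show "lev (sum_list (fwd_path n)) = real n * nz"
    by (induction n) (simp_all add: fwd_path_def lev_add base_path lev_z0 algebra_simps)
  show "i \<noteq> k \<Longrightarrow> tau i (sum_list (fwd_path n)) = 0"
    by (induction n) (simp_all add: fwd_path_def tau_add base_path tau_z0)
qed

text \<open>The weight is shifted together with the environment, so that z becomes the origin and
  the past becomes the half-space below 0, as in the mixing condition.\<close>

lemma forward_start_shift:
  assumes G: "G \<in> borel_measurable path_space" and f: "f \<in> borel_measurable (env_sigma (half_space l z))"
  shows "\<exists>f'. f' \<in> borel_measurable (env_sigma (half_space l 0)) \<and> (\<integral>\<^sup>+\<omega>. f' \<omega> \<partial>\<P>) = (\<integral>\<^sup>+\<omega>. f \<omega> \<partial>\<P>) \<and>
    (\<integral>\<^sup>+\<omega>. f \<omega> * (\<integral>\<^sup>+X. G X \<partial>quenched \<omega> (z + p)) \<partial>\<P>) =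
    (\<integral>\<^sup>+\<omega>. f' \<omega> * (\<integral>\<^sup>+X. G (\<lambda>m. X m + z) \<partial>quenched \<omega> p) \<partial>\<P>)"
proof (intro exI conjI)
  let ?g = "\<lambda>\<omega>. f (env_shift (- z) \<omega>)"
  have fg: "f \<omega> = ?g (env_shift z \<omega>)" for \<omega> by (simp add: env_shift_def)
  have Gz: "(\<lambda>X. G (\<lambda>m. X m + z)) \<in> borel_measurable path_space"
    by (rule measurable_compose[OF measurable_walk_translate G])
  have "{x. x - - z \<in> half_space l z} = half_space l 0"
    by (auto simp: half_space_def real_vec_add inner_add_left)
  then show g: "?g \<in> borel_measurable (env_sigma (half_space l 0))"
    using measurable_compose[OF measurable_env_shift_sigma[of "- z" "half_space l z"] f] by simp
  have gm: "?g \<in> borel_measurable env_space" by (rule measurable_env_sigma_space[OF g])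
  show "(\<integral>\<^sup>+\<omega>. ?g \<omega> \<partial>\<P>) = (\<integral>\<^sup>+\<omega>. f \<omega> \<partial>\<P>)"
    using stationary_nn_integral[OF law st gm, of z] by (simp add: fg[symmetric])
  have "(\<integral>\<^sup>+\<omega>. f \<omega> * (\<integral>\<^sup>+X. G X \<partial>quenched \<omega> (z + p)) \<partial>\<P>) =
    (\<integral>\<^sup>+\<omega>. ?g (env_shift z \<omega>) * (\<integral>\<^sup>+X. G (\<lambda>m. X m + z) \<partial>quenched (env_shift z \<omega>) p) \<partial>\<P>)"
  proof (rule nn_integral_cong)
    fix \<omega> assume "\<omega> \<in> space \<P>"
    then have "\<omega> \<in> space env_space" by (simp add: spP)
    from nn_integral_quenched_shift[OF this G, of p z]
    show "f \<omega> * (\<integral>\<^sup>+X. G X \<partial>quenched \<omega> (z + p)) =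
      ?g (env_shift z \<omega>) * (\<integral>\<^sup>+X. G (\<lambda>m. X m + z) \<partial>quenched (env_shift z \<omega>) p)"
      by (simp add: fg[symmetric] add.commute)
  qed
  also have "\<dots> = (\<integral>\<^sup>+\<omega>. ?g \<omega> * (\<integral>\<^sup>+X. G (\<lambda>m. X m + z) \<partial>quenched \<omega> p) \<partial>\<P>)"
    by (rule stationary_nn_integral[OF law st])
      (intro borel_measurable_times_ennreal gm measurable_quenched_integral Gz)
  finally show "(\<integral>\<^sup>+\<omega>. f \<omega> * (\<integral>\<^sup>+X. G X \<partial>quenched \<omega> (z + p)) \<partial>\<P>) =
    (\<integral>\<^sup>+\<omega>. ?g \<omega> * (\<integral>\<^sup>+X. G (\<lambda>m. X m + z) \<partial>quenched \<omega> p) \<partial>\<P>)" .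
qed

text \<open>Started at height r, the walk stays in the cone with apex at height r/2 up to
  probability of order 1/r, even when weighted by the past. Restricted to paths that stay there, its
  quenched mean depends on the environment in the cone alone, and mixing applies.\<close>

lemma mixing_start_bound:
  fixes n :: nat
  assumes G: "G \<in> borel_measurable path_space" "\<And>X. G X \<le> 1"
    and f: "f \<in> borel_measurable (env_sigma (half_space l z))"
    and r: "r = real n * nz" "r \<ge> 40" "r \<ge> 4 * L\<^sub>0"
  shows "(\<integral>\<^sup>+\<omega>. f \<omega> * (\<integral>\<^sup>+X. G X \<partial>quenched \<omega> (z + sum_list (fwd_path n))) \<partial>\<P>) \<le>
    ((\<integral>\<^sup>+X. G X \<partial>path_law (z + sum_list (fwd_path n))) + ennreal (\<phi> (r / 2 * l1_norm l)) + ennreal (2 * C\<^sub>2 / r)) *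
    (\<integral>\<^sup>+\<omega>. f \<omega> \<partial>\<P>)"
proof -
  let ?p = "sum_list (fwd_path n)" and ?Gz = "\<lambda>X. G (\<lambda>m. X m + z)" and ?S = "{x. in_cone r x}"
  let ?st = "indicator {X. \<forall>i. X i \<in> ?S} :: (nat \<Rightarrow> int^'d) \<Rightarrow> ennreal"
  have Gz: "?Gz \<in> borel_measurable path_space"
    by (rule measurable_compose[OF measurable_walk_translate G(1)])
  obtain f' where f': "f' \<in> borel_measurable (env_sigma (half_space l 0))"
    and ff': "(\<integral>\<^sup>+\<omega>. f' \<omega> \<partial>\<P>) = (\<integral>\<^sup>+\<omega>. f \<omega> \<partial>\<P>)"
    and eq: "(\<integral>\<^sup>+\<omega>. f \<omega> * (\<integral>\<^sup>+X. G X \<partial>quenched \<omega> (z + ?p)) \<partial>\<P>) =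
      (\<integral>\<^sup>+\<omega>. f' \<omega> * (\<integral>\<^sup>+X. ?Gz X \<partial>quenched \<omega> ?p) \<partial>\<P>)"
    using forward_start_shift[OF G(1) f] by blast
  \<comment> \<open>The value 0 off \<open>env_space\<close> makes the bound by 1 hold for every
    argument, as \<open>cone_mixing_integral\<close> demands.\<close>
  define g where "g \<omega> = (if \<omega> \<in> space env_space then \<integral>\<^sup>+X. ?Gz X * ?st X \<partial>quenched \<omega> ?p else 0)" for \<omega>
  have gS: "g \<in> borel_measurable (env_sigma ?S)"
    by (rule measurable_eq_onI[OF measurable_quenched_stay[OF Gz, where S="?S" and x="?p"]]) (simp add: g_def)
  have Ssub: "?S \<subseteq> {x. real_vec x \<in> mixing_cone R k ((r / 2) *\<^sub>R l) l \<alpha>}"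
    using in_cone_mixing_cone by auto
  have gN: "g \<in> borel_measurable (env_sigma {x. real_vec x \<in> mixing_cone R k ((r / 2) *\<^sub>R l) l \<alpha>})"
    by (rule measurable_env_sigma_mono[OF Ssub gS])
  have hs: "half_space l 0 \<subseteq> {x. real_vec x \<bullet> l \<le> 0}" by (auto simp: half_space_def)
  have f'N: "f' \<in> borel_measurable (env_sigma {x. real_vec x \<bullet> l \<le> 0})"
    by (rule measurable_env_sigma_mono[OF hs f'])
  have g1: "g \<omega> \<le> 1" for \<omega>
  proof (cases "\<omega> \<in> space env_space")
    case True
    interpret q: prob_space "quenched \<omega> ?p" by (rule prob_space_quenched[OF True])
    have "(\<integral>\<^sup>+X. ?Gz X * ?st X \<partial>quenched \<omega> ?p) \<le> (\<integral>\<^sup>+X. 1 \<partial>quenched \<omega> ?p)"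
      using G(2) by (intro nn_integral_mono) (auto simp: indicator_def)
    moreover have "emeasure (quenched \<omega> ?p) UNIV = 1" using q.emeasure_space_1 True by simp
    ultimately show ?thesis using True by (simp add: g_def)
  qed (simp add: g_def)
  have C2r: "C\<^sub>2 / r > 0" using C2_pos r by simp
  \<comment> \<open>The level sets are taken so fine that their error is at most
    \<open>C\<^sub>2 / r\<close>, the bound for leaving the cone; hence the factor 2 in the
    result.\<close>
  obtain m :: nat where m: "m > 0" "1 / real m \<le> C\<^sub>2 / r"
    using real_arch_inverse[of "C\<^sub>2 / r"] C2r by (auto simp: inverse_eq_divide intro: less_imp_le)
  have mix: "(\<integral>\<^sup>+\<omega>. f' \<omega> * g \<omega> \<partial>\<P>) \<le>
    (ennreal (1 / real m) + (\<integral>\<^sup>+\<omega>. g \<omega> \<partial>\<P>) + ennreal (\<phi> (r / 2 * l1_norm l))) * (\<integral>\<^sup>+\<omega>. f' \<omega> \<partial>\<P>)"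
    by (rule cone_mixing_integral[OF f'N gN g1 _ m(1)]) (use r in simp)
  have bad: "(\<integral>\<^sup>+\<omega>. f' \<omega> * emeasure (quenched \<omega> ?p) {X. cone_bad r X} \<partial>\<P>) \<le>
    ennreal (C\<^sub>2 / r) * (\<integral>\<^sup>+\<omega>. f' \<omega> \<partial>\<P>)"
    by (rule cone_bad_bound[OF r(2,3) f'])
  have f'm: "f' \<in> borel_measurable \<P>" and gm: "g \<in> borel_measurable \<P>"
    unfolding mP by (rule measurable_env_sigma_space[OF f'], rule measurable_env_sigma_space[OF gS])
  have qm: "(\<lambda>\<omega>. emeasure (quenched \<omega> ?p) {X. cone_bad r X}) \<in> borel_measurable \<P>"
    unfolding mP by (rule measurable_emeasure_quenched[OF sets_cone_bad])
  have pw: "(\<integral>\<^sup>+X. ?Gz X \<partial>quenched \<omega> ?p) \<le> g \<omega> + emeasure (quenched \<omega> ?p) {X. cone_bad r X}"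
    if \<omega>: "\<omega> \<in> space env_space" for \<omega>
  proof -
    have "(\<integral>\<^sup>+X. ?Gz X \<partial>quenched \<omega> ?p) \<le>
      (\<integral>\<^sup>+X. ?Gz X * ?st X + indicator {X. cone_bad r X} X \<partial>quenched \<omega> ?p)"
    proof (rule nn_integral_mono_AE, use AE_steps[OF \<omega>, of ?p] in eventually_elim)
      case (elim X)
      show ?case
      proof (cases "cone_bad r X")
        case True
        then have "?Gz X \<le> indicator {X. cone_bad r X} X" using G(2) by simp
        then show ?thesis by (simp add: add_increasing)
      next
        case False
        have "in_cone r (X i)" for i
          by (rule cone_good_path(1)[OF r(2) _ _ False])
            (use elim in \<open>simp_all add: lev_fwd_path tau_fwd_path r(1)\<close>)
        then show ?thesis by simp
      qed
    qed
    also have "\<dots> = (\<integral>\<^sup>+X. ?Gz X * ?st X \<partial>quenched \<omega> ?p) + emeasure (quenched \<omega> ?p) {X. cone_bad r X}"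
      using Gz stay_sets(1)[of ?S] sets_cone_bad[of r]
      by (subst nn_integral_add)
        (auto simp: measurable_quenched_cong[OF \<omega>] sets_quenched[OF \<omega>])
    finally show ?thesis using \<omega> by (simp add: g_def)
  qed
  \<comment> \<open>Dropping the confinement can only increase the mean, and stationarity moves the
    start from the endpoint of the forward path back to its translate by z.\<close>
  have gle: "(\<integral>\<^sup>+\<omega>. g \<omega> \<partial>\<P>) \<le> (\<integral>\<^sup>+X. G X \<partial>path_law (z + ?p))"
  proof -
    have "(\<integral>\<^sup>+\<omega>. g \<omega> \<partial>\<P>) \<le> (\<integral>\<^sup>+\<omega>. \<integral>\<^sup>+X. ?Gz X \<partial>quenched \<omega> ?p \<partial>\<P>)"
      by (intro nn_integral_mono) (auto simp: g_def indicator_def spP intro!: nn_integral_mono)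
    also have "\<dots> = (\<integral>\<^sup>+X. ?Gz X \<partial>path_law ?p)" by (rule nn_integral_path_law[OF Gz, symmetric])
    also have "\<dots> = (\<integral>\<^sup>+X. G X \<partial>path_law (z + ?p))"
      unfolding path_law_translate[OF Gz, of ?p] path_law_translate[OF G(1), of "z + ?p"]
      by (simp add: ac_simps)
    finally show ?thesis .
  qed
  have "(\<integral>\<^sup>+\<omega>. f' \<omega> * (\<integral>\<^sup>+X. ?Gz X \<partial>quenched \<omega> ?p) \<partial>\<P>) \<le>
    (\<integral>\<^sup>+\<omega>. f' \<omega> * g \<omega> + f' \<omega> * emeasure (quenched \<omega> ?p) {X. cone_bad r X} \<partial>\<P>)"
    by (intro nn_integral_mono) (use pw in \<open>auto simp: spP distrib_left[symmetric] intro: mult_left_mono\<close>)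
  also have "\<dots> = (\<integral>\<^sup>+\<omega>. f' \<omega> * g \<omega> \<partial>\<P>) +
      (\<integral>\<^sup>+\<omega>. f' \<omega> * emeasure (quenched \<omega> ?p) {X. cone_bad r X} \<partial>\<P>)"
    by (intro nn_integral_add borel_measurable_times_ennreal f'm gm qm)
  also have "\<dots> \<le> (ennreal (1 / real m) + (\<integral>\<^sup>+\<omega>. g \<omega> \<partial>\<P>) + ennreal (\<phi> (r / 2 * l1_norm l))) * (\<integral>\<^sup>+\<omega>. f' \<omega> \<partial>\<P>) +
      ennreal (C\<^sub>2 / r) * (\<integral>\<^sup>+\<omega>. f' \<omega> \<partial>\<P>)"
    by (intro add_mono mix bad)
  also have "\<dots> \<le> (ennreal (C\<^sub>2 / r) + (\<integral>\<^sup>+X. G X \<partial>path_law (z + ?p)) + ennreal (\<phi> (r / 2 * l1_norm l))) * (\<integral>\<^sup>+\<omega>. f' \<omega> \<partial>\<P>) +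
      ennreal (C\<^sub>2 / r) * (\<integral>\<^sup>+\<omega>. f' \<omega> \<partial>\<P>)"
    using m(2) gle by (intro add_mono mult_right_mono ennreal_leI order_refl) auto
  also have "\<dots> = ((\<integral>\<^sup>+X. G X \<partial>path_law (z + ?p)) + ennreal (\<phi> (r / 2 * l1_norm l)) +
      (ennreal (C\<^sub>2 / r) + ennreal (C\<^sub>2 / r))) * (\<integral>\<^sup>+\<omega>. f' \<omega> \<partial>\<P>)"
    by (simp add: distrib_right add_ac)
  also have "ennreal (C\<^sub>2 / r) + ennreal (C\<^sub>2 / r) = ennreal (2 * C\<^sub>2 / r)"
    using C2r by (subst ennreal_plus[symmetric]) (auto simp: add_divide_distrib[symmetric])
  finally show ?thesis unfolding eq ff' .
qed


section \<open>Hitting positions and good blocks\<close>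

text \<open>The default value 0 concerns only paths that never reach s, which form a null
  set.\<close>

definition pos :: "real \<Rightarrow> (nat \<Rightarrow> int^'d) \<Rightarrow> int^'d" where
  "pos s X = (if \<exists>n. s \<le> lev (X n) then X (LEAST n. s \<le> lev (X n)) else 0)"

lemma hits_pos:
  assumes "hits s n X"
  shows "pos s X = X n"
proof -
  have ex: "\<exists>n. s \<le> lev (X n)" using assms by (auto simp: hits_def)
  have "(LEAST n. s \<le> lev (X n)) = n"
    using assms by (intro Least_equality) (auto simp: hits_def not_less[symmetric])
  with ex show ?thesis by (simp add: pos_def)
qed

lemma hits_shift_iff:
  assumes "lev (X 0) < s"
  shows "hits s n (walk_shift 1 X) \<longleftrightarrow> hits s (Suc n) X"
  using assms by (auto simp: hits_def walk_shift_def less_Suc_eq_0_disj)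

lemma reach_iff_hits: "(\<exists>n. s \<le> lev (X n)) \<longleftrightarrow> (\<exists>n. hits s n X)"
  using hits_ex[where s=s and X=X] unfolding hits_def by blast

lemma hits_pos_time: "hits s n X \<Longrightarrow> lev (X 0) < s \<Longrightarrow> n \<noteq> 0"
  by (intro notI) (simp add: hits_def)

lemma pos_future: "lev (X 0) < s \<Longrightarrow> pos s (walk_shift 1 X) = pos s X"
proof -
  assume l0: "lev (X 0) < s"
  show ?thesis
  proof (cases "\<exists>n. hits s n X")
    case True
    then obtain n where n: "hits s n X" by blast
    then have "n \<noteq> 0" using l0 by (rule hits_pos_time)
    then obtain m where m: "n = Suc m" by (cases n) auto
    then have "hits s m (walk_shift 1 X)" using hits_shift_iff[where X=X, OF l0] n by simp
    from hits_pos[OF this] hits_pos[OF n] show ?thesis by (simp add: walk_shift_def m)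
  next
    case False
    then have "\<not> (\<exists>n. hits s n (walk_shift 1 X))" using hits_shift_iff[where X=X, OF l0] by blast
    with False show ?thesis by (simp add: pos_def reach_iff_hits)
  qed
qed

lemma measurable_pos: "pos s \<in> path_space \<rightarrow>\<^sub>M count_space UNIV"
proof (rule measurable_count_space_eq2_countable[THEN iffD2], intro conjI allI impI ballI)
  fix z :: "int^'d"
  have "pos s -` {z} \<inter> space path_space = (\<Union>n. {X. hits s n X \<and> X n = z}) \<union>
    (if z = 0 then space path_space - {X. \<exists>n. s \<le> lev (X n)} else {})" (is "?L = ?R")
  proof (rule set_eqI)
    fix X :: "nat \<Rightarrow> int^'d"
    show "X \<in> ?L \<longleftrightarrow> X \<in> ?R"
    proof (cases "\<exists>n. hits s n X")
      case True
      then obtain n where n: "hits s n X" by blast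
      then have "hits s m X \<longleftrightarrow> m = n" for m using hits_unique by blast
      moreover have "\<exists>n. s \<le> lev (X n)" using n by (auto simp: hits_def)
      ultimately show ?thesis using hits_pos[OF n] by auto
    next
      case False
      then have "\<not> (\<exists>n. s \<le> lev (X n))" using reach_iff_hits by blast
      with False show ?thesis by (auto simp: pos_def)
    qed
  qed
  moreover have "{X. hits s n X \<and> X n = z} \<in> sets path_space" for n
    by (rule sets_prefix[of n]) (auto simp: prefix_det_def hits_def)
  moreover have "space path_space - {X. \<exists>n. s \<le> lev (X n)} \<in> sets path_space"
    by (rule sets.compl_sets[OF sets_reach])
  ultimately show "pos s -` {z} \<inter> space path_space \<in> sets path_space"
    by (auto intro!: sets.Un sets.countable_UN'')
qed auto

definition good_hit :: "real \<Rightarrow> real \<Rightarrow> (nat \<Rightarrow> int^'d) \<Rightarrow> bool" where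
  "good_hit s L X \<longleftrightarrow> (\<exists>n. hits s n X \<and> good L (walk_shift n X))"

lemma sets_good_hit: "{X. good_hit s L X} \<in> sets path_space"
proof -
  have "{X. good_hit s L X} = (\<Union>n. {X. hits s n X} \<inter> walk_shift n -` {X. good L X})"
    by (auto simp: good_hit_def)
  also have "\<dots> \<in> sets path_space"
    by (intro sets.countable_UN'' sets.Int[OF sets_hits measurable_shift_vimage[OF sets_good]]) simp
  finally show ?thesis .
qed

lemma good_hit_future:
  assumes "lev (X 0) < s"
  shows "good_hit s L (walk_shift 1 X) = good_hit s L X"
proof
  assume "good_hit s L (walk_shift 1 X)"
  then obtain n where "hits s n (walk_shift 1 X)" "good L (walk_shift n (walk_shift 1 X))"
    by (auto simp: good_hit_def)
  then have "hits s (Suc n) X" "good L (walk_shift (Suc n) X)"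
    using hits_shift_iff[where X=X, OF assms] by (simp_all add: walk_shift_def)
  then show "good_hit s L X" by (auto simp: good_hit_def)
next
  assume "good_hit s L X"
  then obtain n where n: "hits s n X" "good L (walk_shift n X)" by (auto simp: good_hit_def)
  from n(1) assms have "n \<noteq> 0" by (rule hits_pos_time)
  then obtain m where m: "n = Suc m" by (cases n) auto
  then have "hits s m (walk_shift 1 X)" "good L (walk_shift m (walk_shift 1 X))"
    using n hits_shift_iff[where X=X, OF assms] by (simp_all add: walk_shift_def)
  then show "good_hit s L (walk_shift 1 X)" by (auto simp: good_hit_def)
qed

text \<open>The exit ends at a level of at least s + L, so level t is first hit during the exit or
  at its last step. In the first case the position is in the box; in the second the overshoot over t
  is less than 1, within the range of \<open>norm_le_C0\<close>.\<close>

lemma good_hit_step: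
  assumes X: "steps X" "lev (X 0) \<le> s" and g: "good_hit s L X" and L: "L \<ge> 1" and t: "s \<le> t" "t \<le> s + L"
  shows "\<exists>n. t \<le> lev (X n)" and "norm (real_vec (pos t X - pos s X)) \<le> C\<^sub>0 * L"
proof -
  obtain n where n: "hits s n X" "good L (walk_shift n X)" using g by (auto simp: good_hit_def)
  obtain N where N: "N > n" "\<And>m. n \<le> m \<Longrightarrow> m < N \<Longrightarrow> X m \<in> Box L (X n)"
      "lev (X n) + L \<le> lev (X N)" "\<And>i. i \<noteq> k \<Longrightarrow> \<bar>tau i (X N) - tau i (X n)\<bar> \<le> c * L + 1"
    using goodE[OF n(2)] L by auto
  have sn: "s \<le> lev (X n)" using n(1) by (simp add: hits_def)
  have tN: "t \<le> lev (X N)" using N(3) sn t by linarith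
  then show "\<exists>n. t \<le> lev (X n)" by blast
  obtain m where m: "m \<le> N" "hits t m X" using hits_ex[where n=N and X=X, OF tN] by blast
  have "n \<le> m"
  proof (rule ccontr)
    assume "\<not> n \<le> m"
    then have "lev (X m) < s" using n(1) by (simp add: hits_def)
    with m(2) t show False by (simp add: hits_def)
  qed
  have "norm (real_vec (X m - X n)) \<le> C\<^sub>0 * L"
  proof (cases "m = N")
    case True
    show ?thesis
    proof (rule norm_le_C0[OF L])
      have "lev (X m) < t + 1" using hits_lev_less[OF X(1) _ m(2)] X(2) t by simp
      then show "\<bar>lev (X m - X n)\<bar> \<le> L + 1" using N(3) True sn t L by (simp add: lev_diff)
    qed (use N(4) True in \<open>simp add: tau_diff\<close>)
  next
    case False
    then have "X m \<in> Box L (X n)" using N(2)[of m] m \<open>n \<le> m\<close> by simp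
    then show ?thesis by (intro norm_le_C0[OF L]) (auto simp: Box_def lev_diff tau_diff less_imp_le add_increasing2)
  qed
  then show "norm (real_vec (pos t X - pos s X)) \<le> C\<^sub>0 * L"
    by (simp add: hits_pos[OF n(1)] hits_pos[OF m(2)])
qed

text \<open>Steps of length L starting from s, and one last step to t, which lies within L of the
  last stop; this remainder accounts for the additional L in the bound.\<close>

lemma good_hit_chain:
  assumes X: "steps X" "lev (X 0) \<le> s" and L: "L \<ge> 1"
    and g: "\<And>u. s \<le> u \<Longrightarrow> u \<le> t \<Longrightarrow> good_hit u L X" and st: "s \<le> t"
  shows "norm (real_vec (pos t X - pos s X)) \<le> C\<^sub>0 * (t - s + L)"
proof -
  have ind: "s + real j * L \<le> t \<Longrightarrow> norm (real_vec (pos (s + real j * L) X - pos s X)) \<le> C\<^sub>0 * (real j * L)" for j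
  proof (induction j)
    case 0
    then show ?case by simp
  next
    case (Suc j)
    have e: "s + real (Suc j) * L = s + real j * L + L" by (simp add: algebra_simps)
    then have le: "s + real j * L \<le> t" using Suc.prems L by simp
    have sj: "s \<le> s + real j * L" using L by simp
    have "good_hit (s + real j * L) L X" by (rule g[OF sj le])
    then have "norm (real_vec (pos (s + real (Suc j) * L) X - pos (s + real j * L) X)) \<le> C\<^sub>0 * L"
      unfolding e by (rule good_hit_step(2)[OF X(1) order_trans[OF X(2) sj]]) (use L in auto)
    moreover have "norm (real_vec (pos (s + real (Suc j) * L) X - pos s X)) \<le>
      norm (real_vec (pos (s + real (Suc j) * L) X - pos (s + real j * L) X)) +
      norm (real_vec (pos (s + real j * L) X - pos s X))"
      using norm_triangle_ineq[of "real_vec (pos (s + real (Suc j) * L) X - pos (s + real j * L) X)"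
          "real_vec (pos (s + real j * L) X - pos s X)"]
      by (simp add: real_vec_diff)
    moreover have "C\<^sub>0 * (real (Suc j) * L) = C\<^sub>0 * (real j * L) + C\<^sub>0 * L" by (simp add: algebra_simps)
    ultimately show ?case using Suc.IH[OF le] by linarith
  qed
  define j where "j = nat \<lfloor>(t - s) / L\<rfloor>"
  have q0: "(t - s) / L \<ge> 0" using st L by simp
  have "real j \<le> (t - s) / L" "(t - s) / L < real j + 1" using q0 unfolding j_def by linarith+
  then have j: "real j * L \<le> t - s" "t - s < real j * L + L" using L by (simp_all add: field_simps)
  have "good_hit (s + real j * L) L X" using j L by (intro g) auto
  moreover have "s \<le> s + real j * L" using L by simp
  ultimately have 1: "norm (real_vec (pos t X - pos (s + real j * L) X)) \<le> C\<^sub>0 * L"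
    using order_trans[OF X(2)] j L by (intro good_hit_step(2)[OF X(1)]) auto
  have 2: "norm (real_vec (pos (s + real j * L) X - pos s X)) \<le> C\<^sub>0 * (t - s)"
    using ind[of j] j C0_ge by (smt (verit) mult_left_mono)
  have "norm (real_vec (pos t X - pos s X)) \<le>
      norm (real_vec (pos t X - pos (s + real j * L) X)) + norm (real_vec (pos (s + real j * L) X - pos s X))"
    using norm_triangle_ineq[of "real_vec (pos t X - pos (s + real j * L) X)" "real_vec (pos (s + real j * L) X - pos s X)"]
    by (simp add: real_vec_diff)
  then show ?thesis using 1 2 by (simp add: distrib_left)
qed

definition ball_bad :: "real \<Rightarrow> real \<Rightarrow> (nat \<Rightarrow> int^'d) \<Rightarrow> bool" where
  "ball_bad \<rho> L X \<longleftrightarrow> (\<exists>x\<in>{x. norm (real_vec x) \<le> \<rho>}. bad_at x L X)"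

lemma sets_ball_bad: "{X. ball_bad \<rho> L X} \<in> sets path_space"
proof -
  have "{X. ball_bad \<rho> L X} = (\<Union>x\<in>{x. norm (real_vec x) \<le> \<rho>}. {X. bad_at x L X})"
    by (auto simp: ball_bad_def)
  also have "\<dots> \<in> sets path_space" by (intro sets.countable_UN'' sets_bad_at) auto
  finally show ?thesis .
qed

lemma ball_bad_bound:
  assumes \<rho>: "\<rho> \<ge> 0" and L: "L \<ge> L\<^sub>0"
  shows "emeasure (path_law x0) {X. ball_bad \<rho> L X} \<le> ennreal ((2 * \<rho> + 1) ^ CARD('d) * L powr - M)"
proof -
  let ?Q = "{x :: int^'d. norm (real_vec x) \<le> \<rho>}"
  obtain y where y: "lev y \<le> - \<rho> - L - 1" using exists_low_site by blast
  have "(\<integral>\<^sup>+\<omega>. 1 * emeasure (quenched \<omega> x0) {X. \<exists>x\<in>?Q. bad_at x L X} \<partial>\<P>) \<le>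
    ennreal (real (card ?Q) * L powr - M) * (\<integral>\<^sup>+\<omega>. 1 \<partial>\<P>)"
  proof (rule union_finite[OF finite_lattice_ball(1)[OF \<rho>] L, where y=y])
    show "lev y \<le> lev x - L - 1" if "x \<in> ?Q" for x
      using that abs_lev_le[of x] y by simp
  qed auto
  then have "emeasure (path_law x0) {X. ball_bad \<rho> L X} \<le> ennreal (real (card ?Q) * L powr - M)"
  proof -
    have eq: "{X. \<exists>x\<in>?Q. bad_at x L X} = {X. ball_bad \<rho> L X}" by (simp add: ball_bad_def)
    show ?thesis
      using \<open>_ \<le> ennreal (real (card ?Q) * L powr - M) * _\<close>
      unfolding emeasure_path_law[OF sets_ball_bad] eq by (simp add: emeasure_space_1)
  qed
  also have "\<dots> \<le> ennreal ((2 * \<rho> + 1) ^ CARD('d) * L powr - M)"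
    by (intro ennreal_leI mult_right_mono finite_lattice_ball(2)[OF \<rho>]) simp
  finally show ?thesis .
qed

lemma not_ball_bad_good_hit:
  assumes "\<not> ball_bad \<rho> L X" "\<exists>n. s \<le> lev (X n)" "norm (real_vec (pos s X)) \<le> \<rho>"
  shows "good_hit s L X"
proof -
  obtain n where n: "hits s n X" using assms(2) reach_iff_hits by blast
  have "\<not> bad_at (X n) L X" using assms(1,3) hits_pos[OF n] by (auto simp: ball_bad_def)
  moreover have "lev (X m) < lev (X n)" if "m < n" for m
  proof -
    have "lev (X m) < s" "s \<le> lev (X n)" using n that by (auto simp: hits_def)
    then show ?thesis by simp
  qed
  ultimately have "good L (walk_shift n X)" by (rule bad_at_first)
  with n show ?thesis by (auto simp: good_hit_def)
qed

text \<open>Bootstrap over levels: good exits up to level u - L confine the hitting position of u to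
  the ball, and inside the ball no first visit starts a bad exit, so the exit from u is good as
  well.\<close>

lemma regular_from_0:
  assumes X: "steps X" "X 0 = 0" and L: "L \<ge> 1"
    and nb: "\<not> ball_bad (C\<^sub>0 * (smax + L)) L X" and s: "0 \<le> s" "s \<le> smax"
  shows "good_hit s L X"
proof -
  have C: "C\<^sub>0 \<ge> 0" using C0_ge by simp
  have pos0: "pos 0 X = 0"
  proof -
    have "hits 0 0 X" using X by (simp add: hits_def)
    from hits_pos[OF this] X show ?thesis by simp
  qed
  have "\<forall>u. 0 \<le> u \<and> u \<le> smax \<and> u \<le> real j * L \<longrightarrow> good_hit u L X" for j
  proof (induction j)
    case 0
    show ?case
    proof (intro allI impI)
      fix u assume "0 \<le> u \<and> u \<le> smax \<and> u \<le> real 0 * L"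
      then have u: "u = 0" "smax \<ge> 0" by auto
      have ex: "\<exists>n. 0 \<le> lev (X n)" using X by (intro exI[of _ 0]) simp
      have "norm (real_vec (pos 0 X)) \<le> C\<^sub>0 * (smax + L)" using pos0 u L C by simp
      from not_ball_bad_good_hit[OF nb ex this] show "good_hit u L X" by (simp add: u)
    qed
  next
    case (Suc j)
    show ?case
    proof (intro allI impI)
      fix u assume u: "0 \<le> u \<and> u \<le> smax \<and> u \<le> real (Suc j) * L"
      show "good_hit u L X"
      proof (cases "u \<le> real j * L")
        case True
        with u Suc show ?thesis by blast
      next
        case False
        \<comment> \<open>Levels u \<le> L are reached by one exit from level 0, hence the cut-off;
          all others from level u - L.\<close>
        define v where "v = max 0 (u - L)"
        have e: "real (Suc j) * L = real j * L + L" by (simp add: algebra_simps)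
        have v: "0 \<le> v" "v \<le> u" "u \<le> v + L" using u L by (auto simp: v_def)
        have vj: "v \<le> real j * L" using u e L by (auto simp: v_def)
        have gv: "good_hit w L X" if "0 \<le> w" "w \<le> v" for w
          using Suc that v vj u by auto
        have gvv: "good_hit v L X" using gv v by simp
        have ru: "\<exists>n. u \<le> lev (X n)"
          by (rule good_hit_step(1)[OF X(1) _ gvv L v(2,3)]) (use X v in simp)
        have "norm (real_vec (pos u X)) \<le> C\<^sub>0 * (smax + L)"
        proof (cases "v = 0")
          case True
          have "norm (real_vec (pos u X - pos v X)) \<le> C\<^sub>0 * L"
            by (rule good_hit_step(2)[OF X(1) _ gvv L v(2,3)]) (use X v in simp)
          moreover have "C\<^sub>0 * L \<le> C\<^sub>0 * (smax + L)" using C u by (intro mult_left_mono) auto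
          ultimately show ?thesis using pos0 True by simp
        next
          case False
          then have uv: "u = v + L" by (auto simp: v_def)
          have "norm (real_vec (pos v X - pos 0 X)) \<le> C\<^sub>0 * (v - 0 + L)"
            using gv X by (intro good_hit_chain[OF X(1) _ L _ v(1)]) auto
          moreover have "norm (real_vec (pos u X - pos v X)) \<le> C\<^sub>0 * L"
            by (rule good_hit_step(2)[OF X(1) _ gvv L v(2,3)]) (use X v in simp)
          moreover have "norm (real_vec (pos u X)) \<le>
              norm (real_vec (pos u X - pos v X)) + norm (real_vec (pos v X - pos 0 X))"
            using norm_triangle_ineq[of "real_vec (pos u X - pos v X)" "real_vec (pos v X - pos 0 X)"]
            by (simp add: real_vec_diff pos0)
          ultimately have "norm (real_vec (pos u X)) \<le> C\<^sub>0 * (u + L)"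
            using uv by (simp add: algebra_simps)
          also have "\<dots> \<le> C\<^sub>0 * (smax + L)" using C u by (intro mult_left_mono) auto
          finally show ?thesis .
        qed
        from not_ball_bad_good_hit[OF nb ru this] show ?thesis .
      qed
    qed
  qed
  moreover obtain j :: nat where "s / L \<le> real j" using real_arch_simple by blast
  then have "s \<le> real j * L" using L by (simp add: field_simps)
  ultimately show ?thesis using s by blast
qed


section \<open>Bad blocks\<close>

lemma hits_translate: "hits s n (\<lambda>m. X m + z) \<longleftrightarrow> hits (s - lev z) n X"
  by (simp add: hits_def lev_add algebra_simps)

lemma walk_shift_translate: "walk_shift n (\<lambda>m. X m + z) = (\<lambda>m. walk_shift n X m + z)"
  by (simp add: walk_shift_def)

lemma good_hit_translate: "good_hit s L (\<lambda>m. X m + z) \<longleftrightarrow> good_hit (s - lev z) L X"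
  by (simp add: good_hit_def hits_translate walk_shift_translate good_translate)

definition blocks_bad :: "real \<Rightarrow> real \<Rightarrow> nat \<Rightarrow> (nat \<Rightarrow> int^'d) \<Rightarrow> bool" where
  "blocks_bad a b n X \<longleftrightarrow> (\<exists>j<n. \<not> good_hit (a + real j * b) b X)"

lemma blocks_bad_translate: "blocks_bad a b n (\<lambda>m. X m + z) \<longleftrightarrow> blocks_bad (a - lev z) b n X"
proof -
  have "a + real j * b - lev z = a - lev z + real j * b" for j by simp
  then show ?thesis by (simp only: blocks_bad_def good_hit_translate)
qed

lemma sets_not_good_hit: "{X. \<not> good_hit s L X} \<in> sets path_space"
proof -
  have "space path_space - {X. good_hit s L X} \<in> sets path_space" by (rule sets.compl_sets[OF sets_good_hit])
  moreover have "space path_space - {X. good_hit s L X} = {X. \<not> good_hit s L X}" by auto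
  ultimately show ?thesis by simp
qed

lemma sets_blocks_bad: "{X. blocks_bad a b n X} \<in> sets path_space"
proof -
  have "{X. blocks_bad a b n X} = (\<Union>j\<in>{..<n}. {X. \<not> good_hit (a + real j * b) b X})"
    by (auto simp: blocks_bad_def)
  also have "\<dots> \<in> sets path_space" by (intro sets.countable_UN'' sets_not_good_hit) auto
  finally show ?thesis .
qed

lemma blocks_bad_future:
  assumes "b \<ge> 0"
  shows "future a (indicator {X. blocks_bad a b n X} :: _ \<Rightarrow> real)"
  unfolding future_def
proof (intro allI impI)
  fix X :: "nat \<Rightarrow> int^'d" assume "lev (X 0) < a"
  then have "lev (X 0) < a + real j * b" for j
    using assms by (smt (verit) mult_nonneg_nonneg of_nat_0_le_iff)
  from good_hit_future[where X=X, OF this] have "blocks_bad a b n (walk_shift 1 X) = blocks_bad a b n X"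
    by (simp add: blocks_bad_def)
  then show "indicator {X. blocks_bad a b n X} (walk_shift 1 X) = (indicator {X. blocks_bad a b n X} X :: real)"
    by (simp add: indicator_def)
qed

definition C\<^sub>3 :: real where "C\<^sub>3 = 1 + real CARD('d) / \<alpha>"

lemma C3_ge: "C\<^sub>3 \<ge> 1" using \<alpha> by (simp add: C\<^sub>3_def)

lemma in_cone_norm:
  assumes "in_cone r x" "r \<ge> 0"
  shows "norm (real_vec x) \<le> C\<^sub>3 * lev x"
proof -
  have l0: "0 \<le> lev x" using assms by (simp add: in_cone_def)
  have "(\<Sum>i\<in>UNIV - {k}. \<bar>tau i x\<bar>) \<le> (\<Sum>i\<in>UNIV - {k}. lev x / \<alpha>)"
  proof (rule sum_mono)
    fix i assume "i \<in> UNIV - {k}"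
    then have "\<alpha> * \<bar>tau i x\<bar> \<le> lev x - r / 2" using assms by (simp add: in_cone_def)
    then have "\<alpha> * \<bar>tau i x\<bar> \<le> lev x" using assms(2) by simp
    then show "\<bar>tau i x\<bar> \<le> lev x / \<alpha>" using \<alpha> by (simp add: field_simps)
  qed
  also have "\<dots> = real (card (UNIV - {k})) * (lev x / \<alpha>)" by (rule sum_constant)
  also have "\<dots> \<le> real CARD('d) * (lev x / \<alpha>)"
    using l0 \<alpha> by (intro mult_right_mono) (auto simp: card_Diff_subset)
  finally show ?thesis using norm_le_lev_tau[of x] l0 by (simp add: C\<^sub>3_def distrib_right)
qed

text \<open>A ball of radius of order b^2 has of order b^(2d) sites, and M \<ge> 2d + 1 leaves a
  factor 1/b after the union bound at size b.\<close>

lemma ball_weight: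
  assumes C: "C \<ge> 1" and b: "b \<ge> 1"
  shows "(2 * (4 * C * b\<^sup>2) + 1) ^ CARD('d) * b powr - M \<le> (9 * C) ^ CARD('d) / b"
proof -
  have b2: "b\<^sup>2 \<ge> 1" using b by simp
  then have "1 * 1 \<le> C * b\<^sup>2" using C by (intro mult_mono) auto
  then have "(2 * (4 * C * b\<^sup>2) + 1) ^ CARD('d) \<le> (9 * C * b\<^sup>2) ^ CARD('d)"
    using C by (intro power_mono) auto
  then have "(2 * (4 * C * b\<^sup>2) + 1) ^ CARD('d) * b powr - M \<le> (9 * C * b\<^sup>2) ^ CARD('d) * b powr - M"
    by (rule mult_right_mono) simp
  also have "\<dots> = (9 * C) ^ CARD('d) * (b powr real (2 * CARD('d)) * b powr - M)"
  proof -
    have "(9 * C * b\<^sup>2) ^ CARD('d) = (9 * C) ^ CARD('d) * (b\<^sup>2) ^ CARD('d)" by (rule power_mult_distrib)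
    also have "(b\<^sup>2) ^ CARD('d) = b ^ (2 * CARD('d))" by (rule power_mult[symmetric])
    also have "\<dots> = b powr real (2 * CARD('d))" using b by (intro powr_realpow[symmetric]) simp
    finally show ?thesis by (simp only: mult.assoc)
  qed
  also have "b powr real (2 * CARD('d)) * b powr - M = b powr (real (2 * CARD('d)) - M)"
    by (simp add: powr_add[symmetric])
  also have "b powr (real (2 * CARD('d)) - M) \<le> b powr -1"
  proof (rule powr_mono[OF _ b])
    have "real (2 * CARD('d)) = 2 * real CARD('d)" by simp
    then show "real (2 * CARD('d)) - M \<le> -1" using M d_ge_1 by linarith
  qed
  also have "b powr -1 = 1 / b" using b by (simp add: powr_minus_divide)
  finally show ?thesis using C by (simp add: mult_left_mono)
qed

text \<open>From a start at height r above z, the cone confines all hitting positions up to height 4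
  b^2 to a ball of radius of order b^2, whatever the environment below z. Inside this ball a union
  bound at size b applies, and n \<le> b blocks stay below that height.\<close>

lemma blocks_bad_cone:
  fixes n m :: nat
  assumes r: "r = real m * nz" "r \<ge> 40" "r \<ge> 4 * L\<^sub>0" and b: "b \<ge> L\<^sub>0" and n: "real n \<le> b"
    and \<delta>: "b + 1 \<le> a - lev z" "r \<le> a - lev z" "a - lev z \<le> 2 * b"
    and f: "f \<in> borel_measurable (env_sigma (half_space l z))"
  shows "(\<integral>\<^sup>+\<omega>. f \<omega> * emeasure (quenched \<omega> (z + sum_list (fwd_path m))) {X. blocks_bad a b n X} \<partial>\<P>) \<le>
    ennreal (C\<^sub>2 / r + (9 * C\<^sub>3) ^ CARD('d) / b) * (\<integral>\<^sup>+\<omega>. f \<omega> \<partial>\<P>)"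
proof -
  let ?p = "sum_list (fwd_path m)" and ?E = "{X. blocks_bad a b n X} :: (nat \<Rightarrow> int^'d) set"
  let ?E' = "{X. blocks_bad (a - lev z) b n X} :: (nat \<Rightarrow> int^'d) set"
  define \<delta>' where "\<delta>' = a - lev z"
  have b1: "b \<ge> 1" using b L0 by simp
  have Em: "(indicator ?E :: _ \<Rightarrow> ennreal) \<in> borel_measurable path_space"
    using sets_blocks_bad by simp
  obtain f' where f': "f' \<in> borel_measurable (env_sigma (half_space l 0))"
    and ff': "(\<integral>\<^sup>+\<omega>. f' \<omega> \<partial>\<P>) = (\<integral>\<^sup>+\<omega>. f \<omega> \<partial>\<P>)"
    and eq: "(\<integral>\<^sup>+\<omega>. f \<omega> * (\<integral>\<^sup>+X. indicator ?E X \<partial>quenched \<omega> (z + ?p)) \<partial>\<P>) =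
      (\<integral>\<^sup>+\<omega>. f' \<omega> * (\<integral>\<^sup>+X. indicator ?E (\<lambda>m. X m + z) \<partial>quenched \<omega> ?p) \<partial>\<P>)"
    using forward_start_shift[OF Em f, of ?p] by blast
  define \<rho> where "\<rho> = 4 * C\<^sub>3 * b\<^sup>2"
  have \<rho>0: "\<rho> \<ge> 0" using C3_ge by (simp add: \<rho>_def)
  \<comment> \<open>The lower bound on the height keeps boxes of size b clear of the half-space that
    carries the weight.\<close>
  define Q where "Q = {x :: int^'d. norm (real_vec x) \<le> \<rho> \<and> b + 1 \<le> lev x}"
  have Qsub: "Q \<subseteq> {x. norm (real_vec x) \<le> \<rho>}" by (auto simp: Q_def)
  have Qfin: "finite Q" using finite_subset[OF Qsub finite_lattice_ball(1)[OF \<rho>0]] .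
  have Qcard: "real (card Q) \<le> (2 * \<rho> + 1) ^ CARD('d)"
    by (rule order_trans[OF _ finite_lattice_ball(2)[OF \<rho>0]])
      (use card_mono[OF finite_lattice_ball(1)[OF \<rho>0] Qsub] in simp)
  let ?V = "{X. \<exists>x\<in>Q. bad_at x b X} :: (nat \<Rightarrow> int^'d) set"
  have Vm: "?V \<in> sets path_space"
  proof -
    have "?V = (\<Union>x\<in>Q. {X. bad_at x b X})" by auto
    also have "\<dots> \<in> sets path_space" by (intro sets.countable_UN'' sets_bad_at) auto
    finally show ?thesis .
  qed
  have det: "AE X in quenched \<omega> ?p. X \<in> ?E' \<longrightarrow> X \<in> {X. cone_bad r X} \<union> ?V"
    if \<omega>: "\<omega> \<in> space env_space" for \<omega>
    using AE_steps[OF \<omega>, of ?p]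
  proof eventually_elim
    case (elim X)
    show ?case
    proof
      assume "X \<in> ?E'"
      then obtain j where j: "j < n" "\<not> good_hit (\<delta>' + real j * b) b X" by (auto simp: blocks_bad_def \<delta>'_def)
      define s where "s = \<delta>' + real j * b"
      have jb: "0 \<le> real j * b" "real j * b \<le> b * b"
        using j(1) n b1 by (auto intro!: mult_right_mono)
      have s: "\<delta>' \<le> s" "s + 1 \<le> 4 * b\<^sup>2"
      proof -
        show "\<delta>' \<le> s" using jb by (simp add: s_def)
        have "b * 1 \<le> b * b" "1 * 1 \<le> b * b" using b1 by (intro mult_mono; simp)+
        then show "s + 1 \<le> 4 * b\<^sup>2" using jb \<delta>(3) by (simp add: s_def \<delta>'_def power2_eq_square)
      qed
      show "X \<in> {X. cone_bad r X} \<union> ?V"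
      proof (cases "cone_bad r X")
        case False
        have X0: "lev (X 0) = r" "\<And>i. i \<noteq> k \<Longrightarrow> tau i (X 0) = 0"
          using elim by (simp_all add: lev_fwd_path tau_fwd_path r(1))
        have cone: "in_cone r (X i)" for i by (rule cone_good_path(1)[OF r(2) X0 False])
        have "\<exists>i. s \<le> lev (X i)" by (rule cone_good_path(2)[OF r(2) X0 False])
        then obtain i where i: "hits s i X" using reach_iff_hits by blast
        have "lev (X i) < s + 1"
          using hits_lev_less[OF _ _ i] elim X0(1) \<delta>(2) s(1) by (simp add: \<delta>'_def)
        then have "C\<^sub>3 * lev (X i) \<le> C\<^sub>3 * (4 * b\<^sup>2)" using C3_ge s by (intro mult_left_mono) auto
        then have "norm (real_vec (X i)) \<le> \<rho>"
          using in_cone_norm[OF cone, of i] r(2) by (simp add: \<rho>_def)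
        moreover have "b + 1 \<le> lev (X i)" using i s(1) \<delta>(1) by (simp add: hits_def \<delta>'_def)
        ultimately have XQ: "X i \<in> Q" by (simp add: Q_def)
        have "bad_at (X i) b X"
        proof (rule ccontr)
          assume "\<not> bad_at (X i) b X"
          moreover have "lev (X u) < lev (X i)" if "u < i" for u
          proof -
            have "lev (X u) < s" "s \<le> lev (X i)" using i that by (auto simp: hits_def)
            then show ?thesis by simp
          qed
          ultimately have "good b (walk_shift i X)" by (rule bad_at_first)
          with i j(2) show False by (auto simp: good_hit_def s_def)
        qed
        with XQ show ?thesis by auto
      qed simp
    qed
  qed
  have qm: "(\<lambda>\<omega>. emeasure (quenched \<omega> ?p) E) \<in> borel_measurable \<P>" if "E \<in> sets path_space" for E
    unfolding mP by (rule measurable_emeasure_quenched[OF that])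
  have f'm: "f' \<in> borel_measurable \<P>" unfolding mP by (rule measurable_env_sigma_space[OF f'])
  have "(\<integral>\<^sup>+\<omega>. f \<omega> * emeasure (quenched \<omega> (z + ?p)) ?E \<partial>\<P>) =
    (\<integral>\<^sup>+\<omega>. f \<omega> * (\<integral>\<^sup>+X. indicator ?E X \<partial>quenched \<omega> (z + ?p)) \<partial>\<P>)"
    using sets_blocks_bad by (intro nn_integral_cong) (simp add: sets_quenched spP)
  also have "\<dots> = (\<integral>\<^sup>+\<omega>. f' \<omega> * emeasure (quenched \<omega> ?p) ?E' \<partial>\<P>)"
  proof (unfold eq, rule nn_integral_cong)
    fix \<omega> assume "\<omega> \<in> space \<P>"
    then have \<omega>: "\<omega> \<in> space env_space" by (simp add: spP)
    have "(\<integral>\<^sup>+X. indicator ?E (\<lambda>m. X m + z) \<partial>quenched \<omega> ?p) = (\<integral>\<^sup>+X. indicator ?E' X \<partial>quenched \<omega> ?p)"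
      by (intro nn_integral_cong) (simp add: indicator_def blocks_bad_translate)
    also have "\<dots> = emeasure (quenched \<omega> ?p) ?E'"
      using sets_blocks_bad by (simp add: sets_quenched[OF \<omega>])
    finally show "f' \<omega> * (\<integral>\<^sup>+X. indicator ?E (\<lambda>m. X m + z) \<partial>quenched \<omega> ?p) =
      f' \<omega> * emeasure (quenched \<omega> ?p) ?E'" by simp
  qed
  also have "\<dots> \<le> (\<integral>\<^sup>+\<omega>. f' \<omega> * emeasure (quenched \<omega> ?p) {X. cone_bad r X} +
      f' \<omega> * emeasure (quenched \<omega> ?p) ?V \<partial>\<P>)"
  proof (rule nn_integral_mono)
    fix \<omega> assume "\<omega> \<in> space \<P>"
    then have \<omega>: "\<omega> \<in> space env_space" by (simp add: spP)
    have "emeasure (quenched \<omega> ?p) ?E' \<le> emeasure (quenched \<omega> ?p) ({X. cone_bad r X} \<union> ?V)"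
      by (rule emeasure_mono_AE[OF det[OF \<omega>]]) (use Vm sets_cone_bad in \<open>auto simp: sets_quenched[OF \<omega>]\<close>)
    also have "\<dots> \<le> emeasure (quenched \<omega> ?p) {X. cone_bad r X} + emeasure (quenched \<omega> ?p) ?V"
      by (rule emeasure_subadditive) (use Vm sets_cone_bad in \<open>auto simp: sets_quenched[OF \<omega>]\<close>)
    finally show "f' \<omega> * emeasure (quenched \<omega> ?p) ?E' \<le>
      f' \<omega> * emeasure (quenched \<omega> ?p) {X. cone_bad r X} + f' \<omega> * emeasure (quenched \<omega> ?p) ?V"
      by (simp add: distrib_left[symmetric] mult_left_mono)
  qed
  also have "\<dots> = (\<integral>\<^sup>+\<omega>. f' \<omega> * emeasure (quenched \<omega> ?p) {X. cone_bad r X} \<partial>\<P>) +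
      (\<integral>\<^sup>+\<omega>. f' \<omega> * emeasure (quenched \<omega> ?p) ?V \<partial>\<P>)"
    by (intro nn_integral_add borel_measurable_times_ennreal f'm qm sets_cone_bad Vm)
  also have "\<dots> \<le> ennreal (C\<^sub>2 / r) * (\<integral>\<^sup>+\<omega>. f' \<omega> \<partial>\<P>) +
      ennreal (real (card Q) * b powr - M) * (\<integral>\<^sup>+\<omega>. f' \<omega> \<partial>\<P>)"
    by (intro add_mono cone_bad_bound[OF r(2,3) f'] union_finite[OF Qfin b _ _ f']) (auto simp: Q_def)
  also have "\<dots> \<le> ennreal (C\<^sub>2 / r) * (\<integral>\<^sup>+\<omega>. f' \<omega> \<partial>\<P>) +
      ennreal ((9 * C\<^sub>3) ^ CARD('d) / b) * (\<integral>\<^sup>+\<omega>. f' \<omega> \<partial>\<P>)"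
  proof (intro add_left_mono mult_right_mono ennreal_leI)
    have "real (card Q) * b powr - M \<le> (2 * \<rho> + 1) ^ CARD('d) * b powr - M"
      by (intro mult_right_mono Qcard) simp
    also have "\<dots> \<le> (9 * C\<^sub>3) ^ CARD('d) / b" unfolding \<rho>_def by (rule ball_weight[OF C3_ge b1])
    finally show "real (card Q) * b powr - M \<le> (9 * C\<^sub>3) ^ CARD('d) / b" .
  qed simp
  also have "\<dots> = ennreal (C\<^sub>2 / r + (9 * C\<^sub>3) ^ CARD('d) / b) * (\<integral>\<^sup>+\<omega>. f' \<omega> \<partial>\<P>)"
    using C2_pos C3_ge r b1 by (subst ennreal_plus) (auto simp: distrib_right)
  finally show ?thesis unfolding ff' .
qed

lemma nz_le: "nz \<le> real (length base_path)"
proof -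
  have "lev (sum_list es) \<le> real (length es)" if "set es \<subseteq> forward_steps l" for es
    using that
  proof (induction es)
    case (Cons e es)
    have "e \<in> unit_steps" using Cons.prems forward_steps_unit by auto
    then have "lev e \<le> 1" using unit_step_lev[of e] by simp
    then show ?case using Cons by (simp add: lev_add)
  qed simp
  from this[OF base_path(1)] show ?thesis by (simp add: base_path(2) lev_z0)
qed

text \<open>For large a the ball around the origin that contains the hitting positions has too many
  sites for a union bound at size b. Applying \<open>key_bound\<close> with constant past functional
  restarts the count near level a - 2 b, which makes the bound uniform in a.\<close>

lemma blocks_bad_far:
  fixes n m I :: nat
  assumes r: "r = real m * nz" "r \<ge> 40" "r \<ge> 4 * L\<^sub>0" and b: "b \<ge> L\<^sub>0" and n: "real n \<le> b"
    and I: "I > 0" "real I \<le> b - 1" "real (length (fwd_path m)) \<le> b" and a: "a \<ge> 2 * b"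
  shows "emeasure (path_law 0) {X. blocks_bad a b n X} \<le>
    ennreal (C\<^sub>2 / r + (9 * C\<^sub>3) ^ CARD('d) / b + sqrt (insens (length (fwd_path m)) / real I))"
proof -
  let ?G = "indicator {X. blocks_bad a b n X} :: (nat \<Rightarrow> int^'d) \<Rightarrow> real"
  have b1: "b \<ge> 1" using b L0 by simp
  have m0: "m > 0" using r by (cases m) auto
  interpret Q: prob_space "path_law 0" by (rule prob_space_path_law)
  have G: "?G \<in> borel_measurable path_space" using sets_blocks_bad by simp
  have Gi: "ennreal (?G X) = indicator {X. blocks_bad a b n X} X" for X by (simp add: indicator_def)
  have len: "real m * nz \<le> real (length (fwd_path m))"
    using mult_left_mono[OF nz_le, of "real m"] by (simp add: fwd_path(2))
  let ?B = "C\<^sub>2 / r + (9 * C\<^sub>3) ^ CARD('d) / b"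
  have B0: "?B \<ge> 0" using C2_pos C3_ge r b1 by simp
  have "(\<integral>\<^sup>+X. 1 * ennreal (?G X) \<partial>path_law 0) \<le>
    ennreal ?B * (\<integral>\<^sup>+X. 1 \<partial>path_law 0) + ennreal (1 * sqrt (insens (length (fwd_path m)) / real I))"
  \<comment> \<open>The window of I \<le> b - 1 levels above a - 2 b keeps z between b + 1 and 2 b
    levels below a, as \<open>blocks_bad_cone\<close> requires.\<close>
  proof (rule key_bound[where a="a - 2 * b" and A=a])
    show "future a ?G" by (rule blocks_bad_future) (use b1 in simp)
    show "adapted (a - 2 * b) (\<lambda>_. 1)" by (simp add: adapted_def)
    show "a - 2 * b + real I + real (length (fwd_path m)) \<le> a" using I b1 by simp
    fix z and f :: "'d env \<Rightarrow> ennreal"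
    assume z: "a - 2 * b \<le> lev z" "lev z < a - 2 * b + real I"
      and f: "f \<in> borel_measurable (env_sigma (half_space l z))"
    have "(\<integral>\<^sup>+\<omega>. f \<omega> * (\<integral>\<^sup>+X. ennreal (?G X) \<partial>quenched \<omega> (z + sum_list (fwd_path m))) \<partial>\<P>) =
      (\<integral>\<^sup>+\<omega>. f \<omega> * emeasure (quenched \<omega> (z + sum_list (fwd_path m))) {X. blocks_bad a b n X} \<partial>\<P>)"
      unfolding Gi using sets_blocks_bad by (intro nn_integral_cong) (simp add: sets_quenched spP)
    also have "\<dots> \<le> ennreal ?B * (\<integral>\<^sup>+\<omega>. f \<omega> \<partial>\<P>)"
      by (rule blocks_bad_cone[OF r b n _ _ _ f]) (use z I len r(1) b1 in auto)
    finally show "(\<integral>\<^sup>+\<omega>. f \<omega> * (\<integral>\<^sup>+X. ennreal (?G X) \<partial>quenched \<omega> (z + sum_list (fwd_path m))) \<partial>\<P>) \<le>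
      ennreal ?B * (\<integral>\<^sup>+\<omega>. f \<omega> \<partial>\<P>)" .
  qed (use I a G fwd_path m0 in auto)
  then have "emeasure (path_law 0) {X. blocks_bad a b n X} \<le>
    ennreal ?B + ennreal (sqrt (insens (length (fwd_path m)) / real I))"
    unfolding Gi using sets_blocks_bad Q.emeasure_space_1 by (simp add: sets_path_law)
  also have "\<dots> = ennreal (?B + sqrt (insens (length (fwd_path m)) / real I))"
    using B0 \<kappa> by (intro ennreal_plus[symmetric]) (auto simp: insens_def)
  finally show ?thesis .
qed

text \<open>Here the start is the origin itself, and \<open>regular_from_0\<close> confines the
  hitting positions to a ball of radius of order b^2.\<close>

lemma blocks_bad_near:
  fixes n :: nat
  assumes b: "b \<ge> L\<^sub>0" and n: "real n \<le> b" and a: "0 \<le> a" "a \<le> 2 * b"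
  shows "emeasure (path_law 0) {X. blocks_bad a b n X} \<le> ennreal ((9 * C\<^sub>0) ^ CARD('d) / b)"
proof -
  have b1: "b \<ge> 1" using b L0 by simp
  define \<rho> where "\<rho> = 4 * C\<^sub>0 * b\<^sup>2"
  have bb: "b * 1 \<le> b * b" using b1 by (intro mult_left_mono) auto
  \<comment> \<open>\<open>\<rho> / C\<^sub>0 - b\<close> is the value of \<open>smax\<close> for
    which the ball in \<open>regular_from_0\<close> has radius \<rho>.\<close>
  have sm: "C\<^sub>0 * ((\<rho> / C\<^sub>0 - b) + b) = \<rho>" using C0_ge by simp
  have "AE X in path_law 0. X \<in> {X. blocks_bad a b n X} \<longrightarrow> X \<in> {X. ball_bad \<rho> b X}"
    using AE_start[of 0]
  proof eventually_elim
    case (elim X)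
    have "good_hit (a + real j * b) b X" if nb: "\<not> ball_bad \<rho> b X" and j: "j < n" for j
    proof (rule regular_from_0[where smax="\<rho> / C\<^sub>0 - b"])
      show "\<not> ball_bad (C\<^sub>0 * (\<rho> / C\<^sub>0 - b + b)) b X" using nb sm by simp
      show "0 \<le> a + real j * b" using a b1 by simp
      have "real j * b \<le> b * b" using j n b1 by (intro mult_right_mono) auto
      then show "a + real j * b \<le> \<rho> / C\<^sub>0 - b"
        using a bb C0_ge by (simp add: \<rho>_def power2_eq_square)
    qed (use elim b1 in auto)
    then show ?case by (auto simp: blocks_bad_def)
  qed
  then have "emeasure (path_law 0) {X. blocks_bad a b n X} \<le> emeasure (path_law 0) {X. ball_bad \<rho> b X}"
    by (rule emeasure_mono_AE) (simp add: sets_path_law sets_ball_bad)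
  also have "\<dots> \<le> ennreal ((2 * \<rho> + 1) ^ CARD('d) * b powr - M)"
    by (rule ball_bad_bound[OF _ b]) (use C0_ge in \<open>simp add: \<rho>_def\<close>)
  also have "\<dots> \<le> ennreal ((9 * C\<^sub>0) ^ CARD('d) / b)"
    unfolding \<rho>_def using C0_ge by (intro ennreal_leI ball_weight[OF _ b1]) auto
  finally show ?thesis .
qed

text \<open>The constant \<open>\<gamma>\<close> lets the length of the gap at scale \<open>2 ^ j\<close> grow linearly in \<open>j\<close> while
  \<open>insens\<close> of the corresponding path stays below \<open>2 powr (j / 2)\<close>.\<close>

definition \<gamma> :: real where "\<gamma> = ln 2 / (2 * real (length base_path) * (2 + ln (1 / \<kappa>)))"

definition reps :: "nat \<Rightarrow> nat" where "reps j = nat \<lfloor>\<gamma> * real j\<rfloor>"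

lemma ell_pos: "real (length base_path) \<ge> 1" using base_path(3) by (cases base_path) auto

lemma ln_inverse_kappa_nonneg: "ln (1 / \<kappa>) \<ge> 0" using \<kappa> by simp

lemma \<gamma>_pos: "\<gamma> > 0"
  unfolding \<gamma>_def using ell_pos ln_inverse_kappa_nonneg by (intro divide_pos_pos mult_pos_pos) auto

lemma reps_le: "real (reps j) \<le> \<gamma> * real j"
  unfolding reps_def using \<gamma>_pos by (simp add: of_nat_nat)

lemma reps_ge: "\<gamma> * real j - 1 \<le> real (reps j)"
proof -
  have "\<gamma> * real j \<ge> 0" using \<gamma>_pos by simp
  then show ?thesis unfolding reps_def by linarith
qed

lemma length_reps: "real (length (fwd_path (reps j))) \<le> \<gamma> * real (length base_path) * real j"
proof -
  have "real (length (fwd_path (reps j))) = real (reps j) * real (length base_path)" by (simp add: fwd_path(2))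
  also have "\<dots> \<le> \<gamma> * real j * real (length base_path)" by (intro mult_right_mono reps_le) simp
  finally show ?thesis by (simp add: mult_ac)
qed

lemma \<gamma>_ell: "\<gamma> * real (length base_path) * (2 + ln (1 / \<kappa>)) = ln 2 / 2"
proof -
  have "real (length base_path) \<noteq> 0" "2 + ln (1 / \<kappa>) \<noteq> 0" using ell_pos ln_inverse_kappa_nonneg by linarith+
  moreover have "u / (2 * x * y) * x * y = u / 2" if "x \<noteq> 0" "y \<noteq> 0" for u x y :: real
    using that by simp
  ultimately show ?thesis unfolding \<gamma>_def by blast
qed

lemma length_reps_le: "real (length (fwd_path (reps j))) \<le> real j / 4"
proof -
  have "\<gamma> * real (length base_path) * 2 \<le> \<gamma> * real (length base_path) * (2 + ln (1 / \<kappa>))"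
    using \<gamma>_pos ln_inverse_kappa_nonneg by (intro mult_left_mono) auto
  then have "\<gamma> * real (length base_path) \<le> 1 / 4"
    unfolding \<gamma>_ell using ln_2_less_1 by simp
  then have "\<gamma> * real (length base_path) * real j \<le> 1 / 4 * real j" by (rule mult_right_mono) simp
  then show ?thesis using length_reps[of j] by simp
qed

lemma insens_reps: "insens (length (fwd_path (reps j))) \<le> 2 powr (real j / 2)"
proof -
  define n where "n = length (fwd_path (reps j))"
  \<comment> \<open>From n \<le> exp n the cost is at most exp (n (2 + ln (1/\<kappa>))); this is
    the origin of the last factor in the denominator of \<gamma>.\<close>
  have "(real n)\<^sup>2 \<le> exp (real n) ^ 2"
  proof (rule power_mono)
    show "real n \<le> exp (real n)" using exp_ge_add_one_self[of "real n"] by linarith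
  qed simp
  also have "\<dots> = exp (2 * real n)" by (simp add: exp_double)
  finally have n2: "(real n)\<^sup>2 \<le> exp (2 * real n)" .
  have kn: "1 / \<kappa> ^ n = exp (real n * ln (1 / \<kappa>))"
    using \<kappa> by (simp add: exp_of_nat_mult power_one_over)
  have "insens n = (real n)\<^sup>2 * (1 / \<kappa> ^ n)" by (simp add: insens_def)
  also have "\<dots> \<le> exp (2 * real n) * (1 / \<kappa> ^ n)" using n2 \<kappa> by (intro mult_right_mono) auto
  also have "\<dots> = exp (real n * (2 + ln (1 / \<kappa>)))"
    unfolding kn by (simp add: exp_add[symmetric] algebra_simps)
  also have "\<dots> \<le> exp (\<gamma> * real (length base_path) * real j * (2 + ln (1 / \<kappa>)))"
    using length_reps[of j] ln_inverse_kappa_nonneg unfolding n_def by (simp add: mult_right_mono)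
  also have "\<gamma> * real (length base_path) * real j * (2 + ln (1 / \<kappa>)) = real j / 2 * ln 2"
    using \<gamma>_ell by (simp add: mult_ac)
  also have "exp (real j / 2 * ln 2) = 2 powr (real j / 2)" by (simp add: powr_def)
  finally show ?thesis by (simp add: n_def)
qed

text \<open>With 2^(j-2) levels to share it, the cost 2^(j/2) of the gap leaves an error of order
  2^(-j/4).\<close>

lemma sqrt_ins_reps:
  assumes j: "j \<ge> 2"
  shows "sqrt (insens (length (fwd_path (reps j))) / real (2 ^ (j - 2))) \<le> 2 * 2 powr (- real j / 4)"
proof -
  have e: "real (2 ^ (j - 2)) = 2 powr (real j - 2)"
    using j by (simp add: powr_realpow[symmetric] of_nat_diff)
  have "insens (length (fwd_path (reps j))) / real (2 ^ (j - 2)) \<le> 2 powr (real j / 2) / 2 powr (real j - 2)"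
    unfolding e using insens_reps[of j] by (intro divide_right_mono) auto
  also have "\<dots> = (2 * 2 powr (- real j / 4))\<^sup>2"
  proof -
    have "(2 * 2 powr (- real j / 4))\<^sup>2 = 2 powr 2 * (2 powr (- real j / 4) * 2 powr (- real j / 4))"
      by (simp add: power2_eq_square)
    also have "\<dots> = 2 powr (2 + (- real j / 4 + - real j / 4))" by (simp only: powr_add[symmetric])
    also have "2 + (- real j / 4 + - real j / 4) = real j / 2 - (real j - 2)" by simp
    also have "2 powr (real j / 2 - (real j - 2)) = 2 powr (real j / 2) / 2 powr (real j - 2)"
      by (rule powr_diff)
    finally show ?thesis by (rule sym)
  qed
  finally show ?thesis by (rule real_le_lsqrt[rotated -1]) auto
qed

text \<open>The summands bound, in units of 1/j, the escape from the cone when r is of order j, the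
  union bounds far from and near the origin, and the insensitivity error.\<close>

definition C\<^sub>4 :: real where
  "C\<^sub>4 = 2 * C\<^sub>2 / (\<gamma> * nz) + (9 * C\<^sub>3) ^ CARD('d) + (9 * C\<^sub>0) ^ CARD('d) + 12"

lemma C4_pos: "C\<^sub>4 > 0"
  unfolding C\<^sub>4_def using C2_pos \<gamma>_pos nz_pos C3_ge C0_ge by (intro add_nonneg_pos) auto

text \<open>The gap has a length of order j, the logarithm of the block size, so escaping from its
  cone is bounded by order 1/j; this term determines the rate. Uniformity in a is what lets
  \<open>mean_chain\<close> apply the bound to blocks at every level.\<close>

lemma blocks_bad_bound:
  obtains j\<^sub>1 where "j\<^sub>1 \<ge> 4" "\<And>j a n. j \<ge> j\<^sub>1 \<Longrightarrow> 0 \<le> a \<Longrightarrow> n \<le> 2 ^ j \<Longrightarrow>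
    emeasure (path_law 0) {X. blocks_bad a (2 ^ j) n X} \<le> ennreal (C\<^sub>4 / real j)"
proof -
  \<comment> \<open>The thresholds make the number of repetitions at least \<gamma> j / 2, the
    height r of the forward path at least 40 and at least 4 \<open>L\<^sub>0\<close>, and the block
    size at least \<open>L\<^sub>0\<close>.\<close>
  define j\<^sub>1 where "j\<^sub>1 = nat \<lceil>max (max 4 (2 / \<gamma>)) (max (80 / (\<gamma> * nz)) (max (8 * L\<^sub>0 / (\<gamma> * nz)) L\<^sub>0))\<rceil>"
  show ?thesis
  proof (rule that[of j\<^sub>1])
    show "j\<^sub>1 \<ge> 4" unfolding j\<^sub>1_def by linarith
    fix j n :: nat and a :: real assume j: "j \<ge> j\<^sub>1" and a: "0 \<le> a" and n: "n \<le> 2 ^ j"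
    have "real j \<ge> max (max 4 (2 / \<gamma>)) (max (80 / (\<gamma> * nz)) (max (8 * L\<^sub>0 / (\<gamma> * nz)) L\<^sub>0))"
      using j unfolding j\<^sub>1_def by linarith
    then have j4: "real j \<ge> 4" and j2: "real j \<ge> 2 / \<gamma>" and j80: "real j \<ge> 80 / (\<gamma> * nz)"
      and j8: "real j \<ge> 8 * L\<^sub>0 / (\<gamma> * nz)" and jL: "real j \<ge> L\<^sub>0" by auto
    have gn: "\<gamma> * nz > 0" using \<gamma>_pos nz_pos by simp
    define r where "r = real (reps j) * nz"
    have "\<gamma> * real j / 2 \<le> real (reps j)"
      using reps_ge[of j] j2 \<gamma>_pos by (simp add: field_simps)
    then have rj: "r \<ge> \<gamma> * nz * real j / 2"
      unfolding r_def using nz_pos by (simp add: mult_right_mono[of _ _ nz] field_simps)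
    have r: "r \<ge> 40" "r \<ge> 4 * L\<^sub>0" using rj j80 j8 gn by (auto simp: field_simps)
    have bj: "real j \<le> 2 ^ j" using of_nat_less_two_power[of j, where 'a=real] by simp
    have b: "(2::real) ^ j \<ge> L\<^sub>0" using bj jL by linarith
    have nb: "real n \<le> 2 ^ j" using n by (metis of_nat_le_iff of_nat_numeral of_nat_power)
    have inv: "1 / (2::real) ^ j \<le> 1 / real j" using bj j4 by (intro divide_left_mono) auto
    have pw: "u / 2 ^ j \<le> u / real j" if "u \<ge> 0" for u :: real
      using mult_left_mono[OF inv that] by simp
    show "emeasure (path_law 0) {X. blocks_bad a (2 ^ j) n X} \<le> ennreal (C\<^sub>4 / real j)"
    proof (cases "a \<ge> 2 * 2 ^ j")
      case True
      have jn: "j \<ge> 2" using j4 by simp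
      have I: "real (2 ^ (j - 2)) = 2 ^ j / 4"
      proof -
        obtain i where "j = i + 2" using jn by (metis le_add_diff_inverse2)
        then show ?thesis by (simp add: power_add)
      qed
      have b4: "(2::real) ^ j \<ge> 4" using bj j4 by linarith
      have "emeasure (path_law 0) {X. blocks_bad a (2 ^ j) n X} \<le>
        ennreal (C\<^sub>2 / r + (9 * C\<^sub>3) ^ CARD('d) / 2 ^ j + sqrt (insens (length (fwd_path (reps j))) / real (2 ^ (j - 2))))"
      proof (rule blocks_bad_far[OF r_def r b nb _ _ _ True])
        show "real (2 ^ (j - 2)) \<le> 2 ^ j - 1" unfolding I using b4 by simp
        show "real (length (fwd_path (reps j))) \<le> 2 ^ j" using length_reps_le[of j] bj j4 by linarith
      qed simp
      also have "\<dots> \<le> ennreal (C\<^sub>4 / real j)"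
      proof (rule ennreal_leI)
        have 1: "C\<^sub>2 / r \<le> 2 * C\<^sub>2 / (\<gamma> * nz) / real j"
        proof -
          have "C\<^sub>2 / r \<le> C\<^sub>2 / (\<gamma> * nz * real j / 2)"
            using rj r C2_pos gn j4 by (intro divide_left_mono) (auto intro!: mult_pos_pos)
          then show ?thesis by (simp add: field_simps)
        qed
        have 2: "(9 * C\<^sub>3) ^ CARD('d) / 2 ^ j \<le> (9 * C\<^sub>3) ^ CARD('d) / real j"
          using C3_ge by (intro pw) simp
        have 3: "sqrt (insens (length (fwd_path (reps j))) / real (2 ^ (j - 2))) \<le> 12 / real j"
        proof -
          have "real j / 4 * ln 2 \<le> exp (real j / 4 * ln 2)"
            using exp_ge_add_one_self[of "real j / 4 * ln 2"] by linarith
          then have e: "real j / 4 * ln 2 \<le> 2 powr (real j / 4)" by (simp add: powr_def)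
          have "real j / 4 * (2 / 3) \<le> real j / 4 * ln 2" using ln2_ge_two_thirds by (intro mult_left_mono) auto
          then have "real j / 6 \<le> 2 powr (real j / 4)" using e by linarith
          then have "2 / 2 powr (real j / 4) \<le> 2 / (real j / 6)" using j4 by (intro divide_left_mono) auto
          then have "2 * 2 powr (- real j / 4) \<le> 12 / real j" by (simp add: powr_minus_divide)
          then show ?thesis using sqrt_ins_reps[OF jn] by simp
        qed
        have "0 \<le> (9 * C\<^sub>0) ^ CARD('d) / real j" using C0_ge by simp
        then show "C\<^sub>2 / r + (9 * C\<^sub>3) ^ CARD('d) / 2 ^ j + sqrt (insens (length (fwd_path (reps j))) / real (2 ^ (j - 2)))
          \<le> C\<^sub>4 / real j"
          unfolding C\<^sub>4_def add_divide_distrib using 1 2 3 by linarith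
      qed
      finally show ?thesis .
    next
      case False
      have "emeasure (path_law 0) {X. blocks_bad a (2 ^ j) n X} \<le> ennreal ((9 * C\<^sub>0) ^ CARD('d) / 2 ^ j)"
        by (rule blocks_bad_near[OF b nb a]) (use False in simp)
      also have "\<dots> \<le> ennreal (C\<^sub>4 / real j)"
      proof (rule ennreal_leI)
        have "(9 * C\<^sub>0) ^ CARD('d) / 2 ^ j \<le> (9 * C\<^sub>0) ^ CARD('d) / real j"
          using C0_ge by (intro pw) simp
        also have "\<dots> \<le> C\<^sub>4 / real j"
          unfolding C\<^sub>4_def using C2_pos gn C3_ge C0_ge by (intro divide_right_mono) (auto intro!: add_nonneg_nonneg)
        finally show "(9 * C\<^sub>0) ^ CARD('d) / 2 ^ j \<le> C\<^sub>4 / real j" .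
      qed
      finally show ?thesis .
    qed
  qed
qed

end

section \<open>Block increments\<close>

text \<open>An odd, 1-Lipschitz truncation: oddness turns bounds for w into bounds for - w, and the
  Lipschitz property passes estimates of increments on to the truncated ones.\<close>

definition clamp_abs :: "real \<Rightarrow> real \<Rightarrow> real" where
  "clamp_abs B x = max (- B) (min B x)"

lemma clamp_abs_le: "B \<ge> 0 \<Longrightarrow> \<bar>clamp_abs B x\<bar> \<le> B"
  by (auto simp: clamp_abs_def)

lemma clamp_abs_id: "\<bar>x\<bar> \<le> B \<Longrightarrow> clamp_abs B x = x"
  by (auto simp: clamp_abs_def)

lemma clamp_abs_lipschitz: "\<bar>clamp_abs B x - clamp_abs B y\<bar> \<le> \<bar>x - y\<bar>"
  by (auto simp: clamp_abs_def max_def min_def)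

lemma clamp_abs_minus: "B \<ge> 0 \<Longrightarrow> clamp_abs B (- x) = - clamp_abs B x"
  by (auto simp: clamp_abs_def max_def min_def)

context rwre
begin

definition inc :: "real^'d \<Rightarrow> real \<Rightarrow> real \<Rightarrow> (nat \<Rightarrow> int^'d) \<Rightarrow> real" where
  "inc w a b X = real_vec (pos (a + b) X - pos a X) \<bullet> w"

text \<open>Truncation makes the functional bounded on all paths. The level has a factor 2 to spare
  over the bound of \<open>good_hit_step\<close>, which leaves room for
  \<open>C\<^sub>0 * (b + L)\<close> from \<open>good_hit_chain\<close> when L \<le> b.\<close>

definition S :: "real^'d \<Rightarrow> real \<Rightarrow> real \<Rightarrow> (nat \<Rightarrow> int^'d) \<Rightarrow> real" where
  "S w a b X = clamp_abs (2 * C\<^sub>0 * b) (inc w a b X)"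

lemma measurable_pos_fun: "(\<lambda>X. g (pos s X) (pos t X)) \<in> borel_measurable path_space"
proof (rule measurable_compose_countable[where f="\<lambda>z X. g z (pos t X)" and g="pos s"])
  show "(\<lambda>X. g z (pos t X)) \<in> borel_measurable path_space" for z
    by (rule measurable_compose[OF measurable_pos]) simp
qed (rule measurable_pos)

lemma measurable_S: "S w a b \<in> borel_measurable path_space"
  unfolding S_def[abs_def] inc_def by (rule measurable_pos_fun)

lemma abs_S_le: "b \<ge> 0 \<Longrightarrow> \<bar>S w a b X\<bar> \<le> 2 * C\<^sub>0 * b"
  unfolding S_def using C0_ge by (intro clamp_abs_le) simp

lemma future_S:
  assumes "b \<ge> 0"
  shows "future a (S w a b)"
  unfolding future_def
proof (intro allI impI)
  fix X :: "nat \<Rightarrow> int^'d" assume "lev (X 0) < a"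
  then have "pos (a + b) (walk_shift 1 X) = pos (a + b) X" "pos a (walk_shift 1 X) = pos a X"
    using assms by (intro pos_future; simp)+
  then show "S w a b (walk_shift 1 X) = S w a b X" by (simp only: S_def inc_def)
qed

lemma S_minus: "b \<ge> 0 \<Longrightarrow> S (- w) a b X = - S w a b X"
  unfolding S_def inc_def using C0_ge by (simp add: clamp_abs_minus)

lemma adapted_pos: "t \<le> s \<Longrightarrow> adapted s (pos t)"
  unfolding adapted_def
proof (intro allI impI)
  fix X Y n assume t: "t \<le> s" and h: "hits s n X" and eq: "\<forall>i\<le>n. X i = Y i"
  have "t \<le> lev (X n)" using h t by (simp add: hits_def)
  then obtain m where m: "m \<le> n" "hits t m X" using hits_ex[where X=X and n=n] by blast
  then have "hits t m Y" using eq by (simp add: hits_def)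
  then show "pos t X = pos t Y" using hits_pos[OF m(2)] hits_pos[of t m Y] m eq by simp
qed

lemma adapted_S:
  assumes "a + b \<le> s" "b \<ge> 0"
  shows "adapted s (S w a b)"
  unfolding adapted_def
proof (intro allI impI)
  fix X Y n assume h: "hits s n X" "\<forall>i\<le>n. X i = Y i"
  have "a \<le> s" using assms by simp
  then have "pos (a + b) X = pos (a + b) Y" "pos a X = pos a Y"
    using adapted_pos[of "a + b" s] adapted_pos[of a s] assms(1) h unfolding adapted_def by blast+
  then show "S w a b X = S w a b Y" by (simp only: S_def inc_def)
qed

lemma integrable_path_law:
  fixes F :: "(nat \<Rightarrow> int^'d) \<Rightarrow> real"
  assumes "F \<in> borel_measurable path_space" "\<And>X. \<bar>F X\<bar> \<le> B"
  shows "integrable (path_law x) F"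
proof -
  interpret Q: prob_space "path_law x" by (rule prob_space_path_law)
  show ?thesis
    by (rule Q.integrable_const_bound[where B=B]) (use assms in \<open>simp_all add: measurable_path_law\<close>)
qed

lemma integrable_S: "b \<ge> 0 \<Longrightarrow> integrable (path_law x) (S w a b)"
  by (rule integrable_path_law[OF measurable_S abs_S_le])

definition ES :: "real^'d \<Rightarrow> real \<Rightarrow> real \<Rightarrow> real" where
  "ES w a b = (\<integral>X. S w a b X \<partial>path_law 0)"

lemma ES_minus: "b \<ge> 0 \<Longrightarrow> ES (- w) a b = - ES w a b"
proof -
  assume "b \<ge> 0"
  then have "S (- w) a b = (\<lambda>X. - S w a b X)" by (intro ext S_minus)
  then show ?thesis by (simp add: ES_def)
qed

lemma measure_path_law_UNIV [simp]: "measure (path_law x) UNIV = 1"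
  using prob_space.prob_space[OF prob_space_path_law, of x] by simp

lemma abs_ES_le:
  assumes "b \<ge> 0"
  shows "\<bar>ES w a b\<bar> \<le> 2 * C\<^sub>0 * b"
proof -
  interpret Q: prob_space "path_law 0" by (rule prob_space_path_law)
  have "\<bar>ES w a b\<bar> \<le> (\<integral>X. \<bar>S w a b X\<bar> \<partial>path_law 0)"
    unfolding ES_def by (rule integral_abs_bound)
  also have "\<dots> \<le> (\<integral>X. 2 * C\<^sub>0 * b \<partial>path_law 0)"
    using integrable_S[OF assms] abs_S_le[OF assms] by (intro integral_mono) auto
  finally show ?thesis by (simp add: Q.prob_space)
qed

lemma inner_unit: "norm w \<le> 1 \<Longrightarrow> \<bar>v \<bullet> w\<bar> \<le> norm v"
  for v w :: "real^'d"
  using Cauchy_Schwarz_ineq2[of v w] mult_left_mono[of "norm w" 1 "norm v"] by simp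

lemma expectation_close:
  fixes F H :: "(nat \<Rightarrow> int^'d) \<Rightarrow> real"
  assumes F: "F \<in> borel_measurable path_space" "\<And>X. \<bar>F X\<bar> \<le> B"
    and H: "H \<in> borel_measurable path_space" "\<And>X. \<bar>H X\<bar> \<le> B'"
    and E: "E \<in> sets path_space" "emeasure (path_law 0) E \<le> ennreal p" "p \<ge> 0"
    and d: "d \<ge> 0" "AE X in path_law 0. X \<notin> E \<longrightarrow> \<bar>F X - H X\<bar> \<le> d"
  shows "\<bar>(\<integral>X. F X \<partial>path_law 0) - (\<integral>X. H X \<partial>path_law 0)\<bar> \<le> d + (B + B') * p"
proof -
  interpret Q: prob_space "path_law 0" by (rule prob_space_path_law)
  have iF: "integrable (path_law 0) F" and iH: "integrable (path_law 0) H"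
    by (rule integrable_path_law[OF F], rule integrable_path_law[OF H])
  have BB: "B + B' \<ge> 0" using F(2)[of "\<lambda>_. 0"] H(2)[of "\<lambda>_. 0"] by linarith
  have Em: "E \<in> sets (path_law 0)" using E by (simp add: sets_path_law)
  have iE: "integrable (path_law 0) (\<lambda>X. d + (B + B') * indicat_real E X)"
    using Em by (auto intro!: integrable_add integrable_mult_right simp: Q.emeasure_eq_measure)
  have "\<bar>(\<integral>X. F X \<partial>path_law 0) - (\<integral>X. H X \<partial>path_law 0)\<bar> = \<bar>\<integral>X. F X - H X \<partial>path_law 0\<bar>"
    using iF iH by simp
  also have "\<dots> \<le> (\<integral>X. \<bar>F X - H X\<bar> \<partial>path_law 0)" by (rule integral_abs_bound)
  also have "\<dots> \<le> (\<integral>X. d + (B + B') * indicat_real E X \<partial>path_law 0)"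
  proof (rule integral_mono_AE[OF _ iE])
    show "integrable (path_law 0) (\<lambda>X. \<bar>F X - H X\<bar>)" using iF iH by simp
    show "AE X in path_law 0. \<bar>F X - H X\<bar> \<le> d + (B + B') * indicat_real E X"
      using d(2)
    proof eventually_elim
      case (elim X)
      have "\<bar>F X - H X\<bar> \<le> B + B'" using F(2)[of X] H(2)[of X] by linarith
      then show ?case using elim d(1) by (cases "X \<in> E") auto
    qed
  qed
  also have "\<dots> = d + (B + B') * measure (path_law 0) E"
    using Em by (subst Bochner_Integration.integral_add) (auto simp: Q.prob_space Q.emeasure_eq_measure)
  also have "\<dots> \<le> d + (B + B') * p"
    using E(2,3) BB by (intro add_left_mono mult_left_mono) (auto simp: Q.emeasure_eq_measure)
  finally show ?thesis .
qed

definition C\<^sub>5 :: real where "C\<^sub>5 = 4 * C\<^sub>0 + 4 * C\<^sub>0 * (9 * C\<^sub>0) ^ CARD('d)"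

lemma C5_nonneg: "C\<^sub>5 \<ge> 0" using C0_ge by (simp add: C\<^sub>5_def)

text \<open>If all exits at size J are good, displacing a block of length J^2 by at most J moves
  both of its endpoints by order J. A bad exit has probability of order 1/J and costs order J^2.
  Both errors are of order J, small relative to the block.\<close>

lemma ES_shift:
  assumes w: "norm w \<le> 1" and J: "J \<ge> L\<^sub>0" and s: "0 \<le> \<sigma>" "\<sigma> \<le> J"
  shows "\<bar>ES w \<sigma> (J\<^sup>2) - ES w 0 (J\<^sup>2)\<bar> \<le> C\<^sub>5 * J"
proof -
  have J1: "J \<ge> 1" using J L0 by simp
  have JJ: "J \<le> J\<^sup>2" using J1 self_le_power[of J 2] by simp
  have C: "C\<^sub>0 \<ge> 2" by (rule C0_ge)
  define \<rho> where "\<rho> = 4 * C\<^sub>0 * J\<^sup>2"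
  have sm: "C\<^sub>0 * ((\<rho> / C\<^sub>0 - J) + J) = \<rho>" using C by simp
  have "\<rho> / C\<^sub>0 = 4 * J\<^sup>2" using C by (simp add: \<rho>_def)
  then have smge: "\<rho> / C\<^sub>0 - J \<ge> J\<^sup>2 + J" using JJ J1 by linarith
  have "\<bar>(\<integral>X. S w \<sigma> (J\<^sup>2) X \<partial>path_law 0) - (\<integral>X. S w 0 (J\<^sup>2) X \<partial>path_law 0)\<bar> \<le>
    4 * C\<^sub>0 * J + (2 * C\<^sub>0 * J\<^sup>2 + 2 * C\<^sub>0 * J\<^sup>2) * ((9 * C\<^sub>0) ^ CARD('d) / J)"
  proof (rule expectation_close[where E="{X. ball_bad \<rho> J X}"])
    have "emeasure (path_law 0) {X. ball_bad \<rho> J X} \<le> ennreal ((2 * \<rho> + 1) ^ CARD('d) * J powr - M)"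
      by (rule ball_bad_bound[OF _ J]) (use C in \<open>simp add: \<rho>_def\<close>)
    also have "\<dots> \<le> ennreal ((9 * C\<^sub>0) ^ CARD('d) / J)"
      unfolding \<rho>_def using C by (intro ennreal_leI ball_weight[OF _ J1]) auto
    finally show "emeasure (path_law 0) {X. ball_bad \<rho> J X} \<le> ennreal ((9 * C\<^sub>0) ^ CARD('d) / J)" .
    show "AE X in path_law 0. X \<notin> {X. ball_bad \<rho> J X} \<longrightarrow> \<bar>S w \<sigma> (J\<^sup>2) X - S w 0 (J\<^sup>2) X\<bar> \<le> 4 * C\<^sub>0 * J"
      using AE_start[of 0]
    proof eventually_elim
      case (elim X)
      show ?case
      proof
        assume "X \<notin> {X. ball_bad \<rho> J X}"
        then have nb: "\<not> ball_bad (C\<^sub>0 * ((\<rho> / C\<^sub>0 - J) + J)) J X" using sm by simp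
        have X: "steps X" "X 0 = 0" using elim by auto
        have g: "good_hit u J X" if "0 \<le> u" "u \<le> J\<^sup>2 + J" for u
          by (rule regular_from_0[OF X J1 nb that(1)]) (use that(2) smge in simp)
        have 1: "norm (real_vec (pos \<sigma> X - pos 0 X)) \<le> C\<^sub>0 * (\<sigma> - 0 + J)"
          using X s JJ by (intro good_hit_chain[OF X(1) _ J1 _ s(1)] g) auto
        have 2: "norm (real_vec (pos (\<sigma> + J\<^sup>2) X - pos (0 + J\<^sup>2) X)) \<le> C\<^sub>0 * ((\<sigma> + J\<^sup>2) - (0 + J\<^sup>2) + J)"
          using X s JJ by (intro good_hit_chain[OF X(1) _ J1] g) auto
        have "\<bar>inc w \<sigma> (J\<^sup>2) X - inc w 0 (J\<^sup>2) X\<bar> =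
          \<bar>real_vec (pos (\<sigma> + J\<^sup>2) X - pos (0 + J\<^sup>2) X) \<bullet> w - real_vec (pos \<sigma> X - pos 0 X) \<bullet> w\<bar>"
          unfolding inc_def real_vec_diff by (simp add: inner_diff_left)
        also have "\<dots> \<le> norm (real_vec (pos (\<sigma> + J\<^sup>2) X - pos (0 + J\<^sup>2) X)) + norm (real_vec (pos \<sigma> X - pos 0 X))"
          using inner_unit[OF w, of "real_vec (pos (\<sigma> + J\<^sup>2) X - pos (0 + J\<^sup>2) X)"]
            inner_unit[OF w, of "real_vec (pos \<sigma> X - pos 0 X)"] by linarith
        also have "\<dots> \<le> C\<^sub>0 * (\<sigma> + J) + C\<^sub>0 * (\<sigma> + J)" by (intro add_mono) (use 1 2 in simp_all)
        also have "\<dots> \<le> C\<^sub>0 * (J + J) + C\<^sub>0 * (J + J)" using s C by (intro add_mono mult_left_mono) auto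
        finally have "\<bar>inc w \<sigma> (J\<^sup>2) X - inc w 0 (J\<^sup>2) X\<bar> \<le> 4 * C\<^sub>0 * J" by (simp add: algebra_simps)
        then show "\<bar>S w \<sigma> (J\<^sup>2) X - S w 0 (J\<^sup>2) X\<bar> \<le> 4 * C\<^sub>0 * J"
          unfolding S_def by (rule order_trans[OF clamp_abs_lipschitz])
      qed
    qed
  qed (use C J1 in \<open>auto intro: measurable_S abs_S_le sets_ball_bad\<close>)
  also have "\<dots> = C\<^sub>5 * J" using J1 by (simp add: C\<^sub>5_def power2_eq_square algebra_simps)
  finally show ?thesis by (simp add: ES_def)
qed

lemma pos_translate:
  assumes "\<exists>n. s - lev y \<le> lev (X n)"
  shows "pos s (\<lambda>m. X m + y) = pos (s - lev y) X + y"
proof -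
  obtain n where n: "hits (s - lev y) n X" using assms reach_iff_hits by blast
  then have "hits s n (\<lambda>m. X m + y)" by (simp add: hits_translate)
  from hits_pos[OF this] hits_pos[OF n] show ?thesis by simp
qed

lemma S_translate:
  assumes "\<forall>s. \<exists>n. s \<le> lev (X n)"
  shows "S w a b (\<lambda>m. X m + y) = S w (a - lev y) b X"
proof -
  have "pos s (\<lambda>m. X m + y) = pos (s - lev y) X + y" for s
    using assms by (intro pos_translate) blast
  moreover have "a + b - lev y = a - lev y + b" by simp
  ultimately show ?thesis by (simp only: S_def inc_def) simp
qed

text \<open>Relative error in the conditional mean of a block of size 4^i: displacement of the
  start, imperfect mixing, escape from the cone. The factor \<open>4 * C\<^sub>0\<close> is the
  range of S divided by the block size.\<close>

definition e\<^sub>1 :: "nat \<Rightarrow> real" where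
  "e\<^sub>1 i = C\<^sub>5 / 2 ^ i + 4 * C\<^sub>0 * (\<phi> (real (reps i) * nz / 2 * l1_norm l) + 2 * C\<^sub>2 / (real (reps i) * nz))"

lemma l1_norm_l_pos: "l1_norm l > 0"
proof -
  have "norm l \<le> l1_norm l" unfolding l1_norm_def by (rule norm_le_l1_cart)
  then show ?thesis using norm_l by simp
qed

lemma reps_tendsto: "filterlim (\<lambda>i. real (reps i) * nz) at_top sequentially"
proof (rule filterlim_at_top_mono[where f="\<lambda>i. (\<gamma> * real i - 1) * nz"])
  have "filterlim (\<lambda>i. \<gamma> * real i) at_top sequentially"
    using \<gamma>_pos by (intro filterlim_tendsto_pos_mult_at_top[OF tendsto_const _ filterlim_real_sequentially])
  then have "filterlim (\<lambda>i. \<gamma> * real i - 1) at_top sequentially"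
    using filterlim_tendsto_add_at_top[OF tendsto_const[of "-1"]] by simp
  then show "filterlim (\<lambda>i. (\<gamma> * real i - 1) * nz) at_top sequentially"
    using nz_pos by (intro filterlim_at_top_mult_tendsto_pos[OF tendsto_const])
  show "\<forall>\<^sub>F i in sequentially. (\<gamma> * real i - 1) * nz \<le> real (reps i) * nz"
    using reps_ge nz_pos by (intro always_eventually allI mult_right_mono) auto
qed

lemma e1_tendsto: "e\<^sub>1 \<longlonglongrightarrow> 0"
proof -
  have f: "filterlim (\<lambda>i. real (reps i) * nz / 2 * l1_norm l) at_top sequentially"
  proof -
    have "filterlim (\<lambda>i. real (reps i) * nz * (l1_norm l / 2)) at_top sequentially"
      using l1_norm_l_pos by (intro filterlim_at_top_mult_tendsto_pos[OF tendsto_const _ reps_tendsto]) simp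
    then show ?thesis by (simp add: mult_ac)
  qed
  have "(\<lambda>i. \<phi> (real (reps i) * nz / 2 * l1_norm l)) \<longlonglongrightarrow> 0"
    by (rule filterlim_compose[OF \<phi>(2) f])
  moreover have "(\<lambda>i. 2 * C\<^sub>2 / (real (reps i) * nz)) \<longlonglongrightarrow> 0"
    by (rule tendsto_divide_0[OF tendsto_const filterlim_at_top_imp_at_infinity[OF reps_tendsto]])
  moreover have "(\<lambda>i. C\<^sub>5 / 2 ^ i) \<longlonglongrightarrow> 0"
  proof -
    have "(\<lambda>i. C\<^sub>5 * (1 / 2) ^ i) \<longlonglongrightarrow> C\<^sub>5 * 0"
      by (intro tendsto_mult tendsto_const LIMSEQ_power_zero) simp
    then show ?thesis by (simp add: power_one_over field_simps)
  qed
  ultimately have "(\<lambda>i. C\<^sub>5 / 2 ^ i + 4 * C\<^sub>0 * (\<phi> (real (reps i) * nz / 2 * l1_norm l) + 2 * C\<^sub>2 / (real (reps i) * nz)))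
    \<longlonglongrightarrow> 0 + 4 * C\<^sub>0 * (0 + 0)"
    by (intro tendsto_add tendsto_mult tendsto_const)
  then show ?thesis unfolding e\<^sub>1_def[abs_def] by simp
qed

text \<open>By translation the walk from y sees a block that starts a - \<open>lev y\<close> levels
  ahead, at most 2^i, so \<open>ES_shift\<close> applies. The affine rescaling of S to [0, 1] is the
  one that \<open>key_bound\<close> requires.\<close>

lemma mean_start:
  fixes i :: nat
  assumes w: "norm w \<le> 1" and i: "i \<ge> 2" "2 ^ i \<ge> L\<^sub>0"
    and \<sigma>: "0 \<le> a - lev y" "a - lev y \<le> 2 ^ i"
  shows "(\<integral>\<^sup>+X. ennreal ((S w a (4 ^ i) X + 2 * C\<^sub>0 * 4 ^ i) / (4 * C\<^sub>0 * 4 ^ i)) \<partial>path_law y) \<le>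
    ennreal ((ES w 0 (4 ^ i) + C\<^sub>5 * 2 ^ i + 2 * C\<^sub>0 * 4 ^ i) / (4 * C\<^sub>0 * 4 ^ i))"
proof -
  interpret Q: prob_space "path_law 0" by (rule prob_space_path_law)
  define b where "b = (4::real) ^ i"
  have b: "b > 0" "b = (2 ^ i)\<^sup>2" by (simp_all add: b_def power2_eq_square power_mult_distrib[symmetric])
  let ?g = "\<lambda>a X. (S w a b X + 2 * C\<^sub>0 * b) / (4 * C\<^sub>0 * b)"
  have den: "4 * C\<^sub>0 * b > 0" using b C0_ge by simp
  have g0: "0 \<le> ?g a X" for a X
    using abs_S_le[of b w a X] b den by (intro divide_nonneg_pos) auto
  have gm: "?g a \<in> borel_measurable path_space" for a
    by (intro borel_measurable_divide borel_measurable_add measurable_S borel_measurable_const)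
  then have gm': "(\<lambda>X. ennreal (?g a X)) \<in> borel_measurable path_space" for a by simp
  have "(\<integral>\<^sup>+X. ennreal (?g a X) \<partial>path_law y) = (\<integral>\<^sup>+X. ennreal (?g a (\<lambda>m. X m + y)) \<partial>path_law 0)"
    by (rule path_law_translate[OF gm'])
  also have "\<dots> = (\<integral>\<^sup>+X. ennreal (?g (a - lev y) X) \<partial>path_law 0)"
    by (rule nn_integral_cong_AE, use AE_reach[of 0] in eventually_elim) (simp add: S_translate)
  also have "\<dots> = ennreal (\<integral>X. ?g (a - lev y) X \<partial>path_law 0)"
    using integrable_S[of b] b g0 by (intro nn_integral_eq_integral) auto
  also have "(\<integral>X. ?g (a - lev y) X \<partial>path_law 0) = (ES w (a - lev y) b + 2 * C\<^sub>0 * b) / (4 * C\<^sub>0 * b)"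
    using integrable_S[of b 0 w "a - lev y"] b by (simp add: ES_def Q.prob_space)
  also have "ennreal \<dots> \<le> ennreal ((ES w 0 b + C\<^sub>5 * 2 ^ i + 2 * C\<^sub>0 * b) / (4 * C\<^sub>0 * b))"
  proof (intro ennreal_leI divide_right_mono)
    show "ES w (a - lev y) b + 2 * C\<^sub>0 * b \<le> ES w 0 b + C\<^sub>5 * 2 ^ i + 2 * C\<^sub>0 * b"
      using ES_shift[OF w i(2) \<sigma>] unfolding b(2)[symmetric] by linarith
  qed (use den in simp)
  finally show ?thesis by (simp add: b_def)
qed

text \<open>The gap of 2^i levels holds the 2^(i-2) levels over which \<open>key_bound\<close>
  averages and the forward path, whose length is at most 2^i / 4. The first error term is
  proportional to the mean of U, the second only to its maximum but decaying in i at a known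
  rate.\<close>

lemma block_mean:
  fixes i :: nat and U :: "(nat \<Rightarrow> int^'d) \<Rightarrow> real"
  assumes w: "norm w \<le> 1" and i: "i \<ge> 2" "2 ^ i \<ge> L\<^sub>0" "real (reps i) * nz \<ge> 40" "real (reps i) * nz \<ge> 4 * L\<^sub>0"
    and a: "a \<ge> 0" and U: "adapted a U" "U \<in> borel_measurable path_space" "\<And>X. 0 \<le> U X" "\<And>X. U X \<le> Um"
  shows "(\<integral>X. U X * S w (a + 2 ^ i) (4 ^ i) X \<partial>path_law 0) \<le>
    (ES w 0 (4 ^ i) + 4 ^ i * e\<^sub>1 i) * (\<integral>X. U X \<partial>path_law 0) + 8 * C\<^sub>0 * 4 ^ i * 2 powr (- real i / 4) * Um"
proof -
  interpret Q: prob_space "path_law 0" by (rule prob_space_path_law)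
  define b where "b = (4::real) ^ i"
  define J where "J = (2::real) ^ i"
  define r where "r = real (reps i) * nz"
  have b: "b > 0" "b = J * J" by (simp_all add: b_def J_def power_mult_distrib[symmetric])
  have J: "J > 0" by (simp add: J_def)
  have Um: "Um \<ge> 0" using order_trans[OF U(3) U(4)] .
  have den: "4 * C\<^sub>0 * b > 0" using b C0_ge by simp
  let ?A = "a + J"
  define G where "G X = (S w ?A b X + 2 * C\<^sub>0 * b) / (4 * C\<^sub>0 * b)" for X
  define g0 where "g0 = (ES w 0 b + C\<^sub>5 * J + 2 * C\<^sub>0 * b) / (4 * C\<^sub>0 * b)"
  define \<epsilon> where "\<epsilon> = \<phi> (r / 2 * l1_norm l) + 2 * C\<^sub>2 / r"
  have Sb: "\<bar>S w ?A b X\<bar> \<le> 2 * C\<^sub>0 * b" for X by (rule abs_S_le) (use b in simp)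
  have G: "0 \<le> G X" "G X \<le> 1" for X
  proof -
    have "0 \<le> S w ?A b X + 2 * C\<^sub>0 * b" "S w ?A b X + 2 * C\<^sub>0 * b \<le> 4 * C\<^sub>0 * b"
      using Sb[of X] by linarith+
    then show "0 \<le> G X" "G X \<le> 1"
      using den unfolding G_def by (simp_all only: divide_le_eq_1_pos divide_nonneg_pos)
  qed
  have Gm: "G \<in> borel_measurable path_space"
    unfolding G_def[abs_def]
    by (intro borel_measurable_divide borel_measurable_add measurable_S borel_measurable_const)
  have Gf: "future ?A G"
    using future_S[of b ?A w] b unfolding future_def G_def by auto
  have r0: "r \<ge> 40" "r \<ge> 4 * L\<^sub>0" using i by (auto simp: r_def)
  have kk0: "reps i > 0" using r0(1) by (cases "reps i") (auto simp: r_def)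
  have l1: "r / 2 * l1_norm l \<ge> 0" using r0 l1_norm_l_pos by simp
  have \<epsilon>0: "\<epsilon> \<ge> 0" using \<phi>(1)[OF l1] C2_pos r0 by (simp add: \<epsilon>_def)
  have g00: "g0 \<ge> 0"
  proof -
    have "\<bar>ES w 0 b\<bar> \<le> 2 * C\<^sub>0 * b" by (rule abs_ES_le) (use b in simp)
    moreover have "0 \<le> C\<^sub>5 * J" using C5_nonneg J by simp
    ultimately show ?thesis using den unfolding g0_def by (intro divide_nonneg_pos) auto
  qed
  obtain i' where i': "i = i' + 2" using i(1) by (metis le_add_diff_inverse2)
  have I: "real (2 ^ (i - 2)) = J / 4" by (simp add: J_def i' power_add)
  have iJ: "real i \<le> J" using of_nat_less_two_power[of i, where 'a=real] by (simp add: J_def)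
  have len: "real (length (fwd_path (reps i))) \<le> J / 4" using length_reps_le[of i] iJ by linarith
  have rlen: "r \<le> real (length (fwd_path (reps i)))"
    using mult_left_mono[OF nz_le, of "real (reps i)"] by (simp add: fwd_path(2) r_def)
  have main: "(\<integral>\<^sup>+X. ennreal (U X) * ennreal (G X) \<partial>path_law 0) \<le>
    ennreal (g0 + \<epsilon>) * (\<integral>\<^sup>+X. ennreal (U X) \<partial>path_law 0) +
    ennreal (Um * sqrt (insens (length (fwd_path (reps i))) / real (2 ^ (i - 2))))"
  proof (rule key_bound[OF G Gm Gf])
    show "adapted a (\<lambda>X. ennreal (U X))" using U(1) unfolding adapted_def by metis
    show "a + real (2 ^ (i - 2)) + real (length (fwd_path (reps i))) \<le> a + J" using I len J by simp
    fix z and f :: "'d env \<Rightarrow> ennreal"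
    assume z: "a \<le> lev z" "lev z < a + real (2 ^ (i - 2))" and f: "f \<in> borel_measurable (env_sigma (half_space l z))"
    let ?p = "sum_list (fwd_path (reps i))"
    have lp: "lev (z + ?p) = lev z + r" by (simp add: lev_add lev_fwd_path r_def)
    have "(\<integral>\<^sup>+\<omega>. f \<omega> * (\<integral>\<^sup>+X. ennreal (G X) \<partial>quenched \<omega> (z + ?p)) \<partial>\<P>) \<le>
      ((\<integral>\<^sup>+X. ennreal (G X) \<partial>path_law (z + ?p)) + ennreal (\<phi> (r / 2 * l1_norm l)) + ennreal (2 * C\<^sub>2 / r)) *
      (\<integral>\<^sup>+\<omega>. f \<omega> \<partial>\<P>)"
      by (rule mixing_start_bound[OF _ _ f r_def r0]) (use Gm G in \<open>auto simp: ennreal_le_1\<close>)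
    also have "\<dots> \<le> (ennreal g0 + ennreal (\<phi> (r / 2 * l1_norm l)) + ennreal (2 * C\<^sub>2 / r)) * (\<integral>\<^sup>+\<omega>. f \<omega> \<partial>\<P>)"
    proof (intro mult_right_mono add_right_mono)
      show "(\<integral>\<^sup>+X. ennreal (G X) \<partial>path_law (z + ?p)) \<le> ennreal g0"
        unfolding G_def g0_def b_def J_def
        by (rule mean_start[OF w i(1,2)])
          (use z lp rlen len I r0 J in \<open>auto simp: J_def[symmetric]\<close>)
    qed simp
    also have "ennreal g0 + ennreal (\<phi> (r / 2 * l1_norm l)) + ennreal (2 * C\<^sub>2 / r) = ennreal (g0 + \<epsilon>)"
      using g00 \<phi>(1)[OF l1] C2_pos r0 by (simp add: \<epsilon>_def ennreal_plus[symmetric] add.assoc del: ennreal_plus)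
    finally show "(\<integral>\<^sup>+\<omega>. f \<omega> * (\<integral>\<^sup>+X. ennreal (G X) \<partial>quenched \<omega> (z + ?p)) \<partial>\<P>) \<le>
      ennreal (g0 + \<epsilon>) * (\<integral>\<^sup>+\<omega>. f \<omega> \<partial>\<P>)" .
  qed (use U Um a fwd_path kk0 in \<open>auto intro: ennreal_leI\<close>)
  have iU: "integrable (path_law 0) U"
    by (rule integrable_path_law[OF U(2), where B=Um]) (use U in \<open>simp add: abs_le_iff order_trans[of _ 0]\<close>)
  have UGb: "\<bar>U X * G X\<bar> \<le> Um" for X
    using mult_mono[OF U(4)[of X] G(2)[of X]] U(3)[of X] G(1)[of X] Um by (simp add: abs_mult)
  have iUG: "integrable (path_law 0) (\<lambda>X. U X * G X)"
    by (rule integrable_path_law[OF _ UGb]) (intro borel_measurable_times U(2) Gm)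
  have sq: "sqrt (insens (length (fwd_path (reps i))) / real (2 ^ (i - 2))) \<le> 2 * 2 powr (- real i / 4)"
    by (rule sqrt_ins_reps[OF i(1)])
  have UI: "(\<integral>\<^sup>+X. ennreal (U X) \<partial>path_law 0) = ennreal (\<integral>X. U X \<partial>path_law 0)"
    using iU U(3) by (intro nn_integral_eq_integral) auto
  have UI0: "(\<integral>X. U X \<partial>path_law 0) \<ge> 0" using U(3) by simp
  have "ennreal (\<integral>X. U X * G X \<partial>path_law 0) = (\<integral>\<^sup>+X. ennreal (U X * G X) \<partial>path_law 0)"
    using iUG U(3) G by (intro nn_integral_eq_integral[symmetric]) auto
  also have "\<dots> = (\<integral>\<^sup>+X. ennreal (U X) * ennreal (G X) \<partial>path_law 0)"
    using U(3) G by (intro nn_integral_cong) (simp add: ennreal_mult)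
  also note main
  also have "ennreal (g0 + \<epsilon>) * (\<integral>\<^sup>+X. ennreal (U X) \<partial>path_law 0) +
    ennreal (Um * sqrt (insens (length (fwd_path (reps i))) / real (2 ^ (i - 2)))) \<le>
    ennreal ((g0 + \<epsilon>) * (\<integral>X. U X \<partial>path_law 0)) + ennreal (Um * (2 * 2 powr (- real i / 4)))"
    unfolding UI using g00 \<epsilon>0 UI0 sq Um
    by (intro add_mono ennreal_leI mult_left_mono) (auto simp: ennreal_mult)
  also have "\<dots> = ennreal ((g0 + \<epsilon>) * (\<integral>X. U X \<partial>path_law 0) + Um * (2 * 2 powr (- real i / 4)))"
    using g00 \<epsilon>0 UI0 Um by (intro ennreal_plus[symmetric]) auto
  finally have UG: "(\<integral>X. U X * G X \<partial>path_law 0) \<le> (g0 + \<epsilon>) * (\<integral>X. U X \<partial>path_law 0) + Um * (2 * 2 powr (- real i / 4))"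
    using g00 \<epsilon>0 UI0 Um by (subst (asm) ennreal_le_iff) auto
  have "(\<integral>X. U X * S w ?A b X \<partial>path_law 0) = (\<integral>X. 4 * C\<^sub>0 * b * (U X * G X) - 2 * C\<^sub>0 * b * U X \<partial>path_law 0)"
  proof (intro Bochner_Integration.integral_cong refl)
    fix X
    have "4 * C\<^sub>0 * b \<noteq> 0" using den by linarith
    then have "4 * C\<^sub>0 * b * G X = S w ?A b X + 2 * C\<^sub>0 * b"
      by (simp only: G_def times_divide_eq_right nonzero_mult_div_cancel_left not_False_eq_True)
    then have S_eq: "S w ?A b X = 4 * C\<^sub>0 * b * G X - 2 * C\<^sub>0 * b" by linarith
    show "U X * S w ?A b X = 4 * C\<^sub>0 * b * (U X * G X) - 2 * C\<^sub>0 * b * U X"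
      unfolding S_eq by (simp add: algebra_simps)
  qed
  also have "\<dots> = 4 * C\<^sub>0 * b * (\<integral>X. U X * G X \<partial>path_law 0) - 2 * C\<^sub>0 * b * (\<integral>X. U X \<partial>path_law 0)"
    using iU iUG by simp
  also have "\<dots> \<le> 4 * C\<^sub>0 * b * ((g0 + \<epsilon>) * (\<integral>X. U X \<partial>path_law 0) + Um * (2 * 2 powr (- real i / 4))) -
      2 * C\<^sub>0 * b * (\<integral>X. U X \<partial>path_law 0)"
    using den by (intro diff_right_mono mult_left_mono UG) simp
  also have "\<dots> = (4 * C\<^sub>0 * b * g0 - 2 * C\<^sub>0 * b + 4 * C\<^sub>0 * b * \<epsilon>) * (\<integral>X. U X \<partial>path_law 0) +
      8 * C\<^sub>0 * b * 2 powr (- real i / 4) * Um"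
    by (simp add: algebra_simps)
  also have "4 * C\<^sub>0 * b * g0 = ES w 0 b + C\<^sub>5 * J + 2 * C\<^sub>0 * b"
  proof -
    have "4 * C\<^sub>0 * b \<noteq> 0" using den by linarith
    then show ?thesis
      by (simp only: g0_def times_divide_eq_right nonzero_mult_div_cancel_left not_False_eq_True)
  qed
  also have "ES w 0 b + C\<^sub>5 * J + 2 * C\<^sub>0 * b - 2 * C\<^sub>0 * b + 4 * C\<^sub>0 * b * \<epsilon> = ES w 0 b + b * e\<^sub>1 i"
  proof -
    have e: "e\<^sub>1 i = C\<^sub>5 / J + 4 * C\<^sub>0 * \<epsilon>" unfolding e\<^sub>1_def \<epsilon>_def r_def J_def ..
    have "b * e\<^sub>1 i = C\<^sub>5 * J + 4 * C\<^sub>0 * b * \<epsilon>"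
      unfolding e b(2) using J by (simp add: field_simps)
    then show ?thesis by linarith
  qed
  finally show ?thesis by (simp add: b_def J_def)
qed


section \<open>Convergence of the means\<close>

definition large_scale :: "nat \<Rightarrow> bool" where
  "large_scale i \<longleftrightarrow> i \<ge> 2 \<and> 2 ^ i \<ge> L\<^sub>0 \<and> real (reps i) * nz \<ge> 40 \<and> real (reps i) * nz \<ge> 4 * L\<^sub>0"

lemma pow4: "(4::real) ^ i = (2 ^ i)\<^sup>2"
  by (simp add: power2_eq_square power_mult_distrib[symmetric])

lemma eventually_large_scale: "\<forall>\<^sub>F i in sequentially. large_scale i"
proof -
  have "\<forall>\<^sub>F i in sequentially. max 40 (4 * L\<^sub>0) \<le> real (reps i) * nz"
    using reps_tendsto unfolding filterlim_at_top by blast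
  moreover have "\<forall>\<^sub>F i in sequentially. L\<^sub>0 \<le> real i"
    using filterlim_real_sequentially unfolding filterlim_at_top by blast
  moreover have "\<forall>\<^sub>F i in sequentially. (2::nat) \<le> i" by (rule eventually_ge_at_top)
  ultimately show ?thesis
  proof eventually_elim
    case (elim i)
    have "real i \<le> 2 ^ i" using of_nat_less_two_power[of i, where 'a=real] by simp
    then have "L\<^sub>0 \<le> 2 ^ i" using elim(2) by linarith
    with elim show ?case by (simp add: large_scale_def)
  qed
qed

text \<open>Covers both cases of a block moved to an arbitrary level: the error of
  \<open>block_mean\<close> for U = 1, and that of \<open>ES_shift\<close>.\<close>

definition e\<^sub>3 :: "nat \<Rightarrow> real" where
  "e\<^sub>3 i = \<bar>e\<^sub>1 i\<bar> + 8 * C\<^sub>0 * 2 powr (- real i / 4) + C\<^sub>5 / 2 ^ i"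

lemma powr_quarter_tendsto: "(\<lambda>i. 2 powr (- real i / 4)) \<longlonglongrightarrow> 0"
proof -
  have "(\<lambda>i. (2 powr (- 1 / 4)) ^ i) \<longlonglongrightarrow> (0::real)"
    by (rule LIMSEQ_power_zero) (simp add: powr_less_one)
  moreover have "(2 powr (- 1 / 4)) ^ i = 2 powr (- real i / 4)" for i
    by (simp add: powr_realpow[symmetric] powr_powr)
  ultimately show ?thesis by simp
qed

lemma e3_tendsto: "e\<^sub>3 \<longlonglongrightarrow> 0"
proof -
  have "(\<lambda>i. C\<^sub>5 * (1 / 2) ^ i) \<longlonglongrightarrow> C\<^sub>5 * 0"
    by (intro tendsto_mult tendsto_const LIMSEQ_power_zero) simp
  then have 1: "(\<lambda>i. C\<^sub>5 / 2 ^ i) \<longlonglongrightarrow> 0" by (simp add: power_one_over field_simps)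
  have "(\<lambda>i. \<bar>e\<^sub>1 i\<bar> + 8 * C\<^sub>0 * 2 powr (- real i / 4) + C\<^sub>5 / 2 ^ i) \<longlonglongrightarrow> \<bar>0\<bar> + 8 * C\<^sub>0 * 0 + 0"
    by (intro tendsto_add tendsto_mult tendsto_const tendsto_rabs e1_tendsto powr_quarter_tendsto 1)
  then show ?thesis unfolding e\<^sub>3_def[abs_def] by simp
qed

text \<open>Near the origin \<open>ES_shift\<close> compares the two blocks directly; beyond level
  2^i there is room in front of the block for the gap of \<open>block_mean\<close>.\<close>

lemma mean_all_levels_upper:
  assumes w: "norm w \<le> 1" and large_scale: "large_scale i" and a: "a \<ge> 0"
  shows "ES w a (4 ^ i) \<le> ES w 0 (4 ^ i) + 4 ^ i * e\<^sub>3 i"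
proof (cases "a \<le> 2 ^ i")
  case True
  have "ES w a (4 ^ i) \<le> ES w 0 (4 ^ i) + C\<^sub>5 * 2 ^ i"
    using ES_shift[OF w _ a True] large_scale unfolding pow4 large_scale_def by (simp add: abs_le_iff)
  also have "C\<^sub>5 * 2 ^ i = 4 ^ i * (C\<^sub>5 / 2 ^ i)" unfolding pow4 by (simp add: power2_eq_square)
  also have "\<dots> \<le> 4 ^ i * e\<^sub>3 i"
    unfolding e\<^sub>3_def using C0_ge by (intro mult_left_mono) auto
  finally show ?thesis by simp
next
  case False
  have "(\<integral>X. 1 * S w (a - 2 ^ i + 2 ^ i) (4 ^ i) X \<partial>path_law 0) \<le>
    (ES w 0 (4 ^ i) + 4 ^ i * e\<^sub>1 i) * (\<integral>X. 1 \<partial>path_law 0) + 8 * C\<^sub>0 * 4 ^ i * 2 powr (- real i / 4) * 1"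
    by (rule block_mean[OF w]) (use large_scale False in \<open>auto simp: large_scale_def adapted_def\<close>)
  then have "ES w a (4 ^ i) \<le> ES w 0 (4 ^ i) + 4 ^ i * (e\<^sub>1 i + 8 * C\<^sub>0 * 2 powr (- real i / 4))"
    by (simp add: ES_def algebra_simps)
  also have "\<dots> \<le> ES w 0 (4 ^ i) + 4 ^ i * e\<^sub>3 i"
  proof (intro add_left_mono mult_left_mono)
    have "0 \<le> C\<^sub>5 / 2 ^ i" using C5_nonneg by simp
    then show "e\<^sub>1 i + 8 * C\<^sub>0 * 2 powr (- real i / 4) \<le> e\<^sub>3 i"
      unfolding e\<^sub>3_def using abs_ge_self[of "e\<^sub>1 i"] by linarith
  qed simp
  finally show ?thesis .
qed

text \<open>The lower bound is the upper bound for - w.\<close>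

lemma mean_all_levels:
  assumes w: "norm w \<le> 1" and large_scale: "large_scale i" and a: "a \<ge> 0"
  shows "\<bar>ES w a (4 ^ i) - ES w 0 (4 ^ i)\<bar> \<le> 4 ^ i * e\<^sub>3 i"
  using mean_all_levels_upper[OF w large_scale a] mean_all_levels_upper[OF _ large_scale a, of "- w"] w
  by (simp add: ES_minus abs_le_iff)

lemma inc_bound_good_hit:
  assumes X: "steps X" "X 0 = 0" and w: "norm w \<le> 1" and a: "0 \<le> a" and b: "b \<ge> 1" and g: "good_hit a b X"
  shows "\<bar>inc w a b X\<bar> \<le> C\<^sub>0 * b"
proof -
  have "norm (real_vec (pos (a + b) X - pos a X)) \<le> C\<^sub>0 * b"
    by (rule good_hit_step(2)[OF X(1) _ g b]) (use X a b in auto)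
  then show ?thesis unfolding inc_def using inner_unit[OF w] order_trans by blast
qed

lemma inc_sum: "inc w a (real n * b) X = (\<Sum>j<n. inc w (a + real j * b) b X)"
proof (induction n)
  case (Suc n)
  have e: "a + real (Suc n) * b = a + real n * b + b" by (simp add: algebra_simps)
  have "inc w a (real (Suc n) * b) X = inc w a (real n * b) X + inc w (a + real n * b) b X"
    unfolding inc_def e by (simp add: real_vec_diff inner_diff_left)
  with Suc show ?case by simp
qed (simp add: inc_def)

text \<open>In good blocks, and hence in the block composed of them, the truncation is inactive, and
  plain increments add up.\<close>

lemma S_telescope:
  assumes X: "steps X" "X 0 = 0" and w: "norm w \<le> 1" and a: "0 \<le> a" and b: "b \<ge> 1"
    and g: "\<not> blocks_bad a b n X"
  shows "S w a (real n * b) X = (\<Sum>j<n. S w (a + real j * b) b X)"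
proof -
  have C: "C\<^sub>0 \<ge> 0" using C0_ge by simp
  have inc: "\<bar>inc w (a + real j * b) b X\<bar> \<le> C\<^sub>0 * b" if "j < n" for j
    using g that a b by (intro inc_bound_good_hit[OF X w _ b]) (auto simp: blocks_bad_def)
  have "C\<^sub>0 * b \<le> 2 * C\<^sub>0 * b" using C b by simp
  then have "S w (a + real j * b) b X = inc w (a + real j * b) b X" if "j < n" for j
    unfolding S_def using inc[OF that] by (intro clamp_abs_id) linarith
  then have sum: "(\<Sum>j<n. S w (a + real j * b) b X) = inc w a (real n * b) X"
    unfolding inc_sum by (intro sum.cong) auto
  have "\<bar>inc w a (real n * b) X\<bar> \<le> (\<Sum>j<n. \<bar>inc w (a + real j * b) b X\<bar>)"
    unfolding inc_sum by (rule sum_abs)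
  also have "\<dots> \<le> (\<Sum>j<n. C\<^sub>0 * b)" by (intro sum_mono inc) auto
  also have "\<dots> = C\<^sub>0 * (real n * b)" by simp
  also have "\<dots> \<le> 2 * C\<^sub>0 * (real n * b)" using C b by simp
  finally have "S w a (real n * b) X = inc w a (real n * b) X"
    unfolding S_def[of w a "real n * b"] by (rule clamp_abs_id)
  then show ?thesis using sum by simp
qed

lemma ES_superblock:
  assumes w: "norm w \<le> 1" and a: "0 \<le> a" and b: "b \<ge> 1"
    and p: "emeasure (path_law 0) {X. blocks_bad a b n X} \<le> ennreal p" "p \<ge> 0"
  shows "\<bar>ES w a (real n * b) - (\<Sum>j<n. ES w (a + real j * b) b)\<bar> \<le> 4 * C\<^sub>0 * p * (real n * b)"
proof -
  have b0: "b \<ge> 0" using b by simp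
  have "\<bar>(\<integral>X. S w a (real n * b) X \<partial>path_law 0) - (\<integral>X. (\<Sum>j<n. S w (a + real j * b) b X) \<partial>path_law 0)\<bar> \<le>
    0 + (2 * C\<^sub>0 * (real n * b) + 2 * C\<^sub>0 * (real n * b)) * p"
  proof (rule expectation_close[OF measurable_S _ _ _ sets_blocks_bad p order_refl])
    show "\<bar>S w a (real n * b) X\<bar> \<le> 2 * C\<^sub>0 * (real n * b)" for X
      using b by (intro abs_S_le) simp
    show "(\<lambda>X. \<Sum>j<n. S w (a + real j * b) b X) \<in> borel_measurable path_space"
      by (intro borel_measurable_sum measurable_S)
    show "\<bar>\<Sum>j<n. S w (a + real j * b) b X\<bar> \<le> 2 * C\<^sub>0 * (real n * b)" for X
    proof -
      have "\<bar>\<Sum>j<n. S w (a + real j * b) b X\<bar> \<le> (\<Sum>j<n. \<bar>S w (a + real j * b) b X\<bar>)" by (rule sum_abs)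
      also have "\<dots> \<le> (\<Sum>j<n. 2 * C\<^sub>0 * b)" by (intro sum_mono abs_S_le b0)
      finally show ?thesis by (simp add: mult_ac)
    qed
    show "AE X in path_law 0. X \<notin> {X. blocks_bad a b n X} \<longrightarrow>
        \<bar>S w a (real n * b) X - (\<Sum>j<n. S w (a + real j * b) b X)\<bar> \<le> 0"
      using AE_start[of 0] by eventually_elim (auto simp: S_telescope[OF _ _ w a b])
  qed
  moreover have "(\<integral>X. (\<Sum>j<n. S w (a + real j * b) b X) \<partial>path_law 0) = (\<Sum>j<n. ES w (a + real j * b) b)"
    unfolding ES_def by (rule Bochner_Integration.integral_sum) (rule integrable_S[OF b0])
  ultimately show ?thesis by (simp add: ES_def algebra_simps)
qed

text \<open>A block of size \<open>2 ^ j\<close> is cut into blocks of about the square root of its size; the term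
  \<open>- 4 A / j\<close> of the bound absorbs the error \<open>O(1 / j)\<close> of this step in the recursion from
  \<open>j\<close> to \<open>(j + 1) div 2\<close>.\<close>

lemma mean_chain:
  assumes w: "norm w \<le> 1" and large_scale: "large_scale i" and j1: "2 * i \<ge> j\<^sub>1"
    and sb: "\<And>j a n. j \<ge> j\<^sub>1 \<Longrightarrow> 0 \<le> a \<Longrightarrow> n \<le> 2 ^ j \<Longrightarrow>
      emeasure (path_law 0) {X. blocks_bad a (2 ^ j) n X} \<le> ennreal (C\<^sub>4 / real j)"
    and j: "j \<ge> 2 * i" and a: "a \<ge> 0"
  shows "\<bar>ES w a (2 ^ j) - 2 ^ j * (ES w 0 (4 ^ i) / 4 ^ i)\<bar> \<le>
    2 ^ j * (e\<^sub>3 i + 5 * (4 * C\<^sub>0 * C\<^sub>4) / real (2 * i) - 4 * (4 * C\<^sub>0 * C\<^sub>4) / real j)"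
  using j a
proof (induction j arbitrary: a rule: less_induct)
  case (less j)
  define A where "A = 4 * C\<^sub>0 * C\<^sub>4"
  define u where "u = ES w 0 (4 ^ i) / 4 ^ i"
  have A: "A > 0" using C0_ge C4_pos by (simp add: A_def)
  have i2: "i \<ge> 2" using large_scale by (simp add: large_scale_def)
  have e: "(2::real) ^ (2 * i) = 4 ^ i" by (simp add: power_mult)
  \<comment> \<open>One enlargement: a block of length 2^(s+t) is cut into 2^t blocks of length 2^s.
    The restriction t \<le> s is the range in which bad blocks have probability at most
    \<open>C\<^sub>4 / real s\<close>.\<close>
  have step: "\<bar>ES w a (2 ^ (s + t)) - 2 ^ (s + t) * u\<bar> \<le> 2 ^ (s + t) * (\<delta> + A / real s)"
    if s: "s \<ge> j\<^sub>1" "s > 0" and ts: "t \<le> s" and bd: "\<And>a. a \<ge> 0 \<Longrightarrow> \<bar>ES w a (2 ^ s) - 2 ^ s * u\<bar> \<le> 2 ^ s * \<delta>"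
      and a: "a \<ge> 0" for s t :: nat and \<delta> a :: real
  proof -
    let ?b = "(2::real) ^ s"
    have n: "(2::nat) ^ t \<le> 2 ^ s" using ts by (intro power_increasing) auto
    have eq: "real (2 ^ t) * ?b = 2 ^ (s + t)" by (simp add: power_add)
    have "\<bar>ES w a (real (2 ^ t) * ?b) - (\<Sum>j<2 ^ t. ES w (a + real j * ?b) ?b)\<bar> \<le>
      4 * C\<^sub>0 * (C\<^sub>4 / real s) * (real (2 ^ t) * ?b)"
      by (rule ES_superblock[OF w a _ sb[OF s(1) a n]]) (use C4_pos in simp_all)
    then have 1: "\<bar>ES w a (2 ^ (s + t)) - (\<Sum>j<2 ^ t. ES w (a + real j * ?b) ?b)\<bar> \<le> 2 ^ (s + t) * (A / real s)"
      unfolding eq by (simp add: A_def mult_ac)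
    have "\<bar>(\<Sum>j<2 ^ t. ES w (a + real j * ?b) ?b) - 2 ^ (s + t) * u\<bar> =
      \<bar>\<Sum>j<(2::nat) ^ t. ES w (a + real j * ?b) ?b - ?b * u\<bar>"
      by (simp add: sum_subtractf power_add mult_ac)
    also have "\<dots> \<le> (\<Sum>j<(2::nat) ^ t. \<bar>ES w (a + real j * ?b) ?b - ?b * u\<bar>)" by (rule sum_abs)
    also have "\<dots> \<le> (\<Sum>j<(2::nat) ^ t. ?b * \<delta>)" using a by (intro sum_mono bd) simp
    also have "\<dots> = 2 ^ (s + t) * \<delta>" by (simp add: power_add)
    finally show ?thesis using 1 by (simp add: distrib_left)
  qed
  have base: "\<bar>ES w a (2 ^ (2 * i)) - 2 ^ (2 * i) * u\<bar> \<le> 2 ^ (2 * i) * e\<^sub>3 i" if "a \<ge> 0" for a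
    unfolding e using mean_all_levels[OF w large_scale that] by (simp add: u_def)
  have ri: "real (2 * i) > 0" using i2 by simp
  have "\<bar>ES w a (2 ^ j) - 2 ^ j * u\<bar> \<le> 2 ^ j * (e\<^sub>3 i + 5 * A / real (2 * i) - 4 * A / real j)"
  proof (cases "j \<le> 4 * i")
    case True
    define t where "t = j - 2 * i"
    have t: "j = 2 * i + t" "t \<le> 2 * i" using less.prems True by (auto simp: t_def)
    have "\<bar>ES w a (2 ^ j) - 2 ^ j * u\<bar> \<le> 2 ^ j * (e\<^sub>3 i + A / real (2 * i))"
      unfolding t(1) using i2 by (intro step[OF j1 _ t(2) base less.prems(2)]) auto
    also have "\<dots> \<le> 2 ^ j * (e\<^sub>3 i + 5 * A / real (2 * i) - 4 * A / real j)"
    proof (rule mult_left_mono)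
      have "4 * A / real j \<le> 4 * A / real (2 * i)"
        using less.prems ri A by (intro divide_left_mono) auto
      moreover have "5 * A / real (2 * i) = A / real (2 * i) + 4 * A / real (2 * i)"
        by (simp add: add_divide_distrib[symmetric])
      ultimately show "e\<^sub>3 i + A / real (2 * i) \<le> e\<^sub>3 i + 5 * A / real (2 * i) - 4 * A / real j" by linarith
    qed simp
    finally show ?thesis .
  next
    case False
    define s where "s = (j + 1) div 2"
    define t where "t = j - s"
    have st: "j = s + t" "t \<le> s" "s < j" "s \<ge> 2 * i" "s \<ge> j\<^sub>1" "s > 0" "4 * s \<le> 2 * j + 2"
      using False j1 i2 by (auto simp: s_def t_def)
    have IH: "\<bar>ES w a (2 ^ s) - 2 ^ s * u\<bar> \<le> 2 ^ s * (e\<^sub>3 i + 5 * A / real (2 * i) - 4 * A / real s)" if "a \<ge> 0" for a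
      using less.IH[OF st(3,4) that] by (simp only: A_def u_def)
    have "\<bar>ES w a (2 ^ j) - 2 ^ j * u\<bar> \<le>
      2 ^ j * ((e\<^sub>3 i + 5 * A / real (2 * i) - 4 * A / real s) + A / real s)"
      unfolding st(1) by (rule step[OF st(5,6,2) IH less.prems(2)])
    also have "\<dots> \<le> 2 ^ j * (e\<^sub>3 i + 5 * A / real (2 * i) - 4 * A / real j)"
    proof (rule mult_left_mono)
      \<comment> \<open>Here s is at most 3j/4, so the correction term gains 4A/s - 4A/j \<ge> A/s,
        which pays for the error of this enlargement.\<close>
      have "4 * real s \<le> 3 * real j" using st(7) False i2 by linarith
      then have "4 * A * real s \<le> 3 * A * real j" using A by (simp add: mult.assoc mult.left_commute[of _ A])
      then have "4 * A / real j \<le> 3 * A / real s" using st by (simp add: field_simps)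
      moreover have "4 * A / real s = 3 * A / real s + A / real s" by (simp add: add_divide_distrib[symmetric])
      ultimately show "e\<^sub>3 i + 5 * A / real (2 * i) - 4 * A / real s + A / real s \<le>
        e\<^sub>3 i + 5 * A / real (2 * i) - 4 * A / real j" by linarith
    qed simp
    finally show ?thesis .
  qed
  then show ?case by (simp only: A_def u_def)
qed

text \<open>One application of \<open>mean_chain\<close> puts every later scale within
  \<open>e\<^sub>3 i\<close> + O(1/i) of scale i. The mixing error is incurred at scale i only, so
  its convergence to 0 is enough.\<close>

lemma mean_converges:
  assumes w: "norm w \<le> 1"
  shows "convergent (\<lambda>i. ES w 0 (4 ^ i) / 4 ^ i)"
proof (rule Cauchy_convergent, rule metric_CauchyI)
  fix \<epsilon> :: real assume \<epsilon>: "\<epsilon> > 0"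
  define A where "A = 4 * C\<^sub>0 * C\<^sub>4"
  have A: "A > 0" using C0_ge C4_pos by (simp add: A_def)
  obtain j\<^sub>1 where "j\<^sub>1 \<ge> 4" and sb: "\<And>j a n. j \<ge> j\<^sub>1 \<Longrightarrow> 0 \<le> a \<Longrightarrow> n \<le> 2 ^ j \<Longrightarrow>
      emeasure (path_law 0) {X. blocks_bad a (2 ^ j) n X} \<le> ennreal (C\<^sub>4 / real j)"
    by (rule blocks_bad_bound) (rule that)
  have "(\<lambda>i. e\<^sub>3 i + 5 * A / real (2 * i)) \<longlonglongrightarrow> 0 + 0"
  proof (intro tendsto_add e3_tendsto)
    have "(\<lambda>i. 5 * A / 2 * (1 / real i)) \<longlonglongrightarrow> 5 * A / 2 * 0"
      by (intro tendsto_mult tendsto_const lim_1_over_n)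
    then show "(\<lambda>i. 5 * A / real (2 * i)) \<longlonglongrightarrow> 0" by (simp add: field_simps)
  qed
  then have "\<forall>\<^sub>F i in sequentially. e\<^sub>3 i + 5 * A / real (2 * i) < \<epsilon> / 2"
    using \<epsilon> by (intro order_tendstoD) auto
  then have "\<forall>\<^sub>F i in sequentially. e\<^sub>3 i + 5 * A / real (2 * i) < \<epsilon> / 2 \<and> large_scale i \<and> j\<^sub>1 \<le> i"
    using eventually_large_scale eventually_ge_at_top[of j\<^sub>1] by eventually_elim simp
  then obtain i where i: "e\<^sub>3 i + 5 * A / real (2 * i) < \<epsilon> / 2" "large_scale i" "j\<^sub>1 \<le> i"
    using eventually_happens'[OF sequentially_bot] by blast
  have near: "dist (ES w 0 (4 ^ i') / 4 ^ i') (ES w 0 (4 ^ i) / 4 ^ i) < \<epsilon> / 2" if i': "i' \<ge> i" for i'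
  proof -
    have e: "(2::real) ^ (2 * i') = 4 ^ i'" by (simp add: power_mult)
    have "\<bar>ES w 0 (2 ^ (2 * i')) - 2 ^ (2 * i') * (ES w 0 (4 ^ i) / 4 ^ i)\<bar> \<le>
      2 ^ (2 * i') * (e\<^sub>3 i + 5 * (4 * C\<^sub>0 * C\<^sub>4) / real (2 * i) - 4 * (4 * C\<^sub>0 * C\<^sub>4) / real (2 * i'))"
      by (rule mean_chain[OF w i(2) _ sb]) (use i i' in auto)
    also have "\<dots> \<le> 2 ^ (2 * i') * (e\<^sub>3 i + 5 * A / real (2 * i))"
      using A by (intro mult_left_mono) (auto simp: A_def)
    finally have "\<bar>ES w 0 (4 ^ i') - 4 ^ i' * (ES w 0 (4 ^ i) / 4 ^ i)\<bar> \<le> 4 ^ i' * (e\<^sub>3 i + 5 * A / real (2 * i))"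
      unfolding e .
    moreover have "\<bar>ES w 0 (4 ^ i') - 4 ^ i' * (ES w 0 (4 ^ i) / 4 ^ i)\<bar> =
      4 ^ i' * \<bar>ES w 0 (4 ^ i') / 4 ^ i' - ES w 0 (4 ^ i) / 4 ^ i\<bar>"
    proof -
      have "ES w 0 (4 ^ i') - 4 ^ i' * (ES w 0 (4 ^ i) / 4 ^ i) =
        4 ^ i' * (ES w 0 (4 ^ i') / 4 ^ i' - ES w 0 (4 ^ i) / 4 ^ i)" by (simp add: right_diff_distrib)
      then show ?thesis by (simp only: abs_mult) simp
    qed
    ultimately have "\<bar>ES w 0 (4 ^ i') / 4 ^ i' - ES w 0 (4 ^ i) / 4 ^ i\<bar> \<le> e\<^sub>3 i + 5 * A / real (2 * i)"
      by simp
    with i(1) show ?thesis by (simp add: dist_real_def)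
  qed
  show "\<exists>N. \<forall>m\<ge>N. \<forall>n\<ge>N. dist (ES w 0 (4 ^ m) / 4 ^ m) (ES w 0 (4 ^ n) / 4 ^ n) < \<epsilon>"
    using near by (intro exI[of _ i]) (meson dist_triangle_half_l)
qed

text \<open>Displacement in direction w per level gained and not per unit of time; it makes sense
  even for a walk of zero velocity.\<close>

definition speed :: "real^'d \<Rightarrow> real" where
  "speed w = lim (\<lambda>i. ES w 0 (4 ^ i) / 4 ^ i)"

lemma speed: "norm w \<le> 1 \<Longrightarrow> (\<lambda>i. ES w 0 (4 ^ i) / 4 ^ i) \<longlonglongrightarrow> speed w"
  unfolding speed_def using mean_converges by (simp add: convergent_LIMSEQ_iff)

lemma speed_minus: "norm w \<le> 1 \<Longrightarrow> speed (- w) = - speed w"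
proof -
  assume w: "norm w \<le> 1"
  have "(\<lambda>i. ES (- w) 0 (4 ^ i) / 4 ^ i) \<longlonglongrightarrow> - speed w"
    using tendsto_minus[OF speed[OF w]] by (simp add: ES_minus)
  then show ?thesis using speed[of "- w"] w LIMSEQ_unique by fastforce
qed


section \<open>Concentration of the hitting positions\<close>

text \<open>A block of length 4^i preceded by the gap of 2^i levels that \<open>block_mean\<close>
  requires; the gaps are a vanishing fraction of the whole.\<close>

definition period :: "nat \<Rightarrow> real" where
  "period i = 4 ^ i + 2 ^ i"

text \<open>The main part of the upper bound in \<open>block_mean\<close> for the mean of a block
  given the past, mixing error included. The centred sums W then have a conditional drift that is
  nonpositive up to summable errors.\<close>

definition drift :: "real^'d \<Rightarrow> nat \<Rightarrow> real" where
  "drift w i = ES w 0 (4 ^ i) + 4 ^ i * e\<^sub>1 i"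

definition block :: "real^'d \<Rightarrow> nat \<Rightarrow> nat \<Rightarrow> (nat \<Rightarrow> int^'d) \<Rightarrow> real" where
  "block w i j = S w (real j * period i + 2 ^ i) (4 ^ i)"

definition W :: "real^'d \<Rightarrow> nat \<Rightarrow> nat \<Rightarrow> (nat \<Rightarrow> int^'d) \<Rightarrow> real" where
  "W w i n X = (\<Sum>j<n. block w i j X - drift w i)"

lemma period_pos: "period i > 0" by (simp add: period_def add_pos_pos)

lemma measurable_W: "W w i n \<in> borel_measurable path_space"
  unfolding W_def[abs_def] block_def
  by (intro borel_measurable_sum borel_measurable_diff measurable_S borel_measurable_const)

lemma adapted_W: "adapted (real n * period i) (W w i n)"
  unfolding adapted_def
proof (intro allI impI)
  fix X Y m assume h: "hits (real n * period i) m X" "\<forall>i\<le>m. X i = Y i"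
  have "block w i j X = block w i j Y" if "j < n" for j
  proof -
    have "real j + 1 \<le> real n" using that by linarith
    then have "(real j + 1) * period i \<le> real n * period i"
      using period_pos[of i] by (intro mult_right_mono) auto
    then have "real j * period i + 2 ^ i + 4 ^ i \<le> real n * period i"
      by (simp add: distrib_right period_def)
    then have "adapted (real n * period i) (block w i j)"
      unfolding block_def by (rule adapted_S) simp
    with h show ?thesis unfolding adapted_def by blast
  qed
  then show "W w i n X = W w i n Y" unfolding W_def by simp
qed

lemma abs_block_le:
  assumes "\<bar>e\<^sub>1 i\<bar> \<le> C\<^sub>0"
  shows "\<bar>block w i j X - drift w i\<bar> \<le> 5 * C\<^sub>0 * 4 ^ i"
proof -
  have "\<bar>block w i j X\<bar> \<le> 2 * C\<^sub>0 * 4 ^ i" unfolding block_def by (rule abs_S_le) simp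
  moreover have "\<bar>ES w 0 (4 ^ i)\<bar> \<le> 2 * C\<^sub>0 * 4 ^ i" by (rule abs_ES_le) simp
  moreover have "\<bar>4 ^ i * e\<^sub>1 i\<bar> \<le> C\<^sub>0 * 4 ^ i"
    using mult_left_mono[OF assms, of "4 ^ i"] by (simp add: abs_mult mult.commute)
  ultimately show ?thesis unfolding drift_def by linarith
qed

lemma abs_W_le:
  assumes "\<bar>e\<^sub>1 i\<bar> \<le> C\<^sub>0"
  shows "\<bar>W w i n X\<bar> \<le> real n * (5 * C\<^sub>0 * 4 ^ i)"
proof -
  have "\<bar>W w i n X\<bar> \<le> (\<Sum>j<n. \<bar>block w i j X - drift w i\<bar>)" unfolding W_def by (rule sum_abs)
  also have "\<dots> \<le> (\<Sum>j<n. 5 * C\<^sub>0 * 4 ^ i)" by (intro sum_mono abs_block_le assms)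
  finally show ?thesis by simp
qed

lemma square_pos_part_add: "(max 0 (x + s))\<^sup>2 \<le> (max 0 x)\<^sup>2 + 2 * (max 0 x * s) + s\<^sup>2" for x s :: real
proof (cases "x \<ge> 0")
  case True
  have "(max 0 (x + s))\<^sup>2 \<le> (x + s)\<^sup>2" by (auto simp: max_def)
  with True show ?thesis by (simp add: power2_sum)
next
  case False
  then have "\<bar>max 0 (x + s)\<bar> \<le> \<bar>s\<bar>" by (simp add: max_def)
  then have "(max 0 (x + s))\<^sup>2 \<le> s\<^sup>2" by (simp only: abs_le_square_iff)
  with False show ?thesis by (simp add: max_def)
qed

text \<open>Since \<open>block_mean\<close> bounds the conditional drift only from above, the second moment is
  available for the positive part of \<open>W\<close> only.\<close>

lemma W_second_moment:
  assumes w: "norm w \<le> 1" and large_scale: "large_scale i" and e1: "\<bar>e\<^sub>1 i\<bar> \<le> C\<^sub>0"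
  shows "(\<integral>X. (max 0 (W w i n X))\<^sup>2 \<partial>path_law 0) \<le>
    (C\<^sub>0 * 4 ^ i)\<^sup>2 * (25 * real n + 80 * 2 powr (- real i / 4) * (real n)\<^sup>2)"
proof (induction n)
  case 0
  then show ?case by (simp add: W_def)
next
  case (Suc n)
  interpret Q: prob_space "path_law 0" by (rule prob_space_path_law)
  define D where "D = 5 * C\<^sub>0 * 4 ^ i"
  define q where "q = 2 powr (- real i / 4)"
  define U where "U X = max 0 (W w i n X)" for X
  let ?s = "\<lambda>X. block w i n X - drift w i"
  have C: "C\<^sub>0 > 0" using C0_ge by simp
  have D: "D > 0" using C by (simp add: D_def)
  have Um: "U \<in> borel_measurable path_space"
    unfolding U_def[abs_def] by (intro borel_measurable_max borel_measurable_const measurable_W)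
  have U: "0 \<le> U X" "U X \<le> real n * D" for X
    using abs_W_le[OF e1, of w n X] D by (auto simp: U_def D_def)
  have Ua: "adapted (real n * period i) U"
    using adapted_W[of n i w] unfolding adapted_def U_def by metis
  have sm: "block w i n \<in> borel_measurable path_space" unfolding block_def by (rule measurable_S)
  have bb: "\<bar>block w i n X\<bar> \<le> 2 * C\<^sub>0 * 4 ^ i" for X unfolding block_def by (rule abs_S_le) simp
  have s: "\<bar>?s X\<bar> \<le> D" for X unfolding D_def by (rule abs_block_le[OF e1])
  have iU: "integrable (path_law 0) U"
    by (rule integrable_path_law[OF Um, where B="real n * D"]) (use U in \<open>simp add: abs_le_iff order_trans[of _ 0]\<close>)
  have iUU: "integrable (path_law 0) (\<lambda>X. (U X)\<^sup>2)"
  proof (rule integrable_path_law[where B="(real n * D)\<^sup>2"])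
    show "(\<lambda>X. (U X)\<^sup>2) \<in> borel_measurable path_space" by (intro borel_measurable_power Um)
    show "\<bar>(U X)\<^sup>2\<bar> \<le> (real n * D)\<^sup>2" for X using power_mono[OF U(2)[of X] U(1)[of X], of 2] by simp
  qed
  have iUb: "integrable (path_law 0) (\<lambda>X. U X * block w i n X)"
  proof (rule integrable_path_law[where B="(real n * D) * (2 * C\<^sub>0 * 4 ^ i)"])
    show "(\<lambda>X. U X * block w i n X) \<in> borel_measurable path_space" by (intro borel_measurable_times Um sm)
    show "\<bar>U X * block w i n X\<bar> \<le> (real n * D) * (2 * C\<^sub>0 * 4 ^ i)" for X
      unfolding abs_mult using U[of X] bb[of X] D by (intro mult_mono) auto
  qed
  \<comment> \<open>\<open>block_mean\<close> at the end of the n-th period, with the positive part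
    of W as functional of the past; it controls the cross term of the recursion.\<close>
  have mean: "(\<integral>X. U X * block w i n X \<partial>path_law 0) \<le>
    drift w i * (\<integral>X. U X \<partial>path_law 0) + 8 * C\<^sub>0 * 4 ^ i * q * (real n * D)"
    unfolding block_def drift_def q_def
    by (rule block_mean[OF w _ _ _ _ _ Ua Um U]) (use large_scale period_pos[of i] in \<open>auto simp: large_scale_def\<close>)
  have "(\<integral>X. (max 0 (W w i (Suc n) X))\<^sup>2 \<partial>path_law 0) \<le>
    (\<integral>X. (U X)\<^sup>2 + 2 * (U X * block w i n X - drift w i * U X) + D\<^sup>2 \<partial>path_law 0)"
  proof (rule integral_mono)
    show "integrable (path_law 0) (\<lambda>X. (max 0 (W w i (Suc n) X))\<^sup>2)"
    proof (rule integrable_path_law[where B="(real (Suc n) * D)\<^sup>2"])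
      show "(\<lambda>X. (max 0 (W w i (Suc n) X))\<^sup>2) \<in> borel_measurable path_space"
        by (intro borel_measurable_power borel_measurable_max borel_measurable_const measurable_W)
      fix X
      have "max 0 (W w i (Suc n) X) \<le> real (Suc n) * D"
        using abs_W_le[OF e1, of w "Suc n" X] D unfolding D_def[symmetric] by (auto simp: max_def)
      then show "\<bar>(max 0 (W w i (Suc n) X))\<^sup>2\<bar> \<le> (real (Suc n) * D)\<^sup>2"
        using power_mono[of "max 0 (W w i (Suc n) X)" _ 2] by simp
    qed
    show "integrable (path_law 0) (\<lambda>X. (U X)\<^sup>2 + 2 * (U X * block w i n X - drift w i * U X) + D\<^sup>2)"
      using iU iUU iUb by simp
    fix X
    have "(max 0 (W w i (Suc n) X))\<^sup>2 \<le> (U X)\<^sup>2 + 2 * (U X * ?s X) + (?s X)\<^sup>2"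
      using square_pos_part_add[of "W w i n X" "?s X"] by (simp add: W_def U_def)
    also have "(?s X)\<^sup>2 \<le> D\<^sup>2" using s[of X] D by (simp add: abs_le_square_iff[symmetric])
    finally show "(max 0 (W w i (Suc n) X))\<^sup>2 \<le> (U X)\<^sup>2 + 2 * (U X * block w i n X - drift w i * U X) + D\<^sup>2"
      by (simp add: algebra_simps)
  qed
  also have "\<dots> = (\<integral>X. (U X)\<^sup>2 \<partial>path_law 0) +
      2 * ((\<integral>X. U X * block w i n X \<partial>path_law 0) - drift w i * (\<integral>X. U X \<partial>path_law 0)) + D\<^sup>2"
    using iU iUU iUb by simp
  also have "\<dots> \<le> (C\<^sub>0 * 4 ^ i)\<^sup>2 * (25 * real n + 80 * q * (real n)\<^sup>2) + 2 * (8 * C\<^sub>0 * 4 ^ i * q * (real n * D)) + D\<^sup>2"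
  proof (intro add_right_mono add_mono mult_left_mono)
    show "(\<integral>X. (U X)\<^sup>2 \<partial>path_law 0) \<le> (C\<^sub>0 * 4 ^ i)\<^sup>2 * (25 * real n + 80 * q * (real n)\<^sup>2)"
      using Suc.IH unfolding U_def q_def .
    show "(\<integral>X. U X * block w i n X \<partial>path_law 0) - drift w i * (\<integral>X. U X \<partial>path_law 0) \<le> 8 * C\<^sub>0 * 4 ^ i * q * (real n * D)"
      using mean by (simp only: diff_le_eq add.commute)
  qed simp
  also have "\<dots> = (C\<^sub>0 * 4 ^ i)\<^sup>2 * (25 * real (Suc n) + 80 * q * ((real n)\<^sup>2 + real n))"
    by (simp add: D_def power2_eq_square algebra_simps)
  also have "\<dots> \<le> (C\<^sub>0 * 4 ^ i)\<^sup>2 * (25 * real (Suc n) + 80 * q * (real (Suc n))\<^sup>2)"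
  proof (intro mult_left_mono add_left_mono)
    show "(real n)\<^sup>2 + real n \<le> (real (Suc n))\<^sup>2" by (simp add: power2_eq_square algebra_simps)
  qed (simp_all add: q_def)
  finally show ?case unfolding q_def .
qed

text \<open>Chebyshev's inequality. With n \<ge> 4^i blocks the diagonal term 25 n is at most 25 n^2
  / 4^i, so both terms decay geometrically in i.\<close>

lemma W_tail:
  assumes w: "norm w \<le> 1" and large_scale: "large_scale i" and e1: "\<bar>e\<^sub>1 i\<bar> \<le> C\<^sub>0" and \<epsilon>: "\<epsilon> > 0" and n: "real n \<ge> 4 ^ i"
  shows "measure (path_law 0) {X. \<epsilon> * (real n * 4 ^ i) \<le> W w i n X} \<le>
    C\<^sub>0\<^sup>2 / \<epsilon>\<^sup>2 * (25 * (1 / 4) ^ i + 80 * 2 powr (- real i / 4))"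
proof -
  interpret Q: prob_space "path_law 0" by (rule prob_space_path_law)
  define q where "q = 2 powr (- real i / 4)"
  define t where "t = \<epsilon> * (real n * 4 ^ i)"
  let ?E = "{X. t \<le> W w i n X}"
  have n0: "real n > 0" using n by (rule less_le_trans[rotated]) simp
  have t: "t > 0" using \<epsilon> n0 by (simp add: t_def)
  have Es: "?E \<in> sets (path_law 0)"
    using measurable_sets[OF measurable_W[of w i n], of "{t..}"]
    by (simp add: sets_path_law vimage_def)
  have "t\<^sup>2 * measure (path_law 0) ?E = (\<integral>X. t\<^sup>2 * indicat_real ?E X \<partial>path_law 0)"
    using Es by simp
  also have "\<dots> \<le> (\<integral>X. (max 0 (W w i n X))\<^sup>2 \<partial>path_law 0)"
  proof (rule integral_mono)
    show "integrable (path_law 0) (\<lambda>X. t\<^sup>2 * indicat_real ?E X)"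
      using Es by (auto simp: Q.emeasure_eq_measure)
    show "integrable (path_law 0) (\<lambda>X. (max 0 (W w i n X))\<^sup>2)"
    proof (rule integrable_path_law[where B="(real n * (5 * C\<^sub>0 * 4 ^ i))\<^sup>2"])
      show "(\<lambda>X. (max 0 (W w i n X))\<^sup>2) \<in> borel_measurable path_space"
        by (intro borel_measurable_power borel_measurable_max borel_measurable_const measurable_W)
      fix X
      have "max 0 (W w i n X) \<le> real n * (5 * C\<^sub>0 * 4 ^ i)"
        using abs_W_le[OF e1, of w n X] by (auto simp: max_def)
      then show "\<bar>(max 0 (W w i n X))\<^sup>2\<bar> \<le> (real n * (5 * C\<^sub>0 * 4 ^ i))\<^sup>2"
        using power_mono[of "max 0 (W w i n X)" _ 2] by simp
    qed
    show "t\<^sup>2 * indicat_real ?E X \<le> (max 0 (W w i n X))\<^sup>2" for X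
      using t by (auto simp: indicator_def intro!: power_mono)
  qed
  also have "\<dots> \<le> (C\<^sub>0 * 4 ^ i)\<^sup>2 * (25 * real n + 80 * q * (real n)\<^sup>2)"
    unfolding q_def by (rule W_second_moment[OF w large_scale e1])
  also have "25 * real n \<le> 25 * (1 / 4) ^ i * (real n)\<^sup>2"
  proof -
    have "1 \<le> (1 / 4) ^ i * real n" using n by (simp add: power_one_over field_simps)
    from mult_right_mono[OF this, of "25 * real n"] show ?thesis by (simp add: power2_eq_square mult_ac)
  qed
  also have "(C\<^sub>0 * 4 ^ i)\<^sup>2 * (25 * (1 / 4) ^ i * (real n)\<^sup>2 + 80 * q * (real n)\<^sup>2) =
      t\<^sup>2 * (C\<^sub>0\<^sup>2 / \<epsilon>\<^sup>2 * (25 * (1 / 4) ^ i + 80 * q))"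
    using \<epsilon> by (simp add: t_def power_mult_distrib field_simps)
  finally have "t\<^sup>2 * measure (path_law 0) ?E \<le> t\<^sup>2 * (C\<^sub>0\<^sup>2 / \<epsilon>\<^sup>2 * (25 * (1 / 4) ^ i + 80 * q))"
    by (simp add: mult_left_mono)
  then have "measure (path_law 0) ?E \<le> C\<^sub>0\<^sup>2 / \<epsilon>\<^sup>2 * (25 * (1 / 4) ^ i + 80 * q)"
    by (rule mult_left_le_imp_le) (use t in simp)
  then show ?thesis unfolding t_def q_def .
qed

lemma pos_0: "X 0 = 0 \<Longrightarrow> pos 0 X = 0"
proof -
  assume X: "X 0 = 0"
  then have "hits 0 0 X" by (simp add: hits_def)
  from hits_pos[OF this] X show ?thesis by simp
qed

text \<open>W leaves out the gaps, each of which contributes at most 2 \<open>C\<^sub>0\<close> 2^i.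
  Good exits at size 2^i bound the displacement over a block by \<open>C\<^sub>0\<close> (4^i +
  2^i), below the truncation level of S.\<close>

lemma pos_le_W:
  assumes w: "norm w \<le> 1" and X: "steps X" "X 0 = 0"
    and g: "\<And>u. 0 \<le> u \<Longrightarrow> u \<le> real n * period i \<Longrightarrow> good_hit u (2 ^ i) X" and m: "m \<le> n"
  shows "real_vec (pos (real m * period i) X) \<bullet> w \<le> W w i m X + real m * drift w i + 2 * real m * C\<^sub>0 * 2 ^ i"
  using m
proof (induction m)
  case 0
  then show ?case using X by (simp add: pos_0 W_def)
next
  case (Suc m)
  have C: "C\<^sub>0 > 0" using C0_ge by simp
  let ?a = "real m * period i" and ?J = "(2::real) ^ i" and ?b = "(4::real) ^ i"
  have a0: "?a \<ge> 0" using period_pos[of i] by simp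
  have J1: "?J \<ge> 1" and Jb: "?J \<le> ?b" by (auto intro: power_mono)
  have e: "real (Suc m) * period i = ?a + ?J + ?b" by (simp add: period_def algebra_simps)
  have le: "real (Suc m) * period i \<le> real n * period i"
    using Suc.prems period_pos[of i] by (intro mult_right_mono) auto
  have g': "good_hit u ?J X" if "0 \<le> u" "u \<le> ?a + ?J + ?b" for u
    by (rule g) (use that le e in auto)
  have aJ: "0 \<le> ?a + ?J" using a0 by (rule add_nonneg_nonneg) simp
  have b0: "u \<le> ?a + ?J \<Longrightarrow> u \<le> ?a + ?J + ?b" for u by (erule order_trans) simp
  have 1: "norm (real_vec (pos (?a + ?J) X - pos ?a X)) \<le> C\<^sub>0 * (?a + ?J - ?a + ?J)"
    by (rule good_hit_chain[OF X(1) _ J1 g']) (use X a0 in \<open>auto intro: b0\<close>)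
  have 2: "norm (real_vec (pos (?a + ?J + ?b) X - pos (?a + ?J) X)) \<le> C\<^sub>0 * (?a + ?J + ?b - (?a + ?J) + ?J)"
    by (rule good_hit_chain[OF X(1) _ J1 g']) (use X aJ in \<open>auto intro: order_trans[OF aJ]\<close>)
  also have "\<dots> \<le> 2 * C\<^sub>0 * ?b" using C Jb by (simp add: algebra_simps)
  finally have "\<bar>inc w (?a + ?J) ?b X\<bar> \<le> 2 * C\<^sub>0 * ?b"
    unfolding inc_def using inner_unit[OF w] order_trans by blast
  then have bl: "block w i m X = inc w (?a + ?J) ?b X"
    unfolding block_def S_def by (rule clamp_abs_id)
  have "real_vec (pos (?a + ?J) X - pos ?a X) \<bullet> w \<le> 2 * C\<^sub>0 * ?J"
    using inner_unit[OF w, of "real_vec (pos (?a + ?J) X - pos ?a X)"] 1 by simp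
  moreover have "real_vec (pos (?a + ?J + ?b) X) \<bullet> w =
    real_vec (pos ?a X) \<bullet> w + real_vec (pos (?a + ?J) X - pos ?a X) \<bullet> w + block w i m X"
    unfolding bl inc_def by (simp add: real_vec_diff inner_diff_left)
  moreover have "real_vec (pos ?a X) \<bullet> w \<le> W w i m X + real m * drift w i + 2 * real m * C\<^sub>0 * ?J"
    using Suc by simp
  ultimately show ?case unfolding e by (simp add: W_def algebra_simps)
qed

text \<open>With J = 2^i the levels in question are of order J^4, so the ball has of order J^(4d)
  sites, and M \<ge> 4d + 1 makes the union bound at size J of order 1/J.\<close>

lemma regular_bound:
  assumes n: "real n \<le> 16 * 4 ^ i" and J: "2 ^ i \<ge> L\<^sub>0"
  shows "measure (path_law 0) {X. ball_bad (C\<^sub>0 * (real n * period i + 2 ^ i)) (2 ^ i) X} \<le>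
    (67 * C\<^sub>0) ^ CARD('d) * (1 / 2) ^ i"
proof -
  interpret Q: prob_space "path_law 0" by (rule prob_space_path_law)
  define J where "J = (2::real) ^ i"
  define d where "d = CARD('d)"
  have C: "C\<^sub>0 > 0" using C0_ge by simp
  have J1: "J \<ge> 1" by (simp add: J_def)
  have b: "(4::real) ^ i = J\<^sup>2" unfolding J_def by (rule pow4)
  have J2: "J \<le> J\<^sup>2" "1 \<le> J ^ 4" "J \<le> J ^ 4"
    using J1 self_le_power[of J 2] self_le_power[of J 4] by auto
  \<comment> \<open>The period is at most 2 J^2 and n at most 16 J^2; the remaining J brings 32 to
    33, and 67 = 2 * 33 + 1 appears in the count of sites.\<close>
  have p: "real n * period i + J \<le> 33 * J ^ 4"
  proof -
    have "period i \<le> 2 * J\<^sup>2" unfolding period_def b J_def[symmetric] using J2 by simp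
    then have "real n * period i \<le> (16 * J\<^sup>2) * (2 * J\<^sup>2)"
      using n period_pos[of i] unfolding b by (intro mult_mono) auto
    also have "\<dots> = 32 * J ^ 4" by (simp add: power2_eq_square power4_eq_xxxx)
    finally show ?thesis using J2 by linarith
  qed
  define \<rho> where "\<rho> = C\<^sub>0 * (real n * period i + J)"
  have \<rho>0: "\<rho> \<ge> 0" using C period_pos[of i] J1 by (simp add: \<rho>_def)
  have "\<rho> \<le> C\<^sub>0 * (33 * J ^ 4)" unfolding \<rho>_def using C by (intro mult_left_mono p) simp
  moreover have "1 * 1 \<le> C\<^sub>0 * J ^ 4" using J2 C0_ge by (intro mult_mono) auto
  ultimately have \<rho>: "2 * \<rho> + 1 \<le> 67 * C\<^sub>0 * J ^ 4" by simp
  have "(2 * \<rho> + 1) ^ d * J powr - M \<le> (67 * C\<^sub>0 * J ^ 4) ^ d * J powr - M"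
    using \<rho> \<rho>0 by (intro mult_right_mono power_mono) auto
  also have "\<dots> = (67 * C\<^sub>0) ^ d * (J powr (4 * real d) * J powr - M)"
  proof -
    have "(J ^ 4) ^ d = J ^ (4 * d)" by (rule power_mult[symmetric])
    also have "\<dots> = J powr real (4 * d)" using J1 by (intro powr_realpow[symmetric]) simp
    also have "real (4 * d) = 4 * real d" by simp
    finally show ?thesis unfolding power_mult_distrib[of "67 * C\<^sub>0" "J ^ 4"] by simp
  qed
  also have "\<dots> = (67 * C\<^sub>0) ^ d * J powr (4 * real d - M)" by (simp add: powr_add[symmetric])
  also have "\<dots> \<le> (67 * C\<^sub>0) ^ d * J powr - 1"
  proof (intro mult_left_mono powr_mono J1)
    show "4 * real d - M \<le> - 1" using M d_ge_1 unfolding d_def by linarith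
  qed (use C in simp)
  also have "J powr - 1 = (1 / 2) ^ i"
  proof -
    have "J powr - 1 = inverse J" using J1 by (simp only: powr_minus) simp
    then show ?thesis unfolding J_def by (simp only: power_one_over inverse_eq_divide)
  qed
  finally have *: "(2 * \<rho> + 1) ^ d * J powr - M \<le> (67 * C\<^sub>0) ^ d * (1 / 2) ^ i" .
  have "emeasure (path_law 0) {X. ball_bad \<rho> J X} \<le> ennreal ((2 * \<rho> + 1) ^ CARD('d) * J powr - M)"
    by (rule ball_bad_bound[OF \<rho>0]) (use J in \<open>simp add: J_def\<close>)
  also have "\<dots> \<le> ennreal ((67 * C\<^sub>0) ^ d * (1 / 2) ^ i)" using * unfolding d_def by (rule ennreal_leI)
  finally show ?thesis
    using C unfolding \<rho>_def J_def d_def by (simp add: Q.emeasure_eq_measure)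
qed

section \<open>Almost sure convergence along sparse levels\<close>

lemma AE_eventually_not:
  fixes E :: "nat \<Rightarrow> (nat \<Rightarrow> int^'d) set"
  assumes E: "\<And>i. E i \<in> sets path_space" and b: "\<forall>\<^sub>F i in sequentially. measure (path_law 0) (E i) \<le> g i"
    and g: "summable g"
  shows "AE X in path_law 0. \<forall>\<^sub>F i in sequentially. X \<notin> E i"
proof -
  interpret Q: prob_space "path_law 0" by (rule prob_space_path_law)
  have "AE X in path_law 0. eventually (\<lambda>i. X \<in> space (path_law 0) - E i) sequentially"
  proof (rule borel_cantelli_AE1)
    show "summable (\<lambda>i. measure (path_law 0) (E i))"
      by (rule summable_comparison_test_ev[OF _ g]) (use b in simp)
  qed (use E in \<open>auto simp: sets_path_law Q.emeasure_eq_measure\<close>)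
  then show ?thesis
  proof eventually_elim
    case (elim X)
    then show ?case by eventually_elim simp
  qed
qed

text \<open>The freedom of a factor 16 in the choice of n matches the ratio between the levels 4^i *
  \<open>period i\<close> of consecutive scales, so that fixed proportions between two scales can be
  treated as well.\<close>

lemma AE_pos_upper:
  fixes n :: "nat \<Rightarrow> nat"
  assumes w: "norm w \<le> 1" and n: "\<And>i. real (n i) \<ge> 4 ^ i" "\<And>i. real (n i) \<le> 16 * 4 ^ i" and \<epsilon>: "\<epsilon> > 0"
  shows "AE X in path_law 0. \<forall>\<^sub>F i in sequentially.
    real_vec (pos (real (n i) * period i) X) \<bullet> w / (real (n i) * period i) \<le> speed w + 2 * \<epsilon>"
proof -
  define E where "E i = {X. \<epsilon> * (real (n i) * 4 ^ i) \<le> W w i (n i) X}" for i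
  define E' where "E' i = {X. ball_bad (C\<^sub>0 * (real (n i) * period i + 2 ^ i)) (2 ^ i) X}" for i
  have sumq: "summable (\<lambda>i. 2 powr (- real i / 4) :: real)"
  proof -
    have "summable (\<lambda>i. (2 powr (- 1 / 4) :: real) ^ i)"
      by (rule summable_geometric) (simp add: powr_less_one)
    moreover have "(2 powr (- 1 / 4)) ^ i = (2 powr (- real i / 4) :: real)" for i
      by (simp add: powr_realpow[symmetric] powr_powr)
    ultimately show ?thesis by (simp only:)
  qed
  have ev: "\<forall>\<^sub>F i in sequentially. large_scale i \<and> \<bar>e\<^sub>1 i\<bar> \<le> C\<^sub>0"
  proof (rule eventually_conj[OF eventually_large_scale])
    have "\<forall>\<^sub>F i in sequentially. \<bar>e\<^sub>1 i\<bar> < C\<^sub>0"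
      using tendsto_rabs[OF e1_tendsto] C0_ge by (intro order_tendstoD(2)[where y="\<bar>0\<bar>"]) auto
    then show "\<forall>\<^sub>F i in sequentially. \<bar>e\<^sub>1 i\<bar> \<le> C\<^sub>0" by eventually_elim simp
  qed
  have A: "AE X in path_law 0. \<forall>\<^sub>F i in sequentially. X \<notin> E i"
  proof (rule AE_eventually_not)
    show "E i \<in> sets path_space" for i
      using measurable_sets[OF measurable_W[of w i "n i"], of "{\<epsilon> * (real (n i) * 4 ^ i)..}"]
      by (simp add: vimage_def E_def)
    show "\<forall>\<^sub>F i in sequentially. measure (path_law 0) (E i) \<le>
        C\<^sub>0\<^sup>2 / \<epsilon>\<^sup>2 * (25 * (1 / 4) ^ i + 80 * 2 powr (- real i / 4))"
      using ev unfolding E_def by eventually_elim (rule W_tail[OF w _ _ \<epsilon> n(1)], auto)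
    show "summable (\<lambda>i. C\<^sub>0\<^sup>2 / \<epsilon>\<^sup>2 * (25 * (1 / 4) ^ i + 80 * 2 powr (- real i / 4)))"
      by (intro summable_mult summable_add sumq summable_geometric) simp
  qed
  have B: "AE X in path_law 0. \<forall>\<^sub>F i in sequentially. X \<notin> E' i"
  proof (rule AE_eventually_not)
    show "E' i \<in> sets path_space" for i unfolding E'_def by (rule sets_ball_bad)
    show "\<forall>\<^sub>F i in sequentially. measure (path_law 0) (E' i) \<le> (67 * C\<^sub>0) ^ CARD('d) * (1 / 2) ^ i"
      using eventually_large_scale unfolding E'_def by eventually_elim (rule regular_bound[OF n(2)], simp add: large_scale_def)
    show "summable (\<lambda>i. (67 * C\<^sub>0) ^ CARD('d) * (1 / 2) ^ i)"
      by (intro summable_mult summable_geometric) simp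
  qed
  \<comment> \<open>Off the exceptional sets \<open>x i\<close> bounds the displacement divided by n
    4^i: mean of a block, mixing error, fluctuation, gaps. Dividing by the full period contributes
    the factor 1 + 2^-i.\<close>
  define x where "x i = ES w 0 (4 ^ i) / 4 ^ i + e\<^sub>1 i + \<epsilon> + 2 * C\<^sub>0 * (1 / 2) ^ i" for i
  have half: "(\<lambda>i. (1 / 2) ^ i :: real) \<longlonglongrightarrow> 0" by (rule LIMSEQ_power_zero) simp
  have "(\<lambda>i. x i / (1 + (1 / 2) ^ i)) \<longlonglongrightarrow> (speed w + 0 + \<epsilon> + 2 * C\<^sub>0 * 0) / (1 + 0)"
    unfolding x_def
    by (intro tendsto_divide tendsto_add tendsto_mult tendsto_const speed[OF w] e1_tendsto half) simp
  then have lim: "\<forall>\<^sub>F i in sequentially. x i / (1 + (1 / 2) ^ i) < speed w + 2 * \<epsilon>"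
    using \<epsilon> by (intro order_tendstoD(2)) auto
  show ?thesis
    using A B AE_start[of 0]
  proof eventually_elim
    case (elim X)
    from elim(1,2) lim show ?case
    proof eventually_elim
      case (elim i)
      have X: "steps X" "X 0 = 0" using \<open>X 0 = 0 \<and> steps X\<close> by auto
      have ni: "real (n i) > 0" using n(1)[of i] by (rule less_le_trans[rotated]) simp
      have "real_vec (pos (real (n i) * period i) X) \<bullet> w \<le>
        W w i (n i) X + real (n i) * drift w i + 2 * real (n i) * C\<^sub>0 * 2 ^ i"
      proof (rule pos_le_W[OF w X _ order_refl])
        fix u assume "0 \<le> u" "u \<le> real (n i) * period i"
        then show "good_hit u (2 ^ i) X"
          by (rule regular_from_0[OF X, rotated 2]) (use elim(2) in \<open>auto simp: E'_def\<close>)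
      qed
      also have "\<dots> \<le> real (n i) * 4 ^ i * x i"
      proof -
        have "real (n i) * 4 ^ i * x i = real (n i) * (ES w 0 (4 ^ i) + 4 ^ i * e\<^sub>1 i) +
          \<epsilon> * (real (n i) * 4 ^ i) + 2 * real (n i) * C\<^sub>0 * (4 ^ i * (1 / 2) ^ i)"
          unfolding x_def by (simp add: algebra_simps)
        moreover have "(4::real) ^ i * (1 / 2) ^ i = 2 ^ i" by (simp add: power_mult_distrib[symmetric])
        ultimately show ?thesis using elim(1) unfolding E_def drift_def by simp
      qed
      finally have "real_vec (pos (real (n i) * period i) X) \<bullet> w / (real (n i) * period i) \<le>
        real (n i) * 4 ^ i * x i / (real (n i) * period i)"
        using ni period_pos[of i] by (intro divide_right_mono) auto
      also have "\<dots> = x i / (1 + (1 / 2) ^ i)"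
      proof -
        have "period i = 4 ^ i * (1 + (1 / 2) ^ i)"
          by (simp add: period_def distrib_left power_mult_distrib[symmetric])
        then show ?thesis using ni by simp
      qed
      finally show ?case using elim(3) by simp
    qed
  qed
qed

definition u\<^sub>0 :: "real^'d" where "u\<^sub>0 = (\<chi> j. speed (axis j 1))"

text \<open>The upper bounds for an axis vector and its negative enclose one coordinate; tolerances
  of the form 1 / (q + 1) keep the number of exceptional sets countable.\<close>

lemma AE_pos_limit:
  fixes n :: "nat \<Rightarrow> nat"
  assumes n: "\<And>i. real (n i) \<ge> 4 ^ i" "\<And>i. real (n i) \<le> 16 * 4 ^ i"
  shows "AE X in path_law 0.
    (\<lambda>i. real_vec (pos (real (n i) * period i) X) /\<^sub>R (real (n i) * period i)) \<longlonglongrightarrow> u\<^sub>0"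
proof -
  define x where "x X w i = real_vec (pos (real (n i) * period i) X) \<bullet> w / (real (n i) * period i)" for X w i
  have "AE X in path_law 0. \<forall>q j. \<forall>\<^sub>F i in sequentially. x X (axis j 1) i \<le> speed (axis j 1) + 2 * (1 / real (Suc q))"
    unfolding AE_all_countable x_def by (intro allI AE_pos_upper n) auto
  moreover have "AE X in path_law 0. \<forall>q j. \<forall>\<^sub>F i in sequentially. x X (- axis j 1) i \<le> speed (- axis j 1) + 2 * (1 / real (Suc q))"
    unfolding AE_all_countable x_def by (intro allI AE_pos_upper n) auto
  ultimately show ?thesis
  proof eventually_elim
    case (elim X)
    have "(\<lambda>i. x X (axis j 1) i) \<longlonglongrightarrow> speed (axis j 1)" for j
    proof (rule LIMSEQ_I)
      fix r :: real assume "r > 0"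
      then obtain q where q: "1 / real (Suc q) < r / 2" using reals_Archimedean[of "r / 2"] by (auto simp: inverse_eq_divide)
      have "\<forall>\<^sub>F i in sequentially. norm (x X (axis j 1) i - speed (axis j 1)) < r"
        using elim(1)[rule_format, of j q] elim(2)[rule_format, of j q]
      proof eventually_elim
        case (elim i)
        have "x X (- axis j 1) i = - x X (axis j 1) i" by (simp add: x_def)
        moreover have "speed (- axis j 1) = - speed (axis j 1)" by (rule speed_minus) simp
        ultimately have "\<bar>x X (axis j 1) i - speed (axis j 1)\<bar> \<le> 2 * (1 / real (Suc q))" using elim by linarith
        also have "\<dots> < r" using q by linarith
        finally show ?case by simp
      qed
      then show "\<exists>n0. \<forall>n\<ge>n0. norm (x X (axis j 1) n - speed (axis j 1)) < r" by (simp only: eventually_sequentially)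
    qed
    then show ?case
      by (intro vec_tendstoI) (simp add: u\<^sub>0_def x_def inner_axis divide_inverse mult.commute)
  qed
qed


section \<open>The limiting direction\<close>

text \<open>By \<open>AE_pos_limit\<close> the hitting position of level N is eventually in a ball
  of radius proportional to N, with of order N^d sites. Boxes of size proportional to N fail there
  with probability of order N^(d - M), which is summable because N \<ge> 4^i.\<close>

lemma AE_good_hit_multiple:
  fixes n :: "nat \<Rightarrow> nat"
  assumes n: "\<And>i. real (n i) \<ge> 4 ^ i" "\<And>i. real (n i) \<le> 16 * 4 ^ i" and \<eta>: "\<eta> > 0"
  shows "AE X in path_law 0. \<forall>\<^sub>F i in sequentially. good_hit (real (n i) * period i) (\<eta> * (real (n i) * period i)) X"
proof -
  interpret Q: prob_space "path_law 0" by (rule prob_space_path_law)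
  define N where "N i = real (n i) * period i" for i
  define B where "B = norm u\<^sub>0 + 1"
  have B: "B > 0" by (simp add: B_def add_nonneg_pos)
  have p1: "period i \<ge> 1" for i unfolding period_def by (intro add_increasing2) auto
  have N4: "4 ^ i \<le> N i" for i
    using mult_mono[OF n(1)[of i] p1[of i]] by (simp add: N_def)
  have N1: "1 \<le> N i" for i using N4[of i] by (rule order_trans[rotated]) simp
  have N0: "0 < N i" for i using N1[of i] by linarith
  define E where "E i = {X. ball_bad (B * N i) (\<eta> * N i) X}" for i
  have "AE X in path_law 0. \<forall>\<^sub>F i in sequentially. X \<notin> E i"
  proof (rule AE_eventually_not)
    show "E i \<in> sets path_space" for i unfolding E_def by (rule sets_ball_bad)
    have "\<forall>\<^sub>F i in sequentially. L\<^sub>0 / \<eta> \<le> real i"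
      using filterlim_real_sequentially unfolding filterlim_at_top by blast
    then show "\<forall>\<^sub>F i in sequentially. measure (path_law 0) (E i) \<le> (2 * B + 1) ^ CARD('d) * \<eta> powr - M * (1 / 4) ^ i"
    proof eventually_elim
      case (elim i)
      have "real i \<le> 4 ^ i" using of_nat_less_two_power[of i, where 'a=real]
        power_mono[of 2 "4::real" i] by linarith
      then have "L\<^sub>0 / \<eta> \<le> N i" using elim N4[of i] by linarith
      then have L: "L\<^sub>0 \<le> \<eta> * N i" using \<eta> by (simp add: pos_divide_le_eq mult.commute)
      have "(2 * (B * N i) + 1) ^ CARD('d) \<le> ((2 * B + 1) * N i) ^ CARD('d)"
      proof (rule power_mono)
        show "2 * (B * N i) + 1 \<le> (2 * B + 1) * N i" using N1[of i] by (simp add: distrib_right)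
        show "0 \<le> 2 * (B * N i) + 1" using B N0[of i] by (intro add_nonneg_nonneg mult_nonneg_nonneg) auto
      qed
      also have "\<dots> = (2 * B + 1) ^ CARD('d) * N i powr real CARD('d)"
        unfolding power_mult_distrib by (subst powr_realpow[OF N0]) (rule refl)
      finally have "(2 * (B * N i) + 1) ^ CARD('d) * (\<eta> * N i) powr - M \<le>
        (2 * B + 1) ^ CARD('d) * N i powr real CARD('d) * (\<eta> * N i) powr - M"
        by (rule mult_right_mono) simp
      also have "(\<eta> * N i) powr - M = \<eta> powr - M * N i powr - M"
        by (rule powr_mult)
      also have "(2 * B + 1) ^ CARD('d) * N i powr real CARD('d) * (\<eta> powr - M * N i powr - M) =
        (2 * B + 1) ^ CARD('d) * \<eta> powr - M * (N i powr real CARD('d) * N i powr - M)" by (simp only: mult_ac)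
      also have "N i powr real CARD('d) * N i powr - M = N i powr (real CARD('d) + - M)"
        by (rule powr_add[symmetric])
      also have "(2 * B + 1) ^ CARD('d) * \<eta> powr - M * N i powr (real CARD('d) + - M) \<le>
        (2 * B + 1) ^ CARD('d) * \<eta> powr - M * (1 / 4) ^ i"
      proof (rule mult_left_mono)
        have "N i powr (real CARD('d) + - M) \<le> N i powr - 1"
          by (rule powr_mono[OF _ N1]) (use M d_ge_1 in linarith)
        also have "N i powr - 1 = inverse (N i)" using N0[of i] by (simp only: powr_minus) simp
        also have "inverse (N i) \<le> inverse (4 ^ i)" by (rule le_imp_inverse_le[OF N4]) simp
        also have "inverse (4 ^ i) = (1 / 4 :: real) ^ i" by (simp only: power_one_over inverse_eq_divide)
        finally show "N i powr (real CARD('d) + - M) \<le> (1 / 4) ^ i" .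
        show "0 \<le> (2 * B + 1) ^ CARD('d) * \<eta> powr - M" using B by simp
      qed
      finally have *: "(2 * (B * N i) + 1) ^ CARD('d) * (\<eta> * N i) powr - M \<le>
        (2 * B + 1) ^ CARD('d) * \<eta> powr - M * (1 / 4) ^ i" unfolding powr_mult .
      have BN: "0 \<le> B * N i" using B N0[of i] by simp
      have "emeasure (path_law 0) (E i) \<le> ennreal ((2 * (B * N i) + 1) ^ CARD('d) * (\<eta> * N i) powr - M)"
        unfolding E_def by (rule ball_bad_bound[OF BN L])
      also have "\<dots> \<le> ennreal ((2 * B + 1) ^ CARD('d) * \<eta> powr - M * (1 / 4) ^ i)"
        by (rule ennreal_leI[OF *])
      finally show ?case using B by (simp add: Q.emeasure_eq_measure)
    qed
    show "summable (\<lambda>i. (2 * B + 1) ^ CARD('d) * \<eta> powr - M * (1 / 4) ^ i)"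
      by (intro summable_mult summable_geometric) simp
  qed
  then show ?thesis
    using AE_pos_limit[of n, OF n] AE_reach[of 0]
  proof eventually_elim
    case (elim X)
    have "\<forall>\<^sub>F i in sequentially. norm (real_vec (pos (N i) X) /\<^sub>R N i) < B"
      using tendsto_norm[OF elim(2)] unfolding N_def B_def by (intro order_tendstoD) auto
    with elim(1) show ?case
    proof eventually_elim
      case (elim i)
      have "norm (real_vec (pos (N i) X)) \<le> B * N i"
        using elim(2) N0[of i] by (simp add: pos_divide_less_eq divide_inverse[symmetric] mult.commute[of "inverse _"])
      with elim(1) show ?case
        using \<open>\<forall>s. \<exists>n. s \<le> lev (X n)\<close> unfolding E_def N_def by (intro not_ball_bad_good_hit) auto
    qed
  qed
qed

lemma lev_pos_ge: "\<exists>n. s \<le> lev (X n) \<Longrightarrow> s \<le> lev (pos s X)"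
proof -
  assume "\<exists>n. s \<le> lev (X n)"
  then obtain n where "hits s n X" using reach_iff_hits by blast
  then show ?thesis using hits_pos[of s n X] by (simp add: hits_def)
qed

text \<open>The hitting position of level N has level at least N, so the limit has a component of at
  least 1 along l. The inequality does not involve X, so holding almost surely means that it is
  true.\<close>

lemma u0_nonzero: "u\<^sub>0 \<noteq> 0"
proof -
  interpret Q: prob_space "path_law 0" by (rule prob_space_path_law)
  define N where "N i = real (4 ^ i) * period i" for i
  have N0: "0 < N i" for i using period_pos[of i] by (simp add: N_def)
  have "AE X in path_law 0. (\<lambda>i. real_vec (pos (N i) X) /\<^sub>R N i) \<longlonglongrightarrow> u\<^sub>0"
    unfolding N_def by (rule AE_pos_limit) auto
  then have "AE X in path_law 0. u\<^sub>0 \<bullet> l \<ge> 1"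
    using AE_reach[of 0]
  proof eventually_elim
    case (elim X)
    have "(\<lambda>i. (real_vec (pos (N i) X) /\<^sub>R N i) \<bullet> l) \<longlonglongrightarrow> u\<^sub>0 \<bullet> l"
      by (intro tendsto_inner elim tendsto_const)
    then show ?case
    proof (rule LIMSEQ_le_const, intro exI[of _ 0] allI impI)
      fix i
      have "N i \<le> lev (pos (N i) X)" by (rule lev_pos_ge) (use elim(2) in blast)
      then show "1 \<le> (real_vec (pos (N i) X) /\<^sub>R N i) \<bullet> l"
        using N0[of i] by (simp add: lev_def[symmetric] divide_inverse[symmetric] mult.commute[of "inverse _"])
    qed
  qed
  then have "u\<^sub>0 \<bullet> l \<ge> 1" by (simp only: Q.AE_const)
  then show ?thesis by auto
qed

section \<open>Interpolation between grid levels\<close>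

definition grid :: "nat \<Rightarrow> nat \<Rightarrow> nat \<Rightarrow> nat" where
  "grid D m i = nat \<lfloor>(1 + real m / real D) * 4 ^ i\<rfloor>"

text \<open>As m runs from 0 to 15 D, the multiples run from 4^i to 16 * 4^i in steps of 4^i / D, up
  to rounding to whole periods.\<close>

lemma grid_bounds:
  assumes D: "D \<ge> 1" and m: "m \<le> 15 * D"
  shows "real (grid D m i) \<le> (1 + real m / real D) * 4 ^ i"
    and "(1 + real m / real D) * 4 ^ i < real (grid D m i) + 1"
    and "4 ^ i \<le> real (grid D m i)" and "real (grid D m i) \<le> 16 * 4 ^ i"
proof -
  let ?x = "(1 + real m / real D) * 4 ^ i"
  have r0: "real m / real D \<ge> 0" by simp
  have "real m \<le> 15 * real D" using m by (simp only: of_nat_le_iff[where 'a=real, symmetric] of_nat_mult of_nat_numeral)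
  then have r15: "real m / real D \<le> 15" using D by (simp add: divide_le_eq)
  have x0: "?x \<ge> 0" by simp
  then have e: "real (grid D m i) = of_int \<lfloor>?x\<rfloor>" by (simp add: grid_def)
  show 1: "real (grid D m i) \<le> ?x" and "?x < real (grid D m i) + 1"
    unfolding e by (rule of_int_floor_le, rule real_of_int_floor_add_one_gt)
  have "1 * 4 ^ i \<le> ?x" using r0 by (intro mult_right_mono) auto
  then have "real_of_int (4 ^ i) \<le> ?x" by simp
  then have "4 ^ i \<le> \<lfloor>?x\<rfloor>" by (simp only: le_floor_iff)
  then have "real_of_int (4 ^ i) \<le> of_int \<lfloor>?x\<rfloor>" by (simp only: of_int_le_iff)
  then show "4 ^ i \<le> real (grid D m i)" unfolding e by simp
  have "?x \<le> 16 * 4 ^ i" using r15 by (intro mult_right_mono) auto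
  with 1 show "real (grid D m i) \<le> 16 * 4 ^ i" by linarith
qed

text \<open>Consecutive levels 4^i * \<open>period i\<close> differ by a factor of at most 16, so
  the ranges from one of them to 16 times it cover all large levels.\<close>

lemma level_index:
  assumes s: "4 ^ i\<^sub>0 * period i\<^sub>0 \<le> s"
  obtains i where "i \<ge> i\<^sub>0" "4 ^ i * period i \<le> s" "s < 16 * (4 ^ i * period i)"
proof -
  let ?Q = "\<lambda>i. 4 ^ i * period i"
  have up: "?Q (Suc i) \<le> 16 * ?Q i" for i by (simp add: period_def algebra_simps)
  have big: "real i \<le> ?Q i" for i
  proof -
    have "real i \<le> 2 ^ i" using of_nat_less_two_power[of i, where 'a=real] by simp
    also have "\<dots> \<le> period i" by (simp add: period_def)
    also have "1 * period i \<le> 4 ^ i * period i" using period_pos[of i] by (intro mult_right_mono) auto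
    finally show ?thesis by simp
  qed
  obtain j where j: "s < real j" using reals_Archimedean2 by blast
  have "s < ?Q (Suc (i\<^sub>0 + j))" using big[of "Suc (i\<^sub>0 + j)"] j by simp
  then have ex: "\<exists>i. i \<ge> i\<^sub>0 \<and> s < ?Q (Suc i)" by (intro exI[of _ "i\<^sub>0 + j"]) simp
  define i where "i = (LEAST i. i \<ge> i\<^sub>0 \<and> s < ?Q (Suc i))"
  have i: "i \<ge> i\<^sub>0" "s < ?Q (Suc i)" using LeastI_ex[OF ex] unfolding i_def by auto
  have "?Q i \<le> s"
  proof (cases "i = i\<^sub>0")
    case False
    then obtain i' where i': "i = Suc i'" "i' \<ge> i\<^sub>0" using i(1) by (cases i) auto
    have "i' < i" using i' by simp
    from not_less_Least[OF this[unfolded i_def]] show ?thesis using i' by simp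
  qed (use s in simp)
  then show thesis by (rule that[OF i(1) _ less_le_trans[OF i(2) up]])
qed

definition top_level :: "(nat \<Rightarrow> int^'d) \<Rightarrow> nat \<Rightarrow> real" where
  "top_level X t = Max ((\<lambda>m. lev (X m)) ` {..t})"

lemma top_level_ge: "m \<le> t \<Longrightarrow> lev (X m) \<le> top_level X t"
  unfolding top_level_def by (rule Max_ge) auto

lemma top_level_attained: "\<exists>m\<le>t. top_level X t = lev (X m)"
proof -
  have "top_level X t \<in> (\<lambda>m. lev (X m)) ` {..t}" unfolding top_level_def by (rule Max_in) auto
  then show ?thesis by auto
qed

text \<open>The first hitting of a grid level \<open>N\<close> just below the current top level starts a good exit of a box
  of size \<open>3N/D\<close>, which is not yet completed.\<close>

lemma near_grid_level:
  assumes D: "D \<ge> 1" and L: "L \<ge> 1"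
    and s: "N \<le> top_level X t" "top_level X t < N + L" and g: "good_hit N L X"
  shows "norm (real_vec (X t) - real_vec (pos N X)) \<le> C\<^sub>0 * L"
proof -
  obtain n where n: "hits N n X" "good L (walk_shift n X)" using g by (auto simp: good_hit_def)
  have X0: "walk_shift n X 0 = X n" by (simp add: walk_shift_def)
  obtain n' where n': "\<forall>m<n'. walk_shift n X m \<in> Box L (X n)" "lev (X n) + L \<le> lev (walk_shift n X n')"
    using n(2) unfolding good_def X0 by blast
  obtain m where m: "m \<le> t" "top_level X t = lev (X m)" using top_level_attained by blast
  have nt: "n \<le> t"
  proof (rule ccontr)
    assume "\<not> n \<le> t"
    then have "lev (X m) < N" using n(1) m by (simp add: hits_def)
    with m s show False by simp
  qed
  have "t - n < n'"
  proof (rule ccontr)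
    assume "\<not> t - n < n'"
    then have "lev (walk_shift n X n') \<le> top_level X t"
      unfolding walk_shift_def by (intro top_level_ge) (use nt in simp)
    moreover have "N \<le> lev (X n)" using n(1) by (simp add: hits_def)
    ultimately show False using n'(2) s by simp
  qed
  then have "walk_shift n X (t - n) \<in> Box L (X n)" using n'(1) by blast
  then have b: "X t \<in> Box L (X n)" using nt by (simp add: walk_shift_def)
  have "norm (real_vec (X t - X n)) \<le> C\<^sub>0 * L"
    by (rule norm_le_C0[OF L]) (use b in \<open>auto simp: Box_def lev_diff tau_diff less_imp_le\<close>)
  then show ?thesis using hits_pos[OF n(1)] by (simp add: real_vec_diff)
qed

text \<open>Some grid level N satisfies N \<le> s < N + 2 N/D for the top level s. The three parts
  of the constant are the box of size 3 N/D that contains the walk, the error 1/D of the hitting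
  position of N, and the replacement of N by s.\<close>

lemma eventually_near_ray:
  assumes D: "D \<ge> 1" and reach: "\<forall>s. \<exists>n. s \<le> lev (X n)"
    and lim: "\<And>m. m \<le> 15 * D \<Longrightarrow>
      (\<lambda>i. real_vec (pos (real (grid D m i) * period i) X) /\<^sub>R (real (grid D m i) * period i)) \<longlonglongrightarrow> u\<^sub>0"
    and g: "\<And>m. m \<le> 15 * D \<Longrightarrow> \<forall>\<^sub>F i in sequentially.
      good_hit (real (grid D m i) * period i) (3 / real D * (real (grid D m i) * period i)) X"
  shows "\<forall>\<^sub>F t in sequentially. 0 < top_level X t \<and>
    norm (real_vec (X t) - top_level X t *\<^sub>R u\<^sub>0) \<le> top_level X t * ((3 * C\<^sub>0 + 1 + 2 * norm u\<^sub>0) / real D)"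
proof -
  define N where "N m i = real (grid D m i) * period i" for m i
  have D0: "real D > 0" using D by simp
  have C: "C\<^sub>0 > 0" using C0_ge by simp
  have "\<forall>\<^sub>F i in sequentially. \<forall>m\<in>{..15 * D}. norm (real_vec (pos (N m i) X) /\<^sub>R N m i - u\<^sub>0) < 1 / real D \<and>
    good_hit (N m i) (3 / real D * N m i) X"
  proof (intro eventually_ball_finite ballI eventually_conj)
    fix m assume "m \<in> {..15 * D}"
    then have m: "m \<le> 15 * D" by simp
    show "\<forall>\<^sub>F i in sequentially. norm (real_vec (pos (N m i) X) /\<^sub>R N m i - u\<^sub>0) < 1 / real D"
      using tendstoD[OF lim[OF m], of "1 / real D"] D0 unfolding N_def dist_norm by simp
    show "\<forall>\<^sub>F i in sequentially. good_hit (N m i) (3 / real D * N m i) X" unfolding N_def by (rule g[OF m])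
  qed simp
  then obtain i\<^sub>1 where i1: "\<And>i m. i \<ge> i\<^sub>1 \<Longrightarrow> m \<le> 15 * D \<Longrightarrow>
      norm (real_vec (pos (N m i) X) /\<^sub>R N m i - u\<^sub>0) < 1 / real D \<and> good_hit (N m i) (3 / real D * N m i) X"
    unfolding eventually_sequentially by (auto simp: atMost_iff)
  \<comment> \<open>The bound by D ensures D \<le> 4^i, so that rounding to whole periods costs at
    most a fraction 1/D.\<close>
  define i\<^sub>0 where "i\<^sub>0 = max i\<^sub>1 D"
  obtain t\<^sub>0 where t0: "4 ^ i\<^sub>0 * period i\<^sub>0 \<le> lev (X t\<^sub>0)" using reach by blast
  have "0 < top_level X t \<and>
    norm (real_vec (X t) - top_level X t *\<^sub>R u\<^sub>0) \<le> top_level X t * ((3 * C\<^sub>0 + 1 + 2 * norm u\<^sub>0) / real D)"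
    if t: "t \<ge> t\<^sub>0" for t
  proof -
    define s where "s = top_level X t"
    have "4 ^ i\<^sub>0 * period i\<^sub>0 \<le> s" using t0 top_level_ge[OF t, of X] by (simp add: s_def)
    then obtain i where i: "i \<ge> i\<^sub>0" "4 ^ i * period i \<le> s" "s < 16 * (4 ^ i * period i)"
      by (rule level_index)
    define Q where "Q = 4 ^ i * period i"
    have Q0: "Q > 0" using period_pos[of i] by (simp add: Q_def)
    have D4: "real D \<le> 4 ^ i"
    proof -
      have "real D \<le> real i" using i(1) by (simp add: i\<^sub>0_def)
      also have "real i < 2 ^ i" by (rule of_nat_less_two_power)
      also have "2 ^ i \<le> (4::real) ^ i" by (intro power_mono) auto
      finally show ?thesis by simp
    qed
    have PQ: "period i \<le> Q / real D"
      using mult_right_mono[OF D4, of "period i"] period_pos[of i] D0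
      by (simp add: Q_def pos_le_divide_eq mult.commute)
    \<comment> \<open>The place of s on the grid between Q and 16 Q, in units of Q/D; its integer
      part is the grid index m.\<close>
    define x where "x = (s / Q - 1) * real D"
    have sQ: "1 \<le> s / Q" "s / Q < 16" using i(2,3) Q0 by (simp_all add: Q_def[symmetric] pos_le_divide_eq pos_divide_less_eq)
    have x0: "x \<ge> 0" unfolding x_def using sQ by (intro mult_nonneg_nonneg) auto
    have x15: "x < 15 * real D" unfolding x_def using sQ D0 by (intro mult_strict_right_mono) auto
    define m where "m = nat \<lfloor>x\<rfloor>"
    have mx: "real m \<le> x" "x < real m + 1" using x0 by (simp_all add: m_def)
    have "real m < real (15 * D)" using mx x15 by simp
    then have m: "m \<le> 15 * D" by (simp only: of_nat_less_iff less_imp_le)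
    let ?N = "N m i" and ?r = "1 + real m / real D"
    note gb = grid_bounds[OF D m, of i]
    have QN: "Q \<le> ?N" unfolding Q_def N_def using gb(3) period_pos[of i] by (intro mult_right_mono) auto
    have sr: "?r * Q \<le> s" "s < ?r * Q + Q / real D"
    proof -
      have s: "s = (1 + x / real D) * Q" using D0 Q0 by (simp add: x_def)
      have "1 + real m / real D \<le> 1 + x / real D" using mx D0 by (intro add_left_mono divide_right_mono) auto
      then show "?r * Q \<le> s" unfolding s using Q0 by (intro mult_right_mono) auto
      have "x / real D < (real m + 1) / real D" using mx D0 by (intro divide_strict_right_mono) auto
      then have "1 + x / real D < ?r + 1 / real D" by (simp add: add_divide_distrib)
      from mult_strict_right_mono[OF this Q0] show "s < ?r * Q + Q / real D"
        unfolding s by (simp add: distrib_right)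
    qed
    have Ns: "?N \<le> s"
    proof -
      have "?N \<le> ?r * 4 ^ i * period i" unfolding N_def using gb(1) period_pos[of i] by (intro mult_right_mono) auto
      then show ?thesis using sr(1) by (simp add: Q_def mult.assoc)
    qed
    \<comment> \<open>The floor in \<open>grid\<close> loses less than one period.\<close>
    have "?r * Q \<le> ?N + period i"
    proof -
      have "?r * 4 ^ i * period i \<le> (real (grid D m i) + 1) * period i"
        using gb(2) period_pos[of i] by (intro mult_right_mono) auto
      then show ?thesis by (simp add: Q_def N_def mult.assoc distrib_right)
    qed
    moreover have "Q / real D \<le> ?N / real D" using QN D0 by (intro divide_right_mono) auto
    ultimately have sN: "s < ?N + 2 * (?N / real D)" using sr(2) PQ by linarith
    have N0: "?N > 0" using QN Q0 by simp
    have ND: "?N / real D \<ge> 1"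
    proof -
      have "1 * 4 ^ i \<le> period i * 4 ^ i" by (intro mult_right_mono) (simp_all add: period_def add_increasing2)
      then have "4 ^ i \<le> Q" by (simp only: Q_def mult.commute mult_1)
      then have "real D \<le> Q" using D4 by linarith
      then have "real D \<le> ?N" using QN by simp
      then show ?thesis using D0 by (simp add: pos_le_divide_eq)
    qed
    have ii: "i \<ge> i\<^sub>1" using i(1) by (simp add: i\<^sub>0_def)
    have 1: "norm (real_vec (X t) - real_vec (pos ?N X)) \<le> C\<^sub>0 * (3 / real D * ?N)"
    proof (rule near_grid_level[OF D])
      show "1 \<le> 3 / real D * ?N" using ND by simp
      show "?N \<le> top_level X t" using Ns by (simp add: s_def)
      have "3 / real D * ?N = 3 * (?N / real D)" by simp
      then show "top_level X t < ?N + 3 / real D * ?N" using sN ND unfolding s_def by linarith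
      show "good_hit ?N (3 / real D * ?N) X" using i1[OF ii m] by blast
    qed
    have 2: "norm (real_vec (pos ?N X) - ?N *\<^sub>R u\<^sub>0) \<le> ?N * (1 / real D)"
    proof -
      have "real_vec (pos ?N X) - ?N *\<^sub>R u\<^sub>0 = ?N *\<^sub>R (real_vec (pos ?N X) /\<^sub>R ?N - u\<^sub>0)"
        using N0 by (simp add: scaleR_diff_right)
      then have "norm (real_vec (pos ?N X) - ?N *\<^sub>R u\<^sub>0) = ?N * norm (real_vec (pos ?N X) /\<^sub>R ?N - u\<^sub>0)"
        using N0 by (simp only: norm_scaleR abs_of_pos)
      also have "\<dots> \<le> ?N * (1 / real D)"
        using i1[OF ii m] N0 by (intro mult_left_mono) auto
      finally show ?thesis .
    qed
    have 3: "norm (?N *\<^sub>R u\<^sub>0 - s *\<^sub>R u\<^sub>0) \<le> 2 * (?N / real D) * norm u\<^sub>0"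
    proof -
      have "norm (?N *\<^sub>R u\<^sub>0 - s *\<^sub>R u\<^sub>0) = (s - ?N) * norm u\<^sub>0"
        unfolding scaleR_diff_left[symmetric] norm_scaleR using Ns by (simp only: abs_minus_commute[of "N m i"] abs_of_nonneg diff_ge_0_iff_ge)
      also have "\<dots> \<le> 2 * (?N / real D) * norm u\<^sub>0" using sN by (intro mult_right_mono) auto
      finally show ?thesis .
    qed
    have "real_vec (X t) - s *\<^sub>R u\<^sub>0 = (real_vec (X t) - real_vec (pos ?N X)) +
      (real_vec (pos ?N X) - ?N *\<^sub>R u\<^sub>0) + (?N *\<^sub>R u\<^sub>0 - s *\<^sub>R u\<^sub>0)" by simp
    then have "norm (real_vec (X t) - s *\<^sub>R u\<^sub>0) \<le> norm (real_vec (X t) - real_vec (pos ?N X)) +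
      norm (real_vec (pos ?N X) - ?N *\<^sub>R u\<^sub>0) + norm (?N *\<^sub>R u\<^sub>0 - s *\<^sub>R u\<^sub>0)"
      by (metis norm_triangle_le add_right_mono norm_triangle_ineq)
    also have "\<dots> \<le> C\<^sub>0 * (3 / real D * ?N) + ?N * (1 / real D) + 2 * (?N / real D) * norm u\<^sub>0"
      using 1 2 3 by linarith
    also have "\<dots> = ?N * ((3 * C\<^sub>0 + 1 + 2 * norm u\<^sub>0) / real D)"
      by (simp add: add_divide_distrib distrib_left mult_ac)
    also have "\<dots> \<le> s * ((3 * C\<^sub>0 + 1 + 2 * norm u\<^sub>0) / real D)"
      using Ns C D0 by (intro mult_right_mono divide_nonneg_pos) auto
    finally show ?thesis using N0 Ns by (simp add: s_def)
  qed
  then show ?thesis unfolding eventually_sequentially by blast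
qed

text \<open>Dividing by the top level instead of time gives a nonzero limit, and normalisation
  cancels the top level. The grids for all D and m are treated on one almost sure event; D is then
  chosen according to the desired precision.\<close>

lemma AE_direction:
  "AE X in path_law 0. (\<lambda>t. real_vec (X t) /\<^sub>R norm (real_vec (X t))) \<longlonglongrightarrow> u\<^sub>0 /\<^sub>R norm u\<^sub>0"
proof -
  define N where "N D m i = real (grid D m i) * period i" for D m i
  have "AE X in path_law 0. \<forall>D m. D \<ge> 1 \<longrightarrow> m \<le> 15 * D \<longrightarrow>
      (\<lambda>i. real_vec (pos (N D m i) X) /\<^sub>R N D m i) \<longlonglongrightarrow> u\<^sub>0"
    unfolding AE_all_countable
  proof (intro allI)
    fix D m :: nat
    show "AE X in path_law 0. D \<ge> 1 \<longrightarrow> m \<le> 15 * D \<longrightarrow> (\<lambda>i. real_vec (pos (N D m i) X) /\<^sub>R N D m i) \<longlonglongrightarrow> u\<^sub>0"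
    proof (cases "D \<ge> 1 \<and> m \<le> 15 * D")
      case True
      then have "AE X in path_law 0. (\<lambda>i. real_vec (pos (N D m i) X) /\<^sub>R N D m i) \<longlonglongrightarrow> u\<^sub>0"
        unfolding N_def by (intro AE_pos_limit grid_bounds(3,4)) auto
      then show ?thesis by eventually_elim simp
    qed (intro AE_I2, blast)
  qed
  moreover have "AE X in path_law 0. \<forall>D m. D \<ge> 1 \<longrightarrow> m \<le> 15 * D \<longrightarrow>
      (\<forall>\<^sub>F i in sequentially. good_hit (N D m i) (3 / real D * N D m i) X)"
    unfolding AE_all_countable
  proof (intro allI)
    fix D m :: nat
    show "AE X in path_law 0. D \<ge> 1 \<longrightarrow> m \<le> 15 * D \<longrightarrow>
      (\<forall>\<^sub>F i in sequentially. good_hit (N D m i) (3 / real D * N D m i) X)"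
    proof (cases "D \<ge> 1 \<and> m \<le> 15 * D")
      case True
      then have "AE X in path_law 0. \<forall>\<^sub>F i in sequentially. good_hit (N D m i) (3 / real D * N D m i) X"
        unfolding N_def by (intro AE_good_hit_multiple grid_bounds(3,4)) auto
      then show ?thesis by eventually_elim simp
    qed (intro AE_I2, blast)
  qed
  ultimately show ?thesis
    using AE_reach[of 0]
  proof eventually_elim
    case (elim X)
    define K where "K = 3 * C\<^sub>0 + 1 + 2 * norm u\<^sub>0"
    have K: "K > 0" using C0_ge by (simp add: K_def add_pos_nonneg)
    have near: "\<forall>\<^sub>F t in sequentially. 0 < top_level X t \<and>
        norm (real_vec (X t) - top_level X t *\<^sub>R u\<^sub>0) \<le> top_level X t * (K / real D)" if "D \<ge> 1" for D
      unfolding K_def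
      by (rule eventually_near_ray[OF that elim(3)]) (use elim(1,2) that in \<open>auto simp: N_def\<close>)
    have lim: "(\<lambda>t. real_vec (X t) /\<^sub>R top_level X t) \<longlonglongrightarrow> u\<^sub>0"
    proof (rule tendstoI)
      fix r :: real assume r: "r > 0"
      obtain D where D: "K / r < real D" using reals_Archimedean2 by blast
      have D0: "real D > 0" using D K r by (meson divide_pos_pos less_trans)
      then have D1: "D \<ge> 1" by simp
      have KD: "K / real D < r" using D D0 r by (simp add: divide_less_eq mult.commute)
      show "\<forall>\<^sub>F t in sequentially. dist (real_vec (X t) /\<^sub>R top_level X t) u\<^sub>0 < r"
        using near[OF D1]
      proof eventually_elim
        case (elim t)
        let ?s = "top_level X t"
        have "real_vec (X t) - ?s *\<^sub>R u\<^sub>0 = ?s *\<^sub>R (real_vec (X t) /\<^sub>R ?s - u\<^sub>0)"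
          using elim by (simp add: scaleR_diff_right)
        then have "norm (real_vec (X t) - ?s *\<^sub>R u\<^sub>0) = ?s * norm (real_vec (X t) /\<^sub>R ?s - u\<^sub>0)"
          using elim by (simp only: norm_scaleR abs_of_pos)
        then have "?s * norm (real_vec (X t) /\<^sub>R ?s - u\<^sub>0) \<le> ?s * (K / real D)"
          using elim by simp
        then have "norm (real_vec (X t) /\<^sub>R ?s - u\<^sub>0) \<le> K / real D"
          by (rule mult_left_le_imp_le) (use elim in simp)
        with KD show ?case by (simp add: dist_norm)
      qed
    qed
    have "(\<lambda>t. (real_vec (X t) /\<^sub>R top_level X t) /\<^sub>R norm (real_vec (X t) /\<^sub>R top_level X t))
        \<longlonglongrightarrow> u\<^sub>0 /\<^sub>R norm u\<^sub>0"
      using u0_nonzero by (intro tendsto_scaleR tendsto_inverse tendsto_norm lim) simp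
    moreover have "\<forall>\<^sub>F t in sequentially. (real_vec (X t) /\<^sub>R top_level X t) /\<^sub>R norm (real_vec (X t) /\<^sub>R top_level X t) =
        real_vec (X t) /\<^sub>R norm (real_vec (X t))"
      using near[OF order_refl] by eventually_elim simp
    ultimately show ?case by (rule Lim_transform_eventually)
  qed
qed

text \<open>P is not assumed measurable: a measurable null set that covers the failures is extended
  to a product set, whose annealed measure is again 0.\<close>

lemma AE_annealedI:
  assumes "AE X in path_law 0. P X"
  shows "AE (\<omega>, X) in annealed \<P> 0. P X"
proof -
  have sp: "space (path_law 0) = UNIV"
    using sets_eq_imp_space_eq[OF sets_path_law[of 0]] by (simp add: space_PiM)
  have spA: "space (annealed \<P> 0) = space env_space \<times> UNIV"
    using sets_eq_imp_space_eq[OF sets_annealed[OF law, of 0]] by (simp add: space_pair_measure space_PiM)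
  obtain B where B: "{X. \<not> P X} \<subseteq> B" "emeasure (path_law 0) B = 0" "B \<in> sets path_space"
    using assms by (elim AE_E) (auto simp: sp sets_path_law)
  have E: "space env_space \<in> sets (env_space :: 'd env measure)" by simp
  have "emeasure (annealed \<P> 0) (space env_space \<times> B) =
      (\<integral>\<^sup>+\<omega>\<in>space env_space. emeasure (quenched \<omega> 0) B \<partial>\<P>)"
    by (rule emeasure_annealed_Times[OF law E B(3)])
  also have "\<dots> = (\<integral>\<^sup>+\<omega>. emeasure (quenched \<omega> 0) B \<partial>\<P>)"
    by (rule nn_integral_cong) (simp add: spP)
  also have "\<dots> = 0" using B by (simp add: emeasure_path_law[symmetric])
  finally have "space env_space \<times> B \<in> null_sets (annealed \<P> 0)"
    using B(3) by (intro null_setsI) (auto simp: sets_annealed[OF law])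
  then show ?thesis by (rule AE_I') (use B(1) in \<open>auto simp: spA\<close>)
qed

end

theorem theorem1p1:
  fixes \<P> :: "('d::finite) env measure"
    and l :: "real^'d" and R :: "real^'d \<Rightarrow> real^'d" and k :: 'd
    and M c \<alpha> :: real and \<phi> :: "real \<Rightarrow> real"
  assumes "l \<in> rational_sphere"
    and "orthogonal_transformation R" and "R (axis k 1) = l"
    and "M > 6 * real CARD('d)" and "c > 0"
    and "0 < \<alpha>" and "\<alpha> \<le> min (1 / 9) (1 / (2 * c + 1))"
    and "\<And>r. r \<ge> 0 \<Longrightarrow> \<phi> r \<ge> 0" and "(\<phi> \<longlongrightarrow> 0) at_top"
    and "env_law \<P>" and "stationary \<P>"
    and "uniformly_elliptic \<P> l"
    and "cone_mixing \<P> R k l \<alpha> \<phi>"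
    and "polynomial_condition \<P> R k l M c"
  shows "\<exists>v \<in> sphere 0 1. AE (\<omega>, X) in annealed \<P> 0.
           (\<lambda>n. real_vec (X n) /\<^sub>R norm (real_vec (X n))) \<longlonglongrightarrow> v"
proof -
  obtain z\<^sub>0 where z0: "z\<^sub>0 \<noteq> 0" "l = real_vec z\<^sub>0 /\<^sub>R norm (real_vec z\<^sub>0)"
    using assms(1) unfolding rational_sphere_def by blast
  have "norm l = 1"
    using orthogonal_transformation_norm[OF assms(2), of "axis k 1"] assms(3) by simp
  then have "l \<noteq> 0" by auto
  with assms(10-12) obtain \<kappa> :: real where \<kappa>: "0 < \<kappa>" "\<kappa> \<le> 1"
    "AE \<omega> in \<P>. \<forall>x. \<forall>e\<in>forward_steps l. \<kappa> \<le> \<omega> x e"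
    by (rule uniform_ellipticity_everywhere)
  obtain L\<^sub>0 where L0: "L\<^sub>0 \<ge> 1"
    "\<And>L y A. L \<ge> L\<^sub>0 \<Longrightarrow> y \<in> half_space l 0 \<Longrightarrow> A \<in> sets (env_sigma (half_space l y)) \<Longrightarrow>
       (\<integral>\<^sup>+\<omega>. indicator A \<omega> * emeasure (quenched \<omega> 0) (bad_path R k l c L y) \<partial>\<P>)
         \<le> ennreal (L powr - M) * emeasure \<P> A"
    by (rule polynomial_condition_bound[OF assms(10,14)]) (rule that)
  have \<alpha>: "\<alpha> \<le> 1 / 9" "\<alpha> \<le> 1 / (2 * c + 1)" using assms(7) by simp_all
  interpret rwre \<P> l R k M c \<alpha> \<phi> z\<^sub>0 \<kappa> L\<^sub>0
    by unfold_locales (fact assms z0 \<kappa> L0 \<alpha>)+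
  show ?thesis
  proof (intro bexI)
    show "AE (\<omega>, X) in annealed \<P> 0.
        (\<lambda>n. real_vec (X n) /\<^sub>R norm (real_vec (X n))) \<longlonglongrightarrow> u\<^sub>0 /\<^sub>R norm u\<^sub>0"
      by (rule AE_annealedI[OF AE_direction])
    show "u\<^sub>0 /\<^sub>R norm u\<^sub>0 \<in> sphere 0 1" using u0_nonzero by simp
  qed
qed

end
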